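(* Let $A$ be a simple tracially $\mathcal{Z}$-absorbing C*-algebra and let $B$ be a simple C*-algebra. Then the minimal tensor product $A\otimes_{\mathrm{min}}B$ is tracially $\mathcal{Z}$-absorbing.
   Context: C*-algebras are not assumed unital. For positive elements $a,b$ of a C*-algebra $A$, $a \precsim b$ (Cuntz subequivalence) means there is a sequence $(v_n)$ in $A$ with $\|a - v_n b v_n^*\| \to 0$. For self-adjoint $c$ and $\varepsilon>0$, $(c-\varepsilon)_+$ is obtained by applying $t \mapsto \max(t-\varepsilon,0)$. $M_n=M_n(\mathbb{C})$, $[y,z]=yz-zy$. A completely positive contractive (c.p.c.) map $\varphi$ has order zero if $\varphi(y)\varphi(z)=0$ whenever $y,z$ are positive with $yz=0$. A simple C*-algebra $A$ is tracially $\mathcal{Z}$-absorbing if $A \not\cong \mathbb{C}$ and for every $x,a \in A_+$ with $a \neq 0$, every finite set $F \subseteq A$, every $\varepsilon>0$, and every $n \in \mathbb{N}$, there is a c.p.c. order zero map $\varphi\colon M_n \to A$ such that (i) $(x^2 - x\varphi(1)x - \varepsilon)_+ \precsim a$, and (ii) $\|[\varphi(z),b]\| < \varepsilon$ for all $z \in M_n$ with $\|z\| \le 1$ and all $b \in F$. *)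

theory Defs
  imports
    "HOL-Analysis.Analysis"
    "HOL-Computational_Algebra.Polynomial"
    "Jordan_Normal_Form.Matrix"
begin

section \<open>C*-algebras\<close>

class scaleC =
  fixes scaleC :: "complex \<Rightarrow> 'a \<Rightarrow> 'a"  (infixr \<open>*\<^sub>C\<close> 75)

class star =
  fixes star :: "'a \<Rightarrow> 'a"

text \<open>No unit is assumed. The real structure underlying
  \<^class>\<open>banach\<close> is the restriction of the complex one.\<close>

class cstar_algebra = real_normed_algebra + banach + scaleC + star +
  assumes scaleR_eq_scaleC: "r *\<^sub>R a = complex_of_real r *\<^sub>C a"
    and scaleC_add_right: "c *\<^sub>C (a + b) = c *\<^sub>C a + c *\<^sub>C b"
    and scaleC_add_left: "(c + d) *\<^sub>C a = c *\<^sub>C a + d *\<^sub>C a"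
    and scaleC_scaleC: "c *\<^sub>C (d *\<^sub>C a) = (c * d) *\<^sub>C a"
    and mult_scaleC_left: "(c *\<^sub>C a) * b = c *\<^sub>C (a * b)"
    and mult_scaleC_right: "a * (c *\<^sub>C b) = c *\<^sub>C (a * b)"
    and norm_scaleC: "norm (c *\<^sub>C a) = cmod c * norm a"
    and star_add: "star (a + b) = star a + star b"
    and star_scaleC: "star (c *\<^sub>C a) = cnj c *\<^sub>C star a"
    and star_mult: "star (a * b) = star b * star a"
    and star_star: "star (star a) = a"
    and cstar_identity: "norm (star a * a) = (norm a)\<^sup>2"

instantiation complex :: cstar_algebra
begin

definition scaleC_complex :: "complex \<Rightarrow> complex \<Rightarrow> complex"
  where "scaleC_complex c z = c * z"

definition star_complex :: "complex \<Rightarrow> complex"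
  where "star_complex z = cnj z"

instance
  by standard
    (auto simp: scaleC_complex_def star_complex_def algebra_simps scaleR_conv_of_real
      norm_mult power2_eq_square)

end

text \<open>A C*-algebra is a norm-closed *-subalgebra of a type of class
  \<^class>\<open>cstar_algebra\<close>; abstract C*-algebras are the case \<^term>\<open>UNIV\<close>.\<close>

definition cstar_subalgebra :: "'a::cstar_algebra set \<Rightarrow> bool"
  where "cstar_subalgebra A \<longleftrightarrow>
    0 \<in> A \<and> (\<forall>a\<in>A. \<forall>b\<in>A. a + b \<in> A \<and> a * b \<in> A) \<and>
    (\<forall>a\<in>A. \<forall>c. c *\<^sub>C a \<in> A) \<and> (\<forall>a\<in>A. star a \<in> A) \<and> closed A"

definition closed_ideal :: "'a::cstar_algebra set \<Rightarrow> 'a set \<Rightarrow> bool"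
  where "closed_ideal A I \<longleftrightarrow>
    I \<subseteq> A \<and> 0 \<in> I \<and> (\<forall>a\<in>I. \<forall>b\<in>I. a + b \<in> I) \<and> (\<forall>a\<in>I. \<forall>c. c *\<^sub>C a \<in> I) \<and>
    (\<forall>a\<in>I. \<forall>b\<in>A. a * b \<in> I \<and> b * a \<in> I) \<and> closed I"

definition simple_cstar :: "'a::cstar_algebra set \<Rightarrow> bool"
  where "simple_cstar A \<longleftrightarrow>
    cstar_subalgebra A \<and> A \<noteq> {0} \<and> (\<forall>I. closed_ideal A I \<longrightarrow> I = {0} \<or> I = A)"

definition star_hom_on :: "'a::cstar_algebra set \<Rightarrow> ('a \<Rightarrow> 'b::cstar_algebra) \<Rightarrow> bool"
  where "star_hom_on A \<psi> \<longleftrightarrow>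
    (\<forall>a\<in>A. \<forall>b\<in>A. \<psi> (a + b) = \<psi> a + \<psi> b \<and> \<psi> (a * b) = \<psi> a * \<psi> b) \<and>
    (\<forall>a\<in>A. \<forall>c. \<psi> (c *\<^sub>C a) = c *\<^sub>C \<psi> a) \<and> (\<forall>a\<in>A. \<psi> (star a) = star (\<psi> a))"

definition cstar_isomorphic :: "'a::cstar_algebra set \<Rightarrow> 'b::cstar_algebra set \<Rightarrow> bool"
  where "cstar_isomorphic A B \<longleftrightarrow> (\<exists>\<psi>. star_hom_on A \<psi> \<and> bij_betw \<psi> A B)"


section \<open>Spectrum, positivity and continuous functional calculus\<close>

text \<open>In the unitization, \<open>(1 - a)(1 - b) = 1\<close> is equivalent to \<open>a + b = a * b\<close>, so
  \<open>l - a\<close> (for \<open>l \<noteq> 0\<close>) is invertible iff \<open>a / l\<close> is quasi-invertible. The point 0 is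
  left out of the spectrum: it always belongs to the spectrum of an element of a nonunital
  algebra, and it matters neither for positivity nor for the functional calculus with functions
  vanishing at 0. The notions are formulated so that they apply both to C*-algebras and to
  matrices over them.\<close>

definition quasi_invertible :: "'m::{plus,times} set \<Rightarrow> 'm \<Rightarrow> bool"
  where "quasi_invertible S a \<longleftrightarrow> (\<exists>b\<in>S. a + b = a * b \<and> a + b = b * a)"

definition nonzero_spectrum :: "'m::{plus,times,scaleC} set \<Rightarrow> 'm \<Rightarrow> complex set"
  where "nonzero_spectrum S a = {l. l \<noteq> 0 \<and> \<not> quasi_invertible S ((1 / l) *\<^sub>C a)}"

definition positive_in :: "'m::{plus,times,scaleC,star} set \<Rightarrow> 'm \<Rightarrow> bool"
  where "positive_in S a \<longleftrightarrow>
    a \<in> S \<and> star a = a \<and> nonzero_spectrum S a \<subseteq> {complex_of_real t | t. 0 \<le> t}"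

text \<open>\<^term>\<open>power_Suc_alg a n\<close> is the power with exponent \<^term>\<open>Suc n\<close>, and
  \<^term>\<open>poly_alg p a\<close> is the value at \<^term>\<open>a\<close> of \<^term>\<open>p\<close> without its
  constant term.\<close>

primrec power_Suc_alg :: "'a::cstar_algebra \<Rightarrow> nat \<Rightarrow> 'a"
  where
    "power_Suc_alg a 0 = a"
  | "power_Suc_alg a (Suc n) = a * power_Suc_alg a n"

definition poly_alg :: "real poly \<Rightarrow> 'a::cstar_algebra \<Rightarrow> 'a"
  where "poly_alg p a = (\<Sum>i<degree p. coeff p (Suc i) *\<^sub>R power_Suc_alg a i)"

text \<open>For self-adjoint \<^term>\<open>c\<close> and continuous real \<^term>\<open>f\<close> vanishing at 0, this is
  \<open>f(c)\<close>: the limit of \<open>p\<^sub>n(c)\<close> for any polynomials \<open>p\<^sub>n\<close> with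
  \<open>p\<^sub>n(0) = 0\<close> converging to \<^term>\<open>f\<close> uniformly on the spectrum.\<close>

definition fun_calc :: "'a::cstar_algebra set \<Rightarrow> (real \<Rightarrow> real) \<Rightarrow> 'a \<Rightarrow> 'a"
  where "fun_calc A f c = (THE y. y \<in> A \<and>
    (\<forall>p :: nat \<Rightarrow> real poly.
      (\<forall>n. poly (p n) 0 = 0) \<and>
      uniform_limit {t. complex_of_real t \<in> nonzero_spectrum A c} (\<lambda>n. poly (p n)) f sequentially
      \<longrightarrow> (\<lambda>n. poly_alg (p n) c) \<longlonglongrightarrow> y))"

definition cut_down :: "'a::cstar_algebra set \<Rightarrow> 'a \<Rightarrow> real \<Rightarrow> 'a"
  where "cut_down A c \<epsilon> = fun_calc A (\<lambda>t. max (t - \<epsilon>) 0) c"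

text \<open>Meant for positive \<^term>\<open>a\<close> and \<^term>\<open>b\<close>.\<close>

definition cuntz_below :: "'a::cstar_algebra set \<Rightarrow> 'a \<Rightarrow> 'a \<Rightarrow> bool"
  where "cuntz_below A a b \<longleftrightarrow>
    (\<exists>v :: nat \<Rightarrow> 'a. (\<forall>n. v n \<in> A) \<and>
      (\<lambda>n. norm (a - v n * b * star (v n))) \<longlonglongrightarrow> 0)"


section \<open>Matrix algebras\<close>

instantiation mat :: (scaleC) scaleC
begin

definition scaleC_mat :: "complex \<Rightarrow> 'a mat \<Rightarrow> 'a mat"
  where "scaleC_mat c X = map_mat (\<lambda>x. c *\<^sub>C x) X"

instance ..

end

instantiation mat :: (star) star
begin

definition star_mat :: "'a mat \<Rightarrow> 'a mat"
  where "star_mat X = transpose_mat (map_mat star X)"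

instance ..

end

definition mat_alg :: "nat \<Rightarrow> 'a set \<Rightarrow> 'a mat set"
  where "mat_alg k A = {X \<in> carrier_mat k k. elements_mat X \<subseteq> A}"

abbreviation cmat_alg :: "nat \<Rightarrow> complex mat set"
  where "cmat_alg n \<equiv> mat_alg n UNIV"

definition vec_l2norm :: "complex vec \<Rightarrow> real"
  where "vec_l2norm v = L2_set (\<lambda>i. cmod (vec_index v i)) {..<dim_vec v}"

definition mat_opnorm :: "complex mat \<Rightarrow> real"
  where "mat_opnorm X =
    Sup {vec_l2norm (X *\<^sub>v v) | v. v \<in> carrier_vec (dim_col X) \<and> vec_l2norm v \<le> 1}"


section \<open>Completely positive contractive order zero maps on matrix algebras\<close>

text \<open>The \<^term>\<open>k\<close>-th amplification of \<open>\<phi> : M\<^sub>n \<rightarrow> A\<close>, where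
  \<open>M\<^sub>k(M\<^sub>n)\<close> is identified with the \<^term>\<open>k * n\<close>-square matrices, read as
  \<^term>\<open>k\<close>-square arrays of blocks of size \<^term>\<open>n\<close>.\<close>

definition amplification :: "nat \<Rightarrow> nat \<Rightarrow> (complex mat \<Rightarrow> 'a) \<Rightarrow> complex mat \<Rightarrow> 'a mat"
  where "amplification k n \<phi> X =
    mat k k (\<lambda>(i, j). \<phi> (mat n n (\<lambda>(p, q). X $$ (i * n + p, j * n + q))))"

definition linear_on_mat :: "nat \<Rightarrow> 'a::cstar_algebra set \<Rightarrow> (complex mat \<Rightarrow> 'a) \<Rightarrow> bool"
  where "linear_on_mat n A \<phi> \<longleftrightarrow>
    (\<forall>X\<in>carrier_mat n n. \<phi> X \<in> A) \<and>
    (\<forall>X\<in>carrier_mat n n. \<forall>Y\<in>carrier_mat n n. \<phi> (X + Y) = \<phi> X + \<phi> Y) \<and>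
    (\<forall>X\<in>carrier_mat n n. \<forall>c. \<phi> (c *\<^sub>C X) = c *\<^sub>C \<phi> X)"

definition completely_positive :: "nat \<Rightarrow> 'a::cstar_algebra set \<Rightarrow> (complex mat \<Rightarrow> 'a) \<Rightarrow> bool"
  where "completely_positive n A \<phi> \<longleftrightarrow>
    (\<forall>k\<ge>1. \<forall>X. positive_in (cmat_alg (k * n)) X
      \<longrightarrow> positive_in (mat_alg k A) (amplification k n \<phi> X))"

definition cpc_order_zero :: "nat \<Rightarrow> 'a::cstar_algebra set \<Rightarrow> (complex mat \<Rightarrow> 'a) \<Rightarrow> bool"
  where "cpc_order_zero n A \<phi> \<longleftrightarrow>
    linear_on_mat n A \<phi> \<and> completely_positive n A \<phi> \<and>
    (\<forall>X\<in>carrier_mat n n. norm (\<phi> X) \<le> mat_opnorm X) \<and>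
    (\<forall>Y Z. positive_in (cmat_alg n) Y \<and> positive_in (cmat_alg n) Z \<and> Y * Z = 0\<^sub>m n n
      \<longrightarrow> \<phi> Y * \<phi> Z = 0)"


section \<open>Tracial Z-absorption\<close>

definition tracially_Z_absorbing :: "'a::cstar_algebra set \<Rightarrow> bool"
  where "tracially_Z_absorbing A \<longleftrightarrow>
    simple_cstar A \<and> \<not> cstar_isomorphic A (UNIV :: complex set) \<and>
    (\<forall>x a F \<epsilon> n.
      positive_in A x \<and> positive_in A a \<and> a \<noteq> 0 \<and> finite F \<and> F \<subseteq> A \<and> 0 < \<epsilon> \<and> 1 \<le> n \<longrightarrow>
      (\<exists>\<phi>. cpc_order_zero n A \<phi> \<and>
        cuntz_below A (cut_down A (x * x - x * \<phi> (1\<^sub>m n) * x) \<epsilon>) a \<and>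
        (\<forall>z\<in>carrier_mat n n. mat_opnorm z \<le> 1 \<longrightarrow>
          (\<forall>b\<in>F. norm (\<phi> z * b - b * \<phi> z) < \<epsilon>))))"


section \<open>The Hilbert spaces \<open>\<ell>\<^sup>2(X)\<close>\<close>

text \<open>Up to unitary equivalence every Hilbert space is of this form, and
  \<open>\<ell>\<^sup>2(X) \<otimes> \<ell>\<^sup>2(Y) = \<ell>\<^sup>2(X \<times> Y)\<close>.\<close>

definition square_summable :: "('x \<Rightarrow> complex) \<Rightarrow> bool"
  where "square_summable f \<longleftrightarrow> (\<lambda>x. (cmod (f x))\<^sup>2) summable_on UNIV"

lemma square_summableI:
  assumes "\<And>F. finite F \<Longrightarrow> (\<Sum>x\<in>F. (cmod (f x))\<^sup>2) \<le> C"
  shows "square_summable f"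
  unfolding square_summable_def
  by (rule nonneg_bdd_above_summable_on) (auto intro!: bdd_aboveI2[where M=C] assms)

lemma square_summable_mult:
  assumes "square_summable f" "square_summable g"
  shows "(\<lambda>x. cnj (f x) * g x) summable_on UNIV"
proof -
  have "(\<lambda>x. norm (cnj (f x) * g x)) summable_on UNIV"
    by (rule abs_summable_product)
      (use assms in \<open>simp_all add: square_summable_def norm_mult power2_eq_square\<close>)
  then show ?thesis
    by (rule Infinite_Sum.abs_summable_summable)
qed

lemma square_summable_scale:
  assumes "square_summable f"
  shows "square_summable (\<lambda>x. c * f x)"
  using summable_on_cmult_right[OF assms[unfolded square_summable_def], of "(cmod c)\<^sup>2"]
  by (simp add: square_summable_def norm_mult power_mult_distrib)

lemma square_summable_add:
  assumes "square_summable f" "square_summable g"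
  shows "square_summable (\<lambda>x. f x + g x)"
proof -
  have bound: "(cmod (f x + g x))\<^sup>2 \<le> 2 * (cmod (f x))\<^sup>2 + 2 * (cmod (g x))\<^sup>2" for x
  proof -
    have "(cmod (f x + g x))\<^sup>2 \<le> (cmod (f x) + cmod (g x))\<^sup>2"
      by (intro power_mono norm_triangle_ineq) auto
    also have "\<dots> \<le> 2 * (cmod (f x))\<^sup>2 + 2 * (cmod (g x))\<^sup>2"
      using sum_squares_bound[of "cmod (f x)" "cmod (g x)"] by (simp add: power2_sum)
    finally show ?thesis .
  qed
  have "(\<lambda>x. 2 * (cmod (f x))\<^sup>2 + 2 * (cmod (g x))\<^sup>2) summable_on UNIV"
    using assms unfolding square_summable_def
    by (intro summable_on_add summable_on_cmult_right)
  from summable_on_comparison_test[OF this bound] show ?thesis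
    by (simp add: square_summable_def)
qed

typedef 'x ell2 = "{f :: 'x \<Rightarrow> complex. square_summable f}"
  morphisms ell2_apply Abs_ell2
  by (rule exI[of _ "\<lambda>_. 0"]) (simp add: square_summable_def)

setup_lifting type_definition_ell2

lemma square_summable_ell2 [simp]: "square_summable (ell2_apply v)"
  using ell2_apply by blast

lemma ell2_eqI: "(\<And>x. ell2_apply v x = ell2_apply w x) \<Longrightarrow> v = w"
  by (simp add: ell2_apply_inject[symmetric] fun_eq_iff)

definition cinner :: "'x ell2 \<Rightarrow> 'x ell2 \<Rightarrow> complex"
  where "cinner v w = (\<Sum>\<^sub>\<infinity>x. cnj (ell2_apply v x) * ell2_apply w x)"

instantiation ell2 :: (type) "{real_vector, scaleC}"
begin

lift_definition zero_ell2 :: "'a ell2" is "\<lambda>_. 0"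
  by (simp add: square_summable_def)

lift_definition plus_ell2 :: "'a ell2 \<Rightarrow> 'a ell2 \<Rightarrow> 'a ell2" is "\<lambda>f g x. f x + g x"
  by (rule square_summable_add)

lift_definition uminus_ell2 :: "'a ell2 \<Rightarrow> 'a ell2" is "\<lambda>f x. - f x"
  by (simp add: square_summable_def)

lift_definition minus_ell2 :: "'a ell2 \<Rightarrow> 'a ell2 \<Rightarrow> 'a ell2" is "\<lambda>f g x. f x - g x"
  using square_summable_add[OF _ square_summable_scale[where c="-1"]] by simp

lift_definition scaleR_ell2 :: "real \<Rightarrow> 'a ell2 \<Rightarrow> 'a ell2" is "\<lambda>r f x. complex_of_real r * f x"
  by (rule square_summable_scale)

lift_definition scaleC_ell2 :: "complex \<Rightarrow> 'a ell2 \<Rightarrow> 'a ell2" is "\<lambda>c f x. c * f x"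
  by (rule square_summable_scale)

instance
  by standard (transfer; simp add: algebra_simps)+

end

lemma cinner_add_left: "cinner (u + v) w = cinner u w + cinner v w"
  unfolding cinner_def plus_ell2.rep_eq complex_cnj_add distrib_right
  by (intro infsum_add square_summable_mult square_summable_ell2)

lemma cinner_commute: "cinner v w = cnj (cinner w v)"
  unfolding cinner_def by (simp flip: infsum_cnj add: mult.commute)

lemma cinner_add_right: "cinner w (u + v) = cinner w u + cinner w v"
  by (metis cinner_add_left cinner_commute complex_cnj_add)

lemma cinner_scaleC_right: "cinner v (c *\<^sub>C w) = c * cinner v w"
  unfolding cinner_def scaleC_ell2.rep_eq
  by (simp flip: infsum_cmult_right' add: algebra_simps)

lemma cinner_scaleC_left: "cinner (c *\<^sub>C v) w = cnj c * cinner v w"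
  by (metis cinner_commute cinner_scaleC_right complex_cnj_mult)

lemma ell2_scaleR_scaleC: "r *\<^sub>R (v :: 'x ell2) = complex_of_real r *\<^sub>C v"
  by transfer simp

lemma cinner_self: "cinner v v = complex_of_real (\<Sum>\<^sub>\<infinity>x. (cmod (ell2_apply v x))\<^sup>2)"
proof -
  have "cinner v v = (\<Sum>\<^sub>\<infinity>x. complex_of_real ((cmod (ell2_apply v x))\<^sup>2))"
    unfolding cinner_def complex_norm_square by (simp add: mult.commute)
  also have "\<dots> = complex_of_real (\<Sum>\<^sub>\<infinity>x. (cmod (ell2_apply v x))\<^sup>2)"
    using square_summable_ell2[of v] unfolding square_summable_def
    by (intro infsumI has_sum_of_real) simp
  finally show ?thesis .
qed

instantiation ell2 :: (type) real_inner
begin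

definition inner_ell2 :: "'a ell2 \<Rightarrow> 'a ell2 \<Rightarrow> real"
  where "inner_ell2 v w = Re (cinner v w)"

definition norm_ell2 :: "'a ell2 \<Rightarrow> real"
  where "norm_ell2 v = sqrt (\<Sum>\<^sub>\<infinity>x. (cmod (ell2_apply v x))\<^sup>2)"

definition sgn_ell2 :: "'a ell2 \<Rightarrow> 'a ell2"
  where "sgn_ell2 v = v /\<^sub>R norm v"

definition dist_ell2 :: "'a ell2 \<Rightarrow> 'a ell2 \<Rightarrow> real"
  where "dist_ell2 v w = norm (v - w)"

definition uniformity_ell2 :: "('a ell2 \<times> 'a ell2) filter"
  where "uniformity_ell2 = (INF e\<in>{0<..}. principal {(v, w). dist v w < e})"

definition open_ell2 :: "'a ell2 set \<Rightarrow> bool"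
  where "open_ell2 U \<longleftrightarrow> (\<forall>v\<in>U. \<forall>\<^sub>F (v', w) in uniformity. v' = v \<longrightarrow> w \<in> U)"

instance
proof
  fix u v w :: "'a ell2" and r :: real
  show "inner v w = inner w v"
    unfolding inner_ell2_def by (subst cinner_commute) simp
  show "inner (u + v) w = inner u w + inner v w"
    by (simp add: inner_ell2_def cinner_add_left)
  show "inner (r *\<^sub>R v) w = r * inner v w"
    by (simp add: inner_ell2_def ell2_scaleR_scaleC cinner_scaleC_left)
  show "0 \<le> inner v v"
    by (simp add: inner_ell2_def cinner_self infsum_nonneg)
  show "inner v v = 0 \<longleftrightarrow> v = 0"
  proof
    assume "inner v v = 0"
    then have *: "(\<Sum>\<^sub>\<infinity>x. (cmod (ell2_apply v x))\<^sup>2) \<le> 0"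
      by (simp add: inner_ell2_def cinner_self)
    have "(cmod (ell2_apply v x))\<^sup>2 = 0" for x
      using square_summable_ell2[of v] unfolding square_summable_def
      by (rule nonneg_infsum_le_0D[OF *]) auto
    then show "v = 0"
      by (intro ell2_eqI) (simp add: zero_ell2.rep_eq)
  qed (simp add: inner_ell2_def cinner_def zero_ell2.rep_eq)
  show "norm v = sqrt (inner v v)"
    by (simp add: inner_ell2_def cinner_self norm_ell2_def)
qed (fact sgn_ell2_def dist_ell2_def uniformity_ell2_def open_ell2_def)+

end

lemma norm_ell2_sq: "(norm v)\<^sup>2 = (\<Sum>\<^sub>\<infinity>x. (cmod (ell2_apply v x))\<^sup>2)"
  by (simp add: norm_ell2_def infsum_nonneg)

lemma cinner_self_norm: "cinner v v = complex_of_real ((norm v)\<^sup>2)"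
  by (simp add: cinner_self norm_ell2_sq)

lemma finite_sum_le_norm_ell2: "finite F \<Longrightarrow> (\<Sum>x\<in>F. (cmod (ell2_apply v x))\<^sup>2) \<le> (norm v)\<^sup>2"
  unfolding norm_ell2_sq using square_summable_ell2[of v] unfolding square_summable_def
  by (intro finite_sum_le_infsum) auto

lemma norm_ell2_leI:
  assumes "\<And>F. finite F \<Longrightarrow> (\<Sum>x\<in>F. (cmod (ell2_apply v x))\<^sup>2) \<le> C\<^sup>2" "0 \<le> C"
  shows "norm v \<le> C"
proof -
  have "(norm v)\<^sup>2 \<le> C\<^sup>2"
    unfolding norm_ell2_sq using square_summable_ell2[of v] unfolding square_summable_def
    by (intro infsum_le_finite_sums) (auto intro: assms)
  then show ?thesis
    using assms(2) power2_le_imp_le by blast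
qed

lemma cmod_ell2_apply_le: "cmod (ell2_apply v x) \<le> norm v"
  using finite_sum_le_norm_ell2[of "{x}" v] by (auto intro: power2_le_imp_le)

lemma norm_scaleC_ell2: "norm (c *\<^sub>C (v :: 'x ell2)) = cmod c * norm v"
proof -
  have "(norm (c *\<^sub>C v))\<^sup>2 = (cmod c * norm v)\<^sup>2"
    unfolding power_mult_distrib norm_ell2_sq scaleC_ell2.rep_eq
    by (simp add: norm_mult power_mult_distrib infsum_cmult_right')
  then show ?thesis
    by (simp add: power2_eq_iff_nonneg)
qed

instance ell2 :: (type) banach
proof
  fix X :: "nat \<Rightarrow> 'a ell2"
  assume X: "Cauchy X"
  have "Cauchy (\<lambda>n. ell2_apply (X n) x)" for x
  proof (rule CauchyI)
    fix e :: real assume "0 < e"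
    then obtain M where M: "\<And>m n. m \<ge> M \<Longrightarrow> n \<ge> M \<Longrightarrow> norm (X m - X n) < e"
      using CauchyD[OF X] by blast
    have "cmod (ell2_apply (X m) x - ell2_apply (X n) x) < e" if "m \<ge> M" "n \<ge> M" for m n
      using cmod_ell2_apply_le[of "X m - X n" x] M[OF that] by (simp add: minus_ell2.rep_eq)
    then show "\<exists>M. \<forall>m\<ge>M. \<forall>n\<ge>M. norm (ell2_apply (X m) x - ell2_apply (X n) x) < e"
      by blast
  qed
  then have "\<exists>l. (\<lambda>n. ell2_apply (X n) x) \<longlonglongrightarrow> l" for x
    by (simp add: Cauchy_convergent_iff convergent_def)
  then obtain f where f: "\<And>x. (\<lambda>n. ell2_apply (X n) x) \<longlonglongrightarrow> f x"
    by metis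
  have bound: "(\<Sum>x\<in>F. (cmod (ell2_apply (X m) x - f x))\<^sup>2) \<le> e\<^sup>2"
    if M: "\<And>m n. m \<ge> M \<Longrightarrow> n \<ge> M \<Longrightarrow> norm (X m - X n) < e" and "m \<ge> M" "finite F"
    for e M m F
  proof (rule LIMSEQ_le_const2)
    show "(\<lambda>n. \<Sum>x\<in>F. (cmod (ell2_apply (X m) x - ell2_apply (X n) x))\<^sup>2)
        \<longlonglongrightarrow> (\<Sum>x\<in>F. (cmod (ell2_apply (X m) x - f x))\<^sup>2)"
      by (intro tendsto_intros f)
    have "(\<Sum>x\<in>F. (cmod (ell2_apply (X m) x - ell2_apply (X n) x))\<^sup>2) \<le> e\<^sup>2" if "n \<ge> M" for n
    proof -
      have "(\<Sum>x\<in>F. (cmod (ell2_apply (X m) x - ell2_apply (X n) x))\<^sup>2) \<le> (norm (X m - X n))\<^sup>2"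
        using finite_sum_le_norm_ell2[OF \<open>finite F\<close>, of "X m - X n"] by (simp add: minus_ell2.rep_eq)
      also have "\<dots> \<le> e\<^sup>2"
        using M[OF \<open>m \<ge> M\<close> that] by (intro power_mono) auto
      finally show ?thesis .
    qed
    then show "\<exists>N. \<forall>n\<ge>N. (\<Sum>x\<in>F. (cmod (ell2_apply (X m) x - ell2_apply (X n) x))\<^sup>2) \<le> e\<^sup>2"
      by blast
  qed
  obtain M where M: "\<And>m n. m \<ge> M \<Longrightarrow> n \<ge> M \<Longrightarrow> norm (X m - X n) < 1"
    using CauchyD[OF X, of 1] by auto
  have "square_summable (\<lambda>x. f x - ell2_apply (X M) x)"
    using bound[OF M, of M] by (intro square_summableI[where C="1\<^sup>2"]) (simp add: norm_minus_commute)
  from square_summable_add[OF this square_summable_ell2[of "X M"]]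
  have sf: "square_summable f" by simp
  have f_apply: "ell2_apply (Abs_ell2 f) = f"
    using sf by (simp add: Abs_ell2_inverse)
  have "X \<longlonglongrightarrow> Abs_ell2 f"
  proof (rule LIMSEQ_I)
    fix e :: real assume "0 < e"
    then have "0 < e / 2" by simp
    then obtain N where N: "\<And>m n. m \<ge> N \<Longrightarrow> n \<ge> N \<Longrightarrow> norm (X m - X n) < e / 2"
      using CauchyD[OF X] by blast
    have "norm (X m - Abs_ell2 f) \<le> e / 2" if "m \<ge> N" for m
      using bound[OF N that] \<open>0 < e\<close>
      by (intro norm_ell2_leI) (auto simp: minus_ell2.rep_eq f_apply)
    then show "\<exists>N. \<forall>m\<ge>N. norm (X m - Abs_ell2 f) < e"
      using \<open>0 < e\<close> by (metis field_sum_of_halves less_add_same_cancel1 order_le_less_trans half_gt_zero)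
  qed
  then show "convergent X"
    by (auto simp: convergent_def)
qed

lemma cinner_bound: "cmod (cinner v w) \<le> norm v * norm w"
proof -
  obtain c where c: "cmod c = 1" "c * cinner v w = complex_of_real (cmod (cinner v w))"
  proof (cases "cinner v w = 0")
    case True then show ?thesis using that[of 1] by simp
  next
    case False
    let ?c = "cnj (cinner v w) / complex_of_real (cmod (cinner v w))"
    have "?c * cinner v w = complex_of_real (cmod (cinner v w))"
      using False complex_norm_square[of "cinner v w"]
      by (simp add: field_simps power2_eq_square)
    moreover have "cmod ?c = 1" using False by (simp add: norm_divide)
    ultimately show ?thesis using that by blast
  qed
  have "cmod (cinner v w) = inner v (c *\<^sub>C w)"
    by (simp add: inner_ell2_def cinner_scaleC_right c)
  also have "\<dots> \<le> norm v * norm (c *\<^sub>C w)"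
    by (rule norm_cauchy_schwarz)
  finally show ?thesis
    by (simp add: norm_scaleC_ell2 c)
qed

definition ket :: "'x \<Rightarrow> 'x ell2"
  where "ket x = Abs_ell2 (\<lambda>y. if y = x then 1 else 0)"

lemma ell2_apply_ket: "ell2_apply (ket x) y = (if y = x then 1 else 0)"
proof -
  have "square_summable (\<lambda>y. if y = x then 1 else 0 :: complex)"
  proof (rule square_summableI)
    fix F :: "'a set" assume "finite F"
    have "(\<Sum>y\<in>F. (cmod (if y = x then 1 else 0))\<^sup>2) = (\<Sum>y\<in>F. if y = x then 1 else 0)"
      by (intro sum.cong) auto
    also have "\<dots> \<le> (1 :: real)"
      using \<open>finite F\<close> by simp
    finally show "(\<Sum>y\<in>F. (cmod (if y = x then 1 else 0))\<^sup>2) \<le> 1" .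
  qed
  then show ?thesis
    by (simp add: ket_def Abs_ell2_inverse)
qed

lemma ell2_apply_sum: "ell2_apply (sum v F) x = (\<Sum>i\<in>F. ell2_apply (v i) x)"
  by (induction F rule: infinite_finite_induct) (auto simp: zero_ell2.rep_eq plus_ell2.rep_eq)

lemma ell2_apply_sum_ket:
  "finite F \<Longrightarrow> ell2_apply (\<Sum>x\<in>F. c x *\<^sub>C ket x) y = (if y \<in> F then c y else 0)"
  by (simp add: ell2_apply_sum scaleC_ell2.rep_eq ell2_apply_ket if_distrib cong: if_cong)

lemma ell2_dense_induct:
  assumes "closed {v. P v}"
    and sum_ket: "\<And>F c. finite F \<Longrightarrow> P (\<Sum>x\<in>F. c x *\<^sub>C ket x)"
  shows "P v"
proof -
  have "\<exists>w\<in>{v. P v}. dist w v < e" if "0 < e" for e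
  proof -
    define g where "g = (\<lambda>x. (cmod (ell2_apply v x))\<^sup>2)"
    have g: "(g has_sum (norm v)\<^sup>2) UNIV"
      using square_summable_ell2[of v] unfolding square_summable_def norm_ell2_sq g_def by simp
    have "0 < (e / 2)\<^sup>2" using that by simp
    then obtain F where F: "finite F" "dist (sum g F) ((norm v)\<^sup>2) \<le> (e / 2)\<^sup>2"
      using has_sum_finite_approximation[OF g] by blast
    define w where "w = (\<Sum>x\<in>F. ell2_apply v x *\<^sub>C ket x)"
    have "norm (w - v) \<le> e / 2"
    proof (rule norm_ell2_leI)
      fix G :: "'a set" assume G: "finite G"
      have "(\<Sum>x\<in>G. (cmod (ell2_apply (w - v) x))\<^sup>2) = (\<Sum>x\<in>G. if x \<in> F then 0 else g x)"
        by (intro sum.cong)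
          (auto simp: w_def minus_ell2.rep_eq ell2_apply_sum_ket[OF F(1)] g_def)
      also have "\<dots> = sum g (G - F)"
        using G by (intro sum.mono_neutral_cong_right) auto
      also have "\<dots> = sum g (G \<union> F) - sum g F"
        using G F(1) by (simp add: sum_diff[symmetric] Un_Diff)
      also have "sum g (G \<union> F) \<le> (norm v)\<^sup>2"
        using G F(1) unfolding g_def by (intro finite_sum_le_norm_ell2) simp
      also have "(norm v)\<^sup>2 - sum g F \<le> (e / 2)\<^sup>2"
        using F(2) by (simp add: dist_real_def)
      finally show "(\<Sum>x\<in>G. (cmod (ell2_apply (w - v) x))\<^sup>2) \<le> (e / 2)\<^sup>2"
        by simp
    qed (use that in simp)
    then have "dist w v < e"
      using that by (simp add: dist_norm)
    moreover have "P w"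
      unfolding w_def by (rule sum_ket[OF F(1)])
    ultimately show ?thesis by blast
  qed
  then have "v \<in> closure {v. P v}"
    by (simp add: closure_approachable)
  then show ?thesis
    using assms(1) by simp
qed

lemma scaleC_ell2_algebra:
  "c *\<^sub>C (u + v) = c *\<^sub>C u + c *\<^sub>C (v :: 'x ell2)"
  "c *\<^sub>C (u - v) = c *\<^sub>C u - c *\<^sub>C (v :: 'x ell2)"
  "c *\<^sub>C (- v) = - (c *\<^sub>C (v :: 'x ell2))"
  "(c + d) *\<^sub>C (v :: 'x ell2) = c *\<^sub>C v + d *\<^sub>C v"
  "c *\<^sub>C (d *\<^sub>C (v :: 'x ell2)) = (c * d) *\<^sub>C v"
  "1 *\<^sub>C (v :: 'x ell2) = v"
  "c *\<^sub>C (0 :: 'x ell2) = 0"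
  by (transfer; simp add: algebra_simps)+

lemma bounded_linear_scaleC_ell2: "bounded_linear (\<lambda>v :: 'x ell2. c *\<^sub>C v)"
proof (rule bounded_linear_intro[where K = "cmod c"])
  show "c *\<^sub>C (u + v) = c *\<^sub>C u + c *\<^sub>C v" for u v :: "'x ell2"
    by transfer (simp add: algebra_simps)
  show "c *\<^sub>C (r *\<^sub>R v) = r *\<^sub>R (c *\<^sub>C v)" for r and v :: "'x ell2"
    by transfer (simp add: algebra_simps)
qed (simp add: norm_scaleC_ell2 mult.commute)

lemma bounded_linear_cinner_right: "bounded_linear (cinner v)"
  by (rule bounded_linear_intro[where K = "norm v"])
    (use cinner_bound[of v] in \<open>simp_all add: cinner_add_right ell2_scaleR_scaleC cinner_scaleC_right
      scaleR_conv_of_real mult.commute\<close>)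

lemma bounded_linear_cinner_left: "bounded_linear (\<lambda>v. cinner v w)"
  by (rule bounded_linear_intro[where K = "norm w"])
    (use cinner_bound[of _ w] in \<open>simp_all add: cinner_add_left ell2_scaleR_scaleC cinner_scaleC_left
      scaleR_conv_of_real mult.commute\<close>)

lemma cinner_ket_left: "cinner (ket x) v = ell2_apply v x"
proof -
  have "cinner (ket x) v = (\<Sum>\<^sub>\<infinity>y\<in>{x}. cnj (ell2_apply (ket x) y) * ell2_apply v y)"
    unfolding cinner_def by (rule infsum_cong_neutral) (auto simp: ell2_apply_ket)
  then show ?thesis
    by (simp add: ell2_apply_ket)
qed

lemma cinner_eqI: "(\<And>u. cinner u v = cinner u w) \<Longrightarrow> v = w"
  by (metis cinner_ket_left ell2_eqI)


section \<open>Bounded operators on \<open>\<ell>\<^sup>2(X)\<close>\<close>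

typedef 'x l2op = "{T :: 'x ell2 \<Rightarrow>\<^sub>L 'x ell2. \<forall>c v. T (c *\<^sub>C v) = c *\<^sub>C T v}"
  morphisms blinfun_of_l2op Abs_l2op
  by (rule exI[of _ 0]) (auto simp: zero_ell2.rep_eq scaleC_ell2.rep_eq intro!: ell2_eqI)

lifting_forget ell2.lifting

setup_lifting type_definition_l2op

lift_definition l2op_apply :: "'x l2op \<Rightarrow> 'x ell2 \<Rightarrow> 'x ell2" is blinfun_apply .

lemma l2op_eqI: "(\<And>v. l2op_apply S v = l2op_apply T v) \<Longrightarrow> S = T"
  by transfer (rule blinfun_eqI)

lemma l2op_apply_scaleC: "l2op_apply T (c *\<^sub>C v) = c *\<^sub>C l2op_apply T v"
  by transfer simp

lemma bounded_linear_l2op_apply: "bounded_linear (l2op_apply T)"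
  by transfer (rule blinfun.bounded_linear_right)

lemma l2op_apply_Abs_l2op:
  assumes "bounded_linear f" "\<And>c v. f (c *\<^sub>C v) = c *\<^sub>C f v"
  shows "l2op_apply (Abs_l2op (Blinfun f)) v = f v"
proof -
  have "blinfun_of_l2op (Abs_l2op (Blinfun f)) = Blinfun f"
    by (rule Abs_l2op_inverse) (simp add: bounded_linear_Blinfun_apply assms)
  then show ?thesis
    by (simp add: l2op_apply.rep_eq bounded_linear_Blinfun_apply assms(1))
qed

lemma l2op_of_fun_exists:
  assumes "bounded_linear f" "\<And>c v. f (c *\<^sub>C v) = c *\<^sub>C f v"
  shows "\<exists>T. \<forall>v. l2op_apply T v = f v"
  using l2op_apply_Abs_l2op[OF assms] by blast

instantiation l2op :: (type) real_normed_algebra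
begin

lift_definition zero_l2op :: "'a l2op" is 0
  by (simp add: scaleC_ell2_algebra)

lift_definition plus_l2op :: "'a l2op \<Rightarrow> 'a l2op \<Rightarrow> 'a l2op" is "(+)"
  by (simp add: scaleC_ell2_algebra blinfun.add_left)

lift_definition minus_l2op :: "'a l2op \<Rightarrow> 'a l2op \<Rightarrow> 'a l2op" is "(-)"
  by (simp add: scaleC_ell2_algebra blinfun.diff_left)

lift_definition uminus_l2op :: "'a l2op \<Rightarrow> 'a l2op" is uminus
  by (simp add: scaleC_ell2_algebra blinfun.minus_left)

lift_definition scaleR_l2op :: "real \<Rightarrow> 'a l2op \<Rightarrow> 'a l2op" is scaleR
  by (simp add: ell2_scaleR_scaleC scaleC_ell2_algebra blinfun.scaleR_left mult.commute)

lift_definition times_l2op :: "'a l2op \<Rightarrow> 'a l2op \<Rightarrow> 'a l2op" is "(o\<^sub>L)"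
  by simp

lift_definition norm_l2op :: "'a l2op \<Rightarrow> real" is norm .

definition sgn_l2op :: "'a l2op \<Rightarrow> 'a l2op"
  where "sgn_l2op T = inverse (norm T) *\<^sub>R T"

definition dist_l2op :: "'a l2op \<Rightarrow> 'a l2op \<Rightarrow> real"
  where "dist_l2op S T = norm (S - T)"

definition uniformity_l2op :: "('a l2op \<times> 'a l2op) filter"
  where "uniformity_l2op = (INF e\<in>{0<..}. principal {(S, T). dist S T < e})"

definition open_l2op :: "'a l2op set \<Rightarrow> bool"
  where "open_l2op U \<longleftrightarrow> (\<forall>S\<in>U. \<forall>\<^sub>F (S', T) in uniformity. S' = S \<longrightarrow> T \<in> U)"

instance
proof
  fix R S T :: "'a l2op" and r s :: real
  show "R + S + T = R + (S + T)" by transfer simp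
  show "R + S = S + R" by transfer simp
  show "0 + R = R" by transfer simp
  show "- R + R = 0" by transfer simp
  show "R - S = R + - S" by transfer simp
  show "r *\<^sub>R (S + T) = r *\<^sub>R S + r *\<^sub>R T" by transfer (simp add: scaleR_add_right)
  show "(r + s) *\<^sub>R T = r *\<^sub>R T + s *\<^sub>R T" by transfer (simp add: scaleR_add_left)
  show "r *\<^sub>R s *\<^sub>R T = (r * s) *\<^sub>R T" by transfer simp
  show "1 *\<^sub>R T = T" by transfer simp
  show "R * S * T = R * (S * T)" by transfer (auto intro: blinfun_eqI)
  show "(R + S) * T = R * T + S * T"
    by transfer (auto intro: blinfun_eqI simp: blinfun.add_left)
  show "R * (S + T) = R * S + R * T"
    by transfer (auto intro: blinfun_eqI simp: blinfun.add_left blinfun.add_right)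
  show "r *\<^sub>R S * T = r *\<^sub>R (S * T)"
    by transfer (auto intro: blinfun_eqI simp: blinfun.scaleR_left)
  show "S * r *\<^sub>R T = r *\<^sub>R (S * T)"
    by transfer (auto intro: blinfun_eqI simp: blinfun.scaleR_left blinfun.scaleR_right)
  show "norm T = 0 \<longleftrightarrow> T = 0" by transfer simp
  show "norm (S + T) \<le> norm S + norm T" by transfer (rule norm_triangle_ineq)
  show "norm (r *\<^sub>R T) = \<bar>r\<bar> * norm T" by transfer simp
  show "norm (S * T) \<le> norm S * norm T" by transfer (rule norm_blinfun_compose)
qed (fact sgn_l2op_def dist_l2op_def uniformity_l2op_def open_l2op_def)+

end

lemma l2op_apply_plus: "l2op_apply (S + T) v = l2op_apply S v + l2op_apply T v"
  by transfer (rule blinfun.add_left)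

lemma l2op_apply_scaleR: "l2op_apply (r *\<^sub>R T) v = r *\<^sub>R l2op_apply T v"
  by transfer (rule blinfun.scaleR_left)

lemma l2op_apply_times: "l2op_apply (S * T) v = l2op_apply S (l2op_apply T v)"
  by transfer simp

lemma norm_l2op_apply: "norm (l2op_apply T v) \<le> norm T * norm v"
  by transfer (rule norm_blinfun)

lemma norm_l2op_leI: "0 \<le> C \<Longrightarrow> (\<And>v. norm (l2op_apply T v) \<le> C * norm v) \<Longrightarrow> norm T \<le> C"
  by transfer (rule norm_blinfun_bound)

instance l2op :: (type) banach
proof
  fix X :: "nat \<Rightarrow> 'a l2op"
  assume X: "Cauchy X"
  have norm_eq: "norm (blinfun_of_l2op S - blinfun_of_l2op T) = norm (S - T)" for S T :: "'a l2op"
    by (simp add: norm_l2op.rep_eq minus_l2op.rep_eq)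
  have "Cauchy (\<lambda>n. blinfun_of_l2op (X n))"
    using X by (simp add: Cauchy_iff norm_eq)
  then obtain L where L: "(\<lambda>n. blinfun_of_l2op (X n)) \<longlonglongrightarrow> L"
    by (auto simp: Cauchy_convergent_iff convergent_def)
  have L_apply: "(\<lambda>n. l2op_apply (X n) v) \<longlonglongrightarrow> blinfun_apply L v" for v
    unfolding l2op_apply.rep_eq by (intro blinfun.tendsto L tendsto_const)
  have "L (c *\<^sub>C v) = c *\<^sub>C L v" for c v
  proof (rule LIMSEQ_unique)
    show "(\<lambda>n. l2op_apply (X n) (c *\<^sub>C v)) \<longlonglongrightarrow> L (c *\<^sub>C v)"
      by (rule L_apply)
    show "(\<lambda>n. l2op_apply (X n) (c *\<^sub>C v)) \<longlonglongrightarrow> c *\<^sub>C L v"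
      unfolding l2op_apply_scaleC
      by (rule bounded_linear.tendsto[OF bounded_linear_scaleC_ell2 L_apply])
  qed
  then have "blinfun_of_l2op (Abs_l2op L) = L"
    by (intro Abs_l2op_inverse) simp
  then have "X \<longlonglongrightarrow> Abs_l2op L"
    using L by (simp add: LIMSEQ_iff flip: norm_eq)
  then show "convergent X"
    by (auto simp: convergent_def)
qed

lemma adjoint_exists: "\<exists>S. \<forall>u v. cinner (l2op_apply T u) v = cinner u (l2op_apply S v)"
proof -
  define f where "f v x = cinner (l2op_apply T (ket x)) v" for v x
  have T_sum: "cinner (l2op_apply T (\<Sum>x\<in>F. c x *\<^sub>C ket x)) v = (\<Sum>x\<in>F. cnj (c x) * f v x)" for F c v
    by (simp add: f_def linear_sum[OF bounded_linear.linear[OF bounded_linear_l2op_apply]]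
      linear_sum[OF bounded_linear.linear[OF bounded_linear_cinner_left]]
      l2op_apply_scaleC cinner_scaleC_left)
  have bound: "(\<Sum>x\<in>F. (cmod (f v x))\<^sup>2) \<le> (norm T * norm v)\<^sup>2" if F: "finite F" for v F
  proof -
    define u where "u = (\<Sum>x\<in>F. f v x *\<^sub>C ket x)"
    define s where "s = (\<Sum>x\<in>F. (cmod (f v x))\<^sup>2)"
    have s0: "0 \<le> s" by (simp add: s_def sum_nonneg)
    have "norm u \<le> sqrt s"
    proof (rule norm_ell2_leI)
      fix G :: "'a set" assume G: "finite G"
      have "(\<Sum>x\<in>G. (cmod (ell2_apply u x))\<^sup>2) = (\<Sum>x\<in>G. if x \<in> F then (cmod (f v x))\<^sup>2 else 0)"
        by (intro sum.cong) (auto simp: u_def ell2_apply_sum_ket[OF F])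
      also have "\<dots> = (\<Sum>x\<in>G \<inter> F. (cmod (f v x))\<^sup>2)"
        using G by (simp add: sum.inter_restrict)
      also have "\<dots> \<le> s"
        unfolding s_def using F by (intro sum_mono2) auto
      finally show "(\<Sum>x\<in>G. (cmod (ell2_apply u x))\<^sup>2) \<le> (sqrt s)\<^sup>2"
        using s0 by simp
    qed (use s0 in simp)
    have "cinner (l2op_apply T u) v = complex_of_real s"
      unfolding u_def T_sum s_def of_real_sum complex_norm_square by (simp add: mult.commute)
    then have "s = cmod (cinner (l2op_apply T u) v)"
      using s0 by simp
    also have "\<dots> \<le> norm (l2op_apply T u) * norm v"
      by (rule cinner_bound)
    also have "\<dots> \<le> norm T * norm u * norm v"
      by (intro mult_right_mono norm_l2op_apply) simp
    also have "\<dots> \<le> norm T * sqrt s * norm v"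
      by (intro mult_right_mono mult_left_mono \<open>norm u \<le> sqrt s\<close>) auto
    finally have *: "sqrt s * sqrt s \<le> (norm T * norm v) * sqrt s"
      using s0 by (simp add: algebra_simps)
    have "sqrt s \<le> norm T * norm v"
    proof (cases "s = 0")
      case False
      then show ?thesis
        using s0 by (intro mult_right_le_imp_le[OF *]) simp
    qed simp
    then have "(sqrt s)\<^sup>2 \<le> (norm T * norm v)\<^sup>2"
      using s0 by (intro power_mono) auto
    then show ?thesis
      using s0 by (simp add: s_def)
  qed
  have f_apply: "ell2_apply (Abs_ell2 (f v)) = f v" for v
    using bound[of _ v] by (intro Abs_ell2_inverse CollectI square_summableI) auto
  have "bounded_linear (\<lambda>v. Abs_ell2 (f v))"
  proof (rule bounded_linear_intro[where K = "norm T"])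
    show "Abs_ell2 (f (u + v)) = Abs_ell2 (f u) + Abs_ell2 (f v)" for u v
      by (rule ell2_eqI) (simp add: f_apply plus_ell2.rep_eq, simp add: f_def cinner_add_right)
    show "Abs_ell2 (f (r *\<^sub>R v)) = r *\<^sub>R Abs_ell2 (f v)" for r v
      by (rule ell2_eqI)
        (simp add: f_apply scaleR_ell2.rep_eq, simp add: f_def ell2_scaleR_scaleC cinner_scaleC_right)
    show "norm (Abs_ell2 (f v)) \<le> norm v * norm T" for v
      using bound[of _ v] by (intro norm_ell2_leI) (auto simp: f_apply mult.commute)
  qed
  moreover have "Abs_ell2 (f (c *\<^sub>C v)) = c *\<^sub>C Abs_ell2 (f v)" for c v
    by (rule ell2_eqI)
      (simp add: f_apply scaleC_ell2.rep_eq, simp add: f_def cinner_scaleC_right)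
  ultimately obtain S where S: "\<And>v. l2op_apply S v = Abs_ell2 (f v)"
    using l2op_of_fun_exists by blast
  have "cinner (l2op_apply T u) v = cinner u (l2op_apply S v)" for u v
  proof (rule ell2_dense_induct[of "\<lambda>u. cinner (l2op_apply T u) v = cinner u (l2op_apply S v)"])
    show "closed {u. cinner (l2op_apply T u) v = cinner u (l2op_apply S v)}"
      by (intro closed_Collect_eq linear_continuous_on bounded_linear_cinner_left
        bounded_linear_compose[OF bounded_linear_cinner_left bounded_linear_l2op_apply])
    fix F :: "'a set" and c assume "finite F"
    show "cinner (l2op_apply T (\<Sum>x\<in>F. c x *\<^sub>C ket x)) v = cinner (\<Sum>x\<in>F. c x *\<^sub>C ket x) (l2op_apply S v)"
      by (simp add: T_sum linear_sum[OF bounded_linear.linear[OF bounded_linear_cinner_left]]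
        cinner_scaleC_left cinner_ket_left S f_apply)
  qed
  then show ?thesis by blast
qed

instantiation l2op :: (type) cstar_algebra
begin

definition scaleC_l2op :: "complex \<Rightarrow> 'a l2op \<Rightarrow> 'a l2op"
  where "scaleC_l2op c T = Abs_l2op (Blinfun (\<lambda>v. c *\<^sub>C l2op_apply T v))"

definition star_l2op :: "'a l2op \<Rightarrow> 'a l2op"
  where "star_l2op T = (THE S. \<forall>u v. cinner (l2op_apply T u) v = cinner u (l2op_apply S v))"

lemma l2op_apply_scaleC_left: "l2op_apply (c *\<^sub>C T) v = c *\<^sub>C l2op_apply T v"
  unfolding scaleC_l2op_def
  by (rule l2op_apply_Abs_l2op)
    (simp_all add: bounded_linear_compose[OF bounded_linear_scaleC_ell2 bounded_linear_l2op_apply]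
      l2op_apply_scaleC scaleC_ell2_algebra mult.commute)

lemma cinner_star: "cinner u (l2op_apply (star T) v) = cinner (l2op_apply T u) v"
proof -
  have "\<exists>!S. \<forall>u v. cinner (l2op_apply T u) v = cinner u (l2op_apply S v)"
  proof (rule ex_ex1I)
    show "\<exists>S. \<forall>u v. cinner (l2op_apply T u) v = cinner u (l2op_apply S v)"
      by (rule adjoint_exists)
    fix S S'
    assume S: "\<forall>u v. cinner (l2op_apply T u) v = cinner u (l2op_apply S v)"
      and S': "\<forall>u v. cinner (l2op_apply T u) v = cinner u (l2op_apply S' v)"
    have "cinner u (l2op_apply S v) = cinner u (l2op_apply S' v)" for u v
      using S S' by simp
    then have "l2op_apply S v = l2op_apply S' v" for v
      by (rule cinner_eqI)
    then show "S = S'"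
      by (rule l2op_eqI)
  qed
  then have "\<forall>u v. cinner (l2op_apply T u) v = cinner u (l2op_apply (star T) v)"
    unfolding star_l2op_def by (rule theI')
  then show ?thesis
    by metis
qed

lemma cinner_star': "cinner (l2op_apply (star T) u) v = cinner u (l2op_apply T v)"
  by (metis cinner_star cinner_commute)

lemma norm_star_le: "norm (star T) \<le> norm (T :: 'a l2op)"
proof (rule norm_l2op_leI)
  fix v
  define w where "w = l2op_apply (star T) v"
  have "complex_of_real ((norm w)\<^sup>2) = cinner (l2op_apply T w) v"
    by (metis cinner_self_norm cinner_star w_def)
  then have "(norm w)\<^sup>2 = cmod (cinner (l2op_apply T w) v)"
    by (metis norm_of_real abs_of_nonneg zero_le_power2)
  also have "\<dots> \<le> norm (l2op_apply T w) * norm v"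
    by (rule cinner_bound)
  also have "\<dots> \<le> norm T * norm w * norm v"
    by (intro mult_right_mono norm_l2op_apply) simp
  finally have "norm w * norm w \<le> (norm T * norm v) * norm w"
    by (simp add: power2_eq_square algebra_simps)
  then show "norm w \<le> norm T * norm v"
    by (cases "norm w = 0") (auto simp: mult_le_cancel_right)
qed simp

instance
proof
  fix S T :: "'a l2op" and r :: real and c d :: complex
  show "r *\<^sub>R T = complex_of_real r *\<^sub>C T"
    by (rule l2op_eqI) (simp add: l2op_apply_scaleC_left l2op_apply_scaleR ell2_scaleR_scaleC)
  show "c *\<^sub>C (S + T) = c *\<^sub>C S + c *\<^sub>C T"
    and "(c + d) *\<^sub>C T = c *\<^sub>C T + d *\<^sub>C T"
    and "c *\<^sub>C d *\<^sub>C T = (c * d) *\<^sub>C T"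
    and "(c *\<^sub>C S) * T = c *\<^sub>C (S * T)"
    and "S * (c *\<^sub>C T) = c *\<^sub>C (S * T)"
    by (rule l2op_eqI; simp add: l2op_apply_scaleC_left l2op_apply_plus l2op_apply_times
        scaleC_ell2_algebra l2op_apply_scaleC)+
  have norm_scaleC_le: "norm (c *\<^sub>C T) \<le> cmod c * norm T" for c and T :: "'a l2op"
    by (rule norm_l2op_leI)
      (auto simp: l2op_apply_scaleC_left norm_scaleC_ell2 mult.assoc
        intro: mult_left_mono norm_l2op_apply)
  show "norm (c *\<^sub>C T) = cmod c * norm T"
  proof (rule antisym[OF norm_scaleC_le])
    show "cmod c * norm T \<le> norm (c *\<^sub>C T)"
    proof (cases "c = 0")
      case False
      have "T = (1 / c) *\<^sub>C (c *\<^sub>C T)"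
        by (rule l2op_eqI) (use False in \<open>simp add: l2op_apply_scaleC_left scaleC_ell2_algebra\<close>)
      then have "norm T \<le> cmod (1 / c) * norm (c *\<^sub>C T)"
        by (metis norm_scaleC_le)
      then show ?thesis
        using False by (simp add: norm_divide field_simps)
    qed simp
  qed
  show "star (S + T) = star S + star T"
    by (intro l2op_eqI cinner_eqI)
      (simp add: cinner_star l2op_apply_plus cinner_add_left cinner_add_right)
  show "star (c *\<^sub>C T) = cnj c *\<^sub>C star T"
    by (intro l2op_eqI cinner_eqI)
      (simp add: cinner_star l2op_apply_scaleC_left cinner_scaleC_left cinner_scaleC_right)
  show "star (S * T) = star T * star S"
    by (intro l2op_eqI cinner_eqI) (simp add: cinner_star l2op_apply_times)
  show star_star: "star (star T) = T" for T :: "'a l2op"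
    by (intro l2op_eqI cinner_eqI) (simp add: cinner_star cinner_star')
  show "norm (star T * T) = (norm T)\<^sup>2"
  proof (rule antisym)
    have "norm (star T * T) \<le> norm (star T) * norm T"
      by (rule norm_mult_ineq)
    also have "\<dots> \<le> norm T * norm T"
      by (intro mult_right_mono norm_star_le) simp
    finally show "norm (star T * T) \<le> (norm T)\<^sup>2"
      by (simp add: power2_eq_square)
    have "norm T \<le> sqrt (norm (star T * T))"
    proof (rule norm_l2op_leI)
      fix v
      have "complex_of_real ((norm (l2op_apply T v))\<^sup>2) = cinner v (l2op_apply (star T * T) v)"
        by (simp add: l2op_apply_times cinner_star cinner_self_norm)
      then have "(norm (l2op_apply T v))\<^sup>2 = cmod (cinner v (l2op_apply (star T * T) v))"
        by (metis norm_of_real abs_of_nonneg zero_le_power2)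
      also have "\<dots> \<le> norm v * norm (l2op_apply (star T * T) v)"
        by (rule cinner_bound)
      also have "\<dots> \<le> norm v * (norm (star T * T) * norm v)"
        by (intro mult_left_mono norm_l2op_apply) simp
      also have "\<dots> = (sqrt (norm (star T * T)) * norm v)\<^sup>2"
        by (simp add: power_mult_distrib power2_eq_square[of "norm v"])
      finally show "norm (l2op_apply T v) \<le> sqrt (norm (star T * T)) * norm v"
        by (rule power2_le_imp_le) simp
    qed simp
    then have "(norm T)\<^sup>2 \<le> (sqrt (norm (star T * T)))\<^sup>2"
      by (intro power_mono) auto
    then show "(norm T)\<^sup>2 \<le> norm (star T * T)"
      by simp
  qed
qed

end


section \<open>The minimal tensor product\<close>

definition tensor_vec :: "'x ell2 \<Rightarrow> 'y ell2 \<Rightarrow> ('x \<times> 'y) ell2"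
  where "tensor_vec v w = Abs_ell2 (\<lambda>(x, y). ell2_apply v x * ell2_apply w y)"

definition tensor_op :: "'x l2op \<Rightarrow> 'y l2op \<Rightarrow> ('x \<times> 'y) l2op"
  where "tensor_op S T = (THE R. \<forall>v w.
    l2op_apply R (tensor_vec v w) = tensor_vec (l2op_apply S v) (l2op_apply T w))"

lemma ell2_apply_tensor_vec:
  "ell2_apply (tensor_vec v w) (x, y) = ell2_apply v x * ell2_apply w y"
proof -
  have "square_summable (\<lambda>(x, y). ell2_apply v x * ell2_apply w y)"
  proof (rule square_summableI)
    fix F :: "('a \<times> 'b) set" assume F: "finite F"
    define f where "f x = (cmod (ell2_apply v x))\<^sup>2" for x
    define g where "g y = (cmod (ell2_apply w y))\<^sup>2" for y
    have "(\<Sum>p\<in>F. (cmod (case p of (x, y) \<Rightarrow> ell2_apply v x * ell2_apply w y))\<^sup>2)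
        = (\<Sum>(x, y)\<in>F. f x * g y)"
      by (intro sum.cong) (auto simp: f_def g_def norm_mult power_mult_distrib)
    also have "\<dots> \<le> (\<Sum>(x, y)\<in>fst ` F \<times> snd ` F. f x * g y)"
      using F by (intro sum_mono2) (force simp: f_def g_def)+
    also have "\<dots> = sum f (fst ` F) * sum g (snd ` F)"
      by (simp add: sum_product sum.cartesian_product)
    also have "\<dots> \<le> (norm v)\<^sup>2 * (norm w)\<^sup>2"
      unfolding f_def g_def using F
      by (intro mult_mono finite_sum_le_norm_ell2) (auto intro: sum_nonneg)
    finally show "(\<Sum>p\<in>F. (cmod (case p of (x, y) \<Rightarrow> ell2_apply v x * ell2_apply w y))\<^sup>2)
        \<le> (norm v)\<^sup>2 * (norm w)\<^sup>2" .
  qed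
  then show ?thesis
    by (simp add: tensor_vec_def Abs_ell2_inverse)
qed

lemma ket_pair: "ket (x, y) = tensor_vec (ket x) (ket y)"
proof (rule ell2_eqI)
  fix p
  show "ell2_apply (ket (x, y)) p = ell2_apply (tensor_vec (ket x) (ket y)) p"
    by (cases p) (simp add: ell2_apply_tensor_vec ell2_apply_ket)
qed

definition slice :: "('x \<times> 'y) ell2 \<Rightarrow> 'y \<Rightarrow> 'x ell2"
  where "slice v y = Abs_ell2 (\<lambda>x. ell2_apply v (x, y))"

lemma sum_slice_le:
  assumes "finite F" "finite G"
  shows "(\<Sum>x\<in>F. \<Sum>y\<in>G. (cmod (ell2_apply v (x, y)))\<^sup>2) \<le> (norm v)\<^sup>2"
  using finite_sum_le_norm_ell2[of "F \<times> G" v] assms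
  by (simp add: sum.cartesian_product)

lemma ell2_apply_slice: "ell2_apply (slice v y) x = ell2_apply v (x, y)"
proof -
  have "square_summable (\<lambda>x. ell2_apply v (x, y))"
    using sum_slice_le[of _ "{y}" v] by (intro square_summableI) simp
  then show ?thesis
    by (simp add: slice_def Abs_ell2_inverse)
qed

lemma sum_norm_slice_le:
  assumes "finite G"
  shows "(\<Sum>y\<in>G. (norm (slice v y))\<^sup>2) \<le> (norm v)\<^sup>2"
proof -
  have slice: "((\<lambda>x. (cmod (ell2_apply v (x, y)))\<^sup>2) has_sum (norm (slice v y))\<^sup>2) UNIV" for y
    using square_summable_ell2[of "slice v y"]
    unfolding square_summable_def norm_ell2_sq ell2_apply_slice by simp
  have "((\<lambda>x. \<Sum>y\<in>G. (cmod (ell2_apply v (x, y)))\<^sup>2) has_sum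
      (\<Sum>y\<in>G. (norm (slice v y))\<^sup>2)) UNIV"
    using assms by (induction G rule: finite_induct) (auto intro!: has_sum_add slice)
  then show ?thesis
    by (rule has_sum_le_finite_sums) (use sum_slice_le[OF _ assms] in auto)
qed

lemma tensor_op_left_exists:
  "\<exists>R. \<forall>v x y. ell2_apply (l2op_apply R v) (x, y) = ell2_apply (l2op_apply T (slice v y)) x"
proof -
  define f where "f v = (\<lambda>(x, y). ell2_apply (l2op_apply T (slice v y)) x)" for v :: "('a \<times> 'b) ell2"
  have bound: "(\<Sum>p\<in>F. (cmod (f v p))\<^sup>2) \<le> (norm T * norm v)\<^sup>2" if F: "finite F" for F v
  proof -
    have "(\<Sum>p\<in>F. (cmod (f v p))\<^sup>2) \<le> (\<Sum>p\<in>fst ` F \<times> snd ` F. (cmod (f v p))\<^sup>2)"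
      using F by (intro sum_mono2) force+
    also have "\<dots> = (\<Sum>x\<in>fst ` F. \<Sum>y\<in>snd ` F. (cmod (f v (x, y)))\<^sup>2)"
      by (simp add: sum.cartesian_product)
    also have "\<dots> = (\<Sum>y\<in>snd ` F. \<Sum>x\<in>fst ` F. (cmod (f v (x, y)))\<^sup>2)"
      by (rule sum.swap)
    also have "\<dots> \<le> (\<Sum>y\<in>snd ` F. (norm (l2op_apply T (slice v y)))\<^sup>2)"
      unfolding f_def using F by (auto intro!: sum_mono finite_sum_le_norm_ell2)
    also have "\<dots> \<le> (\<Sum>y\<in>snd ` F. (norm T)\<^sup>2 * (norm (slice v y))\<^sup>2)"
      by (intro sum_mono, subst power_mult_distrib[symmetric], intro power_mono norm_l2op_apply) simp
    also have "\<dots> = (norm T)\<^sup>2 * (\<Sum>y\<in>snd ` F. (norm (slice v y))\<^sup>2)"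
      by (simp add: sum_distrib_left)
    also have "\<dots> \<le> (norm T)\<^sup>2 * (norm v)\<^sup>2"
      using F by (intro mult_left_mono sum_norm_slice_le) auto
    finally show ?thesis
      by (simp add: power_mult_distrib)
  qed
  have f_apply: "ell2_apply (Abs_ell2 (f v)) = f v" for v
    using bound[of _ v] by (intro Abs_ell2_inverse CollectI square_summableI) auto
  have f_apply': "ell2_apply (Abs_ell2 (f v)) (x, y) = ell2_apply (l2op_apply T (slice v y)) x" for v x y
    unfolding f_apply by (simp add: f_def)
  have slice_add: "slice (u + v) y = slice u y + slice v y" for u v :: "('a \<times> 'b) ell2" and y
    by (rule ell2_eqI) (simp add: ell2_apply_slice plus_ell2.rep_eq)
  have slice_scaleC: "slice (c *\<^sub>C v) y = c *\<^sub>C slice v y" for c and v :: "('a \<times> 'b) ell2" and y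
    by (rule ell2_eqI) (simp add: ell2_apply_slice scaleC_ell2.rep_eq)
  have scaleC: "Abs_ell2 (f (c *\<^sub>C v)) = c *\<^sub>C Abs_ell2 (f v)" for c v
    by (rule ell2_eqI)
      (auto simp: f_apply' scaleC_ell2.rep_eq slice_scaleC l2op_apply_scaleC)
  have "bounded_linear (\<lambda>v. Abs_ell2 (f v))"
  proof (rule bounded_linear_intro[where K = "norm T"])
    show "Abs_ell2 (f (u + v)) = Abs_ell2 (f u) + Abs_ell2 (f v)" for u v
      by (rule ell2_eqI)
        (auto simp: f_apply' plus_ell2.rep_eq slice_add
          linear_add[OF bounded_linear.linear[OF bounded_linear_l2op_apply]])
    show "Abs_ell2 (f (r *\<^sub>R v)) = r *\<^sub>R Abs_ell2 (f v)" for r v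
      by (simp add: ell2_scaleR_scaleC scaleC)
    show "norm (Abs_ell2 (f v)) \<le> norm v * norm T" for v
      using bound[of _ v] by (intro norm_ell2_leI) (auto simp: f_apply mult.commute)
  qed
  then obtain R where "\<And>v. l2op_apply R v = Abs_ell2 (f v)"
    using l2op_of_fun_exists[OF _ scaleC] by blast
  then show ?thesis
    by (intro exI[of _ R]) (simp add: f_apply')
qed

definition flip :: "('x \<times> 'y) ell2 \<Rightarrow> ('y \<times> 'x) ell2"
  where "flip v = Abs_ell2 (\<lambda>(y, x). ell2_apply v (x, y))"

lemma ell2_apply_flip: "ell2_apply (flip v) (y, x) = ell2_apply v (x, y)"
  and norm_flip_le: "norm (flip v) \<le> norm v"
proof -
  have bound: "(\<Sum>p\<in>F. (cmod ((\<lambda>(y, x). ell2_apply v (x, y)) p))\<^sup>2) \<le> (norm v)\<^sup>2"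
    if F: "finite F" for F
  proof -
    have "(\<Sum>p\<in>F. (cmod ((\<lambda>(y, x). ell2_apply v (x, y)) p))\<^sup>2)
        = (\<Sum>p\<in>prod.swap ` F. (cmod (ell2_apply v p))\<^sup>2)"
      by (subst sum.reindex) (auto intro!: sum.cong)
    also have "\<dots> \<le> (norm v)\<^sup>2"
      using F by (intro finite_sum_le_norm_ell2) simp
    finally show ?thesis .
  qed
  have *: "ell2_apply (flip v) = (\<lambda>(y, x). ell2_apply v (x, y))"
    unfolding flip_def using bound by (intro Abs_ell2_inverse CollectI square_summableI) auto
  then show "ell2_apply (flip v) (y, x) = ell2_apply v (x, y)"
    by simp
  show "norm (flip v) \<le> norm v"
    using bound by (intro norm_ell2_leI) (simp_all add: *)
qed

lemma tensor_op_exists: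
  "\<exists>R. \<forall>v w. l2op_apply R (tensor_vec v w) = tensor_vec (l2op_apply S v) (l2op_apply T w)"
proof -
  obtain L :: "('a \<times> 'b) l2op" where L: "\<And>v x y.
      ell2_apply (l2op_apply L v) (x, y) = ell2_apply (l2op_apply S (slice v y)) x"
    using tensor_op_left_exists[of S] by metis
  obtain K :: "('b \<times> 'a) l2op" where K: "\<And>v x y.
      ell2_apply (l2op_apply K v) (x, y) = ell2_apply (l2op_apply T (slice v y)) x"
    using tensor_op_left_exists[of T] by metis
  have flip_add: "flip (u + v) = flip u + flip v" for u v :: "('c \<times> 'd) ell2"
    by (rule ell2_eqI) (auto simp: ell2_apply_flip plus_ell2.rep_eq)
  have flip_scaleC: "flip (c *\<^sub>C v) = c *\<^sub>C flip v" for c and v :: "('c \<times> 'd) ell2"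
    by (rule ell2_eqI) (auto simp: ell2_apply_flip scaleC_ell2.rep_eq)
  have bl_flip: "bounded_linear (flip :: ('c \<times> 'd) ell2 \<Rightarrow> _)"
    by (rule bounded_linear_intro[where K = 1])
      (simp_all add: flip_add flip_scaleC ell2_scaleR_scaleC norm_flip_le)
  have "bounded_linear (\<lambda>v. flip (l2op_apply K (flip v)))"
    by (intro bounded_linear_compose[OF bl_flip]
      bounded_linear_compose[OF bounded_linear_l2op_apply] bl_flip)
  moreover have "flip (l2op_apply K (flip (c *\<^sub>C v))) = c *\<^sub>C flip (l2op_apply K (flip v))" for c v
    by (simp add: flip_scaleC l2op_apply_scaleC)
  ultimately obtain M where M: "\<And>v. l2op_apply M v = flip (l2op_apply K (flip v))"
    using l2op_of_fun_exists by blast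
  have slice_tensor: "slice (tensor_vec v w) y = ell2_apply w y *\<^sub>C v"
    for v :: "'c ell2" and w :: "'d ell2" and y
    by (rule ell2_eqI) (simp add: ell2_apply_slice ell2_apply_tensor_vec scaleC_ell2.rep_eq)
  have flip_tensor: "flip (tensor_vec v w) = tensor_vec w v" for v :: "'c ell2" and w :: "'d ell2"
    by (rule ell2_eqI) (auto simp: ell2_apply_flip ell2_apply_tensor_vec)
  have "l2op_apply M (tensor_vec v w) = tensor_vec v (l2op_apply T w)" for v w
    by (rule ell2_eqI)
      (auto simp: M flip_tensor K slice_tensor ell2_apply_flip ell2_apply_tensor_vec
        l2op_apply_scaleC scaleC_ell2.rep_eq)
  moreover have "l2op_apply L (tensor_vec v w) = tensor_vec (l2op_apply S v) w" for v w
    by (rule ell2_eqI)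
      (auto simp: L slice_tensor ell2_apply_tensor_vec l2op_apply_scaleC scaleC_ell2.rep_eq)
  ultimately show ?thesis
    by (intro exI[of _ "L * M"]) (simp add: l2op_apply_times)
qed

lemma tensor_op_tensor_vec:
  "l2op_apply (tensor_op S T) (tensor_vec v w) = tensor_vec (l2op_apply S v) (l2op_apply T w)"
proof -
  have "\<exists>!R. \<forall>v w.
      l2op_apply R (tensor_vec v w) = tensor_vec (l2op_apply S v) (l2op_apply T w)"
  proof (rule ex_ex1I)
    show "\<exists>R. \<forall>v w. l2op_apply R (tensor_vec v w) = tensor_vec (l2op_apply S v) (l2op_apply T w)"
      by (rule tensor_op_exists)
    fix R R'
    assume R: "\<forall>v w. l2op_apply R (tensor_vec v w) = tensor_vec (l2op_apply S v) (l2op_apply T w)"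
      and R': "\<forall>v w. l2op_apply R' (tensor_vec v w) = tensor_vec (l2op_apply S v) (l2op_apply T w)"
    have ket: "l2op_apply R (ket p) = l2op_apply R' (ket p)" for p
      using R R' by (cases p) (simp add: ket_pair)
    have "l2op_apply R u = l2op_apply R' u" for u
    proof (rule ell2_dense_induct[of "\<lambda>u. l2op_apply R u = l2op_apply R' u"])
      show "closed {u. l2op_apply R u = l2op_apply R' u}"
        by (intro closed_Collect_eq linear_continuous_on bounded_linear_l2op_apply)
      fix F :: "('a \<times> 'b) set" and c assume "finite F"
      show "l2op_apply R (\<Sum>x\<in>F. c x *\<^sub>C ket x) = l2op_apply R' (\<Sum>x\<in>F. c x *\<^sub>C ket x)"
        by (simp add: linear_sum[OF bounded_linear.linear[OF bounded_linear_l2op_apply]]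
          l2op_apply_scaleC ket)
    qed
    then show "R = R'"
      by (rule l2op_eqI)
  qed
  then have "\<forall>v w. l2op_apply (tensor_op S T) (tensor_vec v w)
      = tensor_vec (l2op_apply S v) (l2op_apply T w)"
    unfolding tensor_op_def by (rule theI')
  then show ?thesis by blast
qed

definition faithful_rep :: "'a::cstar_algebra set \<Rightarrow> ('a \<Rightarrow> 'x l2op) \<Rightarrow> bool"
  where "faithful_rep A \<pi> \<longleftrightarrow> star_hom_on A \<pi> \<and> inj_on \<pi> A"

text \<open>For faithful representations \<^term>\<open>\<pi>\<close> of \<^term>\<open>A\<close> and \<^term>\<open>\<sigma>\<close> of
  \<^term>\<open>B\<close>: the norm closure of the algebraic tensor product, acting on the tensor product
  of the two Hilbert spaces. Up to isomorphism it does not depend on the choice of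
  \<^term>\<open>\<pi>\<close> and \<^term>\<open>\<sigma>\<close>.\<close>

definition min_tensor ::
    "'a::cstar_algebra set \<Rightarrow> ('a \<Rightarrow> 'x l2op) \<Rightarrow> 'b::cstar_algebra set \<Rightarrow> ('b \<Rightarrow> 'y l2op)
      \<Rightarrow> ('x \<times> 'y) l2op set"
  where "min_tensor A \<pi> B \<sigma> = closure
    {\<Sum>i<m. tensor_op (\<pi> (a i)) (\<sigma> (b i)) | m (a :: nat \<Rightarrow> 'a) (b :: nat \<Rightarrow> 'b).
      \<forall>i<m. a i \<in> A \<and> b i \<in> B}"

end

theory Submission
  imports Defs "HOL-Computational_Algebra.Fundamental_Theorem_Algebra"
begin

text \<open>The key is a lower bound for nonzero positive elements \<open>h\<close> of \<open>A \<otimes> B\<close>: some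
  \<open>a\<^sub>1 \<otimes> b\<^sub>1\<close> with \<open>a\<^sub>1, b\<^sub>1 \<noteq> 0\<close> is Cuntz below \<open>h\<close>. Slicing \<open>h\<close> by a vector state
  gives a nonzero positive \<open>s \<in> A\<close>. Near the top of its spectrum there is \<open>e \<in> A\<close> excising the
  finitely many elements of \<open>A\<close> that occur in an approximation of \<open>h\<close>, so that
  \<open>(e \<otimes> 1) h (e \<otimes> 1)\<close> is close to \<open>e\<^sup>2 \<otimes> b\<close> where \<open>b\<close> is not small. Simplicity of
  \<open>A \<otimes> B\<close> follows.

  For tracial absorption, let \<open>a\<^sub>1 \<otimes> b\<^sub>1 \<precsim> a\<close> and let \<open>e \<in> A\<close>, \<open>f \<in> B\<close> be approximate
  units for \<open>x\<close> and the finite set. As \<open>B\<close> is simple, \<open>f\<^sup>2\<close> is approximately a sum of \<open>k\<close>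
  elements \<open>c b\<^sub>1 c\<^sup>*\<close>. As \<open>A\<close> has no minimal projection, \<open>k\<close> orthogonal copies of some
  \<open>a\<^sub>2 \<noteq> 0\<close> fit below \<open>a\<^sub>1\<close>. With \<open>\<phi>\<close> obtained in \<open>A\<close> for \<open>e\<close> and \<open>a\<^sub>2\<close>, the map
  \<open>z \<mapsto> \<phi>(z) \<otimes> f\<close> works: \<open>x\<^sup>2 - x (\<phi>(1) \<otimes> f) x\<close> is close to
  \<open>x ((e\<^sup>2 - e \<phi>(1) e - \<delta>)\<^sub>+ \<otimes> f\<^sup>2) x \<precsim> a\<^sub>2 \<otimes> f\<^sup>2 \<precsim> a\<^sub>1 \<otimes> b\<^sub>1 \<precsim> a\<close>.

  A minimal projection \<open>p\<close> is excluded because order zero maps \<open>M\<^sub>2 \<rightarrow> A\<close> that almost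
  commute with \<open>p\<close> and with a partial isometry moving \<open>p\<close> to an orthogonal projection would
  become scalar order zero functionals on \<open>M\<^sub>2\<close> in the limit, with \<open>1\<close> not mapped to \<open>0\<close>.\<close>

section \<open>Unitization\<close>

text \<open>The order of the choices is forced: the number \<open>k\<close> of conjugates of
  \<open>b1\<close> that approximate \<open>f^2\<close> is known only once \<open>f\<close> is
  fixed, \<open>a2\<close> depends on \<open>k\<close>, and only then can an order zero map be
  requested from \<open>A\<close>. As no unit is available, \<open>\<phi>(z) \<otimes> 1\<close>
  need not lie in the tensor product. Using \<open>f\<close> as second factor is harmless for
  commutators: \<open>f b\<close> and \<open>b f\<close> are both close to \<open>b\<close>, so
  \<open>f\<close> need not be central. Spectral positivity is awkward for sums and inequalities.
  The given algebras are therefore replaced by their images under the faithful representations,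
  where positivity means that a quadratic form is nonnegative. Positivity of matrices, needed for
  complete positivity, is treated alike by letting matrices act on a larger Hilbert space. Excision
  is done by functional calculus instead of pure states: only compressions \<open>e y e\<close>
  close to scalar multiples of \<open>e^2\<close> are needed, with \<open>e\<close> supported where
  the slice of \<open>h\<close> is large, so that the compression of \<open>h\<close> cannot become
  small.\<close>

lemma scaleC_one [simp]: "1 *\<^sub>C (a::'a::cstar_algebra) = a"
  using scaleR_eq_scaleC[of 1 a] by simp

lemma scaleC_zero_left [simp]: "0 *\<^sub>C (a::'a::cstar_algebra) = 0"
  using scaleR_eq_scaleC[of 0 a] by simp

lemma scaleC_zero_right [simp]: "c *\<^sub>C (0::'a::cstar_algebra) = 0"
  using scaleC_add_right[of c 0 0] by simp

lemma scaleC_minus_right: "c *\<^sub>C (- a::'a::cstar_algebra) = - (c *\<^sub>C a)"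
  using scaleC_add_right[of c a "- a"] by (simp add: eq_neg_iff_add_eq_0 add.commute)

lemma scaleC_minus_left: "(- c) *\<^sub>C (a::'a::cstar_algebra) = - (c *\<^sub>C a)"
  using scaleC_add_left[of c "- c" a] by (simp add: eq_neg_iff_add_eq_0 add.commute)

lemma scaleC_diff_right: "c *\<^sub>C (a - b::'a::cstar_algebra) = c *\<^sub>C a - c *\<^sub>C b"
  using scaleC_add_right[of c a "- b"] by (simp add: scaleC_minus_right)

lemma scaleC_diff_left: "(c - d) *\<^sub>C (a::'a::cstar_algebra) = c *\<^sub>C a - d *\<^sub>C a"
  using scaleC_add_left[of c "- d" a] by (simp add: scaleC_minus_left)

lemma star_zero [simp]: "star (0::'a::cstar_algebra) = 0"
  using star_add[of 0 "0::'a"] by simp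

lemma star_minus: "star (- a::'a::cstar_algebra) = - star a"
  using star_add[of a "- a"] by (simp add: eq_neg_iff_add_eq_0 add.commute)

lemma star_diff: "star (a - b::'a::cstar_algebra) = star a - star b"
  using star_add[of a "- b"] by (simp add: star_minus)

lemma star_scaleR: "star (r *\<^sub>R a::'a::cstar_algebra) = r *\<^sub>R star a"
  by (simp add: scaleR_eq_scaleC star_scaleC)

lemma star_sum: "star (\<Sum>i\<in>I. f i::'a::cstar_algebra) = (\<Sum>i\<in>I. star (f i))"
  by (induction I rule: infinite_finite_induct) (auto simp: star_add)

lemma scaleC_sum_right: "c *\<^sub>C (\<Sum>i\<in>I. f i::'a::cstar_algebra) = (\<Sum>i\<in>I. c *\<^sub>C f i)"
  by (induction I rule: infinite_finite_induct) (auto simp: scaleC_add_right)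

lemma scaleC_eq_0_iff: "c *\<^sub>C (a::'a::cstar_algebra) = 0 \<longleftrightarrow> c = 0 \<or> a = 0"
  using norm_scaleC[of c a] by (metis mult_eq_0_iff norm_eq_zero)

lemma norm_star [simp]: "norm (star a) = norm (a::'a::cstar_algebra)"
proof -
  have *: "norm b \<le> norm (star b)" for b :: 'a
  proof (cases "norm b = 0")
    case False
    have "norm b * norm b \<le> norm (star b) * norm b"
      using cstar_identity[of b] norm_mult_ineq[of "star b" b] by (simp add: power2_eq_square)
    then show ?thesis
      using False by (simp add: mult_le_cancel_right)
  qed simp
  show ?thesis
    using *[of a] *[of "star a"] by (simp add: star_star)
qed

lemma norm_star_mult_self: "norm (a * star a) = (norm (a::'a::cstar_algebra))\<^sup>2"
  using cstar_identity[of "star a"] by (simp add: star_star)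

lemma norm_selfadjoint_sq: "star (a::'a::cstar_algebra) = a \<Longrightarrow> norm (a * a) = (norm a)\<^sup>2"
  using cstar_identity[of a] by simp

lemma star_mult_self_eq_0_iff: "star a * a = 0 \<longleftrightarrow> (a::'a::cstar_algebra) = 0"
  using cstar_identity[of a] by auto

lemma bounded_linear_scaleC: "bounded_linear (\<lambda>a::'a::cstar_algebra. c *\<^sub>C a)"
  by (rule bounded_linear_intro[where K = "cmod c"])
    (auto simp: scaleC_add_right scaleR_eq_scaleC scaleC_scaleC norm_scaleC mult.commute)

lemma bounded_linear_star: "bounded_linear (star :: 'a::cstar_algebra \<Rightarrow> 'a)"
  by (rule bounded_linear_intro[where K = 1]) (auto simp: star_add star_scaleR)

lemmas tendsto_scaleC = bounded_linear.tendsto[OF bounded_linear_scaleC]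
lemmas tendsto_star [tendsto_intros] = bounded_linear.tendsto[OF bounded_linear_star]

lemma continuous_on_star [continuous_intros]:
  "continuous_on S f \<Longrightarrow> continuous_on S (\<lambda>x. star (f x :: 'a::cstar_algebra))"
  by (rule bounded_linear.continuous_on[OF bounded_linear_star])

datatype 'a unitization = Unitization (scal: complex) (vecp: 'a)

text \<open>Left multiplication by the element on the original algebra. Its operator norm is what
  lets the C*-identity pass to the unitization.\<close>

definition uni_act :: "'a::cstar_algebra unitization \<Rightarrow> 'a \<Rightarrow> 'a"
  where "uni_act x b = scal x *\<^sub>C b + vecp x * b"

lemma bounded_linear_uni_act: "bounded_linear (uni_act x)"
  unfolding uni_act_def
  by (intro bounded_linear_add bounded_linear_scaleC bounded_linear_mult_right)

instantiation unitization :: (cstar_algebra) "{real_normed_vector, scaleC, star, times, one}"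
begin

definition "0 = Unitization 0 0"
definition "1 = Unitization 1 0"
definition "x + y = Unitization (scal x + scal y) (vecp x + vecp y)"
definition "- x = Unitization (- scal x) (- vecp x)"
definition "x - y = Unitization (scal x - scal y) (vecp x - vecp y)"
definition "x * y = Unitization (scal x * scal y)
  (scal x *\<^sub>C vecp y + scal y *\<^sub>C vecp x + vecp x * vecp y)"
definition "r *\<^sub>R x = Unitization (r *\<^sub>R scal x) (r *\<^sub>R vecp x)"
definition "c *\<^sub>C x = Unitization (c * scal x) (c *\<^sub>C vecp x)"
definition "star x = Unitization (cnj (scal x)) (star (vecp x))"

text \<open>The scalar part enters the norm so that it stays definite when the algebra is unital.\<close>
definition "norm x = max (cmod (scal x)) (onorm (uni_act x))"

definition "sgn x = inverse (norm x) *\<^sub>R (x::'a unitization)"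
definition "dist x y = norm (x - y::'a unitization)"
definition uniformity_unitization :: "('a unitization \<times> 'a unitization) filter"
  where "uniformity_unitization = (INF e\<in>{0<..}. principal {(v, w). dist v w < e})"
definition open_unitization :: "'a unitization set \<Rightarrow> bool"
  where "open_unitization U \<longleftrightarrow> (\<forall>v\<in>U. \<forall>\<^sub>F (v', w) in uniformity. v' = v \<longrightarrow> w \<in> U)"

lemma uni_act_simps:
  "uni_act (x + y) b = uni_act x b + uni_act y b"
  "uni_act (x - y) b = uni_act x b - uni_act y b"
  "uni_act (r *\<^sub>R x) b = r *\<^sub>R uni_act x b"
  "uni_act (c *\<^sub>C x) b = c *\<^sub>C uni_act x b"
  "uni_act (x * y) b = uni_act x (uni_act y b)"
proof -
  show "uni_act (r *\<^sub>R x) b = r *\<^sub>R uni_act x b"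
    by (simp add: uni_act_def scaleR_unitization_def scaleR_eq_scaleC scaleC_complex_def
        scaleC_scaleC mult_scaleC_left scaleC_add_right)
qed (simp_all add: uni_act_def plus_unitization_def minus_unitization_def scaleC_unitization_def
      times_unitization_def scaleC_add_left scaleC_add_right scaleC_diff_left
      scaleC_scaleC mult_scaleC_left mult_scaleC_right algebra_simps)

lemma norm_uni_act: "norm (uni_act x b) \<le> norm x * norm b"
proof -
  have "norm (uni_act x b) \<le> onorm (uni_act x) * norm b"
    by (rule onorm[OF bounded_linear_uni_act])
  also have "\<dots> \<le> norm x * norm b"
    unfolding norm_unitization_def by (intro mult_right_mono) auto
  finally show ?thesis .
qed

lemma norm_unitization_leI:
  assumes "cmod (scal x) \<le> K" "\<And>b. norm (uni_act x b) \<le> K * norm b"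
  shows "norm x \<le> K"
  unfolding norm_unitization_def using assms
  by (auto intro!: onorm_bound order_trans[OF norm_ge_zero assms(1)])

lemma scal_le_norm: "cmod (scal x) \<le> norm x"
  by (simp add: norm_unitization_def)

text \<open>Applying \<open>uni_act x\<close> to \<open>star (vecp x)\<close> produces the square of
  \<open>norm (vecp x)\<close> by the C*-identity. The bound gives definiteness of the norm and
  reduces completeness to the two components.\<close>

lemma norm_vecp_le: "norm (vecp x) \<le> norm (scal x) + norm x"
proof (cases "vecp x = 0")
  case False
  let ?b = "star (vecp x)"
  have "vecp x * ?b = uni_act x ?b - scal x *\<^sub>C ?b"
    by (simp add: uni_act_def)
  then have "norm (vecp x * ?b) \<le> norm (uni_act x ?b) + norm (scal x *\<^sub>C ?b)"
    by (metis norm_triangle_ineq4)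
  also have "\<dots> \<le> norm x * norm (vecp x) + norm (scal x) * norm (vecp x)"
    using norm_uni_act[of x ?b] by (simp add: norm_scaleC)
  finally have "norm (vecp x) * norm (vecp x) \<le> (norm x + norm (scal x)) * norm (vecp x)"
    by (simp add: norm_star_mult_self power2_eq_square algebra_simps)
  then show ?thesis
    using False by (simp add: mult_le_cancel_right)
qed (use order_trans[OF norm_ge_zero scal_le_norm, of x] in simp)

instance
proof
  fix x y z :: "'a unitization" and r s :: real
  note defs = zero_unitization_def one_unitization_def plus_unitization_def uminus_unitization_def
    minus_unitization_def scaleR_unitization_def
  show "x + y + z = x + (y + z)" "x + y = y + x" "0 + x = x" "- x + x = 0" "x - y = x + - y"
    "r *\<^sub>R (x + y) = r *\<^sub>R x + r *\<^sub>R y" "(r + s) *\<^sub>R x = r *\<^sub>R x + s *\<^sub>R x"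
    "r *\<^sub>R s *\<^sub>R x = (r * s) *\<^sub>R x" "1 *\<^sub>R x = x"
    by (simp_all add: defs algebra_simps)
  show "norm x = 0 \<longleftrightarrow> x = 0"
  proof
    assume *: "norm x = 0"
    then have "scal x = 0"
      using scal_le_norm[of x] by simp
    moreover from this have "vecp x = 0"
      using norm_vecp_le[of x] * by simp
    ultimately show "x = 0"
      by (simp add: unitization.expand zero_unitization_def)
  next
    assume "x = 0"
    then show "norm x = 0"
      by (simp add: norm_unitization_def zero_unitization_def uni_act_def[abs_def] onorm_zero)
  qed
  show "norm (x + y) \<le> norm x + norm y"
  proof (rule norm_unitization_leI)
    show "cmod (scal (x + y)) \<le> norm x + norm y"
      using norm_triangle_ineq[of "scal x" "scal y"] scal_le_norm[of x] scal_le_norm[of y]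
      by (simp add: plus_unitization_def)
    show "norm (uni_act (x + y) b) \<le> (norm x + norm y) * norm b" for b
      using norm_triangle_ineq[of "uni_act x b" "uni_act y b"] norm_uni_act[of x b] norm_uni_act[of y b]
      by (simp add: uni_act_simps algebra_simps)
  qed
  have le: "norm (r *\<^sub>R x) \<le> \<bar>r\<bar> * norm x" for r and x :: "'a unitization"
  proof (rule norm_unitization_leI)
    show "cmod (scal (r *\<^sub>R x)) \<le> \<bar>r\<bar> * norm x"
      using scal_le_norm[of x] by (simp add: scaleR_unitization_def mult_left_mono)
    show "norm (uni_act (r *\<^sub>R x) b) \<le> \<bar>r\<bar> * norm x * norm b" for b
      using norm_uni_act[of x b] by (simp add: uni_act_simps mult_left_mono mult.assoc)
  qed
  show "norm (r *\<^sub>R x) = \<bar>r\<bar> * norm x"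
  proof (cases "r = 0")
    case False
    have "x = (1 / r) *\<^sub>R (r *\<^sub>R x)"
      using False by (simp add: scaleR_unitization_def)
    then have "norm x \<le> \<bar>1 / r\<bar> * norm (r *\<^sub>R x)"
      by (metis le)
    then show ?thesis
      using False le[of r x] by (simp add: field_simps)
  next
    case True then show ?thesis
      using le[of 0 x] order_trans[OF norm_ge_zero scal_le_norm, of "0 *\<^sub>R x"] by simp
  qed
qed (fact sgn_unitization_def dist_unitization_def uniformity_unitization_def open_unitization_def)+

end

instantiation unitization :: (cstar_algebra) "{real_normed_algebra_1, cstar_algebra}"
begin

instance
proof
  fix x y z :: "'a unitization" and r s :: real and c d :: complex
  note defs = zero_unitization_def one_unitization_def plus_unitization_def uminus_unitization_def
    minus_unitization_def scaleR_unitization_def scaleC_unitization_def star_unitization_def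
    times_unitization_def
  note alg = scaleC_add_right scaleC_add_left scaleC_scaleC mult_scaleC_left mult_scaleC_right
    star_add star_mult star_star star_scaleC
  show "x * y * z = x * (y * z)" "1 * x = x" "x * 1 = x" "(x + y) * z = x * z + y * z"
    "x * (y + z) = x * y + x * z"
    "r *\<^sub>R x = complex_of_real r *\<^sub>C x"
    "c *\<^sub>C (x + y) = c *\<^sub>C x + c *\<^sub>C y" "(c + d) *\<^sub>C x = c *\<^sub>C x + d *\<^sub>C x"
    "c *\<^sub>C d *\<^sub>C x = (c * d) *\<^sub>C x" "(c *\<^sub>C x) * y = c *\<^sub>C (x * y)"
    "x * (c *\<^sub>C y) = c *\<^sub>C (x * y)"
    "star (x + y) = star x + star y" "star (c *\<^sub>C x) = cnj c *\<^sub>C star x"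
    "star (x * y) = star y * star x" "star (star x) = x"
    "r *\<^sub>R x * y = r *\<^sub>R (x * y)" "x * r *\<^sub>R y = r *\<^sub>R (x * y)"
    "(0::'a unitization) \<noteq> 1"
    by (simp_all add: defs alg algebra_simps scaleR_conv_of_real scaleR_eq_scaleC)
  show norm_mult_le: "norm (x * y) \<le> norm x * norm y" for x y :: "'a unitization"
  proof (rule norm_unitization_leI)
    show "cmod (scal (x * y)) \<le> norm x * norm y"
      using scal_le_norm[of x] scal_le_norm[of y]
      by (simp add: times_unitization_def norm_mult mult_mono)
    fix b
    have "norm (uni_act x (uni_act y b)) \<le> norm x * norm (uni_act y b)"
      by (rule norm_uni_act)
    also have "\<dots> \<le> norm x * (norm y * norm b)"
      by (intro mult_left_mono norm_uni_act) simp
    finally show "norm (uni_act (x * y) b) \<le> norm x * norm y * norm b"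
      by (simp add: uni_act_simps mult.assoc)
  qed
  show "norm (1::'a unitization) = 1"
  proof (rule antisym)
    show "norm (1::'a unitization) \<le> 1"
      by (rule norm_unitization_leI) (auto simp: one_unitization_def uni_act_def)
    show "1 \<le> norm (1::'a unitization)"
      using scal_le_norm[of "1::'a unitization"] by (simp add: one_unitization_def)
  qed
  have le: "norm (c *\<^sub>C x) \<le> cmod c * norm x" for c and x :: "'a unitization"
  proof (rule norm_unitization_leI)
    show "cmod (scal (c *\<^sub>C x)) \<le> cmod c * norm x"
      using scal_le_norm[of x] by (simp add: scaleC_unitization_def mult_left_mono norm_mult)
    show "norm (uni_act (c *\<^sub>C x) b) \<le> cmod c * norm x * norm b" for b
      using norm_uni_act[of x b] by (simp add: uni_act_simps mult_left_mono mult.assoc norm_scaleC)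
  qed
  show "norm (c *\<^sub>C x) = cmod c * norm x"
  proof (cases "c = 0")
    case False
    have "x = (1 / c) *\<^sub>C (c *\<^sub>C x)"
      using False by (simp add: scaleC_unitization_def scaleC_scaleC)
    then have "norm x \<le> cmod (1 / c) * norm (c *\<^sub>C x)"
      by (metis le)
    then show ?thesis
      using False le[of c x] by (simp add: field_simps norm_divide)
  qed (use le[of 0 x] in simp)
  \<comment> \<open>The C*-identity of the algebra, applied to every \<open>uni_act x b\<close>,
    bounds the operator norm; the scalar part is bounded separately.\<close>
  have sq_le: "(norm x)\<^sup>2 \<le> norm (star x * x)" for x :: "'a unitization"
  proof -
    let ?N = "norm (star x * x)"
    have "norm (uni_act x b) \<le> sqrt ?N * norm b" for b
    proof (rule power2_le_imp_le)
      have "star (uni_act x b) * uni_act x b = star b * uni_act (star x * x) b"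
        by (simp add: uni_act_def defs alg algebra_simps)
      then have "(norm (uni_act x b))\<^sup>2 = norm (star b * uni_act (star x * x) b)"
        by (metis cstar_identity)
      also have "\<dots> \<le> norm (star b) * norm (uni_act (star x * x) b)"
        by (rule norm_mult_ineq)
      also have "\<dots> \<le> norm b * (?N * norm b)"
        using norm_uni_act[of "star x * x" b] by (simp add: mult_left_mono)
      finally show "(norm (uni_act x b))\<^sup>2 \<le> (sqrt ?N * norm b)\<^sup>2"
        by (simp add: power2_eq_square algebra_simps)
    qed simp
    moreover have "cmod (scal x) \<le> sqrt ?N"
    proof (rule power2_le_imp_le)
      show "(cmod (scal x))\<^sup>2 \<le> (sqrt ?N)\<^sup>2"
        using scal_le_norm[of "star x * x"] by (simp add: defs norm_mult power2_eq_square)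
    qed simp
    ultimately have "norm x \<le> sqrt ?N"
      by (intro norm_unitization_leI)
    then have "(norm x)\<^sup>2 \<le> (sqrt ?N)\<^sup>2"
      by (intro power_mono) auto
    then show ?thesis by simp
  qed
  have star_le: "norm x \<le> norm (star x)" for x :: "'a unitization"
  proof (cases "norm x = 0")
    case False
    have "norm x * norm x \<le> norm (star x) * norm x"
      using sq_le[of x] norm_mult_le[of "star x" x] by (simp add: power2_eq_square)
    then show ?thesis
      using False by (simp add: mult_le_cancel_right)
  qed simp
  have "norm (star x) \<le> norm x"
    using star_le[of "star x"] by (simp add: defs alg)
  then have "norm (star x * x) \<le> (norm x)\<^sup>2"
    using norm_mult_le[of "star x" x] mult_right_mono[of "norm (star x)" "norm x" "norm x"]
    by (simp add: power2_eq_square)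
  then show "norm (star x * x) = (norm x)\<^sup>2"
    using sq_le[of x] by simp
next
  fix X :: "nat \<Rightarrow> 'a unitization"
  assume X: "Cauchy X"
  have lin: "scal (x - y) = scal x - scal y" "vecp (x - y) = vecp x - vecp y" for x y :: "'a unitization"
    by (simp_all add: minus_unitization_def)
  have scal_C: "Cauchy (\<lambda>n. scal (X n))"
  proof (rule CauchyI)
    fix e :: real assume "0 < e"
    then obtain M where "\<forall>m\<ge>M. \<forall>n\<ge>M. norm (X m - X n) < e"
      using CauchyD[OF X] by blast
    then show "\<exists>M. \<forall>m\<ge>M. \<forall>n\<ge>M. norm (scal (X m) - scal (X n)) < e"
      by (metis lin(1) scal_le_norm order_le_less_trans)
  qed
  have vecp_C: "Cauchy (\<lambda>n. vecp (X n))"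
  proof (rule CauchyI)
    fix e :: real assume "0 < e"
    then obtain M where M: "\<forall>m\<ge>M. \<forall>n\<ge>M. norm (X m - X n) < e / 2"
      using CauchyD[OF X, of "e / 2"] by auto
    have "norm (vecp (X m) - vecp (X n)) < e" if "m \<ge> M" "n \<ge> M" for m n
    proof -
      have "norm (X m - X n) < e / 2"
        using M that by blast
      then show ?thesis
        using norm_vecp_le[of "X m - X n"] scal_le_norm[of "X m - X n"]
        unfolding lin by linarith
    qed
    then show "\<exists>M. \<forall>m\<ge>M. \<forall>n\<ge>M. norm (vecp (X m) - vecp (X n)) < e"
      by blast
  qed
  obtain l a where l: "(\<lambda>n. scal (X n)) \<longlonglongrightarrow> l" and a: "(\<lambda>n. vecp (X n)) \<longlonglongrightarrow> a"
    using scal_C vecp_C by (auto simp: Cauchy_convergent_iff convergent_def)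
  have bound: "norm x \<le> norm (scal x) + norm (vecp x)" for x :: "'a unitization"
  proof (rule norm_unitization_leI)
    fix b
    have "norm (uni_act x b) \<le> norm (scal x *\<^sub>C b) + norm (vecp x * b)"
      unfolding uni_act_def by (rule norm_triangle_ineq)
    also have "\<dots> \<le> norm (scal x) * norm b + norm (vecp x) * norm b"
      by (intro add_mono norm_mult_ineq) (simp add: norm_scaleC)
    finally show "norm (uni_act x b) \<le> (norm (scal x) + norm (vecp x)) * norm b"
      by (simp add: algebra_simps)
  qed simp
  have "(\<lambda>n. norm (scal (X n) - l) + norm (vecp (X n) - a)) \<longlonglongrightarrow> 0"
    using l a by (intro tendsto_add_zero) (simp_all add: LIM_zero_iff tendsto_norm_zero)
  then have "(\<lambda>n. X n - Unitization l a) \<longlonglongrightarrow> 0"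
    by (rule Lim_null_comparison[rotated])
      (use bound in \<open>auto intro!: always_eventually simp: minus_unitization_def simp del: norm_triangle_ineq\<close>,
        metis unitization.sel)
  then have "X \<longlonglongrightarrow> Unitization l a"
    by (simp add: LIM_zero_iff)
  then show "convergent X"
    by (auto simp: convergent_def)
qed

end

abbreviation uni_emb :: "'a::cstar_algebra \<Rightarrow> 'a unitization"
  where "uni_emb \<equiv> Unitization 0"

lemma uni_emb_hom:
  "uni_emb (a + b) = uni_emb a + uni_emb b"
  "uni_emb (a * b) = uni_emb a * uni_emb b"
  "uni_emb (c *\<^sub>C a) = c *\<^sub>C uni_emb a"
  "uni_emb (star a) = star (uni_emb a)"
  "uni_emb 0 = 0"
  by (simp_all add: plus_unitization_def times_unitization_def scaleC_unitization_def
      star_unitization_def zero_unitization_def)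

lemma norm_uni_emb: "norm (uni_emb a) = norm a"
proof (rule antisym)
  show "norm (uni_emb a) \<le> norm a"
    by (rule norm_unitization_leI) (auto simp: uni_act_def norm_mult_ineq)
  show "norm a \<le> norm (uni_emb a)"
    using norm_vecp_le[of "uni_emb a"] by simp
qed

section \<open>Spectral theory of self-adjoint elements\<close>

lemma cstar_subalgebraD:
  assumes "cstar_subalgebra A"
  shows "0 \<in> A" "a \<in> A \<Longrightarrow> b \<in> A \<Longrightarrow> a + b \<in> A" "a \<in> A \<Longrightarrow> b \<in> A \<Longrightarrow> a * b \<in> A"
    "a \<in> A \<Longrightarrow> c *\<^sub>C a \<in> A" "a \<in> A \<Longrightarrow> star a \<in> A" "closed A"
    "a \<in> A \<Longrightarrow> - a \<in> A" "a \<in> A \<Longrightarrow> b \<in> A \<Longrightarrow> a - b \<in> A" "a \<in> A \<Longrightarrow> r *\<^sub>R a \<in> A"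
proof -
  show *: "0 \<in> A" "a \<in> A \<Longrightarrow> b \<in> A \<Longrightarrow> a + b \<in> A" "a \<in> A \<Longrightarrow> b \<in> A \<Longrightarrow> a * b \<in> A"
    "a \<in> A \<Longrightarrow> c *\<^sub>C a \<in> A" "a \<in> A \<Longrightarrow> star a \<in> A" "closed A" for a b c
    using assms by (auto simp: cstar_subalgebra_def)
  show m: "a \<in> A \<Longrightarrow> - a \<in> A" for a
    using *(4)[of a "-1"] by (simp add: scaleC_minus_left)
  show "a \<in> A \<Longrightarrow> b \<in> A \<Longrightarrow> a - b \<in> A"
    using *(2)[of a "- b"] m by simp
  show "a \<in> A \<Longrightarrow> r *\<^sub>R a \<in> A"
    by (simp add: scaleR_eq_scaleC *)
qed

lemma cstar_subalgebra_sum: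
  "cstar_subalgebra A \<Longrightarrow> (\<And>i. i \<in> I \<Longrightarrow> f i \<in> A) \<Longrightarrow> (\<Sum>i\<in>I. f i) \<in> A"
  by (induction I rule: infinite_finite_induct) (auto intro: cstar_subalgebraD)

section \<open>Polynomials and spectra in unital algebras\<close>

definition cpeval :: "complex poly \<Rightarrow> 'u::{real_normed_algebra_1,cstar_algebra} \<Rightarrow> 'u"
  where "cpeval p x = fold_coeffs (\<lambda>a y. a *\<^sub>C 1 + x * y) p 0"

lemma cpeval_0 [simp]: "cpeval 0 x = 0"
  by (simp add: cpeval_def)

lemma cpeval_pCons [simp]: "cpeval (pCons a p) x = a *\<^sub>C 1 + x * cpeval p x"
  by (cases "a = 0 \<and> p = 0") (auto simp: cpeval_def fold_coeffs_pCons_eq)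

lemma cpeval_add: "cpeval (p + q) x = cpeval p x + cpeval q x"
  by (induction p q rule: poly_induct2) (auto simp: scaleC_add_left algebra_simps)

lemma cpeval_smult: "cpeval (Polynomial.smult c p) x = c *\<^sub>C cpeval p x"
  by (induction p) (auto simp: scaleC_add_right scaleC_scaleC mult_scaleC_right)

lemma cpeval_mult: "cpeval (p * q) x = cpeval p x * cpeval q x"
  by (induction p)
    (auto simp: cpeval_add cpeval_smult mult_scaleC_left distrib_right mult.assoc)

lemma cpeval_commute: "x * y = y * x \<Longrightarrow> cpeval p x * y = y * cpeval p x"
  by (induction p) (simp_all add: distrib_left distrib_right mult_scaleC_left mult_scaleC_right,
     metis mult.assoc)

lemma star_one [simp]: "star (1::'u::{real_normed_algebra_1,cstar_algebra}) = 1"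
  by (metis mult_1_left mult_1_right star_mult star_star)

locale unital_cstar =
  fixes S :: "'u::{real_normed_algebra_1,cstar_algebra} set"
  assumes sub: "cstar_subalgebra S" and one: "1 \<in> S"
begin

lemmas closed_ops = cstar_subalgebraD[OF sub] one

definition invertible_in :: "'u \<Rightarrow> bool"
  where "invertible_in x \<longleftrightarrow> x \<in> S \<and> (\<exists>y\<in>S. x * y = 1 \<and> y * x = 1)"

definition spec :: "'u \<Rightarrow> complex set"
  where "spec x = {l. \<not> invertible_in (x - l *\<^sub>C 1)}"

lemma invertible_in_mult: "invertible_in a \<Longrightarrow> invertible_in b \<Longrightarrow> invertible_in (a * b)"
  unfolding invertible_in_def
  by (metis closed_ops(3) mult.assoc mult_1_left)

text \<open>\<open>b * y\<close> is a right inverse and \<open>y * b\<close> a left inverse of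
  \<open>a\<close>, so the two agree.\<close>

lemma invertible_in_factor:
  assumes "a \<in> S" "b \<in> S" "a * b = b * a" "invertible_in (a * b)"
  shows "invertible_in a"
proof -
  obtain y where y: "y \<in> S" "a * b * y = 1" "y * (a * b) = 1"
    using assms by (auto simp: invertible_in_def)
  have 1: "a * (b * y) = 1" "(y * b) * a = 1"
    using y(2,3) assms(3) by (metis mult.assoc)+
  then have "y * b = b * y"
    by (metis mult.assoc mult_1_left mult_1_right)
  then show ?thesis
    using 1 y assms closed_ops unfolding invertible_in_def by metis
qed

lemma invertible_in_scaleC: "c \<noteq> 0 \<Longrightarrow> invertible_in x \<Longrightarrow> invertible_in (c *\<^sub>C x)"
  unfolding invertible_in_def
proof (elim conjE bexE, intro conjI)
  fix y assume "c \<noteq> 0" "y \<in> S" "x * y = 1" "y * x = 1"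
  then show "\<exists>y\<in>S. c *\<^sub>C x * y = 1 \<and> y * c *\<^sub>C x = 1"
    by (intro bexI[of _ "(1/c) *\<^sub>C y"])
      (auto simp: mult_scaleC_left mult_scaleC_right scaleC_scaleC closed_ops)
qed (simp add: closed_ops)

text \<open>The one-sided inverses are the fixed points of the contractions
  \<open>y \<mapsto> 1 + x y\<close> and \<open>y \<mapsto> 1 + y x\<close> of the complete set
  \<open>S\<close>. This replaces summing the geometric series and keeps the inverse in
  \<open>S\<close>.\<close>

lemma neumann:
  assumes x: "x \<in> S" "norm x < 1"
  shows "\<exists>y\<in>S. (1 - x) * y = 1 \<and> y * (1 - x) = 1 \<and> norm y \<le> 1 / (1 - norm x)"
proof -
  have S: "complete S" "S \<noteq> {}"
    using closed_ops by (auto simp: complete_eq_closed)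
  have "\<exists>!y\<in>S. 1 + x * y = y"
    by (rule Banach_fix[OF S, where c = "norm x"])
      (use x closed_ops norm_mult_ineq in \<open>auto simp: dist_norm simp flip: right_diff_distrib\<close>)
  then obtain y where y: "y \<in> S" "1 + x * y = y" by blast
  have "\<exists>!y\<in>S. 1 + y * x = y"
    by (rule Banach_fix[OF S, where c = "norm x"])
      (use x closed_ops norm_mult_ineq[of _ x] in \<open>auto simp: dist_norm mult.commute[of "norm x"] simp flip: left_diff_distrib\<close>)
  then obtain z where z: "z \<in> S" "1 + z * x = z" by blast
  have 1: "(1 - x) * y = 1" "z * (1 - x) = 1"
    using y z by (auto simp: algebra_simps)
  then have "z = y"
    by (metis mult.assoc mult_1_left mult_1_right)
  moreover have "norm y \<le> 1 + norm x * norm y"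
    using norm_triangle_ineq[of 1 "x * y"] norm_mult_ineq[of x y] y(2) by (simp add: field_simps)
  then have "norm y \<le> 1 / (1 - norm x)"
    using x by (simp add: field_simps)
  ultimately show ?thesis
    using 1 y(1) by blast
qed

lemma spec_norm_le:
  assumes "x \<in> S" "l \<in> spec x" shows "cmod l \<le> norm x"
proof (rule ccontr)
  assume *: "\<not> cmod l \<le> norm x"
  then have l: "l \<noteq> 0" by auto
  have "norm ((1 / l) *\<^sub>C x) < 1"
    using * l by (simp add: norm_scaleC norm_divide field_simps)
  then have "invertible_in (1 - (1 / l) *\<^sub>C x)"
    using neumann[of "(1 / l) *\<^sub>C x"] assms(1) by (auto simp: invertible_in_def closed_ops)
  then have "invertible_in ((- l) *\<^sub>C (1 - (1 / l) *\<^sub>C x))"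
    using l by (intro invertible_in_scaleC) auto
  also have "(- l) *\<^sub>C (1 - (1 / l) *\<^sub>C x) = x - l *\<^sub>C 1"
    using l by (simp add: scaleC_diff_right scaleC_minus_left scaleC_scaleC)
  finally show False
    using assms(2) by (simp add: spec_def)
qed

text \<open>Translating by \<open>i t\<close> moves a nonreal spectral value out of the norm bound
  for large \<open>t\<close>.\<close>
lemma spec_real:
  assumes x: "x \<in> S" "star x = x" and l: "l \<in> spec x" shows "Im l = 0"
proof -
  have *: "2 * Im l * t \<le> (norm x)\<^sup>2" for t
  proof -
    let ?m = "\<i> * complex_of_real t"
    let ?y = "x + ?m *\<^sub>C 1"
    have shift: "?y - (l + ?m) *\<^sub>C 1 = x - l *\<^sub>C 1"
      by (simp add: scaleC_add_left)
    have "l + ?m \<in> spec ?y"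
      using l unfolding spec_def mem_Collect_eq shift .
    then have "cmod (l + ?m) \<le> norm ?y"
      using x by (intro spec_norm_le) (auto simp: closed_ops)
    then have "(cmod (l + ?m))\<^sup>2 \<le> (norm ?y)\<^sup>2"
      by (intro power_mono) auto
    also have "star ?y * ?y = x * x + of_real (t\<^sup>2) *\<^sub>C 1"
      using x by (simp add: star_add star_scaleC algebra_simps scaleC_minus_left mult_scaleC_left
          mult_scaleC_right scaleC_scaleC scaleC_diff_right power2_eq_square)
    then have "(norm ?y)\<^sup>2 = norm (x * x + of_real (t\<^sup>2) *\<^sub>C 1)"
      using cstar_identity[of ?y] by simp
    also have "\<dots> \<le> norm (x * x) + norm (of_real (t\<^sup>2) *\<^sub>C (1::'u))"
      by (rule norm_triangle_ineq)
    also have "\<dots> = (norm x)\<^sup>2 + t\<^sup>2"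
      using x norm_selfadjoint_sq[of x] by (simp add: norm_scaleC norm_power)
    finally have "(Re l)\<^sup>2 + (Im l + t)\<^sup>2 \<le> (norm x)\<^sup>2 + t\<^sup>2"
      by (simp add: cmod_power2)
    then show ?thesis
      by (simp add: power2_sum) (smt (verit) zero_le_power2)
  qed
  show ?thesis
  proof (rule ccontr)
    assume "Im l \<noteq> 0"
    then show False
      using *[of "((norm x)\<^sup>2 + 1) / (2 * Im l)"] by simp
  qed
qed

text \<open>The root is \<open>1 - y\<close> for a fixed point \<open>y\<close> of
  \<open>T y = (b + y^2) / 2\<close>. The radius \<open>\<rho>\<close> is the smaller solution of
  \<open>norm b + \<rho>^2 = 2 \<rho>\<close>, so \<open>T\<close> preserves the ball of radius
  \<open>\<rho>\<close> and contracts it by the factor \<open>\<rho> < 1\<close>. Commutation with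
  everything that commutes with \<open>b\<close> is a closed condition preserved by
  \<open>T\<close>, hence it is built into the set \<open>X\<close>.\<close>

lemma sqrt_one_minus:
  assumes b: "b \<in> S" "star b = b" "norm b < 1"
  shows "\<exists>k\<in>S. star k = k \<and> k * k = 1 - b \<and> (\<forall>z. z * b = b * z \<longrightarrow> z * k = k * z)"
proof -
  define \<rho> where "\<rho> = 1 - sqrt (1 - norm b)"
  have \<rho>: "0 \<le> \<rho>" "\<rho> < 1" "norm b + \<rho> * \<rho> = 2 * \<rho>"
  proof -
    have "sqrt (1 - norm b) * sqrt (1 - norm b) = 1 - norm b"
      using b by simp
    then show "norm b + \<rho> * \<rho> = 2 * \<rho>"
      by (simp add: \<rho>_def algebra_simps)
  qed (use b in \<open>auto simp: \<rho>_def\<close>)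
  define com where "com y \<longleftrightarrow> (\<forall>z. z * b = b * z \<longrightarrow> z * y = y * z)" for y
  define X where "X = {y\<in>S. norm y \<le> \<rho> \<and> star y = y \<and> com y}"
  have "X = S \<inter> {y. norm y \<le> \<rho>} \<inter> {y. star y = y} \<inter> (\<Inter>z\<in>{z. z * b = b * z}. {y. z * y = y * z})"
    by (auto simp: X_def com_def)
  moreover have "closed \<dots>"
    by (intro closed_Int closed_INT ballI closed_ops closed_Collect_le closed_Collect_eq
        continuous_intros)
  ultimately have "complete X"
    by (simp add: complete_eq_closed)
  moreover have "0 \<in> X"
    using \<rho> by (simp add: X_def com_def closed_ops)
  ultimately have X: "complete X" "X \<noteq> {}" by auto
  define T where "T y = (1/2) *\<^sub>R (b + y * y)" for y
  have "\<exists>!y\<in>X. T y = y"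
  proof (rule Banach_fix[OF X, where c = \<rho>])
    show "T ` X \<subseteq> X"
    proof safe
      fix y assume y: "y \<in> X"
      have "norm (y * y) \<le> \<rho> * \<rho>"
        using norm_mult_ineq[of y y] y \<rho> mult_mono[of "norm y" \<rho> "norm y" \<rho>]
        by (auto simp: X_def)
      then have "norm (T y) \<le> \<rho>"
        using norm_triangle_ineq[of b "y * y"] \<rho> by (simp add: T_def)
      moreover have "com (T y)"
        unfolding com_def
      proof (intro allI impI)
        fix z assume z: "z * b = b * z"
        have zy: "z * y = y * z" using y z by (simp add: X_def com_def)
        have "z * (y * y) = y * y * z" by (metis zy mult.assoc)
        then show "z * T y = T y * z" by (simp add: T_def distrib_left distrib_right z)
      qed
      ultimately show "T y \<in> X"
        using y b by (simp add: X_def T_def closed_ops star_add star_mult star_scaleR)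
    qed
    show "dist (T x) (T y) \<le> \<rho> * dist x y" if xy: "x \<in> X" "y \<in> X" for x y
    proof -
      have "T x - T y = (1/2) *\<^sub>R (x * (x - y) + (x - y) * y)"
        by (simp add: T_def algebra_simps)
      then have "norm (T x - T y) \<le> 1/2 * (norm (x * (x - y)) + norm ((x - y) * y))"
        using norm_triangle_ineq[of "x * (x - y)" "(x - y) * y"] by simp
      also have "norm (x * (x - y)) \<le> \<rho> * norm (x - y)"
        using xy norm_mult_ineq[of x "x - y"] mult_right_mono[of "norm x" \<rho> "norm (x - y)"]
        by (auto simp: X_def)
      also have "norm ((x - y) * y) \<le> \<rho> * norm (x - y)"
        using xy norm_mult_ineq[of "x - y" y] mult_left_mono[of "norm y" \<rho> "norm (x - y)"]
        by (auto simp: X_def mult.commute)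
      finally show "dist (T x) (T y) \<le> \<rho> * dist x y"
        by (simp add: dist_norm)
    qed
  qed (use \<rho>(1,2) in auto)
  then obtain y where y: "y \<in> X" "T y = y" by blast
  have "b + y * y = 2 *\<^sub>R T y"
    by (simp add: T_def)
  then have "b + y * y = y + y"
    using y(2) by (simp add: scaleR_2)
  then have b_eq: "b = y + y - y * y"
    by (metis add_diff_cancel_right')
  have sq: "(1 - y) * (1 - y) = 1 - b"
    unfolding b_eq by (simp add: left_diff_distrib right_diff_distrib)
  have "z * (1 - y) = (1 - y) * z" if "z * b = b * z" for z
  proof -
    have "z * y = y * z" using y(1) that by (simp add: X_def com_def)
    then show ?thesis by (simp add: right_diff_distrib left_diff_distrib)
  qed
  moreover have "1 - y \<in> S" "star (1 - y) = 1 - y"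
    using y(1) by (simp_all add: X_def star_diff closed_ops)
  ultimately show ?thesis
    using sq by (intro bexI[of _ "1 - y"] conjI allI impI)
qed

text \<open>If neither \<open>1\<close> nor \<open>-1\<close> is in the spectrum of \<^term>\<open>c\<close>, then
  \<open>r c\<^sup>2 + q\<^sup>2 = 1 - s\<close> with \<^term>\<open>q\<close> self-adjoint and commuting with
  \<^term>\<open>c\<close>, where \<open>r > 1 - s\<close>; the C*-identity for
  \<open>sqrt r c + i q\<close> then contradicts \<open>norm c = 1\<close>.\<close>
lemma not_both_invertible:
  assumes c: "c \<in> S" "star c = c" "norm c = 1"
    and inv: "invertible_in (1 - c)" "invertible_in (1 + c)"
  shows False
proof -
  define b where "b = c * c"
  have b: "b \<in> S" "star b = b" "norm b = 1"
    using c norm_selfadjoint_sq[of c] by (auto simp: b_def star_mult closed_ops)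
  have "invertible_in ((1 - c) * (1 + c))"
    using inv by (rule invertible_in_mult)
  also have "(1 - c) * (1 + c) = 1 - b"
    by (simp add: b_def algebra_simps)
  finally obtain G where G: "G \<in> S" "(1 - b) * G = 1" "G * (1 - b) = 1"
    by (auto simp: invertible_in_def)
  define M where "M = norm G"
  have "G \<noteq> 0" using G by auto
  then have M: "M > 0" by (simp add: M_def)
  \<comment> \<open>So small that the perturbation \<open>E\<close> has norm at most 1/8 and
    \<open>s g\<close> has norm less than 1, which makes both square roots below available. The
    value \<open>r\<close> is the midpoint of \<open>1 - s\<close> and 1.\<close>
  define s where "s = 1 / (4 * M + 1)"
  define r where "r = 1 - s / 2"
  have s: "0 < s" "s < 1" using M by (auto simp: s_def)
  have sM: "s * M \<le> 1/4" using M by (simp add: s_def field_simps)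
  define E where "E = - ((1 - r) *\<^sub>R G * b)"
  have E: "E \<in> S" "norm E \<le> 1/8"
  proof -
    have "norm E \<le> norm ((1 - r) *\<^sub>R G) * norm b"
      unfolding E_def norm_minus_cancel by (rule norm_mult_ineq)
    also have "\<dots> \<le> 1/8"
      using b s sM by (simp add: r_def M_def)
    finally show "norm E \<le> 1/8" .
  qed (use G b in \<open>simp add: E_def closed_ops\<close>)
  have "norm E < 1" using E by simp
  from neumann[OF E(1) this] obtain H where H: "H \<in> S" "(1 - E) * H = 1" "H * (1 - E) = 1"
    "norm H \<le> 1 / (1 - norm E)" by blast
  have "1 / (1 - norm E) \<le> 2" using E by (simp add: field_simps)
  then have H2: "norm H \<le> 2" using H by simp
  have rb: "1 - r *\<^sub>R b = (1 - b) * (1 - E)"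
  proof -
    have "(1 - b) * (1 - E) = (1 - b) + (1 - r) *\<^sub>R ((1 - b) * G * b)"
      by (simp add: E_def left_diff_distrib right_diff_distrib distrib_left scaleR_right_diff_distrib mult.assoc)
    then have "(1 - b) * (1 - E) = (1 - b) + (1 - r) *\<^sub>R b"
      by (simp add: G)
    then show ?thesis by (simp add: scaleR_left_diff_distrib)
  qed
  define g where "g = H * G"
  have g: "g \<in> S" "(1 - r *\<^sub>R b) * g = 1" "g * (1 - r *\<^sub>R b) = 1"
  proof -
    have "(1 - r *\<^sub>R b) * g = (1 - b) * ((1 - E) * H) * G" "g * (1 - r *\<^sub>R b) = H * (G * (1 - b)) * (1 - E)"
      unfolding rb g_def by (simp_all only: mult.assoc)
    then show "(1 - r *\<^sub>R b) * g = 1" "g * (1 - r *\<^sub>R b) = 1"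
      using H G by simp_all
  qed (use H G in \<open>simp add: g_def closed_ops\<close>)
  have "norm g \<le> norm H * norm G" unfolding g_def by (rule norm_mult_ineq)
  also have "\<dots> \<le> 2 * M" using H2 by (simp add: M_def mult_right_mono)
  finally have "s * norm g \<le> s * (2 * M)"
    using s by (intro mult_left_mono) auto
  also have "\<dots> = 2 * (s * M)" by simp
  also have "\<dots> < 1" using sM by linarith
  finally have sg: "norm (s *\<^sub>R g) < 1" using s by simp
  have "star g * (1 - r *\<^sub>R b) = 1"
    using arg_cong[OF g(2), of star] b by (simp add: star_mult star_diff star_scaleR)
  then have g_sa: "star g = g"
    using g(2) by (metis mult.assoc[of "star g"] mult_1_left mult_1_right)
  have "s *\<^sub>R g \<in> S" "star (s *\<^sub>R g) = s *\<^sub>R g" "r *\<^sub>R b \<in> S" "star (r *\<^sub>R b) = r *\<^sub>R b"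
    using g b g_sa by (simp_all add: closed_ops star_scaleR)
  note rs = this
  obtain l where l: "l \<in> S" "star l = l" "l * l = 1 - s *\<^sub>R g"
      "\<And>z. z * (s *\<^sub>R g) = (s *\<^sub>R g) * z \<Longrightarrow> z * l = l * z"
    using sqrt_one_minus[OF rs(1,2) sg] by blast
  have "norm (r *\<^sub>R b) < 1" using b s by (simp add: r_def)
  then obtain k where k: "k \<in> S" "star k = k" "k * k = 1 - r *\<^sub>R b"
      "\<And>z. z * (r *\<^sub>R b) = (r *\<^sub>R b) * z \<Longrightarrow> z * k = k * z"
    using sqrt_one_minus[OF rs(3,4)] by blast
  have comm_g: "z * g = g * z" if "z * b = b * z" for z
  proof -
    have 1: "z * (1 - r *\<^sub>R b) = (1 - r *\<^sub>R b) * z"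
      using that by (simp add: algebra_simps)
    have "z * g = g * (1 - r *\<^sub>R b) * z * g" by (simp only: g(3) mult_1_left)
    also have "\<dots> = g * (z * ((1 - r *\<^sub>R b) * g))"
      by (metis 1 mult.assoc)
    finally show ?thesis by (simp only: g(2) mult_1_right)
  qed
  have comm_l: "z * l = l * z" if "z * b = b * z" for z
    by (rule l(4)) (simp add: comm_g[OF that])
  have comm_k: "z * k = k * z" if "z * b = b * z" for z
    by (rule k(4)) (simp add: that)
  have cb: "c * b = b * c" by (simp add: b_def mult.assoc)
  have bk: "b * k = k * b" using comm_k[of b] by simp
  have kl: "k * l = l * k" by (rule comm_l) (rule bk[symmetric])
  \<comment> \<open>As \<open>g\<close> is the inverse of \<open>1 - r b\<close>, the square of
    \<open>q\<close> is \<open>(1 - r b) (1 - s g) = 1 - r b - s\<close>.\<close>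
  define q where "q = k * l"
  have q: "q \<in> S" "star q = q" using k(1,2) l(1,2) by (simp_all add: q_def closed_ops star_mult kl)
  have cq: "c * q = q * c"
    unfolding q_def by (metis comm_k[OF cb] comm_l[OF cb] mult.assoc)
  have "q * q = (k * k) * (l * l)"
    unfolding q_def by (metis kl mult.assoc)
  also have "\<dots> = (1 - r *\<^sub>R b) - s *\<^sub>R ((1 - r *\<^sub>R b) * g)"
    unfolding k(3) l(3) by (simp add: right_diff_distrib)
  finally have "q * q = (1 - r *\<^sub>R b) - s *\<^sub>R 1"
    unfolding g(2) .
  then have qq: "r *\<^sub>R b + q * q = (1 - s) *\<^sub>R 1"
    by (simp add: scaleR_left_diff_distrib)
  have r0: "0 < r" using s by (simp add: r_def)
  define w where "w = sqrt r *\<^sub>R c + \<i> *\<^sub>C q"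
  have sw: "star w = sqrt r *\<^sub>R c - \<i> *\<^sub>C q"
    using c q by (simp add: w_def star_add star_scaleR star_scaleC scaleC_minus_left)
  have dd: "(sqrt r *\<^sub>R c) * (sqrt r *\<^sub>R c) = r *\<^sub>R b" and dq: "(sqrt r *\<^sub>R c) * q = q * (sqrt r *\<^sub>R c)"
    using r0 cq by (simp_all add: b_def)
  have "(d - \<i> *\<^sub>C q) * (d + \<i> *\<^sub>C q) = d * d + q * q" if "d * q = q * d" for d
    by (simp add: that distrib_left left_diff_distrib mult_scaleC_left mult_scaleC_right
        scaleC_scaleC scaleC_minus_left scaleC_diff_right)
  from this[OF dq] have "star w * w = r *\<^sub>R b + q * q"
    unfolding sw unfolding w_def dd .
  then have nw: "(norm w)\<^sup>2 = 1 - s"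
    using cstar_identity[of w] qq s by simp
  have "w + star w = sqrt r *\<^sub>R c + sqrt r *\<^sub>R c"
    unfolding sw unfolding w_def by simp
  then have "2 *\<^sub>R (sqrt r *\<^sub>R c) = w + star w"
    by (simp only: scaleR_2)
  then have "2 * norm (sqrt r *\<^sub>R c) \<le> norm w + norm (star w)"
    by (metis norm_triangle_ineq norm_scaleR abs_numeral)
  then have "sqrt r \<le> norm w" using c r0 by simp
  then have "(sqrt r)\<^sup>2 \<le> (norm w)\<^sup>2" using r0 by (intro power_mono) auto
  then have "r \<le> 1 - s" using r0 nw by simp
  then show False using s by (simp add: r_def)
qed

text \<open>Scaled to norm one, this is \<open>not_both_invertible\<close>. It takes the place of
  the spectral radius formula, without norms of powers or complex analysis.\<close>

lemma norm_in_spec: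
  assumes x: "x \<in> S" "star x = x"
  shows "complex_of_real (norm x) \<in> spec x \<or> complex_of_real (- norm x) \<in> spec x"
proof (cases "x = 0")
  case True
  then show ?thesis by (auto simp: spec_def invertible_in_def)
next
  case False
  define c where "c = complex_of_real (1 / norm x) *\<^sub>C x"
  have c: "c \<in> S" "star c = c" "norm c = 1"
    using x False by (auto simp: c_def closed_ops star_scaleC norm_scaleC norm_divide)
  have 1: "1 - c = complex_of_real (- 1 / norm x) *\<^sub>C (x - complex_of_real (norm x) *\<^sub>C 1)"
    "1 + c = complex_of_real (1 / norm x) *\<^sub>C (x - complex_of_real (- norm x) *\<^sub>C 1)"
    using False by (simp_all add: c_def scaleC_diff_right scaleC_add_right scaleC_scaleC scaleC_minus_left)
  show ?thesis
  proof (rule ccontr)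
    assume *: "\<not> ?thesis"
    have "invertible_in (1 - c)" "invertible_in (1 + c)"
      unfolding 1 using * False by (auto simp: spec_def intro!: invertible_in_scaleC)
    then show False
      using not_both_invertible[OF c] by blast
  qed
qed

lemma cpeval_in: "x \<in> S \<Longrightarrow> cpeval p x \<in> S"
  by (induction p) (auto simp: closed_ops)

text \<open>One half of the spectral mapping theorem: \<open>P\<close> splits into linear factors,
  and each of them gives an invertible element.\<close>

lemma cpeval_invertible:
  assumes "x \<in> S" "P \<noteq> 0" "\<And>r. poly P r = 0 \<Longrightarrow> r \<notin> spec x"
  shows "invertible_in (cpeval P x)"
  using assms(2,3)
proof (induction "degree P" arbitrary: P)
  case 0
  then obtain c where c: "P = [:c:]" "c \<noteq> 0"
    by (metis degree_eq_zeroE pCons_0_0)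
  have "invertible_in 1"
    by (auto simp: invertible_in_def closed_ops)
  then show ?case
    using c invertible_in_scaleC[of c 1] by simp
next
  case (Suc n)
  then have "\<not> constant (poly P)"
    by (simp add: constant_degree)
  then obtain r where r: "poly P r = 0"
    using fundamental_theorem_of_algebra by blast
  then have "[:- r, 1:] dvd P"
    by (simp only: poly_eq_0_iff_dvd)
  then obtain Q where Q: "P = [:- r, 1:] * Q"
    by (elim dvdE)
  have Q0: "Q \<noteq> 0"
    using Q Suc.prems(1) by (metis mult_zero_right)
  have "degree P = degree [:- r, 1:] + degree Q"
    unfolding Q by (rule degree_mult_eq) (simp_all add: Q0)
  then have "n = degree Q"
    using Suc.hyps(2) by simp
  moreover have "s \<notin> spec x" if "poly Q s = 0" for s
    by (rule Suc.prems(2)) (simp only: Q poly_mult that mult_zero_right)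
  ultimately have "invertible_in (cpeval Q x)"
    using Q0 by (intro Suc.hyps(1))
  moreover have "invertible_in (x - r *\<^sub>C 1)"
    using Suc.prems(2)[OF r] by (simp add: spec_def)
  ultimately have "invertible_in ((x - r *\<^sub>C 1) * cpeval Q x)"
    by (intro invertible_in_mult)
  also have "(x - r *\<^sub>C 1) * cpeval Q x = cpeval P x"
    by (subst Q, simp only: cpeval_mult) (simp add: scaleC_minus_left)
  finally show ?case .
qed

text \<open>The other half: \<open>P - P(l)\<close> contains the factor \<open>x - l\<close>, which
  commutes with the cofactor, so invertibility of the product would make \<open>x - l\<close>
  invertible.\<close>

lemma spec_cpeval:
  assumes "x \<in> S" "l \<in> spec x" shows "poly P l \<in> spec (cpeval P x)"
proof -
  have "poly (P - [:poly P l:]) l = 0" by simp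
  then have "[:- l, 1:] dvd P - [:poly P l:]"
    by (simp only: poly_eq_0_iff_dvd)
  then obtain Q where Q: "P - [:poly P l:] = [:- l, 1:] * Q"
    by (elim dvdE)
  have "cpeval P x - poly P l *\<^sub>C 1 = cpeval (P + - [:poly P l:]) x"
    unfolding cpeval_add by (simp add: scaleC_minus_left)
  also have "P + - [:poly P l:] = [:- l, 1:] * Q"
    using Q by (simp only: diff_conv_add_uminus)
  also have "cpeval \<dots> x = (x - l *\<^sub>C 1) * cpeval Q x"
    by (simp only: cpeval_mult) (simp add: scaleC_minus_left)
  finally have *: "cpeval P x - poly P l *\<^sub>C 1 = (x - l *\<^sub>C 1) * cpeval Q x" .
  have xl: "x - l *\<^sub>C 1 \<in> S"
    using assms(1) by (simp add: closed_ops)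
  show ?thesis
  proof (rule ccontr)
    assume "poly P l \<notin> spec (cpeval P x)"
    then have "invertible_in ((x - l *\<^sub>C 1) * cpeval Q x)"
      by (simp add: spec_def *)
    moreover have "(x - l *\<^sub>C 1) * cpeval Q x = cpeval Q x * (x - l *\<^sub>C 1)"
      using cpeval_commute[of x x Q]
      by (simp add: left_diff_distrib right_diff_distrib mult_scaleC_left mult_scaleC_right)
    ultimately have "invertible_in (x - l *\<^sub>C 1)"
      using invertible_in_factor[OF xl cpeval_in[OF assms(1)]] by blast
    then show False
      using assms(2) by (simp add: spec_def)
  qed
qed

end

section \<open>From nonunital algebras to their unitizations\<close>

definition uni_sub :: "'a::cstar_algebra set \<Rightarrow> 'a unitization set"
  where "uni_sub A = {x. vecp x \<in> A}"

lemma bounded_linear_vecp: "bounded_linear (vecp :: 'a::cstar_algebra unitization \<Rightarrow> 'a)"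
proof (rule bounded_linear_intro[where K = 2])
  show "norm (vecp x) \<le> norm x * 2" for x :: "'a unitization"
    using norm_vecp_le[of x] scal_le_norm[of x] by simp
qed (simp_all add: plus_unitization_def scaleR_unitization_def)

lemma unital_cstar_uni_sub:
  assumes A: "cstar_subalgebra A" shows "unital_cstar (uni_sub A)"
proof
  have "closed (uni_sub A)"
    unfolding uni_sub_def using continuous_closed_vimage[OF cstar_subalgebraD(6)[OF A], of vecp]
    by (simp add: vimage_def linear_continuous_at[OF bounded_linear_vecp])
  then show "cstar_subalgebra (uni_sub A)"
    unfolding cstar_subalgebra_def
    by (auto simp: uni_sub_def plus_unitization_def times_unitization_def scaleC_unitization_def
        star_unitization_def zero_unitization_def cstar_subalgebraD[OF A])
  show "1 \<in> uni_sub A"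
    by (simp add: uni_sub_def one_unitization_def cstar_subalgebraD[OF A])
qed

lemma quasi_invertible_iff:
  assumes A: "cstar_subalgebra A" and a: "a \<in> A"
  shows "quasi_invertible A a \<longleftrightarrow> unital_cstar.invertible_in (uni_sub A) (1 - uni_emb a)"
proof -
  interpret unital_cstar "uni_sub A" by (rule unital_cstar_uni_sub[OF A])
  note defs = one_unitization_def minus_unitization_def times_unitization_def scaleC_minus_left
  have in_A: "1 - uni_emb a \<in> uni_sub A"
    using a by (simp add: uni_sub_def defs cstar_subalgebraD[OF A])
  show ?thesis
  proof
    assume "quasi_invertible A a"
    then obtain b where "b \<in> A" "a + b = a * b" "a + b = b * a"
      by (auto simp: quasi_invertible_def)
    then show "invertible_in (1 - uni_emb a)"
      using in_A unfolding invertible_in_def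
      by (intro conjI bexI[of _ "1 - uni_emb b"])
        (auto simp: defs uni_sub_def cstar_subalgebraD[OF A] algebra_simps)
  next
    assume "invertible_in (1 - uni_emb a)"
    then obtain y where y: "y \<in> uni_sub A" "(1 - uni_emb a) * y = 1" "y * (1 - uni_emb a) = 1"
      unfolding invertible_in_def by blast
    from y(1) have yA: "vecp y \<in> A"
      by (simp add: uni_sub_def)
    have s: "scal y = 1"
      using y(2) by (simp add: defs)
    show "quasi_invertible A a"
      unfolding quasi_invertible_def
      using y(2,3) yA s by (intro bexI[of _ "- vecp y"])
        (auto simp: defs cstar_subalgebraD[OF A] algebra_simps)
  qed
qed

lemma nonzero_spectrum_eq:
  assumes A: "cstar_subalgebra A" and a: "a \<in> A"
  shows "nonzero_spectrum A a = unital_cstar.spec (uni_sub A) (uni_emb a) - {0}"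
proof -
  interpret unital_cstar "uni_sub A" by (rule unital_cstar_uni_sub[OF A])
  have "quasi_invertible A ((1 / l) *\<^sub>C a) \<longleftrightarrow> invertible_in (uni_emb a - l *\<^sub>C 1)"
    if "l \<noteq> 0" for l
  proof -
    have 1: "uni_emb a - l *\<^sub>C 1 = (- l) *\<^sub>C (1 - uni_emb ((1 / l) *\<^sub>C a))"
      using that by (simp add: uni_emb_hom scaleC_diff_right scaleC_scaleC scaleC_minus_left)
    have 2: "1 - uni_emb ((1 / l) *\<^sub>C a) = (- 1 / l) *\<^sub>C (uni_emb a - l *\<^sub>C 1)"
      using that by (simp add: uni_emb_hom scaleC_diff_right scaleC_scaleC scaleC_minus_left)
    have "invertible_in (1 - uni_emb ((1 / l) *\<^sub>C a)) \<longleftrightarrow> invertible_in (uni_emb a - l *\<^sub>C 1)"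
    proof
      assume "invertible_in (1 - uni_emb ((1 / l) *\<^sub>C a))"
      then show "invertible_in (uni_emb a - l *\<^sub>C 1)"
        unfolding 1 using that by (intro invertible_in_scaleC) auto
    next
      assume "invertible_in (uni_emb a - l *\<^sub>C 1)"
      then show "invertible_in (1 - uni_emb ((1 / l) *\<^sub>C a))"
        unfolding 2 using that by (intro invertible_in_scaleC) auto
    qed
    then show ?thesis
      using a by (subst quasi_invertible_iff[OF A]) (auto simp: cstar_subalgebraD[OF A])
  qed
  then show ?thesis
    by (auto simp: nonzero_spectrum_def spec_def)
qed

section \<open>Polynomials without constant term in a self-adjoint element\<close>

abbreviation cpoly :: "real poly \<Rightarrow> complex poly"
  where "cpoly \<equiv> map_poly complex_of_real"

lemma poly_cpoly: "poly (cpoly p) (complex_of_real t) = complex_of_real (poly p t)"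
  by (induction p) (simp_all add: map_poly_pCons)

lemma poly_alg_0 [simp]: "poly_alg 0 a = 0"
  by (simp add: poly_alg_def)

lemma poly_alg_pCons:
  "poly_alg (pCons b p) a = coeff p 0 *\<^sub>R a + a * poly_alg p (a::'a::cstar_algebra)"
proof (cases "p = 0")
  case False
  then have "poly_alg (pCons b p) a = (\<Sum>i<Suc (degree p). coeff p i *\<^sub>R power_Suc_alg a i)"
    by (simp add: poly_alg_def)
  also have "\<dots> = coeff p 0 *\<^sub>R a + (\<Sum>i<degree p. coeff p (Suc i) *\<^sub>R (a * power_Suc_alg a i))"
    by (subst sum.lessThan_Suc_shift) simp
  also have "(\<Sum>i<degree p. coeff p (Suc i) *\<^sub>R (a * power_Suc_alg a i)) = a * poly_alg p a"
    by (simp add: poly_alg_def sum_distrib_left)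
  finally show ?thesis .
qed (simp add: poly_alg_def)

lemma uni_emb_poly_alg:
  "cpeval (cpoly p) (uni_emb a) = complex_of_real (coeff p 0) *\<^sub>C 1 + uni_emb (poly_alg p a)"
  by (induction p)
    (auto simp: map_poly_pCons poly_alg_pCons uni_emb_hom scaleR_eq_scaleC distrib_left mult_scaleC_right)

lemma poly_alg_eqI:
  assumes "poly p 0 = 0"
    and "cpeval (cpoly p) (uni_emb c) = uni_emb y"
  shows "poly_alg p c = y"
  using assms by (simp add: uni_emb_poly_alg poly_0_coeff_0)

lemma uni_emb_poly_alg0: "poly p 0 = 0 \<Longrightarrow> uni_emb (poly_alg p a) = cpeval (cpoly p) (uni_emb a)"
  by (simp add: uni_emb_poly_alg poly_0_coeff_0)

lemma cpoly_add: "cpoly (p + q) = cpoly p + cpoly q"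
  by (rule poly_eqI) (simp add: coeff_map_poly)

lemma cpoly_smult: "cpoly (Polynomial.smult c p) = Polynomial.smult (complex_of_real c) (cpoly p)"
  by (rule poly_eqI) (simp add: coeff_map_poly)

lemma cpoly_mult: "cpoly (p * q) = cpoly p * cpoly q"
  by (induction p) (simp_all add: map_poly_pCons cpoly_add cpoly_smult)

lemma poly_alg_add:
  "poly p 0 = 0 \<Longrightarrow> poly q 0 = 0 \<Longrightarrow> poly_alg (p + q) c = poly_alg p c + poly_alg q c"
  by (rule poly_alg_eqI) (simp_all add: uni_emb_hom uni_emb_poly_alg0 cpoly_add cpeval_add)

lemma poly_alg_smult:
  "poly p 0 = 0 \<Longrightarrow> poly_alg (Polynomial.smult r p) c = r *\<^sub>R poly_alg p c"
  by (rule poly_alg_eqI) (simp_all add: scaleR_eq_scaleC uni_emb_hom uni_emb_poly_alg0 cpoly_smult cpeval_smult)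

lemma poly_alg_diff:
  "poly p 0 = 0 \<Longrightarrow> poly q 0 = 0 \<Longrightarrow> poly_alg (p - q) c = poly_alg p c - poly_alg q c"
  using poly_alg_add[of p "Polynomial.smult (-1) q" c] poly_alg_smult[of q "-1" c] by simp

lemma poly_alg_mult:
  "poly p 0 = 0 \<Longrightarrow> poly q 0 = 0 \<Longrightarrow> poly_alg (p * q) c = poly_alg p c * poly_alg q c"
  by (rule poly_alg_eqI) (simp_all add: uni_emb_hom uni_emb_poly_alg0 cpoly_mult cpeval_mult)

lemma poly_alg_in:
  assumes "0 \<in> X" "c \<in> X" "\<And>x y. x \<in> X \<Longrightarrow> y \<in> X \<Longrightarrow> x + y \<in> X"
    "\<And>r x. x \<in> X \<Longrightarrow> r *\<^sub>R x \<in> X" "\<And>x. x \<in> X \<Longrightarrow> c * x \<in> X"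
  shows "poly_alg p c \<in> X"
  using assms by (induction p) (auto simp: poly_alg_pCons)

lemma poly_alg_commute:
  fixes c :: "'a::cstar_algebra"
  assumes "z * c = c * z" shows "z * poly_alg p c = poly_alg p c * z"
proof -
  have "poly_alg p c \<in> {x. z * x = x * z}"
    by (rule poly_alg_in) (use assms in \<open>auto simp: algebra_simps\<close>, metis mult.assoc)
  then show ?thesis by simp
qed

lemma star_poly_alg:
  fixes c :: "'a::cstar_algebra"
  assumes "star c = c" shows "star (poly_alg p c) = poly_alg p c"
  using assms
  by (induction p) (auto simp: poly_alg_pCons star_add star_scaleR star_mult poly_alg_commute)

definition rspec :: "'a::cstar_algebra set \<Rightarrow> 'a \<Rightarrow> real set"
  where "rspec A c = {t. complex_of_real t \<in> nonzero_spectrum A c}"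

context
  fixes A :: "'a::cstar_algebra set" and c :: 'a
  assumes A: "cstar_subalgebra A" and c: "c \<in> A" "star c = c"
begin

interpretation unital_cstar "uni_sub A" by (rule unital_cstar_uni_sub[OF A])

lemma uni_c: "uni_emb c \<in> uni_sub A" "star (uni_emb c) = uni_emb c"
  using c by (simp_all add: uni_sub_def star_unitization_def)

lemma nonzero_spectrum_real: "l \<in> nonzero_spectrum A c \<Longrightarrow> l = complex_of_real (Re l) \<and> Re l \<in> rspec A c"
proof -
  assume l: "l \<in> nonzero_spectrum A c"
  then have "l = complex_of_real (Re l)"
    using spec_real[OF uni_c, of l] by (simp add: nonzero_spectrum_eq[OF A c(1)] complex_eq_iff)
  then show ?thesis
    using l unfolding rspec_def by simp
qed

lemma rspec_bound: "t \<in> rspec A c \<Longrightarrow> \<bar>t\<bar> \<le> norm c"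
  using spec_norm_le[OF uni_c(1), of "complex_of_real t"]
  by (simp add: rspec_def nonzero_spectrum_eq[OF A c(1)] norm_uni_emb)

lemma rspec_nonzero: "t \<in> rspec A c \<Longrightarrow> t \<noteq> 0"
  by (auto simp: rspec_def nonzero_spectrum_def)

lemma norm_in_rspec: "c \<noteq> 0 \<Longrightarrow> norm c \<in> rspec A c \<or> - norm c \<in> rspec A c"
  using norm_in_spec[OF uni_c]
  by (simp add: rspec_def nonzero_spectrum_eq[OF A c(1)] norm_uni_emb del: of_real_minus)

lemma poly_alg_in_subalgebra: "poly_alg p c \<in> A"
  by (rule poly_alg_in) (use c in \<open>auto intro: cstar_subalgebraD[OF A]\<close>)

text \<open>The norm of the self-adjoint element \<open>p(c)\<close> is, up to sign, one of its
  spectral values \<open>m\<close>, so \<open>p - m\<close> must have a root in the spectrum of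
  \<open>c\<close>. Since \<open>p(0) = 0\<close> and \<open>m \<noteq> 0\<close>, that root is not
  0; hence a bound on the nonzero spectrum suffices.\<close>

lemma norm_poly_alg_le:
  assumes p: "poly p 0 = 0" and M: "0 \<le> M" "\<And>t. t \<in> rspec A c \<Longrightarrow> \<bar>poly p t\<bar> \<le> M"
  shows "norm (poly_alg p c) \<le> M"
proof (cases "poly_alg p c = 0")
  case False
  define h where "h = uni_emb (poly_alg p c)"
  have h: "h \<in> uni_sub A" "star h = h" "h = cpeval (cpoly p) (uni_emb c)"
    using c uni_emb_poly_alg0[OF p, of c, symmetric]
    by (simp_all add: h_def uni_sub_def poly_alg_in_subalgebra star_unitization_def star_poly_alg)
  obtain m where m: "complex_of_real m \<in> spec h" "\<bar>m\<bar> = norm h"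
    using norm_in_spec[OF h(1,2)] by (metis abs_norm_cancel abs_minus_cancel)
  have m0: "m \<noteq> 0"
    using m False by (auto simp: h_def norm_uni_emb)
  define P where "P = cpoly p + - [:complex_of_real m:]"
  have P: "cpeval P (uni_emb c) = h - complex_of_real m *\<^sub>C 1"
    unfolding P_def cpeval_add h(3) by (simp add: scaleC_minus_left)
  have P0: "P \<noteq> 0"
  proof
    assume "P = 0"
    then have "poly (cpoly p) (complex_of_real 0) = complex_of_real m"
      by (simp only: P_def add_eq_0_iff2) (simp add: poly_minus)
    then show False
      using p m0 unfolding poly_cpoly by simp
  qed
  have "\<not> invertible_in (cpeval P (uni_emb c))"
    using m by (simp add: P spec_def)
  then obtain r where r: "poly P r = 0" "r \<in> spec (uni_emb c)"
    using cpeval_invertible[OF uni_c(1) P0] by blast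
  obtain t where t: "r = complex_of_real t"
    using spec_real[OF uni_c r(2)] by (metis complex_is_Real_iff Reals_cases)
  have "poly p t = m"
    using r(1) unfolding P_def t by (simp add: poly_cpoly)
  moreover from this have "t \<noteq> 0"
    using p m0 by auto
  then have "t \<in> rspec A c"
    using r(2) by (simp add: rspec_def nonzero_spectrum_eq[OF A c(1)] t)
  ultimately show ?thesis
    using M(2)[of t] m(2) by (simp add: h_def norm_uni_emb)
qed (use M in simp)

lemma poly_le_norm_poly_alg:
  assumes p: "poly p 0 = 0" and t: "t \<in> rspec A c"
  shows "\<bar>poly p t\<bar> \<le> norm (poly_alg p c)"
proof -
  have h: "uni_emb (poly_alg p c) \<in> uni_sub A"
    by (simp add: uni_sub_def poly_alg_in_subalgebra)
  have "complex_of_real t \<in> spec (uni_emb c)"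
    using t by (simp add: rspec_def nonzero_spectrum_eq[OF A c(1)])
  from spec_cpeval[OF uni_c(1) this, of "cpoly p"] show ?thesis
    using spec_norm_le[OF h, of "complex_of_real (poly p t)"]
    by (simp add: poly_cpoly uni_emb_poly_alg0[OF p] norm_uni_emb flip: uni_emb_poly_alg0[OF p])
qed

end

section \<open>Continuous functional calculus\<close>

definition cont0 :: "(real \<Rightarrow> real) \<Rightarrow> bool"
  where "cont0 f \<longleftrightarrow> continuous_on UNIV f \<and> f 0 = 0"

lemma Weierstrass_poly:
  assumes f: "cont0 f" and R: "0 \<le> R"
  obtains p :: "nat \<Rightarrow> real poly"
  where "\<And>n. poly (p n) 0 = 0" "uniform_limit {-R..R} (\<lambda>n. poly (p n)) f sequentially"
proof -
  have "\<exists>p. poly p 0 = 0 \<and> (\<forall>t\<in>{-R..R}. \<bar>poly p t - f t\<bar> < e)" if "0 < e" for e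
  proof -
    have "continuous_on {-R..R} f"
      using f by (auto simp: cont0_def intro: continuous_on_subset)
    then obtain g where g: "real_polynomial_function g" "\<And>x. x \<in> {-R..R} \<Longrightarrow> \<bar>f x - g x\<bar> < e / 2"
      using Stone_Weierstrass_real_polynomial_function[of "{-R..R}" f "e / 2"] \<open>0 < e\<close> by auto
    obtain a n where an: "g = (\<lambda>x. \<Sum>i\<le>n. a i * x ^ i)"
      using g(1) by (auto simp: real_polynomial_function_iff_sum)
    define q where "q = (\<Sum>i\<le>n. monom (a i) i)"
    have q: "poly q = g"
      by (simp add: q_def an poly_sum poly_monom fun_eq_iff)
    \<comment> \<open>Removing the constant term costs at most another \<open>e / 2\<close>, because
      \<open>f 0 = 0\<close>.\<close>
    define p where "p = q - [:poly q 0:]"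
    have "\<bar>poly p t - f t\<bar> < e" if "t \<in> {-R..R}" for t
    proof -
      have "\<bar>f t - g t\<bar> < e / 2" "\<bar>g 0\<bar> < e / 2"
        using g(2)[OF that] g(2)[of 0] R f by (auto simp: cont0_def)
      then show ?thesis
        by (simp add: p_def q abs_if split: if_splits)
    qed
    then show ?thesis
      by (intro exI[of _ p]) (simp add: p_def)
  qed
  then have "\<exists>p. \<forall>n. poly (p n) 0 = 0 \<and> (\<forall>t\<in>{-R..R}. \<bar>poly (p n) t - f t\<bar> < inverse (real (Suc n)))"
    by (intro choice allI) simp
  then obtain p where p: "\<And>n. poly (p n) 0 = 0"
    "\<And>n t. t \<in> {-R..R} \<Longrightarrow> \<bar>poly (p n) t - f t\<bar> < inverse (real (Suc n))"
    by blast
  have "uniform_limit {-R..R} (\<lambda>n. poly (p n)) f sequentially"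
  proof (rule uniform_limitI)
    fix e :: real assume "0 < e"
    with LIMSEQ_inverse_real_of_nat have "\<forall>\<^sub>F n in sequentially. inverse (real (Suc n)) < e"
      by (rule order_tendstoD)
    then show "\<forall>\<^sub>F n in sequentially. \<forall>x\<in>{-R..R}. dist (poly (p n) x) (f x) < e"
      by eventually_elim (auto simp: dist_real_def intro!: less_trans[OF p(2)])
  qed
  then show ?thesis
    using p(1) that by blast
qed

context
  fixes A :: "'a::cstar_algebra set" and c :: 'a
  assumes A: "cstar_subalgebra A" and c: "c \<in> A" "star c = c"
begin

lemma poly_alg_diff_tendsto_0:
  assumes pq: "\<And>n. poly (p n) 0 = 0" "\<And>n. poly (q n) 0 = 0"
    and lim: "uniform_limit (rspec A c) (\<lambda>n. poly (p n)) f sequentially"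
      "uniform_limit (rspec A c) (\<lambda>n. poly (q n)) f sequentially"
  shows "(\<lambda>n. poly_alg (p n) c - poly_alg (q n) c) \<longlonglongrightarrow> 0"
proof (rule LIMSEQ_I)
  fix e :: real assume e: "0 < e"
  have "uniform_limit (rspec A c) (\<lambda>n t. poly (p n) t - poly (q n) t) (\<lambda>t. f t - f t) sequentially"
    by (intro uniform_limit_intros lim)
  then have "\<forall>\<^sub>F n in sequentially. \<forall>t\<in>rspec A c. \<bar>poly (p n - q n) t\<bar> < e / 2"
    using e by (auto dest!: uniform_limitD[where e="e/2"] simp: dist_real_def)
  then have "\<forall>\<^sub>F n in sequentially. norm (poly_alg (p n - q n) c) \<le> e / 2"
    by eventually_elim (use e pq in \<open>intro norm_poly_alg_le[OF A c], auto intro: less_imp_le\<close>)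
  then have "\<forall>\<^sub>F n in sequentially. norm (poly_alg (p n) c - poly_alg (q n) c - 0) < e"
    by eventually_elim (use e pq in \<open>auto simp: poly_alg_diff\<close>)
  then show "\<exists>N. \<forall>n\<ge>N. norm (poly_alg (p n) c - poly_alg (q n) c - 0) < e"
    by (simp add: eventually_sequentially)
qed

lemma poly_alg_convergent:
  assumes p: "\<And>n. poly (p n) 0 = 0"
    and lim: "uniform_limit (rspec A c) (\<lambda>n. poly (p n)) f sequentially"
  shows "convergent (\<lambda>n. poly_alg (p n) c)"
  unfolding Cauchy_convergent_iff[symmetric]
proof (rule CauchyI)
  fix e :: real assume e: "0 < e"
  then have "\<forall>\<^sub>F n in sequentially. \<forall>t\<in>rspec A c. dist (poly (p n) t) (f t) < e / 4"
    using uniform_limitD[OF lim, of "e / 4"] by simp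
  then obtain N where N: "\<And>n t. n \<ge> N \<Longrightarrow> t \<in> rspec A c \<Longrightarrow> \<bar>poly (p n) t - f t\<bar> < e / 4"
    by (auto simp: eventually_sequentially dist_real_def)
  have "norm (poly_alg (p m) c - poly_alg (p n) c) < e" if mn: "m \<ge> N" "n \<ge> N" for m n
  proof -
    have "norm (poly_alg (p m - p n) c) \<le> e / 2"
    proof (rule norm_poly_alg_le[OF A c])
      show "\<bar>poly (p m - p n) t\<bar> \<le> e / 2" if "t \<in> rspec A c" for t
        using N[OF mn(1) that] N[OF mn(2) that] by (simp add: abs_if split: if_splits)
    qed (use e p in auto)
    then show ?thesis
      using e p by (simp add: poly_alg_diff)
  qed
  then show "\<exists>M. \<forall>m\<ge>M. \<forall>n\<ge>M. norm (poly_alg (p m) c - poly_alg (p n) c) < e"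
    by blast
qed

lemma rspec_subset: "norm c \<le> R \<Longrightarrow> rspec A c \<subseteq> {-R..R}"
  using rspec_bound[OF A c] by force

text \<open>Any two admissible sequences of polynomials have the same limit, so the definite
  description in \<open>fun_calc\<close> is met by exactly one element as soon as one such sequence
  is given.\<close>

lemma fun_calc_lim:
  assumes f: "cont0 f" and p: "\<And>n. poly (p n) 0 = 0"
    and lim: "uniform_limit (rspec A c) (\<lambda>n. poly (p n)) f sequentially"
  shows "(\<lambda>n. poly_alg (p n) c) \<longlonglongrightarrow> fun_calc A f c" "fun_calc A f c \<in> A"
proof -
  obtain y where y: "(\<lambda>n. poly_alg (p n) c) \<longlonglongrightarrow> y"
    using poly_alg_convergent[OF p lim] by (auto simp: convergent_def)
  have yA: "y \<in> A"
    by (rule closed_sequentially[OF cstar_subalgebraD(6)[OF A] _ y])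
      (auto intro: poly_alg_in_subalgebra[OF A c])
  have rs: "{t. complex_of_real t \<in> nonzero_spectrum A c} = rspec A c"
    by (simp add: rspec_def)
  have "fun_calc A f c = y"
    unfolding fun_calc_def rs
  proof (rule the_equality)
    show "y \<in> A \<and> (\<forall>p. (\<forall>n. poly (p n) 0 = 0) \<and> uniform_limit (rspec A c) (\<lambda>n. poly (p n)) f sequentially \<longrightarrow>
      (\<lambda>n. poly_alg (p n) c) \<longlonglongrightarrow> y)"
    proof (intro conjI yA allI impI, elim conjE)
      fix q :: "nat \<Rightarrow> real poly"
      assume q: "\<forall>n. poly (q n) 0 = 0" "uniform_limit (rspec A c) (\<lambda>n. poly (q n)) f sequentially"
      from poly_alg_diff_tendsto_0[OF _ p q(2) lim] q(1)
      have "(\<lambda>n. (poly_alg (q n) c - poly_alg (p n) c) + poly_alg (p n) c) \<longlonglongrightarrow> 0 + y"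
        by (intro tendsto_add y) auto
      then show "(\<lambda>n. poly_alg (q n) c) \<longlonglongrightarrow> y"
        by simp
    qed
    fix z
    assume "z \<in> A \<and> (\<forall>p. (\<forall>n. poly (p n) 0 = 0) \<and> uniform_limit (rspec A c) (\<lambda>n. poly (p n)) f sequentially \<longrightarrow>
      (\<lambda>n. poly_alg (p n) c) \<longlonglongrightarrow> z)"
    then have "(\<lambda>n. poly_alg (p n) c) \<longlonglongrightarrow> z"
      using p lim by blast
    then show "z = y"
      using y LIMSEQ_unique by blast
  qed
  then show "(\<lambda>n. poly_alg (p n) c) \<longlonglongrightarrow> fun_calc A f c" "fun_calc A f c \<in> A"
    using y yA by auto
qed

lemma fun_calc_in: "cont0 f \<Longrightarrow> fun_calc A f c \<in> A"
  using Weierstrass_poly[of f "norm c"] fun_calc_lim(2)[of f] uniform_limit_on_subset rspec_subset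
  by (metis norm_ge_zero order_refl)

lemma norm_fun_calc_le:
  assumes f: "cont0 f" and M: "0 \<le> M" "\<And>t. t \<in> rspec A c \<Longrightarrow> \<bar>f t\<bar> \<le> M"
  shows "norm (fun_calc A f c) \<le> M"
proof -
  obtain p :: "nat \<Rightarrow> real poly" where p: "\<And>n. poly (p n) 0 = 0"
    "uniform_limit {-norm c..norm c} (\<lambda>n. poly (p n)) f sequentially"
    using Weierstrass_poly[OF f, of "norm c"] by auto
  have lim: "uniform_limit (rspec A c) (\<lambda>n. poly (p n)) f sequentially"
    using uniform_limit_on_subset[OF p(2) rspec_subset] by simp
  have "norm (fun_calc A f c) \<le> M + e" if "0 < e" for e
  proof (rule tendsto_upperbound[OF tendsto_norm[OF fun_calc_lim(1)[OF f p(1) lim]]])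
    have "\<forall>\<^sub>F n in sequentially. \<forall>t\<in>rspec A c. dist (poly (p n) t) (f t) < e"
      using uniform_limitD[OF lim that] .
    then show "\<forall>\<^sub>F n in sequentially. norm (poly_alg (p n) c) \<le> M + e"
    proof eventually_elim
      case (elim n)
      have "\<bar>poly (p n) t\<bar> \<le> M + e" if "t \<in> rspec A c" for t
        using M(2)[OF that] elim that by (force simp: dist_real_def)
      then show ?case
        using M(1) that p(1) by (intro norm_poly_alg_le[OF A c]) auto
    qed
  qed simp
  then show ?thesis
    by (rule field_le_epsilon)
qed

lemma le_norm_fun_calc:
  assumes f: "cont0 f" and t: "t \<in> rspec A c"
  shows "\<bar>f t\<bar> \<le> norm (fun_calc A f c)"
proof -
  obtain p :: "nat \<Rightarrow> real poly" where p: "\<And>n. poly (p n) 0 = 0"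
    "uniform_limit {-norm c..norm c} (\<lambda>n. poly (p n)) f sequentially"
    using Weierstrass_poly[OF f, of "norm c"] by auto
  have lim: "uniform_limit (rspec A c) (\<lambda>n. poly (p n)) f sequentially"
    using uniform_limit_on_subset[OF p(2) rspec_subset] by simp
  have "(\<lambda>n. poly (p n) t) \<longlonglongrightarrow> f t"
    by (rule tendsto_uniform_limitI[OF lim t])
  then have "(\<lambda>n. \<bar>poly (p n) t\<bar>) \<longlonglongrightarrow> \<bar>f t\<bar>"
    by (rule tendsto_rabs)
  moreover have "(\<lambda>n. norm (poly_alg (p n) c)) \<longlonglongrightarrow> norm (fun_calc A f c)"
    by (intro tendsto_norm fun_calc_lim f p lim)
  ultimately show ?thesis
    by (rule LIMSEQ_le) (auto intro: poly_le_norm_poly_alg[OF A c p(1) t])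
qed

end

lemma cstar_subalgebra_UNIV [simp]: "cstar_subalgebra UNIV"
  by (simp add: cstar_subalgebra_def)

abbreviation fc :: "(real \<Rightarrow> real) \<Rightarrow> 'a::cstar_algebra \<Rightarrow> 'a"
  where "fc \<equiv> fun_calc UNIV"

lemma fc_lim:
  assumes "cont0 f" "star c = c" "norm c \<le> R" "\<And>n. poly (p n) 0 = 0"
    "uniform_limit {-R..R} (\<lambda>n. poly (p n)) f sequentially"
  shows "(\<lambda>n. poly_alg (p n) c) \<longlonglongrightarrow> fc f c"
  using assms
  by (intro fun_calc_lim uniform_limit_on_subset[OF assms(5)] rspec_subset) auto

text \<open>The same polynomials, approximating \<open>f\<close> on an interval that contains both
  spectra, compute both sides. From here on the functional calculus no longer refers to a
  subalgebra.\<close>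

lemma fun_calc_eq_fc:
  assumes A: "cstar_subalgebra A" "c \<in> A" "star c = c" and f: "cont0 f"
  shows "fun_calc A f c = fc f c"
proof -
  obtain p :: "nat \<Rightarrow> real poly" where p: "\<And>n. poly (p n) 0 = 0"
    "uniform_limit {-norm c..norm c} (\<lambda>n. poly (p n)) f sequentially"
    using Weierstrass_poly[OF f, of "norm c"] by auto
  have "(\<lambda>n. poly_alg (p n) c) \<longlonglongrightarrow> fc f c"
    by (rule fc_lim[OF f A(3) order_refl p])
  moreover have "(\<lambda>n. poly_alg (p n) c) \<longlonglongrightarrow> fun_calc A f c"
    using A p by (intro fun_calc_lim f uniform_limit_on_subset[OF p(2)] rspec_subset) auto
  ultimately show ?thesis
    using LIMSEQ_unique by blast
qed

text \<open>What holds for polynomials without constant term and survives limits holds for the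
  functional calculus; commutation, annihilation and unit relations with a fixed element are
  transferred in this way.\<close>

lemma fc_induct:
  assumes f: "cont0 f" "star c = c" and X: "closed X" "\<And>p. poly p 0 = 0 \<Longrightarrow> poly_alg p c \<in> X"
  shows "fc f c \<in> X"
proof -
  obtain p :: "nat \<Rightarrow> real poly" where p: "\<And>n. poly (p n) 0 = 0"
    "uniform_limit {-norm c..norm c} (\<lambda>n. poly (p n)) f sequentially"
    using Weierstrass_poly[OF f(1), of "norm c"] by auto
  show ?thesis
    by (rule closed_sequentially[OF X(1) _ fc_lim[OF f order_refl p]]) (use X p in auto)
qed

lemma fc_in_closed:
  assumes f: "cont0 f" "star c = c" and X: "closed X" "0 \<in> X" "c \<in> X"
    "\<And>x y. x \<in> X \<Longrightarrow> y \<in> X \<Longrightarrow> x + y \<in> X"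
    "\<And>r x. x \<in> X \<Longrightarrow> r *\<^sub>R x \<in> X" "\<And>x. x \<in> X \<Longrightarrow> c * x \<in> X"
  shows "fc f c \<in> X"
  by (rule fc_induct[OF f X(1)], rule poly_alg_in) (use X in auto)

lemma fc_in: "cstar_subalgebra A \<Longrightarrow> c \<in> A \<Longrightarrow> star c = c \<Longrightarrow> cont0 f \<Longrightarrow> fc f c \<in> A"
  using fun_calc_in fun_calc_eq_fc by metis

lemma closed_eqs:
  fixes w :: "'a::cstar_algebra"
  shows "closed {x. star x = (x::'a)}" "closed {x. w * x = x * w}" "closed {x. x * w = 0}"
    "closed {x. w * x = 0}" "closed {x. w * x = x}" "closed {x. x * w = x}"
  by (intro closed_Collect_eq continuous_intros)+

lemma star_fc: "star c = c \<Longrightarrow> cont0 f \<Longrightarrow> star (fc f c) = fc f c"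
  using fc_induct[of f c, OF _ _ closed_eqs(1)] by (auto simp: star_poly_alg)

context
  fixes c w :: "'a::cstar_algebra" and f :: "real \<Rightarrow> real"
  assumes c: "star c = c" and f: "cont0 f"
begin

lemma fc_commute: "w * c = c * w \<Longrightarrow> w * fc f c = fc f c * w"
  using fc_induct[OF f c closed_eqs(2)] by (auto simp: poly_alg_commute)

lemma mult_fc_eq_0: "w * c = 0 \<Longrightarrow> w * fc f c = 0"
  using fc_in_closed[OF f c closed_eqs(4)] by (auto simp: distrib_left mult.assoc[symmetric])

lemma unit_mult_fc: "w * c = c \<Longrightarrow> w * fc f c = fc f c"
  using fc_in_closed[OF f c closed_eqs(5)] by (auto simp: distrib_left mult.assoc[symmetric])

end

lemma cont0_intros [intro]:
  "cont0 f \<Longrightarrow> cont0 g \<Longrightarrow> cont0 (\<lambda>t. f t + g t)"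
  "cont0 f \<Longrightarrow> cont0 g \<Longrightarrow> cont0 (\<lambda>t. f t - g t)"
  "cont0 f \<Longrightarrow> cont0 g \<Longrightarrow> cont0 (\<lambda>t. f t * g t)"
  "cont0 f \<Longrightarrow> cont0 (\<lambda>t. r * f t)"
  "cont0 (\<lambda>t. t)" "cont0 (\<lambda>t. 0)"
  by (auto simp: cont0_def intro!: continuous_intros)

lemma bounded_cont0: "cont0 f \<Longrightarrow> bounded (f ` {-R..R})"
  by (intro compact_imp_bounded compact_continuous_image)
    (auto simp: cont0_def intro: continuous_on_subset)

context
  fixes c :: "'a::cstar_algebra" and f g :: "real \<Rightarrow> real"
  assumes c: "star c = c" and f: "cont0 f" and g: "cont0 g"
begin

lemma fc_add_mult:
  "fc (\<lambda>t. f t + g t) c = fc f c + fc g c" "fc (\<lambda>t. f t * g t) c = fc f c * fc g c"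
proof -
  let ?I = "{-norm c..norm c}"
  obtain p :: "nat \<Rightarrow> real poly" where p: "\<And>n. poly (p n) 0 = 0"
    "uniform_limit ?I (\<lambda>n. poly (p n)) f sequentially"
    using Weierstrass_poly[OF f, of "norm c"] by auto
  obtain q :: "nat \<Rightarrow> real poly" where q: "\<And>n. poly (q n) 0 = 0"
    "uniform_limit ?I (\<lambda>n. poly (q n)) g sequentially"
    using Weierstrass_poly[OF g, of "norm c"] by auto
  have pl: "(\<lambda>n. poly_alg (p n) c) \<longlonglongrightarrow> fc f c" "(\<lambda>n. poly_alg (q n) c) \<longlonglongrightarrow> fc g c"
    by (rule fc_lim[OF f c order_refl p], rule fc_lim[OF g c order_refl q])
  have "(\<lambda>n. poly_alg (p n + q n) c) \<longlonglongrightarrow> fc (\<lambda>t. f t + g t) c"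
    by (rule fc_lim[OF cont0_intros(1)[OF f g] c order_refl])
      (use p q uniform_limit_add[OF p(2) q(2)] in \<open>simp_all add: poly_add[abs_def]\<close>)
  moreover have "(\<lambda>n. poly_alg (p n + q n) c) \<longlonglongrightarrow> fc f c + fc g c"
    using p q by (simp add: poly_alg_add tendsto_add pl)
  ultimately show "fc (\<lambda>t. f t + g t) c = fc f c + fc g c"
    using LIMSEQ_unique by blast
  have "(\<lambda>n. poly_alg (p n * q n) c) \<longlonglongrightarrow> fc (\<lambda>t. f t * g t) c"
    by (rule fc_lim[OF cont0_intros(3)[OF f g] c order_refl])
      (use p q uniform_lim_mult[OF p(2) q(2) bounded_cont0[OF f] bounded_cont0[OF g]] in
        \<open>simp_all add: poly_mult[abs_def]\<close>)
  moreover have "(\<lambda>n. poly_alg (p n * q n) c) \<longlonglongrightarrow> fc f c * fc g c"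
    using p q by (simp add: poly_alg_mult tendsto_mult pl)
  ultimately show "fc (\<lambda>t. f t * g t) c = fc f c * fc g c"
    using LIMSEQ_unique by blast
qed

lemma fc_scale: "fc (\<lambda>t. r * f t) c = r *\<^sub>R fc f c"
proof -
  let ?I = "{-norm c..norm c}"
  obtain p :: "nat \<Rightarrow> real poly" where p: "\<And>n. poly (p n) 0 = 0"
    "uniform_limit ?I (\<lambda>n. poly (p n)) f sequentially"
    using Weierstrass_poly[OF f, of "norm c"] by auto
  have pl: "(\<lambda>n. poly_alg (p n) c) \<longlonglongrightarrow> fc f c"
    by (rule fc_lim[OF f c order_refl p])
  have "(\<lambda>n. poly_alg (Polynomial.smult r (p n)) c) \<longlonglongrightarrow> fc (\<lambda>t. r * f t) c"
    by (rule fc_lim[OF cont0_intros(4)[OF f] c order_refl])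
      (use p bounded_linear.uniform_limit[OF bounded_linear_mult_right p(2), of r] in
        \<open>simp_all add: poly_smult[abs_def]\<close>)
  moreover have "(\<lambda>n. poly_alg (Polynomial.smult r (p n)) c) \<longlonglongrightarrow> r *\<^sub>R fc f c"
    using p by (simp add: poly_alg_smult tendsto_scaleR pl)
  ultimately show ?thesis
    using LIMSEQ_unique by blast
qed

lemma fc_id: "fc (\<lambda>t. t) c = c"
proof -
  have "poly_alg [:0, 1:] c = c"
    by (simp add: poly_alg_pCons)
  moreover have "(\<lambda>n::nat. poly_alg [:0, 1:] c) \<longlonglongrightarrow> fc (\<lambda>t. t) c"
    by (rule fc_lim[OF cont0_intros(5) c order_refl])
      (auto intro!: uniform_limitI)
  ultimately show ?thesis
    by (simp add: LIMSEQ_const_iff)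
qed

end

lemma fc_diff:
  assumes "star c = c" "cont0 f" "cont0 g"
  shows "fc (\<lambda>t. f t - g t) c = fc f c - fc g c"
  using fc_add_mult(1)[OF assms(1,2) cont0_intros(4)[OF assms(3), of "-1"]]
    fc_scale[OF assms(1,3) assms(3), of "-1"] by simp

lemma norm_fc_le:
  assumes "star c = c" "cont0 f" "0 \<le> M" "\<And>t. t \<in> rspec UNIV c \<Longrightarrow> \<bar>f t\<bar> \<le> M"
  shows "norm (fc f c) \<le> M"
  using assms by (intro norm_fun_calc_le) auto

lemma fc_cong:
  assumes "star c = c" "cont0 f" "cont0 g" "\<And>t. t \<in> rspec UNIV c \<Longrightarrow> f t = g t"
  shows "fc f c = fc g c"
proof -
  have "norm (fc (\<lambda>t. f t - g t) c) \<le> 0"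
    by (rule norm_fc_le) (use assms in auto)
  then show ?thesis
    using assms by (simp add: fc_diff)
qed

lemma cut_down_eq_fc:
  assumes "cstar_subalgebra A" "c \<in> A" "star c = c" "0 \<le> \<epsilon>"
  shows "cut_down A c \<epsilon> = fc (\<lambda>t. max (t - \<epsilon>) 0) c"
  unfolding cut_down_def using assms
  by (intro fun_calc_eq_fc) (auto simp: cont0_def intro!: continuous_intros)

section \<open>Homomorphisms\<close>

text \<open>Homomorphisms preserve quasi-inverses and so can only shrink the nonzero spectrum. The
  bare operation classes let one lemma serve algebras, matrices over them, and the maps between the
  two.\<close>

lemma positive_in_hom:
  fixes h :: "'m::{plus,times,scaleC,star} \<Rightarrow> 'n::{plus,times,scaleC,star}"
  assumes S: "\<And>a. a \<in> S \<Longrightarrow> h a \<in> S'"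
    and add: "\<And>a b. a \<in> S \<Longrightarrow> b \<in> S \<Longrightarrow> h (a + b) = h a + h b"
    and mult: "\<And>a b. a \<in> S \<Longrightarrow> b \<in> S \<Longrightarrow> h (a * b) = h a * h b"
    and scale: "\<And>a c. a \<in> S \<Longrightarrow> c *\<^sub>C a \<in> S" "\<And>a c. a \<in> S \<Longrightarrow> h (c *\<^sub>C a) = c *\<^sub>C h a"
    and star: "\<And>a. a \<in> S \<Longrightarrow> h (star a) = star (h a)"
    and pos: "positive_in S a"
  shows "positive_in S' (h a)"
proof -
  have a: "a \<in> S" "star a = a" using pos by (auto simp: positive_in_def)
  have "quasi_invertible S' (h b)" if b: "quasi_invertible S b" "b \<in> S" for b
  proof -
    obtain d where "d \<in> S" "b + d = b * d" "b + d = d * b"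
      using b(1) unfolding quasi_invertible_def by blast
    then show ?thesis
      unfolding quasi_invertible_def using b(2) S add mult
      by (intro bexI[of _ "h d"]) metis+
  qed
  then have "quasi_invertible S' ((1 / l) *\<^sub>C h a)" if "quasi_invertible S ((1 / l) *\<^sub>C a)" for l
    using that scale[OF a(1)] by metis
  then have "nonzero_spectrum S' (h a) \<subseteq> nonzero_spectrum S a"
    unfolding nonzero_spectrum_def by blast
  moreover have "star (h a) = h a"
    using star[OF a(1)] a(2) by simp
  ultimately show ?thesis
    using pos S[OF a(1)] by (auto simp: positive_in_def)
qed

lemma star_hom_onD:
  assumes "star_hom_on A \<psi>"
  shows "a \<in> A \<Longrightarrow> b \<in> A \<Longrightarrow> \<psi> (a + b) = \<psi> a + \<psi> b" "a \<in> A \<Longrightarrow> b \<in> A \<Longrightarrow> \<psi> (a * b) = \<psi> a * \<psi> b"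
    "a \<in> A \<Longrightarrow> \<psi> (c *\<^sub>C a) = c *\<^sub>C \<psi> a" "a \<in> A \<Longrightarrow> \<psi> (star a) = star (\<psi> a)"
  using assms by (auto simp: star_hom_on_def)

context
  fixes A :: "'a::cstar_algebra set" and \<psi> :: "'a \<Rightarrow> 'b::cstar_algebra"
  assumes A: "cstar_subalgebra A" and hom: "star_hom_on A \<psi>"
begin

lemma star_hom_zero: "\<psi> 0 = 0"
  using star_hom_onD(3)[OF hom, of 0 0] cstar_subalgebraD(1)[OF A] by simp

lemma star_hom_minus: "a \<in> A \<Longrightarrow> \<psi> (- a) = - \<psi> a"
  using star_hom_onD(3)[OF hom, of a "-1"] by (simp add: scaleC_minus_left)

lemma star_hom_diff: "a \<in> A \<Longrightarrow> b \<in> A \<Longrightarrow> \<psi> (a - b) = \<psi> a - \<psi> b"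
  using star_hom_onD(1)[OF hom, of a "- b"] by (simp add: star_hom_minus cstar_subalgebraD[OF A])

lemma star_hom_scaleR: "a \<in> A \<Longrightarrow> \<psi> (r *\<^sub>R a) = r *\<^sub>R \<psi> a"
  using star_hom_onD(3)[OF hom] by (simp add: scaleR_eq_scaleC)

lemma star_hom_sum: "(\<And>i. i \<in> I \<Longrightarrow> f i \<in> A) \<Longrightarrow> \<psi> (\<Sum>i\<in>I. f i) = (\<Sum>i\<in>I. \<psi> (f i))"
  by (induction I rule: infinite_finite_induct)
    (auto simp: star_hom_zero star_hom_onD[OF hom] cstar_subalgebra_sum[OF A])

lemma star_hom_positive: "positive_in A a \<Longrightarrow> positive_in (\<psi> ` A) (\<psi> a)"
  by (rule positive_in_hom[where S = A and h = \<psi>])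
    (auto simp: star_hom_onD[OF hom] cstar_subalgebraD[OF A])

lemma star_hom_poly_alg:
  assumes c: "c \<in> A" shows "\<psi> (poly_alg p c) = poly_alg p (\<psi> c)"
proof -
  have "poly_alg p c \<in> A \<and> \<psi> (poly_alg p c) = poly_alg p (\<psi> c)"
    by (induction p)
      (auto simp: c poly_alg_pCons star_hom_zero star_hom_onD[OF hom] star_hom_scaleR cstar_subalgebraD[OF A])
  then show ?thesis by simp
qed

lemma rspec_star_hom: "c \<in> A \<Longrightarrow> rspec UNIV (\<psi> c) \<subseteq> rspec A c"
proof
  fix t assume c: "c \<in> A" and t: "t \<in> rspec UNIV (\<psi> c)"
  let ?b = "(1 / complex_of_real t) *\<^sub>C c"
  have b: "?b \<in> A" "\<psi> ?b = (1 / complex_of_real t) *\<^sub>C \<psi> c"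
    using c by (auto simp: star_hom_onD[OF hom] cstar_subalgebraD[OF A])
  have "quasi_invertible UNIV (\<psi> ?b)" if q: "quasi_invertible A ?b"
  proof -
    obtain d where "d \<in> A" "?b + d = ?b * d" "?b + d = d * ?b"
      using q unfolding quasi_invertible_def by blast
    then show ?thesis
      unfolding quasi_invertible_def using b(1) star_hom_onD(1,2)[OF hom]
      by (intro bexI[of _ "\<psi> d"] conjI) (metis UNIV_I)+
  qed
  then show "t \<in> rspec A c"
    using t b by (auto simp: rspec_def nonzero_spectrum_def)
qed

text \<open>For self-adjoint elements the norm is attained on the spectrum, which cannot grow under
  a homomorphism; the C*-identity reduces the general case to \<open>star a * a\<close>.\<close>

lemma star_hom_contractive: "a \<in> A \<Longrightarrow> norm (\<psi> a) \<le> norm a"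
proof -
  have sa: "norm (\<psi> c) \<le> norm c" if c: "c \<in> A" "star c = c" for c
  proof (cases "\<psi> c = 0")
    case False
    have "star (\<psi> c) = \<psi> c"
      using star_hom_onD(4)[OF hom c(1)] c(2) by simp
    then obtain t where "\<bar>t\<bar> = norm (\<psi> c)" "t \<in> rspec UNIV (\<psi> c)"
      using norm_in_rspec[of UNIV "\<psi> c"] False by (metis UNIV_I abs_minus_cancel abs_norm_cancel cstar_subalgebra_UNIV)
    then show ?thesis
      using rspec_star_hom[OF c(1)] rspec_bound[OF A c, of t] by auto
  qed simp
  assume a: "a \<in> A"
  have "(norm (\<psi> a))\<^sup>2 = norm (\<psi> (star a * a))"
    using a by (simp add: star_hom_onD[OF hom] cstar_subalgebraD[OF A] cstar_identity)
  also have "\<dots> \<le> norm (star a * a)"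
    using a by (intro sa) (auto simp: cstar_subalgebraD[OF A] star_mult star_star)
  finally show ?thesis
    by (simp add: cstar_identity power2_le_iff_abs_le)
qed

lemma star_hom_tendsto:
  assumes "X \<longlonglongrightarrow> a" "\<And>n. X n \<in> A" "a \<in> A"
  shows "(\<lambda>n. \<psi> (X n)) \<longlonglongrightarrow> \<psi> a"
proof -
  have "(\<lambda>n. norm (X n - a)) \<longlonglongrightarrow> 0"
    using assms(1) by (simp add: LIM_zero tendsto_norm_zero)
  then have "(\<lambda>n. \<psi> (X n) - \<psi> a) \<longlonglongrightarrow> 0"
    by (rule Lim_null_comparison[rotated])
      (use assms star_hom_contractive in \<open>auto intro!: always_eventually simp: cstar_subalgebraD[OF A] simp flip: star_hom_diff\<close>)
  then show ?thesis by (simp add: LIM_zero_iff)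
qed

lemma star_hom_fc:
  assumes c: "c \<in> A" "star c = c" and f: "cont0 f"
  shows "\<psi> (fc f c) = fc f (\<psi> c)"
proof -
  obtain p :: "nat \<Rightarrow> real poly" where p: "\<And>n. poly (p n) 0 = 0"
    "uniform_limit {-norm c..norm c} (\<lambda>n. poly (p n)) f sequentially"
    using Weierstrass_poly[OF f, of "norm c"] by auto
  have sa: "star (\<psi> c) = \<psi> c"
    using star_hom_onD(4)[OF hom c(1)] c(2) by simp
  have "(\<lambda>n. poly_alg (p n) c) \<longlonglongrightarrow> fc f c"
    by (rule fc_lim[OF f c(2) order_refl p])
  then have "(\<lambda>n. \<psi> (poly_alg (p n) c)) \<longlonglongrightarrow> \<psi> (fc f c)"
    by (rule star_hom_tendsto) (use A c f in \<open>auto intro: poly_alg_in_subalgebra fc_in\<close>)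
  moreover have "(\<lambda>n. poly_alg (p n) (\<psi> c)) \<longlonglongrightarrow> fc f (\<psi> c)"
    by (rule fc_lim[OF f sa star_hom_contractive[OF c(1)] p])
  ultimately show ?thesis
    using c LIMSEQ_unique by (auto simp: star_hom_poly_alg)
qed

end

lemma closed_idealD:
  assumes "closed_ideal A I"
  shows "I \<subseteq> A" "0 \<in> I" "a \<in> I \<Longrightarrow> b \<in> I \<Longrightarrow> a + b \<in> I" "a \<in> I \<Longrightarrow> c *\<^sub>C a \<in> I"
    "a \<in> I \<Longrightarrow> b \<in> A \<Longrightarrow> a * b \<in> I" "a \<in> I \<Longrightarrow> b \<in> A \<Longrightarrow> b * a \<in> I" "closed I"
  using assms by (simp_all add: closed_ideal_def)

context
  fixes A :: "'a::cstar_algebra set" and \<psi> :: "'a \<Rightarrow> 'b::cstar_algebra"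
  assumes A: "cstar_subalgebra A" and hom: "star_hom_on A \<psi>" and inj: "inj_on \<psi> A"
begin

text \<open>If \<^term>\<open>\<psi>\<close> decreased the norm of a self-adjoint element, the functional calculus
  with a function supported outside the smaller interval would produce a kernel element.\<close>
lemma star_hom_isometric: "a \<in> A \<Longrightarrow> norm (\<psi> a) = norm a"
proof -
  have sa: "norm c \<le> norm (\<psi> c)" if c: "c \<in> A" "star c = c" for c
  proof (rule ccontr)
    assume *: "\<not> norm c \<le> norm (\<psi> c)"
    define r where "r = norm (\<psi> c)"
    define f where "f t = max (\<bar>t\<bar> - r) 0" for t :: real
    have f: "cont0 f"
      by (auto simp: cont0_def f_def[abs_def] r_def intro!: continuous_intros)
    have sa: "star (\<psi> c) = \<psi> c"
      using star_hom_onD(4)[OF hom c(1)] c(2) by simp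
    have "norm (fc f (\<psi> c)) \<le> 0"
      by (rule norm_fc_le[OF sa f])
        (use rspec_bound[OF cstar_subalgebra_UNIV UNIV_I sa] in \<open>auto simp: f_def r_def\<close>)
    then have "\<psi> (fc f c) = \<psi> 0"
      using star_hom_fc[OF A hom c f] star_hom_zero[OF A hom] by simp
    then have 0: "fc f c = 0"
      using inj fc_in[OF A c f] cstar_subalgebraD(1)[OF A] by (auto dest: inj_onD)
    have "c \<noteq> 0" using * by auto
    then obtain t where t: "t \<in> rspec UNIV c" "\<bar>t\<bar> = norm c"
      using norm_in_rspec[OF cstar_subalgebra_UNIV UNIV_I c(2)] by (metis abs_minus_cancel abs_norm_cancel)
    have "\<bar>f t\<bar> \<le> norm (fc f c)"
      by (rule le_norm_fun_calc[OF cstar_subalgebra_UNIV UNIV_I c(2) f t(1)])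
    then show False
      using 0 t(2) * by (simp add: f_def r_def)
  qed
  assume a: "a \<in> A"
  have "(norm a)\<^sup>2 = norm (star a * a)" by (simp add: cstar_identity)
  also have "\<dots> \<le> norm (\<psi> (star a * a))"
    using a by (intro sa) (auto simp: cstar_subalgebraD[OF A] star_mult star_star)
  also have "\<dots> = (norm (\<psi> a))\<^sup>2"
    using a by (simp add: star_hom_onD[OF hom] cstar_subalgebraD[OF A] cstar_identity)
  finally show ?thesis
    using star_hom_contractive[OF A hom a] by (simp add: power2_le_iff_abs_le)
qed

text \<open>Only closedness is at stake: by isometry the preimages of a convergent sequence are
  Cauchy.\<close>

lemma cstar_subalgebra_image: "cstar_subalgebra (\<psi> ` A)"
proof -
  have "closed (\<psi> ` A)"
    unfolding closed_sequential_limits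
  proof (intro allI impI, elim conjE)
    fix Y y assume Y: "\<forall>n. Y n \<in> \<psi> ` A" and y: "Y \<longlonglongrightarrow> y"
    define X where "X n = inv_into A \<psi> (Y n)" for n
    have X: "X n \<in> A" "Y n = \<psi> (X n)" for n
      using Y by (auto simp: X_def inv_into_into f_inv_into_f)
    have "norm (Y m - Y n) = norm (X m - X n)" for m n
      using star_hom_isometric[OF cstar_subalgebraD(8)[OF A X(1) X(1)], of m n]
      by (simp only: X(2) star_hom_diff[OF A hom X(1) X(1)])
    moreover have "Cauchy Y"
      using y by (rule LIMSEQ_imp_Cauchy)
    ultimately have "Cauchy X"
      by (simp only: Cauchy_iff)
    then obtain a where a: "X \<longlonglongrightarrow> a"
      by (auto simp: Cauchy_convergent_iff convergent_def)
    then have aA: "a \<in> A"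
      by (rule closed_sequentially[OF cstar_subalgebraD(6)[OF A] X(1)])
    have "Y \<longlonglongrightarrow> \<psi> a"
      using star_hom_tendsto[OF A hom a X(1) aA] unfolding X(2)[symmetric] .
    then show "y \<in> \<psi> ` A"
      using LIMSEQ_unique[OF y] aA by (metis imageI)
  qed
  then show ?thesis
    unfolding cstar_subalgebra_def
  proof (intro conjI ballI allI)
    show "0 \<in> \<psi> ` A"
      using star_hom_zero[OF A hom] cstar_subalgebraD(1)[OF A] by (metis imageI)
  next
    fix x y c assume "x \<in> \<psi> ` A" "y \<in> \<psi> ` A"
    then obtain a b where ab: "a \<in> A" "b \<in> A" "x = \<psi> a" "y = \<psi> b" by blast
    show "x + y \<in> \<psi> ` A" "x * y \<in> \<psi> ` A" 
      using imageI[OF cstar_subalgebraD(2)[OF A ab(1,2)], of \<psi>] imageI[OF cstar_subalgebraD(3)[OF A ab(1,2)], of \<psi>]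
      by (simp_all only: ab(3,4) star_hom_onD(1,2)[OF hom ab(1,2)])
  next
    fix x c assume "x \<in> \<psi> ` A"
    then obtain a where ab: "a \<in> A" "x = \<psi> a" by blast
    show "c *\<^sub>C x \<in> \<psi> ` A" "star x \<in> \<psi> ` A" 
      using imageI[OF cstar_subalgebraD(4)[OF A ab(1)], of \<psi> c] imageI[OF cstar_subalgebraD(5)[OF A ab(1)], of \<psi>]
      by (simp_all only: ab(2) star_hom_onD(3,4)[OF hom ab(1)])
  qed
qed

lemma star_hom_inv: "star_hom_on (\<psi> ` A) (inv_into A \<psi>)"
  unfolding star_hom_on_def
proof (intro conjI ballI allI)
  note inv = inv_into_f_f[OF inj]
  fix x y c assume "x \<in> \<psi> ` A" "y \<in> \<psi> ` A"
  then obtain a b where ab: "a \<in> A" "b \<in> A" "x = \<psi> a" "y = \<psi> b" by blast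
  show "inv_into A \<psi> (x + y) = inv_into A \<psi> x + inv_into A \<psi> y"
    "inv_into A \<psi> (x * y) = inv_into A \<psi> x * inv_into A \<psi> y"
    unfolding ab(3,4) star_hom_onD(1,2)[OF hom ab(1,2), symmetric]
    by (simp_all add: inv ab(1,2) cstar_subalgebraD[OF A])
next
  note inv = inv_into_f_f[OF inj]
  fix x c assume "x \<in> \<psi> ` A"
  then obtain a where ab: "a \<in> A" "x = \<psi> a" by blast
  show "inv_into A \<psi> (c *\<^sub>C x) = c *\<^sub>C inv_into A \<psi> x" "inv_into A \<psi> (star x) = star (inv_into A \<psi> x)"
    unfolding ab(2) star_hom_onD(3,4)[OF hom ab(1), symmetric]
    by (simp_all add: inv ab(1) cstar_subalgebraD[OF A])
qed

lemma positive_in_image_iff: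
  assumes "x \<in> A" shows "positive_in (\<psi> ` A) (\<psi> x) \<longleftrightarrow> positive_in A x"
proof
  assume "positive_in (\<psi> ` A) (\<psi> x)"
  from star_hom_positive[OF cstar_subalgebra_image star_hom_inv this] show "positive_in A x"
    using inj assms by simp
qed (rule star_hom_positive[OF A hom])

lemma simple_cstar_image:
  assumes simple: "simple_cstar A" shows "simple_cstar (\<psi> ` A)"
  unfolding simple_cstar_def
proof (intro conjI allI impI cstar_subalgebra_image)
  have z: "\<psi> 0 = 0" by (rule star_hom_zero[OF A hom])
  have "A \<noteq> {0}" "0 \<in> A"
    using simple cstar_subalgebraD(1)[OF A] by (simp_all add: simple_cstar_def)
  then obtain a where a: "a \<in> A" "a \<noteq> 0"
    by blast
  then have "\<psi> a \<noteq> 0"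
    using star_hom_isometric[OF a(1)] by auto
  then show "\<psi> ` A \<noteq> {0}" using a by blast
  fix I assume I: "closed_ideal (\<psi> ` A) I"
  note I' = closed_idealD[OF I]
  define J where "J = {a\<in>A. \<psi> a \<in> I}"
  have J_iff: "x \<in> J \<longleftrightarrow> x \<in> A \<and> \<psi> x \<in> I" for x
    by (simp add: J_def)
  have "x \<in> J" if X: "\<And>n. X n \<in> J" "X \<longlonglongrightarrow> x" for X x
  proof -
    have XA: "X n \<in> A" "\<psi> (X n) \<in> I" for n
      using X(1)[of n] by (simp_all add: J_def)
    then have xA: "x \<in> A"
      using closed_sequentially[OF cstar_subalgebraD(6)[OF A] _ X(2)] by blast
    have "(\<lambda>n. \<psi> (X n)) \<longlonglongrightarrow> \<psi> x"
      by (rule star_hom_tendsto[OF A hom X(2) XA(1) xA])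
    then have "\<psi> x \<in> I"
      by (rule closed_sequentially[OF I'(7) XA(2)])
    then show "x \<in> J" using xA by (simp add: J_def)
  qed
  then have "closed J"
    unfolding closed_sequential_limits by blast
  then have "closed_ideal A J"
    unfolding closed_ideal_def
    by (intro conjI ballI allI subsetI)
      (simp_all add: J_iff z I' star_hom_onD[OF hom] cstar_subalgebraD[OF A])
  then have "J = {0} \<or> J = A"
    using simple by (auto simp: simple_cstar_def)
  moreover have "I = \<psi> ` J"
    using I'(1) unfolding J_def by blast
  ultimately show "I = {0} \<or> I = \<psi> ` A"
    using z by (elim disjE) simp_all
qed

lemma not_isomorphic_image:
  assumes "\<not> cstar_isomorphic A (UNIV :: complex set)"
  shows "\<not> cstar_isomorphic (\<psi> ` A) (UNIV :: complex set)"
proof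
  assume "cstar_isomorphic (\<psi> ` A) (UNIV :: complex set)"
  then obtain \<theta> :: "'b \<Rightarrow> complex" where \<theta>: "star_hom_on (\<psi> ` A) \<theta>" "bij_betw \<theta> (\<psi> ` A) UNIV"
    unfolding cstar_isomorphic_def by blast
  have 1: "star_hom_on A (\<lambda>a. \<theta> (\<psi> a))"
    unfolding star_hom_on_def
  proof (intro conjI ballI allI)
    fix a b assume ab: "a \<in> A" "b \<in> A"
    show "\<theta> (\<psi> (a + b)) = \<theta> (\<psi> a) + \<theta> (\<psi> b)" "\<theta> (\<psi> (a * b)) = \<theta> (\<psi> a) * \<theta> (\<psi> b)"
      using star_hom_onD(1,2)[OF hom ab] star_hom_onD(1,2)[OF \<theta>(1) imageI imageI, OF ab] by simp_all
  next
    fix a c assume a: "a \<in> A"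
    show "\<theta> (\<psi> (c *\<^sub>C a)) = c *\<^sub>C \<theta> (\<psi> a)" "\<theta> (\<psi> (star a)) = star (\<theta> (\<psi> a))"
      using star_hom_onD(3,4)[OF hom a] star_hom_onD(3,4)[OF \<theta>(1) imageI, OF a] by simp_all
  qed
  have "inj_on (\<lambda>a. \<theta> (\<psi> a)) A"
    using comp_inj_on[OF inj bij_betw_imp_inj_on[OF \<theta>(2)]] by (simp add: comp_def)
  moreover have "(\<lambda>a. \<theta> (\<psi> a)) ` A = UNIV"
    using bij_betw_imp_surj_on[OF \<theta>(2)] by (simp add: image_image)
  ultimately have "bij_betw (\<lambda>a. \<theta> (\<psi> a)) A UNIV"
    by (simp add: bij_betw_def)
  with 1 have "cstar_isomorphic A (UNIV :: complex set)"
    unfolding cstar_isomorphic_def by (intro exI conjI)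
  with assms show False by simp
qed

end

section \<open>Matrices over a C*-algebra\<close>

lemma mat_alg_iff: "X \<in> mat_alg k A \<longleftrightarrow> X \<in> carrier_mat k k \<and> (\<forall>i<k. \<forall>j<k. X $$ (i, j) \<in> A)"
  by (fastforce simp: mat_alg_def)

lemma mat_alg_simps:
  fixes X Y :: "'a::cstar_algebra mat"
  assumes "i < k" "j < k"
  shows "X \<in> carrier_mat k k \<Longrightarrow> Y \<in> carrier_mat k k \<Longrightarrow> (X + Y) $$ (i, j) = X $$ (i, j) + Y $$ (i, j)"
    "X \<in> carrier_mat k k \<Longrightarrow> Y \<in> carrier_mat k k \<Longrightarrow> (X * Y) $$ (i, j) = (\<Sum>l<k. X $$ (i, l) * Y $$ (l, j))"
    "X \<in> carrier_mat k k \<Longrightarrow> (c *\<^sub>C X) $$ (i, j) = c *\<^sub>C (X $$ (i, j))"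
    "X \<in> carrier_mat k k \<Longrightarrow> star X $$ (i, j) = star (X $$ (j, i))"
  using assms by (auto simp: scaleC_mat_def star_mat_def scalar_prod_def atLeast0LessThan)

lemma mat_alg_carrier:
  "X \<in> carrier_mat k k \<Longrightarrow> Y \<in> carrier_mat k k \<Longrightarrow> X + Y \<in> carrier_mat k k"
  "X \<in> carrier_mat k k \<Longrightarrow> Y \<in> carrier_mat k k \<Longrightarrow> X * Y \<in> carrier_mat k k"
  "X \<in> carrier_mat k k \<Longrightarrow> c *\<^sub>C X \<in> carrier_mat k k"
  "X \<in> carrier_mat k k \<Longrightarrow> star X \<in> carrier_mat k k"
  by (auto simp: scaleC_mat_def star_mat_def)

lemma mat_eqI_carrier:
  "X \<in> carrier_mat k k \<Longrightarrow> Y \<in> carrier_mat k k \<Longrightarrow> (\<And>i j. i < k \<Longrightarrow> j < k \<Longrightarrow> X $$ (i, j) = Y $$ (i, j)) \<Longrightarrow> X = Y"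
  by (intro eq_matI) auto

lemma positive_in_mat_hom:
  fixes A :: "'a::cstar_algebra set" and \<psi> :: "'a \<Rightarrow> 'b::cstar_algebra"
  assumes A: "cstar_subalgebra A" and hom: "star_hom_on A \<psi>" and X: "positive_in (mat_alg k A) X"
  shows "positive_in (mat_alg k (\<psi> ` A)) (map_mat \<psi> X)"
proof (rule positive_in_hom[where S = "mat_alg k A" and h = "map_mat \<psi>", OF _ _ _ _ _ _ X])
  fix X Y :: "'a mat" and c
  assume X: "X \<in> mat_alg k A"
  then have Xc: "X \<in> carrier_mat k k" and XA: "\<And>i j. i < k \<Longrightarrow> j < k \<Longrightarrow> X $$ (i, j) \<in> A"
    by (auto simp: mat_alg_iff)
  show "map_mat \<psi> X \<in> mat_alg k (\<psi> ` A)" "c *\<^sub>C X \<in> mat_alg k A"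
    using Xc XA by (auto simp: mat_alg_iff scaleC_mat_def cstar_subalgebraD[OF A])
  show "map_mat \<psi> (c *\<^sub>C X) = c *\<^sub>C map_mat \<psi> X" "map_mat \<psi> (star X) = star (map_mat \<psi> X)"
    using Xc XA by (auto simp: scaleC_mat_def star_mat_def star_hom_onD[OF hom] intro!: eq_matI)
  assume "Y \<in> mat_alg k A"
  then have Yc: "Y \<in> carrier_mat k k" and YA: "\<And>i j. i < k \<Longrightarrow> j < k \<Longrightarrow> Y $$ (i, j) \<in> A"
    by (auto simp: mat_alg_iff)
  show "map_mat \<psi> (X + Y) = map_mat \<psi> X + map_mat \<psi> Y"
    using Xc XA Yc YA by (auto simp: star_hom_onD[OF hom] intro!: eq_matI)
  show "map_mat \<psi> (X * Y) = map_mat \<psi> X * map_mat \<psi> Y"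
  proof (rule mat_eqI_carrier[of _ k])
    fix i j assume ij: "i < k" "j < k"
    have "map_mat \<psi> (X * Y) $$ (i, j) = \<psi> (\<Sum>l<k. X $$ (i, l) * Y $$ (l, j))"
      using Xc Yc ij by (simp add: mat_alg_simps(2)[OF ij Xc Yc, symmetric])
    also have "\<dots> = (\<Sum>l<k. \<psi> (X $$ (i, l)) * \<psi> (Y $$ (l, j)))"
      using XA YA ij by (subst star_hom_sum[OF A hom]) (auto simp: star_hom_onD[OF hom] cstar_subalgebraD[OF A])
    also have "\<dots> = (map_mat \<psi> X * map_mat \<psi> Y) $$ (i, j)"
      using Xc Yc ij by (subst mat_alg_simps(2)[of _ k _]) auto
    finally show "map_mat \<psi> (X * Y) $$ (i, j) = (map_mat \<psi> X * map_mat \<psi> Y) $$ (i, j)" .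
  qed (use Xc Yc in auto)
qed

text \<open>For \<open>l\<close> other than 0 and 1 the quasi-inverse of \<open>P / l\<close> is
  \<open>P / (1 - l)\<close>, because \<open>1 / l + 1 / (1 - l)\<close> equals the product of the
  two summands. So the nonzero spectrum is contained in \<open>{1}\<close>.\<close>

lemma positive_in_projection:
  assumes P: "P \<in> carrier_mat n n" "P * P = P" "star P = P"
  shows "positive_in (cmat_alg n) P"
proof -
  have mem: "X \<in> cmat_alg n \<longleftrightarrow> X \<in> carrier_mat n n" for X
    by (simp add: mat_alg_iff)
  have "quasi_invertible (cmat_alg n) ((1 / l) *\<^sub>C P)" if l: "l \<noteq> 0" "l \<noteq> 1" for l
  proof -
    have s: "1 / l + 1 / (1 - l) = 1 / l * (1 / (1 - l))"
      using l by (simp add: field_simps)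
    have mult: "(c *\<^sub>C P) * (d *\<^sub>C P) = (c * d) *\<^sub>C P" for c d
    proof -
      have "(c *\<^sub>C P) * (d *\<^sub>C P) = (c * d) *\<^sub>C (P * P)"
      proof (rule mat_eqI_carrier[of _ n])
        fix i j assume ij: "i < n" "j < n"
        show "((c *\<^sub>C P) * (d *\<^sub>C P)) $$ (i, j) = ((c * d) *\<^sub>C (P * P)) $$ (i, j)"
          using P(1) ij by (simp add: mat_alg_simps[of _ n _] mat_alg_carrier scaleC_complex_def
            sum_distrib_left mult.assoc mult.left_commute del: index_mult_mat)
      qed (use P(1) in \<open>simp_all add: mat_alg_carrier\<close>)
      then show ?thesis using P(2) by simp
    qed
    have add: "(c *\<^sub>C P) + (d *\<^sub>C P) = (c + d) *\<^sub>C P" for c d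
      by (rule mat_eqI_carrier[of _ n])
        (use P(1) in \<open>auto simp: mat_alg_carrier mat_alg_simps[of _ n _] scaleC_add_left\<close>)
    show ?thesis
      unfolding quasi_invertible_def using P(1) s
      by (intro bexI[of _ "(1 / (1 - l)) *\<^sub>C P"])
        (auto simp: add mult mem mat_alg_carrier mult.commute)
  qed
  then have "nonzero_spectrum (cmat_alg n) P \<subseteq> {1}"
    by (auto simp: nonzero_spectrum_def)
  also have "\<dots> \<subseteq> {complex_of_real t | t. 0 \<le> t}"
    by (auto intro: exI[of _ 1])
  finally show ?thesis
    using P by (simp add: positive_in_def mem)
qed

lemma positive_one_mat: "positive_in (cmat_alg n) (1\<^sub>m n)"
  by (rule positive_in_projection)
    (auto simp: star_mat_def star_complex_def intro!: eq_matI)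

lemma completely_positive_positive:
  assumes A: "cstar_subalgebra A" and cp: "completely_positive n A \<phi>" and X: "positive_in (cmat_alg n) X"
  shows "positive_in A (\<phi> X)"
proof -
  have Xc: "X \<in> carrier_mat n n"
    using X by (simp add: positive_in_def mat_alg_iff)
  have "positive_in (mat_alg 1 A) (amplification 1 n \<phi> X)"
    using cp[unfolded completely_positive_def, rule_format, of 1 X] X by simp
  then have "positive_in A (amplification 1 n \<phi> X $$ (0, 0))"
    by (intro positive_in_hom[where S = "mat_alg 1 A" and h = "\<lambda>M. M $$ (0, 0)"])
      (simp_all add: mat_alg_iff mat_alg_simps[of _ 1 _] mat_alg_carrier cstar_subalgebraD[OF A])
  also have "amplification 1 n \<phi> X $$ (0, 0) = \<phi> (mat n n (\<lambda>(p, q). X $$ (p, q)))"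
    by (simp add: amplification_def)
  also have "mat n n (\<lambda>(p, q). X $$ (p, q)) = X"
    using Xc by (intro eq_matI) auto
  finally show ?thesis .
qed

lemma cpc_order_zeroD:
  assumes "cpc_order_zero n A \<phi>"
  shows "X \<in> carrier_mat n n \<Longrightarrow> \<phi> X \<in> A"
    "X \<in> carrier_mat n n \<Longrightarrow> Y \<in> carrier_mat n n \<Longrightarrow> \<phi> (X + Y) = \<phi> X + \<phi> Y"
    "X \<in> carrier_mat n n \<Longrightarrow> \<phi> (c *\<^sub>C X) = c *\<^sub>C \<phi> X"
    "completely_positive n A \<phi>"
    "X \<in> carrier_mat n n \<Longrightarrow> norm (\<phi> X) \<le> mat_opnorm X"
    "positive_in (cmat_alg n) X \<Longrightarrow> positive_in (cmat_alg n) Y \<Longrightarrow> X * Y = 0\<^sub>m n n \<Longrightarrow> \<phi> X * \<phi> Y = 0"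
  using assms by (simp_all add: cpc_order_zero_def linear_on_mat_def)

lemma tracially_Z_absorbingD:
  assumes "tracially_Z_absorbing A"
  shows "simple_cstar A" "\<not> cstar_isomorphic A (UNIV :: complex set)"
    "positive_in A x \<Longrightarrow> positive_in A a \<Longrightarrow> a \<noteq> 0 \<Longrightarrow> finite F \<Longrightarrow> F \<subseteq> A \<Longrightarrow> 0 < \<epsilon> \<Longrightarrow> 1 \<le> n \<Longrightarrow>
      \<exists>\<phi>. cpc_order_zero n A \<phi> \<and>
        cuntz_below A (cut_down A (x * x - x * \<phi> (1\<^sub>m n) * x) \<epsilon>) a \<and>
        (\<forall>z\<in>carrier_mat n n. mat_opnorm z \<le> 1 \<longrightarrow> (\<forall>b\<in>F. norm (\<phi> z * b - b * \<phi> z) < \<epsilon>))"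
proof -
  note Z = assms[unfolded tracially_Z_absorbing_def]
  show "simple_cstar A" "\<not> cstar_isomorphic A (UNIV :: complex set)"
    using Z by blast+
  assume "positive_in A x" "positive_in A a" "a \<noteq> 0" "finite F" "F \<subseteq> A" "0 < \<epsilon>" "1 \<le> n"
  then show "\<exists>\<phi>. cpc_order_zero n A \<phi> \<and>
        cuntz_below A (cut_down A (x * x - x * \<phi> (1\<^sub>m n) * x) \<epsilon>) a \<and>
        (\<forall>z\<in>carrier_mat n n. mat_opnorm z \<le> 1 \<longrightarrow> (\<forall>b\<in>F. norm (\<phi> z * b - b * \<phi> z) < \<epsilon>))"
    by (intro Z[THEN conjunct2, THEN conjunct2, rule_format] conjI)
qed

section \<open>Transport of tracial Z-absorption\<close>

context
  fixes A :: "'a::cstar_algebra set" and \<psi> :: "'a \<Rightarrow> 'b::cstar_algebra"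
  assumes A: "cstar_subalgebra A" and hom: "star_hom_on A \<psi>" and inj: "inj_on \<psi> A"
begin

lemma cpc_order_zero_comp:
  assumes \<phi>: "cpc_order_zero n A \<phi>"
  shows "cpc_order_zero n (\<psi> ` A) (\<lambda>z. \<psi> (\<phi> z))"
  unfolding cpc_order_zero_def
proof (intro conjI)
  note \<phi>D = cpc_order_zeroD[OF \<phi>]
  show "linear_on_mat n (\<psi> ` A) (\<lambda>z. \<psi> (\<phi> z))"
    unfolding linear_on_mat_def by (simp add: \<phi>D star_hom_onD[OF hom])
  show "completely_positive n (\<psi> ` A) (\<lambda>z. \<psi> (\<phi> z))"
    unfolding completely_positive_def
  proof (intro allI impI)
    fix k X assume "1 \<le> k" "positive_in (cmat_alg (k * n)) X"
    then have "positive_in (mat_alg k A) (amplification k n \<phi> X)"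
      using \<phi>D(4) by (simp add: completely_positive_def)
    from positive_in_mat_hom[OF A hom this]
    have "positive_in (mat_alg k (\<psi> ` A)) (map_mat \<psi> (amplification k n \<phi> X))" .
    also have "map_mat \<psi> (amplification k n \<phi> X) = amplification k n (\<lambda>z. \<psi> (\<phi> z)) X"
      by (auto simp: amplification_def intro!: eq_matI)
    finally show "positive_in (mat_alg k (\<psi> ` A)) (amplification k n (\<lambda>z. \<psi> (\<phi> z)) X)" .
  qed
  show "\<forall>X\<in>carrier_mat n n. norm (\<psi> (\<phi> X)) \<le> mat_opnorm X"
    by (intro ballI order_trans[OF star_hom_contractive[OF A hom] \<phi>D(5)] \<phi>D(1))
  show "\<forall>Y Z. positive_in (cmat_alg n) Y \<and> positive_in (cmat_alg n) Z \<and> Y * Z = 0\<^sub>m n n \<longrightarrow> \<psi> (\<phi> Y) * \<psi> (\<phi> Z) = 0"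
  proof (intro allI impI, elim conjE)
    fix Y Z assume YZ: "positive_in (cmat_alg n) Y" "positive_in (cmat_alg n) Z" "Y * Z = 0\<^sub>m n n"
    then have "\<phi> Y * \<phi> Z = 0" "\<phi> Y \<in> A" "\<phi> Z \<in> A"
      by (simp_all add: \<phi>D positive_in_def mat_alg_iff)
    then show "\<psi> (\<phi> Y) * \<psi> (\<phi> Z) = 0"
      using star_hom_onD(2)[OF hom, of "\<phi> Y" "\<phi> Z"] star_hom_zero[OF A hom] by simp
  qed
qed

lemma cuntz_below_image:
  assumes "cuntz_below A a b" "a \<in> A" "b \<in> A"
  shows "cuntz_below (\<psi> ` A) (\<psi> a) (\<psi> b)"
proof -
  obtain v where v: "\<And>n. v n \<in> A" "(\<lambda>n. norm (a - v n * b * star (v n))) \<longlonglongrightarrow> 0"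
    using assms by (auto simp: cuntz_below_def)
  have mem: "a - v n * b * star (v n) \<in> A" "v n * b * star (v n) \<in> A" "v n * b \<in> A" "star (v n) \<in> A" for n
    using v assms by (auto simp: cstar_subalgebraD[OF A])
  have "\<psi> a - \<psi> (v n) * \<psi> b * star (\<psi> (v n)) = \<psi> (a - v n * b * star (v n))" for n
    using mem v assms by (simp add: star_hom_diff[OF A hom] star_hom_onD[OF hom])
  then have "norm (\<psi> a - \<psi> (v n) * \<psi> b * star (\<psi> (v n))) = norm (a - v n * b * star (v n))" for n
    using star_hom_isometric[OF A hom inj mem(1)] by simp
  then show ?thesis
    unfolding cuntz_below_def using v by (intro exI[of _ "\<lambda>n. \<psi> (v n)"]) auto
qed

text \<open>Allows the abstract algebras to be replaced by concrete operator algebras, where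
  positivity can be tested on vectors.\<close>

lemma tracially_Z_absorbing_image:
  assumes Z: "tracially_Z_absorbing A"
  shows "tracially_Z_absorbing (\<psi> ` A)"
  unfolding tracially_Z_absorbing_def
proof (intro conjI allI impI, goal_cases)
  case 1
  show ?case
    by (rule simple_cstar_image[OF A hom inj tracially_Z_absorbingD(1)[OF Z]])
next
  case 2
  show ?case
    by (rule not_isomorphic_image[OF A hom inj tracially_Z_absorbingD(2)[OF Z]])
next
  case (3 x' a' F' \<epsilon> n)
  then have 3: "positive_in (\<psi> ` A) x'" "positive_in (\<psi> ` A) a'" "a' \<noteq> 0" "finite F'" "F' \<subseteq> \<psi> ` A"
    "0 < \<epsilon>" "1 \<le> n"
    by simp_all
  have "x' \<in> \<psi> ` A" "a' \<in> \<psi> ` A"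
    using 3(1,2) by (simp_all add: positive_in_def)
  then obtain x a where xa: "x' = \<psi> x" "a' = \<psi> a" "x \<in> A" "a \<in> A"
    by blast
  obtain F where F: "F \<subseteq> A" "finite F" "F' = \<psi> ` F"
    using finite_subset_image[OF 3(4,5)] by blast
  have pos: "positive_in A x" "positive_in A a" "a \<noteq> 0"
    using 3(1-3) positive_in_image_iff[OF A hom inj] star_hom_zero[OF A hom] by (auto simp: xa)
  obtain \<phi> where \<phi>: "cpc_order_zero n A \<phi>"
    "cuntz_below A (cut_down A (x * x - x * \<phi> (1\<^sub>m n) * x) \<epsilon>) a"
    "\<And>z b. z \<in> carrier_mat n n \<Longrightarrow> mat_opnorm z \<le> 1 \<Longrightarrow> b \<in> F \<Longrightarrow> norm (\<phi> z * b - b * \<phi> z) < \<epsilon>"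
    using tracially_Z_absorbingD(3)[OF Z pos F(2,1) 3(6,7)] by blast
  note \<phi>A = cpc_order_zeroD(1)[OF \<phi>(1)]
  have \<phi>1: "\<phi> (1\<^sub>m n) \<in> A" "star (\<phi> (1\<^sub>m n)) = \<phi> (1\<^sub>m n)"
    using completely_positive_positive[OF A cpc_order_zeroD(4)[OF \<phi>(1)] positive_one_mat]
    by (simp_all add: positive_in_def)
  define c where "c = x * x - x * \<phi> (1\<^sub>m n) * x"
  have xsa: "star x = x"
    using pos(1) by (simp add: positive_in_def)
  have c: "c \<in> A" "star c = c"
    using \<phi>1 xa xsa by (simp_all add: c_def cstar_subalgebraD[OF A] star_diff star_mult mult.assoc)
  have \<psi>c: "\<psi> c = x' * x' - x' * \<psi> (\<phi> (1\<^sub>m n)) * x'"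
    using \<phi>1 xa by (simp add: c_def cstar_subalgebraD[OF A] star_hom_diff[OF A hom] star_hom_onD[OF hom])
  have \<psi>c_sa: "star (\<psi> c) = \<psi> c"
    using star_hom_onD(4)[OF hom c(1)] c(2) by simp
  have cont: "cont0 (\<lambda>t. max (t - \<epsilon>) 0)"
    using 3(6) by (auto simp: cont0_def intro!: continuous_intros)
  have cut: "\<psi> (cut_down A c \<epsilon>) = cut_down (\<psi> ` A) (\<psi> c) \<epsilon>" "cut_down A c \<epsilon> \<in> A"
    using 3(6) cut_down_eq_fc[OF A c, of \<epsilon>] cut_down_eq_fc[OF cstar_subalgebra_image[OF A hom inj] imageI[OF c(1)] \<psi>c_sa, of \<epsilon>]
      star_hom_fc[OF A hom c cont] fc_in[OF A c cont] by simp_all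
  show ?case
  proof (intro exI[of _ "\<lambda>z. \<psi> (\<phi> z)"] conjI ballI impI)
    show "cpc_order_zero n (\<psi> ` A) (\<lambda>z. \<psi> (\<phi> z))"
      by (rule cpc_order_zero_comp[OF \<phi>(1)])
    show "cuntz_below (\<psi> ` A) (cut_down (\<psi> ` A) (x' * x' - x' * \<psi> (\<phi> (1\<^sub>m n)) * x') \<epsilon>) a'"
      using cuntz_below_image[OF \<phi>(2)[folded c_def] cut(2) xa(4)] by (simp add: \<psi>c[symmetric] cut(1) xa(2))
    fix z b' assume z: "z \<in> carrier_mat n n" "mat_opnorm z \<le> 1" and "b' \<in> F'"
    then obtain b where b: "b \<in> F" "b \<in> A" "b' = \<psi> b" using F by blast
    have "\<psi> (\<phi> z) * b' - b' * \<psi> (\<phi> z) = \<psi> (\<phi> z * b - b * \<phi> z)"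
      using b \<phi>A[OF z(1)] by (simp add: cstar_subalgebraD[OF A] star_hom_diff[OF A hom] star_hom_onD[OF hom])
    then have "norm (\<psi> (\<phi> z) * b' - b' * \<psi> (\<phi> z)) \<le> norm (\<phi> z * b - b * \<phi> z)"
      using b \<phi>A[OF z(1)] star_hom_contractive[OF A hom] by (simp add: cstar_subalgebraD[OF A])
    then show "norm (\<psi> (\<phi> z) * b' - b' * \<psi> (\<phi> z)) < \<epsilon>"
      using \<phi>(3)[OF z b(1)] by simp
  qed
qed

end

section \<open>Positive operators\<close>

instantiation l2op :: (type) real_normed_algebra_1
begin

definition one_l2op :: "'a l2op"
  where "one_l2op = Abs_l2op (Blinfun (\<lambda>v. v))"

lemma l2op_apply_one [simp]: "l2op_apply 1 v = v"
  unfolding one_l2op_def by (rule l2op_apply_Abs_l2op) (auto simp: bounded_linear_ident)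

instance
proof
  fix T :: "'a l2op"
  show "1 * T = T" "T * 1 = T"
    by (rule l2op_eqI; simp add: l2op_apply_times)+
  \<comment> \<open>A type is never empty, so there is a basis vector, and it separates 1 from
    0.\<close>
  have "norm (ket undefined :: 'a ell2) \<noteq> 0"
    by (metis ell2_apply_ket norm_eq_zero zero_ell2.rep_eq zero_neq_one)
  then have *: "l2op_apply (1 :: 'a l2op) (ket undefined) \<noteq> 0"
    by simp
  have "l2op_apply (0 :: 'a l2op) (ket undefined) = 0"
    using norm_l2op_apply[of 0 "ket undefined :: 'a ell2"] by simp
  then show "(0 :: 'a l2op) \<noteq> 1"
    using * by metis
  show "norm (1 :: 'a l2op) = 1"
  proof (rule antisym)
    show "norm (1 :: 'a l2op) \<le> 1"
      by (rule norm_l2op_leI) simp_all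
    have "norm (ket undefined :: 'a ell2) \<le> norm (1 :: 'a l2op) * norm (ket undefined :: 'a ell2)"
      using norm_l2op_apply[of 1 "ket undefined :: 'a ell2"] by simp
    then show "1 \<le> norm (1 :: 'a l2op)"
      using \<open>norm (ket undefined :: 'a ell2) \<noteq> 0\<close> by (simp add: mult_le_cancel_right1)
  qed
qed

end

lemma l2op_apply_ops:
  "l2op_apply (S + T) v = l2op_apply S v + l2op_apply T v"
  "l2op_apply (S - T) v = l2op_apply S v - l2op_apply T v"
  "l2op_apply (- T) v = - l2op_apply T v"
  "l2op_apply 0 v = 0"
  "l2op_apply (r *\<^sub>R T) v = r *\<^sub>R l2op_apply T v"
  "l2op_apply (S * T) v = l2op_apply S (l2op_apply T v)"
proof -
  show *: "l2op_apply (S + T) v = l2op_apply S v + l2op_apply T v" "l2op_apply (S * T) v = l2op_apply S (l2op_apply T v)"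
    "l2op_apply (r *\<^sub>R T) v = r *\<^sub>R l2op_apply T v" for S T :: "'a l2op" and r
    by (rule l2op_apply_plus l2op_apply_times l2op_apply_scaleR)+
  show m: "l2op_apply (- T) v = - l2op_apply T v" for T
    using *(3)[of "-1" T] by simp
  show "l2op_apply (S - T) v = l2op_apply S v - l2op_apply T v"
    using *(1)[of S "- T"] by (simp add: m)
  show "l2op_apply 0 v = 0"
    using *(3)[of 0 0] by simp
qed

definition qf :: "'x l2op \<Rightarrow> 'x ell2 \<Rightarrow> real"
  where "qf T v = Re (cinner v (l2op_apply T v))"

lemma qf_ops:
  "qf (S + T) v = qf S v + qf T v" "qf (S - T) v = qf S v - qf T v" "qf (- T) v = - qf T v"
  "qf (r *\<^sub>R T) v = r * qf T v" "qf 0 v = 0" "qf 1 v = (norm v)\<^sup>2"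
proof -
  show *: "qf (S + T) v = qf S v + qf T v" "qf (r *\<^sub>R T) v = r * qf T v" for S T :: "'a l2op" and r
    by (simp_all add: qf_def l2op_apply_ops cinner_add_right ell2_scaleR_scaleC cinner_scaleC_right)
  show m: "qf (- T) v = - qf T v" for T
    using *(2)[of "-1" T] by simp
  show "qf (S - T) v = qf S v - qf T v"
    using *(1)[of S "- T"] by (simp add: m)
  show "qf 0 v = 0" "qf 1 v = (norm v)\<^sup>2"
    using *(2)[of 0 0] by (simp_all add: qf_def cinner_self_norm)
qed

lemma qf_conj: "qf (star W * P * W) v = qf P (l2op_apply W v)"
  by (simp add: qf_def l2op_apply_ops cinner_star)

lemma qf_star_mult: "qf (star W * W) v = (norm (l2op_apply W v))\<^sup>2"
  using qf_conj[of W 1 v] by (simp add: qf_ops)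

lemma abs_qf_le: "\<bar>qf T v\<bar> \<le> norm T * (norm v)\<^sup>2"
proof -
  have "\<bar>qf T v\<bar> \<le> cmod (cinner v (l2op_apply T v))"
    unfolding qf_def by (rule abs_Re_le_cmod)
  also have "\<dots> \<le> norm v * norm (l2op_apply T v)"
    by (rule cinner_bound)
  also have "\<dots> \<le> norm v * (norm T * norm v)"
    by (intro mult_left_mono norm_l2op_apply) simp
  finally show ?thesis by (simp add: power2_eq_square algebra_simps)
qed

text \<open>Self-adjointness has to be demanded separately because \<open>qf\<close> keeps only the
  real part of the form.\<close>

definition pos_op :: "'x l2op \<Rightarrow> bool"
  where "pos_op T \<longleftrightarrow> star T = T \<and> (\<forall>v. 0 \<le> qf T v)"

lemma pos_opD: "pos_op T \<Longrightarrow> star T = T" "pos_op T \<Longrightarrow> 0 \<le> qf T v"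
  by (auto simp: pos_op_def)

lemma pos_op_intros:
  "pos_op 0" "pos_op S \<Longrightarrow> pos_op T \<Longrightarrow> pos_op (S + T)" "0 \<le> r \<Longrightarrow> pos_op T \<Longrightarrow> pos_op (r *\<^sub>R T)"
  "pos_op 1"
  by (auto simp: pos_op_def star_add star_scaleR qf_ops)

lemma pos_op_conj: "pos_op P \<Longrightarrow> pos_op (star W * P * W)"
  unfolding pos_op_def qf_conj by (simp add: star_mult star_star mult.assoc)

lemma pos_op_conj': "pos_op P \<Longrightarrow> pos_op (W * P * star W)"
  using pos_op_conj[of P "star W"] by (simp add: star_star)

lemma pos_op_star_mult: "pos_op (star W * W)" "pos_op (W * star W)"
  using pos_op_conj[OF pos_op_intros(4), of W] pos_op_conj'[OF pos_op_intros(4), of W] by simp_all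

lemma pos_op_sum: "(\<And>i. i \<in> I \<Longrightarrow> pos_op (T i)) \<Longrightarrow> pos_op (\<Sum>i\<in>I. T i)"
  by (induction I rule: infinite_finite_induct) (auto simp: pos_op_intros)

lemma pos_op_add_norm:
  assumes "star T = T" "norm T \<le> r" shows "pos_op (T + r *\<^sub>R 1)"
proof -
  have "- (r * (norm v)\<^sup>2) \<le> qf T v" for v
    using abs_qf_le[of T v] mult_right_mono[OF assms(2), of "(norm v)\<^sup>2"] by (simp add: abs_le_iff)
  then show ?thesis
    using assms by (auto simp: pos_op_def star_add star_scaleR qf_ops) (smt (verit))
qed

lemma cont0_sqrt_max [intro]: "cont0 (\<lambda>t. sqrt (max t 0))"
  by (auto simp: cont0_def intro!: continuous_intros)

lemma rspec_mono: "cstar_subalgebra S \<Longrightarrow> T \<in> S \<Longrightarrow> rspec UNIV T \<subseteq> rspec S T"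
  using rspec_star_hom[of S "\<lambda>x. x" T] by (simp add: star_hom_on_def)

text \<open>With \<open>m(t) = max (-t) 0 powr (3/2)\<close>, the form of \<open>T\<close> conjugated by its negative part
  is \<open>- m(T)\<^sup>2\<close>, so positivity of the form forces \<open>m(T) = 0\<close>.\<close>
lemma pos_op_rspec:
  assumes S: "cstar_subalgebra S" "T \<in> S" and T: "pos_op T" and t: "t \<in> rspec S T"
  shows "0 \<le> t"
proof -
  note sa = pos_opD(1)[OF T]
  define f where "f s = max (- s) 0" for s :: real
  define m where "m s = f s * sqrt (f s)" for s
  have f: "cont0 f" and m: "cont0 m"
    by (auto simp: cont0_def f_def[abs_def] m_def[abs_def] intro!: continuous_intros)
  have "fc f T * T * fc f T = fc (\<lambda>s. f s * s * f s) T"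
    using f sa by (simp add: fc_add_mult(2) cont0_intros fc_id)
  also have "(\<lambda>s. f s * s * f s) = (\<lambda>s. -1 * (m s * m s))"
  proof
    fix s :: real
    have "m s * m s = f s * f s * f s" by (simp add: m_def f_def)
    then show "f s * s * f s = -1 * (m s * m s)" by (simp add: f_def max_def)
  qed
  also have "fc \<dots> T = (-1) *\<^sub>R (fc m T * fc m T)"
    by (simp only: fc_scale[OF sa cont0_intros(3)[OF m m] m] fc_add_mult(2)[OF sa m m])
  finally have eq: "fc f T * T * fc f T = (-1) *\<^sub>R (fc m T * fc m T)" .
  have "l2op_apply (fc m T) v = 0" for v
  proof -
    have "0 \<le> qf (fc f T * T * fc f T) v"
      using pos_opD(2)[OF pos_op_conj[OF T, of "fc f T"]] star_fc[OF sa f] by simp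
    also have "\<dots> = - qf (star (fc m T) * fc m T) v"
      unfolding eq star_fc[OF sa m] by (simp add: qf_ops)
    finally show ?thesis
      unfolding qf_star_mult by simp
  qed
  then have "fc m T = 0"
    by (intro l2op_eqI) (simp add: l2op_apply_ops)
  moreover have "\<bar>m t\<bar> \<le> norm (fun_calc S m T)"
    by (rule le_norm_fun_calc[OF S sa m t])
  ultimately have "m t = 0"
    using fun_calc_eq_fc[OF S sa m] by simp
  then show ?thesis by (simp add: m_def f_def max_def split: if_splits)
qed

definition sqrt_op :: "'x l2op \<Rightarrow> 'x l2op"
  where "sqrt_op T = fc (\<lambda>t. sqrt (max t 0)) T"

lemma sqrt_op_rspec:
  assumes sa: "star T = T" and "\<And>t. t \<in> rspec UNIV T \<Longrightarrow> 0 \<le> t"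
  shows "sqrt_op T * sqrt_op T = T" "star (sqrt_op T) = sqrt_op T"
proof -
  have "sqrt_op T * sqrt_op T = fc (\<lambda>t. sqrt (max t 0) * sqrt (max t 0)) T"
    unfolding sqrt_op_def by (rule fc_add_mult(2)[symmetric]) (use sa in auto)
  also have "\<dots> = fc (\<lambda>t. t) T"
  proof (rule fc_cong[OF sa])
    show "cont0 (\<lambda>t. sqrt (max t 0) * sqrt (max t 0))" "cont0 (\<lambda>t. t)"
      by (intro cont0_intros cont0_sqrt_max)+
    show "sqrt (max t 0) * sqrt (max t 0) = t" if "t \<in> rspec UNIV T" for t
      using assms(2)[OF that] by simp
  qed
  finally show "sqrt_op T * sqrt_op T = T"
    using sa by (simp add: fc_id[OF sa cont0_intros(5) cont0_intros(5)])
  show "star (sqrt_op T) = sqrt_op T"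
    unfolding sqrt_op_def by (rule star_fc) (use sa in auto)
qed

lemma sqrt_op:
  assumes "pos_op T"
  shows "sqrt_op T * sqrt_op T = T" "star (sqrt_op T) = sqrt_op T"
  using sqrt_op_rspec[of T] pos_op_rspec[OF cstar_subalgebra_UNIV UNIV_I assms] pos_opD(1)[OF assms]
  by blast+

lemma sqrt_op_in: "cstar_subalgebra S \<Longrightarrow> T \<in> S \<Longrightarrow> pos_op T \<Longrightarrow> sqrt_op T \<in> S"
  unfolding sqrt_op_def by (rule fc_in) (auto dest: pos_opD)

text \<open>A nonnegative spectrum provides a self-adjoint square root, whose square has a
  nonnegative form; the converse is \<open>pos_op_rspec\<close>. As a consequence positivity does
  not depend on the ambient subalgebra.\<close>

lemma positive_in_iff_pos_op:
  assumes S: "cstar_subalgebra S"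
  shows "positive_in S T \<longleftrightarrow> T \<in> S \<and> pos_op T"
proof
  assume T: "positive_in S T"
  then have 1: "T \<in> S" "star T = T" "nonzero_spectrum S T \<subseteq> {complex_of_real t | t. 0 \<le> t}"
    by (simp_all add: positive_in_def)
  have "0 \<le> t" if "t \<in> rspec S T" for t
    using 1(3) that by (auto simp: rspec_def)
  then have "sqrt_op T * sqrt_op T = T" "star (sqrt_op T) = sqrt_op T"
    using sqrt_op_rspec[OF 1(2)] rspec_mono[OF S 1(1)] by blast+
  then show "T \<in> S \<and> pos_op T"
    using pos_op_star_mult(1)[of "sqrt_op T"] 1(1) by simp
next
  assume T: "T \<in> S \<and> pos_op T"
  have "l = complex_of_real (Re l) \<and> 0 \<le> Re l" if "l \<in> nonzero_spectrum S T" for l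
    using nonzero_spectrum_real[OF S _ _ that] T pos_opD(1) pos_op_rspec[OF S] by blast
  then show "positive_in S T"
    using T pos_opD(1) unfolding positive_in_def by blast
qed

text \<open>The form of \<open>T\<close> at \<open>v\<close> is the square of the norm of
  \<open>sqrt_op T\<close> applied to \<open>v\<close>, and the norm of \<open>T\<close> is the
  square of the norm of its root.\<close>

lemma norm_pos_op_le:
  assumes T: "pos_op T" and M: "0 \<le> M" "\<And>v. qf T v \<le> M * (norm v)\<^sup>2"
  shows "norm T \<le> M"
proof -
  have "norm (sqrt_op T) \<le> sqrt M"
  proof (rule norm_l2op_leI)
    fix v
    have "(norm (l2op_apply (sqrt_op T) v))\<^sup>2 = qf T v"
      using qf_star_mult[of "sqrt_op T" v] sqrt_op[OF T] by simp
    also have "\<dots> \<le> (sqrt M * norm v)\<^sup>2"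
      using M(1) M(2)[of v] by (simp add: power_mult_distrib)
    finally show "norm (l2op_apply (sqrt_op T) v) \<le> sqrt M * norm v"
      using M(1) by (auto intro: power2_le_imp_le)
  qed (use M in simp)
  then have "(norm (sqrt_op T))\<^sup>2 \<le> M"
    using M(1) power_mono[of "norm (sqrt_op T)" "sqrt M" 2] by simp
  then show ?thesis
    using sqrt_op[OF T] norm_selfadjoint_sq[of "sqrt_op T"] by simp
qed

lemma norm_mono_pos_op:
  assumes "pos_op a" "pos_op (b - a)" shows "norm a \<le> norm b"
proof (rule norm_pos_op_le[OF assms(1)])
  show "qf a v \<le> norm b * (norm v)\<^sup>2" for v
    using abs_qf_le[of b v] pos_opD(2)[OF assms(2), of v] by (simp add: qf_ops)
qed simp

lemma pos_op_zeroI: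
  assumes "pos_op T" "\<And>v. qf T v \<le> 0" shows "T = 0"
  using norm_pos_op_le[OF assms(1), of 0] assms(2) by simp

lemma pos_op_fc:
  assumes sa: "star c = c" and f: "cont0 f" and nonneg: "\<And>t. 0 \<le> f t"
  shows "pos_op (fc f c)"
proof -
  have g: "cont0 (\<lambda>t. sqrt (f t))"
    using f by (auto simp: cont0_def intro!: continuous_intros)
  have "fc f c = fc (\<lambda>t. sqrt (f t)) c * fc (\<lambda>t. sqrt (f t)) c"
    using fc_add_mult(2)[OF sa g g] nonneg by simp
  then show ?thesis
    using pos_op_star_mult(1)[of "fc (\<lambda>t. sqrt (f t)) c"] star_fc[OF sa g] by simp
qed

section \<open>Cuntz subequivalence\<close>

lemma cuntz_below_iff:
  "cuntz_below A a b \<longleftrightarrow> (\<forall>e>0. \<exists>v\<in>A. norm (a - v * b * star v) < e)"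
proof
  assume "cuntz_below A a b"
  then obtain v where v: "\<And>n. v n \<in> A" "(\<lambda>n. norm (a - v n * b * star (v n))) \<longlonglongrightarrow> 0"
    unfolding cuntz_below_def by blast
  show "\<forall>e>0. \<exists>v\<in>A. norm (a - v * b * star v) < e"
  proof (intro allI impI)
    fix e :: real assume "0 < e"
    then have "\<forall>\<^sub>F n in sequentially. norm (a - v n * b * star (v n)) < e"
      by (rule order_tendstoD(2)[OF v(2)])
    then show "\<exists>v\<in>A. norm (a - v * b * star v) < e"
      using v(1) by (auto simp: eventually_sequentially)
  qed
next
  assume *: "\<forall>e>0. \<exists>v\<in>A. norm (a - v * b * star v) < e"
  have "\<forall>n. \<exists>v. v \<in> A \<and> norm (a - v * b * star v) < inverse (real (Suc n))"
    using * by (metis inverse_positive_iff_positive of_nat_0_less_iff zero_less_Suc)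
  then obtain v where v: "\<And>n. v n \<in> A" "\<And>n. norm (a - v n * b * star (v n)) < inverse (real (Suc n))"
    by metis
  have "(\<lambda>n. norm (a - v n * b * star (v n))) \<longlonglongrightarrow> 0"
    by (rule Lim_null_comparison[OF _ LIMSEQ_inverse_real_of_nat])
      (use v(2) in \<open>auto intro!: always_eventually less_imp_le\<close>)
  then show "cuntz_below A a b"
    unfolding cuntz_below_def using v(1) by blast
qed

lemma cuntz_belowD: "cuntz_below A a b \<Longrightarrow> 0 < e \<Longrightarrow> \<exists>v\<in>A. norm (a - v * b * star v) < e"
  by (simp add: cuntz_below_iff)

lemma cuntz_below_conj: "v \<in> A \<Longrightarrow> cuntz_below A (v * b * star v) b"
  unfolding cuntz_below_iff by (intro allI impI bexI[of _ v]) simp_all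

lemma cuntz_below_limit:
  assumes "\<And>e. 0 < e \<Longrightarrow> \<exists>a'. norm (a - a') < e \<and> cuntz_below A a' b"
  shows "cuntz_below A a b"
  unfolding cuntz_below_iff
proof (intro allI impI)
  fix e :: real assume e: "0 < e"
  then obtain a' where a': "norm (a - a') < e / 2" "cuntz_below A a' b"
    using assms[of "e / 2"] by auto
  then obtain v where v: "v \<in> A" "norm (a' - v * b * star v) < e / 2"
    using cuntz_belowD[of A a' b "e / 2"] e by auto
  have "norm (a - v * b * star v) \<le> norm (a - a') + norm (a' - v * b * star v)"
    using norm_triangle_ineq[of "a - a'" "a' - v * b * star v"] by simp
  then show "\<exists>v\<in>A. norm (a - v * b * star v) < e"
    using a'(1) v by (intro bexI[of _ v]) simp_all
qed

lemma norm_conj_le: "norm (v * x * star v) \<le> (norm (v::'a::cstar_algebra))\<^sup>2 * norm x"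
proof -
  have "norm (v * x * star v) \<le> norm (v * x) * norm v"
    using norm_mult_ineq[of "v * x" "star v"] by simp
  also have "\<dots> \<le> (norm v * norm x) * norm v"
    by (intro mult_right_mono norm_mult_ineq) simp
  finally show ?thesis by (simp add: power2_eq_square algebra_simps)
qed

lemma cuntz_below_trans:
  assumes A: "cstar_subalgebra A" and ab: "cuntz_below A a b" and bc: "cuntz_below A b c"
  shows "cuntz_below A a c"
  unfolding cuntz_below_iff
proof (intro allI impI)
  fix e :: real assume e: "0 < e"
  then obtain v where v: "v \<in> A" "norm (a - v * b * star v) < e / 2"
    using cuntz_belowD[OF ab, of "e / 2"] by auto
  define K where "K = (norm v)\<^sup>2 + 1"
  have K: "0 < K" "(norm v)\<^sup>2 \<le> K"
    by (simp_all add: K_def add_nonneg_pos)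
  obtain w where w: "w \<in> A" "norm (b - w * c * star w) < e / (2 * K)"
    using cuntz_belowD[OF bc, of "e / (2 * K)"] e K by auto
  have "a - (v * w) * c * star (v * w) = (a - v * b * star v) + v * (b - w * c * star w) * star v"
    by (simp add: star_mult algebra_simps)
  then have "norm (a - (v * w) * c * star (v * w)) \<le> norm (a - v * b * star v) + norm (v * (b - w * c * star w) * star v)"
    by (metis norm_triangle_ineq)
  also have "norm (v * (b - w * c * star w) * star v) \<le> (norm v)\<^sup>2 * norm (b - w * c * star w)"
    by (rule norm_conj_le)
  also have "\<dots> \<le> K * (e / (2 * K))"
    by (intro mult_mono less_imp_le[OF w(2)]) (use K in auto)
  also have "\<dots> = e / 2"
    using K by simp
  finally show "\<exists>u\<in>A. norm (a - u * c * star u) < e"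
    using v w by (intro bexI[of _ "v * w"]) (auto simp: cstar_subalgebraD[OF A])
qed

text \<open>The witness is \<open>a\<^sup>1\<^sup>/\<^sup>2 (b + \<delta>)\<^sup>-\<^sup>1\<^sup>/\<^sup>2\<close>; the error
  \<open>\<delta> a\<^sup>1\<^sup>/\<^sup>2 (b + \<delta>)\<^sup>-\<^sup>1 a\<^sup>1\<^sup>/\<^sup>2\<close> has norm at most \<open>\<delta>\<close> because \<open>a \<le> b\<close>.\<close>
lemma cuntz_below_of_le:
  assumes A: "cstar_subalgebra A" and a: "a \<in> A" "pos_op a" and b: "b \<in> A" "pos_op b"
    and le: "pos_op (b - a)"
  shows "cuntz_below A a b"
  unfolding cuntz_below_iff
proof (intro allI impI)
  fix e :: real assume e: "0 < e"
  define \<delta> where "\<delta> = e / 2"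
  have \<delta>: "0 < \<delta>" "\<delta> < e" using e by (simp_all add: \<delta>_def)
  note bsa = pos_opD(1)[OF b(2)]
  define s where "s = sqrt_op a"
  have s: "s \<in> A" "s * s = a" "star s = s"
    using sqrt_op[OF a(2)] sqrt_op_in[OF A a] by (simp_all add: s_def)
  \<comment> \<open>\<open>h(b)\<close> is the inverse root of \<open>b + \<delta>\<close>. As
    \<open>h\<close> does not vanish at 0, the functional calculus is applied to
    \<open>k = h - h 0\<close>, and the constant part enters \<open>v\<close> as a multiple of
    \<open>s\<close>, which keeps \<open>v\<close> in \<open>A\<close>. Similarly
    \<open>1 + j(b)\<close> is the root of \<open>\<delta> / (b + \<delta>)\<close>. The absolute
    values make the functions continuous on the whole line.\<close>
  define h where "h t = 1 / sqrt (\<bar>t\<bar> + \<delta>)" for t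
  define k where "k t = h t - h 0" for t
  define w where "w t = t / (\<bar>t\<bar> + \<delta>)" for t
  define j where "j t = sqrt (\<delta> / (\<bar>t\<bar> + \<delta>)) - 1" for t
  have pos: "0 < \<bar>t\<bar> + \<delta>" for t :: real using \<delta> by linarith
  have ne: "\<bar>t\<bar> + \<delta> \<noteq> 0" for t :: real using pos[of t] by linarith
  have k: "cont0 k" and w: "cont0 w" and j: "cont0 j"
    unfolding cont0_def k_def[abs_def] w_def[abs_def] j_def[abs_def] h_def[abs_def]
    using ne \<delta> by (auto intro!: continuous_intros)
  define v where "v = h 0 *\<^sub>R s + s * fc k b"
  have vA: "v \<in> A"
    unfolding v_def by (intro cstar_subalgebraD[OF A] s fc_in[OF A b(1) bsa k])
  define H where "H = h 0 *\<^sub>R 1 + fc k b"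
  define J where "J = 1 + fc j b"
  have H: "star H = H" "v = s * H" and J: "star J = J"
    using star_fc[OF bsa k] star_fc[OF bsa j]
    by (simp_all add: H_def J_def v_def star_add star_scaleR algebra_simps)
  have idb: "fc (\<lambda>t. t) b = b" by (rule fc_id[OF bsa cont0_intros(5) cont0_intros(5)])
  have HbH: "H * b * H = fc w b"
  proof -
    have 1: "(\<lambda>t. (h 0 * t + k t * t) * h 0 + (h 0 * t + k t * t) * k t) = w"
    proof
      fix t :: real
      have "(h 0 * t + k t * t) * h 0 + (h 0 * t + k t * t) * k t = t * (h t * h t)"
        by (simp add: k_def algebra_simps)
      also have "h t * h t = 1 / (\<bar>t\<bar> + \<delta>)"
        using pos[of t] by (simp add: h_def)
      finally show "(h 0 * t + k t * t) * h 0 + (h 0 * t + k t * t) * k t = w t"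
        by (simp add: w_def)
    qed
    define Hb where "Hb t = h 0 * t + k t * t" for t
    have Hb: "cont0 Hb" unfolding Hb_def[abs_def] by (intro cont0_intros k)
    have Hbfc: "fc Hb b = H * b"
      unfolding Hb_def[abs_def] H_def
      by (simp add: fc_add_mult[OF bsa] cont0_intros k fc_scale[OF bsa cont0_intros(5) k] idb distrib_right)
    have "w = (\<lambda>t. h 0 * Hb t + Hb t * k t)"
      using 1 by (simp add: Hb_def[abs_def] mult.commute)
    then have "fc w b = h 0 *\<^sub>R fc Hb b + fc Hb b * fc k b"
      by (simp add: fc_add_mult[OF bsa] cont0_intros k Hb fc_scale[OF bsa Hb k])
    then show ?thesis by (simp add: Hbfc H_def distrib_left)
  qed
  have JJ: "J * J = 1 - fc w' b" if "w' = (\<lambda>t. -1 * (j t + j t) - j t * j t)" for w'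
    unfolding that
    by (simp only: fc_diff[OF bsa] cont0_intros j fc_scale[OF bsa _ j] fc_add_mult[OF bsa j j])
      (simp add: J_def algebra_simps)
  have jw: "-1 * (j t + j t) - j t * j t = \<bar>t\<bar> / (\<bar>t\<bar> + \<delta>)" for t
  proof -
    have "(j t + 1) * (j t + 1) = \<delta> / (\<bar>t\<bar> + \<delta>)"
      using \<delta> pos[of t] by (simp add: j_def)
    then have "-1 * (j t + j t) - j t * j t = 1 - \<delta> / (\<bar>t\<bar> + \<delta>)"
      by (simp add: algebra_simps)
    then show ?thesis using ne[of t] by (simp add: field_simps)
  qed
  have "fc w b = fc (\<lambda>t. -1 * (j t + j t) - j t * j t) b"
  proof (rule fc_cong[OF bsa w])
    show "cont0 (\<lambda>t. -1 * (j t + j t) - j t * j t)" by (intro cont0_intros j)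
    show "w t = -1 * (j t + j t) - j t * j t" if "t \<in> rspec UNIV b" for t
      unfolding jw using pos_op_rspec[OF cstar_subalgebra_UNIV UNIV_I b(2) that] by (simp add: w_def)
  qed
  then have JJ: "J * J = 1 - fc w b"
    using JJ by simp
  have "a - v * b * star v = s * (J * J) * s"
    unfolding JJ H(2) by (simp add: star_mult s H(1) HbH[symmetric] algebra_simps)
  also have "\<dots> = star (J * s) * (J * s)"
    by (simp add: star_mult s J mult.assoc)
  finally have "norm (a - v * b * star v) = (norm (J * s))\<^sup>2"
    by (simp add: cstar_identity)
  \<comment> \<open>Exchanging the two factors moves \<open>a\<close> between the copies of
    \<open>J\<close>, where \<open>a \<le> b\<close> can be used.\<close>
  also have "\<dots> = norm ((J * s) * star (J * s))"
    by (simp add: norm_star_mult_self)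
  also have "(J * s) * star (J * s) = J * a * J"
    by (simp add: star_mult s J mult.assoc flip: s(2))
  also have "norm (J * a * J) \<le> norm (J * b * J)"
  proof (rule norm_mono_pos_op)
    show "pos_op (J * a * J)" using pos_op_conj[OF a(2), of J] J by simp
    have "J * b * J - J * a * J = J * (b - a) * J" by (simp add: algebra_simps)
    then show "pos_op (J * b * J - J * a * J)" using pos_op_conj[OF le, of J] J by simp
  qed
  also have "J * b * J = fc (\<lambda>t. t - w t * t) b"
  proof -
    have bJ: "b * J = J * b"
      using fc_commute[OF bsa j, of b] by (simp add: J_def distrib_left distrib_right)
    have "J * b * J = J * J * b" by (simp only: bJ mult.assoc)
    also have "\<dots> = b - fc w b * b" by (simp add: JJ left_diff_distrib)
    also have "\<dots> = fc (\<lambda>t. t - w t * t) b"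
      by (simp only: fc_diff[OF bsa cont0_intros(5) cont0_intros(3)[OF w cont0_intros(5)]]
          fc_add_mult(2)[OF bsa w cont0_intros(5)] idb)
    finally show ?thesis .
  qed
  also have "norm (fc (\<lambda>t. t - w t * t) b) \<le> \<delta>"
  proof (rule norm_fc_le[OF bsa])
    show "cont0 (\<lambda>t. t - w t * t)" by (intro cont0_intros w)
    fix t assume "t \<in> rspec UNIV b"
    then have t: "0 \<le> t" by (rule pos_op_rspec[OF cstar_subalgebra_UNIV UNIV_I b(2)])
    have "t - w t * t = \<delta> * (t / (t + \<delta>))"
      using t \<delta> by (simp add: w_def field_simps)
    moreover have "0 \<le> \<delta> * (t / (t + \<delta>))" "\<delta> * (t / (t + \<delta>)) \<le> \<delta> * 1"
      using t \<delta> by (intro mult_nonneg_nonneg mult_left_mono; simp)+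
    ultimately show "\<bar>t - w t * t\<bar> \<le> \<delta>"
      by linarith
  qed (use \<delta> in simp)
  finally show "\<exists>v\<in>A. norm (a - v * b * star v) < e"
    using vA \<delta> by (intro bexI[of _ v]) simp_all
qed

abbreviation cut :: "real \<Rightarrow> 'a::cstar_algebra \<Rightarrow> 'a"
  where "cut \<epsilon> \<equiv> fc (\<lambda>t. max (t - \<epsilon>) 0)"

lemma cont0_cut: "0 \<le> \<epsilon> \<Longrightarrow> cont0 (\<lambda>t. max (t - \<epsilon>) 0)"
  by (auto simp: cont0_def intro!: continuous_intros)

lemma norm_cut_diff: "star c = c \<Longrightarrow> pos_op c \<Longrightarrow> 0 \<le> \<epsilon> \<Longrightarrow> norm (c - cut \<epsilon> c) \<le> \<epsilon>"
proof -
  assume sa: "star c = c" and p: "pos_op c" and \<epsilon>: "0 \<le> \<epsilon>"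
  have "c - cut \<epsilon> c = fc (\<lambda>t. t - max (t - \<epsilon>) 0) c"
    by (simp only: fc_diff[OF sa cont0_intros(5) cont0_cut[OF \<epsilon>]] fc_id[OF sa cont0_intros(5) cont0_intros(5)])
  also have "norm \<dots> \<le> \<epsilon>"
  proof (rule norm_fc_le[OF sa])
    show "cont0 (\<lambda>t. t - max (t - \<epsilon>) 0)" by (intro cont0_intros cont0_cut \<epsilon>)
    show "\<bar>t - max (t - \<epsilon>) 0\<bar> \<le> \<epsilon>" if "t \<in> rspec UNIV c" for t
      using pos_op_rspec[OF cstar_subalgebra_UNIV UNIV_I p that] \<epsilon> by (simp add: max_def)
  qed (rule \<epsilon>)
  finally show ?thesis .
qed

text \<open>With \<open>g(t)^2 (t - \<epsilon>) = max (t - \<epsilon> - \<delta>) 0\<close>,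
  conjugating \<open>a - \<epsilon> \<le> b\<close> by \<open>G = g(a)\<close> puts the cut of
  \<open>a\<close> at \<open>\<epsilon> + \<delta>\<close> below \<open>G b G\<close>, which is
  Cuntz below \<open>b\<close>. The extra \<open>\<delta>\<close>, removed in the limit, keeps
  \<open>g\<close> continuous.\<close>

lemma cuntz_below_cut:
  assumes A: "cstar_subalgebra A" and a: "a \<in> A" "star a = a" and b: "b \<in> A" "pos_op b"
    and \<epsilon>: "0 \<le> \<epsilon>" and le: "pos_op (b - a + \<epsilon> *\<^sub>R 1)"
  shows "cuntz_below A (cut \<epsilon> a) b"
proof (rule cuntz_below_limit)
  fix e :: real assume e: "0 < e"
  define \<delta> where "\<delta> = e / 2"
  have \<delta>: "0 < \<delta>" "\<delta> < e" using e by (simp_all add: \<delta>_def)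
  define p where "p t = max (t - (\<epsilon> + \<delta>)) 0" for t
  define g where "g t = sqrt (p t / max (t - \<epsilon>) \<delta>)" for t
  have ne: "max (t - \<epsilon>) \<delta> > 0" for t using \<delta> by (simp add: less_max_iff_disj)
  have ne': "max (t - \<epsilon>) \<delta> \<noteq> 0" for t using ne[of t] by linarith
  have p: "cont0 p" unfolding p_def[abs_def] using \<epsilon> \<delta> by (intro cont0_cut) simp
  have g: "cont0 g"
    using p ne' unfolding cont0_def g_def[abs_def] by (auto intro!: continuous_intros)
  have gg: "g t * g t * t - \<epsilon> * (g t * g t) = p t" for t
  proof -
    have "0 \<le> p t" by (simp add: p_def)
    then have "g t * g t = p t / max (t - \<epsilon>) \<delta>"
      using ne[of t] by (simp add: g_def)
    then have "g t * g t * t - \<epsilon> * (g t * g t) = p t * ((t - \<epsilon>) / max (t - \<epsilon>) \<delta>)"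
      by (simp add: algebra_simps diff_divide_distrib)
    also have "\<dots> = p t"
    proof (cases "t \<le> \<epsilon> + \<delta>")
      case False
      then have "max (t - \<epsilon>) \<delta> = t - \<epsilon>" "t - \<epsilon> \<noteq> 0" using \<delta> by auto
      then show ?thesis by simp
    qed (simp add: p_def)
    finally show ?thesis .
  qed
  define G where "G = fc g a"
  have G: "star G = G" "G \<in> A" by (simp_all add: G_def star_fc a g fc_in[OF A])
  have ida: "fc (\<lambda>t. t) a = a" by (rule fc_id[OF a(2) cont0_intros(5) cont0_intros(5)])
  have aG: "a * G = G * a"
    unfolding G_def by (rule fc_commute[OF a(2) g]) simp
  have eq: "fc p a = G * a * G - \<epsilon> *\<^sub>R (G * G)"
  proof -
    have "p = (\<lambda>t. g t * g t * t - \<epsilon> * (g t * g t))" using gg by auto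
    then have "fc p a = fc (\<lambda>t. g t * g t * t - \<epsilon> * (g t * g t)) a" by simp
    also have "\<dots> = G * G * a - \<epsilon> *\<^sub>R (G * G)"
      by (simp only: fc_diff[OF a(2)] fc_add_mult(2)[OF a(2)] fc_scale[OF a(2) _ g] cont0_intros g ida G_def)
    finally show ?thesis by (simp only: mult.assoc aG)
  qed
  have pp: "pos_op (fc p a)"
    by (rule pos_op_fc[OF a(2) p]) (simp add: p_def)
  have pb: "pos_op (G * b * G)"
    using pos_op_conj[OF b(2), of G] G(1) by simp
  have "G * b * G - fc p a = star G * (b - a + \<epsilon> *\<^sub>R 1) * G"
    unfolding eq G(1) by (simp add: algebra_simps)
  then have "pos_op (G * b * G - fc p a)"
    using pos_op_conj[OF le] by simp
  then have "cuntz_below A (fc p a) (G * b * G)"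
    by (intro cuntz_below_of_le[OF A _ pp _ pb]) (simp_all add: fc_in[OF A a p] cstar_subalgebraD[OF A] G b)
  moreover have "cuntz_below A (G * b * G) b"
    using cuntz_below_conj[OF G(2), of b] G(1) by simp
  ultimately have "cuntz_below A (fc p a) b"
    by (rule cuntz_below_trans[OF A])
  moreover have "norm (cut \<epsilon> a - fc p a) \<le> \<delta>"
  proof -
    have "cut \<epsilon> a - fc p a = fc (\<lambda>t. max (t - \<epsilon>) 0 - p t) a"
      by (simp only: fc_diff[OF a(2) cont0_cut[OF \<epsilon>] p])
    also have "norm \<dots> \<le> \<delta>"
      by (rule norm_fc_le[OF a(2) cont0_intros(2)[OF cont0_cut[OF \<epsilon>] p]]) (use \<delta> in \<open>auto simp: p_def max_def\<close>)
    finally show ?thesis .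
  qed
  ultimately show "\<exists>a'. norm (cut \<epsilon> a - a') < e \<and> cuntz_below A a' b"
    using \<delta> by (intro exI[of _ "fc p a"]) simp
qed

lemma cuntz_below_cut_norm:
  assumes A: "cstar_subalgebra A" and a: "a \<in> A" "star a = a" and b: "b \<in> A" "pos_op b"
    and \<epsilon>: "norm (a - b) \<le> \<epsilon>"
  shows "cuntz_below A (cut \<epsilon> a) b"
proof (rule cuntz_below_cut[OF A a b])
  show "0 \<le> \<epsilon>" using \<epsilon> norm_ge_zero order_trans by blast
  show "pos_op (b - a + \<epsilon> *\<^sub>R 1)"
    using pos_opD(1)[OF b(2)] a \<epsilon> by (intro pos_op_add_norm) (simp_all add: star_diff norm_minus_commute)
qed

section \<open>The spatial tensor product\<close>

lemma l2op_eqI_ket: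
  assumes "\<And>x. l2op_apply R (ket x) = l2op_apply R' (ket x)" shows "R = R'"
proof (rule l2op_eqI)
  fix u
  show "l2op_apply R u = l2op_apply R' u"
  proof (rule ell2_dense_induct[of "\<lambda>u. l2op_apply R u = l2op_apply R' u"])
    show "closed {u. l2op_apply R u = l2op_apply R' u}"
      by (intro closed_Collect_eq linear_continuous_on bounded_linear_l2op_apply)
    fix F :: "'a set" and c
    show "l2op_apply R (\<Sum>x\<in>F. c x *\<^sub>C ket x) = l2op_apply R' (\<Sum>x\<in>F. c x *\<^sub>C ket x)"
      by (simp add: linear_sum[OF bounded_linear.linear[OF bounded_linear_l2op_apply]]
        l2op_apply_scaleC assms)
  qed
qed

lemma tensor_op_eqI:
  assumes "\<And>v w. l2op_apply R (tensor_vec v w) = l2op_apply R' (tensor_vec v w)" shows "R = R'"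
proof (rule l2op_eqI_ket)
  show "l2op_apply R (ket p) = l2op_apply R' (ket p)" for p
    using assms by (cases p) (simp add: ket_pair)
qed

lemma ell2_eqI_pair: "(\<And>x y. ell2_apply u (x, y) = ell2_apply v (x, y)) \<Longrightarrow> u = v"
  by (rule ell2_eqI) (metis surj_pair)

lemma tensor_vec_linear:
  "tensor_vec (u + u') w = tensor_vec u w + tensor_vec u' w"
  "tensor_vec u (w + w') = tensor_vec u w + tensor_vec u w'"
  "tensor_vec (c *\<^sub>C u) w = c *\<^sub>C tensor_vec u w"
  "tensor_vec u (c *\<^sub>C w) = c *\<^sub>C tensor_vec u w"
  by (rule ell2_eqI_pair,
      simp add: ell2_apply_tensor_vec plus_ell2.rep_eq scaleC_ell2.rep_eq algebra_simps)+

lemma norm_tensor_vec_le: "norm (tensor_vec v w) \<le> norm v * norm w"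
proof (rule norm_ell2_leI)
  fix F :: "('a \<times> 'b) set" assume F: "finite F"
  have "(\<Sum>p\<in>F. (cmod (ell2_apply (tensor_vec v w) p))\<^sup>2)
      = (\<Sum>p\<in>F. (cmod (ell2_apply v (fst p)))\<^sup>2 * (cmod (ell2_apply w (snd p)))\<^sup>2)"
    by (intro sum.cong) (auto simp: ell2_apply_tensor_vec norm_mult power_mult_distrib)
  also have "\<dots> \<le> (\<Sum>p\<in>fst ` F \<times> snd ` F. (cmod (ell2_apply v (fst p)))\<^sup>2 * (cmod (ell2_apply w (snd p)))\<^sup>2)"
    using F by (intro sum_mono2) force+
  also have "\<dots> = (\<Sum>x\<in>fst ` F. (cmod (ell2_apply v x))\<^sup>2) * (\<Sum>y\<in>snd ` F. (cmod (ell2_apply w y))\<^sup>2)"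
    by (simp add: sum_product sum.cartesian_product split_beta)
  also have "\<dots> \<le> (norm v)\<^sup>2 * (norm w)\<^sup>2"
    using F by (intro mult_mono finite_sum_le_norm_ell2) (auto intro: sum_nonneg)
  finally show "(\<Sum>p\<in>F. (cmod (ell2_apply (tensor_vec v w) p))\<^sup>2) \<le> (norm v * norm w)\<^sup>2"
    by (simp add: power_mult_distrib)
qed simp

lemma tensor_op_mult: "tensor_op S T * tensor_op S' T' = tensor_op (S * S') (T * T')"
  by (rule tensor_op_eqI) (simp add: l2op_apply_ops tensor_op_tensor_vec)

lemma tensor_op_linear:
  "tensor_op (S + S') T = tensor_op S T + tensor_op S' T"
  "tensor_op S (T + T') = tensor_op S T + tensor_op S T'"
  "tensor_op (c *\<^sub>C S) T = c *\<^sub>C tensor_op S T"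
  "tensor_op S (c *\<^sub>C T) = c *\<^sub>C tensor_op S T"
  "tensor_op 1 1 = 1"
  by (rule tensor_op_eqI, simp add: l2op_apply_ops tensor_op_tensor_vec tensor_vec_linear l2op_apply_scaleC_left)+

lemma tensor_op_star: "star (tensor_op S T) = tensor_op (star S) (star T)"
proof (rule l2op_eqI_ket, rule ell2_eqI)
  fix p q :: "'a \<times> 'b"
  have entry: "ell2_apply (l2op_apply (star R) (ket x)) y = cnj (ell2_apply (l2op_apply R (ket y)) x)" for R :: "'c l2op" and x y
    by (metis cinner_ket_left cinner_star cinner_commute)
  show "ell2_apply (l2op_apply (star (tensor_op S T)) (ket p)) q
      = ell2_apply (l2op_apply (tensor_op (star S) (star T)) (ket p)) q"
    by (cases p, cases q) (simp add: entry, simp add: ket_pair tensor_op_tensor_vec ell2_apply_tensor_vec entry)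
qed

lemma tensor_op_left_hom: "star_hom_on UNIV (\<lambda>S. tensor_op S 1)"
  and tensor_op_right_hom: "star_hom_on UNIV (\<lambda>T. tensor_op 1 T)"
  unfolding star_hom_on_def
  by (simp_all add: tensor_op_linear tensor_op_mult tensor_op_star)

text \<open>The operator is the product of \<open>S \<otimes> 1\<close> and
  \<open>1 \<otimes> T\<close>, and both embeddings are *-homomorphisms, hence contractive.\<close>

lemma norm_tensor_op_le: "norm (tensor_op S T) \<le> norm S * norm T"
proof -
  have "norm (tensor_op S T) = norm (tensor_op S 1 * tensor_op 1 T)"
    by (simp add: tensor_op_mult)
  also have "\<dots> \<le> norm (tensor_op S (1 :: 'b l2op)) * norm (tensor_op (1 :: 'a l2op) T)"
    by (rule norm_mult_ineq)
  also have "\<dots> \<le> norm S * norm T"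
    by (intro mult_mono star_hom_contractive[OF cstar_subalgebra_UNIV tensor_op_left_hom]
        star_hom_contractive[OF cstar_subalgebra_UNIV tensor_op_right_hom]) auto
  finally show ?thesis .
qed

lemma tensor_op_linear2:
  "tensor_op 0 T = 0" "tensor_op S 0 = 0"
  "tensor_op (S - S') T = tensor_op S T - tensor_op S' T"
  "tensor_op S (T - T') = tensor_op S T - tensor_op S T'"
  "tensor_op (r *\<^sub>R S) T = r *\<^sub>R tensor_op S T"
  "tensor_op S (r *\<^sub>R T) = r *\<^sub>R tensor_op S T"
proof -
  show z: "tensor_op 0 T = 0" "tensor_op S 0 = 0"
    using tensor_op_linear(3)[of 0 0 T] tensor_op_linear(4)[of S 0 0] by simp_all
  show "tensor_op (S - S') T = tensor_op S T - tensor_op S' T"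
    using tensor_op_linear(1)[of "S - S'" S' T] by simp
  show "tensor_op S (T - T') = tensor_op S T - tensor_op S T'"
    using tensor_op_linear(2)[of S "T - T'" T'] by simp
qed (simp_all add: scaleR_eq_scaleC tensor_op_linear)

lemma bounded_linear_tensor_op_left: "bounded_linear (\<lambda>S. tensor_op S T)"
  by (rule bounded_linear_intro[where K = "norm T"])
    (auto simp: tensor_op_linear tensor_op_linear2 norm_tensor_op_le)

lemma bounded_linear_tensor_op_right: "bounded_linear (\<lambda>T. tensor_op S T)"
  by (rule bounded_linear_intro[where K = "norm S"])
    (auto simp: tensor_op_linear tensor_op_linear2 intro: order_trans[OF norm_tensor_op_le])

lemma tensor_op_sum_right: "tensor_op S (\<Sum>i\<in>I. T i) = (\<Sum>i\<in>I. tensor_op S (T i))"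
  by (rule linear_sum[OF bounded_linear.linear[OF bounded_linear_tensor_op_right]])

lemma pos_op_tensor: "pos_op S \<Longrightarrow> pos_op T \<Longrightarrow> pos_op (tensor_op S T)"
  using pos_op_star_mult(1)[of "tensor_op (sqrt_op S) (sqrt_op T)"]
  by (simp add: tensor_op_star tensor_op_mult sqrt_op)

subsection \<open>Slices\<close>

lemma slice_linear:
  "slice (u + u') y = slice u y + slice u' y" "slice (c *\<^sub>C u) y = c *\<^sub>C slice u y"
  "slice (tensor_vec v w) y = ell2_apply w y *\<^sub>C v"
  by (rule ell2_eqI, simp add: ell2_apply_slice plus_ell2.rep_eq scaleC_ell2.rep_eq ell2_apply_tensor_vec)+

lemma norm_slice_le: "norm (slice v y) \<le> norm v"
  using sum_norm_slice_le[of "{y}" v] by (auto intro: power2_le_imp_le)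

text \<open>The slice map \<open>id \<otimes> \<omega>\<close>, where \<open>\<omega>\<close> is the
  vector state of \<open>ket y\<close>.\<close>

definition slice_op :: "'y \<Rightarrow> ('x \<times> 'y) l2op \<Rightarrow> 'x l2op"
  where "slice_op y h = Abs_l2op (Blinfun (\<lambda>v. slice (l2op_apply h (tensor_vec v (ket y))) y))"

lemma norm_ket [simp]: "norm (ket y) = 1"
proof -
  have "complex_of_real ((norm (ket y))\<^sup>2) = 1"
    unfolding cinner_self_norm[symmetric] cinner_ket_left by (simp add: ell2_apply_ket)
  then have "(norm (ket y))\<^sup>2 = 1"
    by (simp only: of_real_eq_1_iff)
  then show ?thesis
    using norm_ge_zero[of "ket y"] by (auto simp: power2_eq_1_iff)
qed

lemma bounded_linear_tensor_vec_left: "bounded_linear (\<lambda>v. tensor_vec v w)"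
  by (rule bounded_linear_intro[where K = "norm w"])
    (simp_all add: tensor_vec_linear ell2_scaleR_scaleC norm_tensor_vec_le)

lemma bounded_linear_slice: "bounded_linear (\<lambda>u. slice u y)"
  by (rule bounded_linear_intro[where K = 1]) (simp_all add: slice_linear ell2_scaleR_scaleC norm_slice_le)

lemma l2op_apply_slice_op: "l2op_apply (slice_op y h) v = slice (l2op_apply h (tensor_vec v (ket y))) y"
  unfolding slice_op_def
proof (rule l2op_apply_Abs_l2op)
  have 2: "bounded_linear (\<lambda>v. l2op_apply h (tensor_vec v (ket y)))"
    by (rule bounded_linear_compose[OF bounded_linear_l2op_apply bounded_linear_tensor_vec_left])
  show "bounded_linear (\<lambda>v. slice (l2op_apply h (tensor_vec v (ket y))) y)"
    by (rule bounded_linear_compose[OF bounded_linear_slice 2])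
qed (simp add: tensor_vec_linear l2op_apply_scaleC slice_linear)

lemma cinner_slice: "cinner v (slice u y) = cinner (tensor_vec v (ket y)) u"
proof (rule ell2_dense_induct[of "\<lambda>v. cinner v (slice u y) = cinner (tensor_vec v (ket y)) u"])
  show "closed {v. cinner v (slice u y) = cinner (tensor_vec v (ket y)) u}"
    by (intro closed_Collect_eq linear_continuous_on bounded_linear_cinner_left
        bounded_linear_compose[OF bounded_linear_cinner_left bounded_linear_tensor_vec_left])
  fix F c
  show "cinner (\<Sum>x\<in>F. c x *\<^sub>C ket x) (slice u y) = cinner (tensor_vec (\<Sum>x\<in>F. c x *\<^sub>C ket x) (ket y)) u"
    by (simp add: linear_sum[OF bounded_linear.linear[OF bounded_linear_cinner_left]]
        linear_sum[OF bounded_linear.linear[OF bounded_linear_tensor_vec_left]]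
        tensor_vec_linear cinner_scaleC_left cinner_ket_left ell2_apply_slice flip: ket_pair)
qed

lemma cinner_slice_op:
  "cinner u (l2op_apply (slice_op y h) v) = cinner (tensor_vec u (ket y)) (l2op_apply h (tensor_vec v (ket y)))"
  by (simp add: l2op_apply_slice_op cinner_slice)

lemma qf_slice_op: "qf (slice_op y h) v = qf h (tensor_vec v (ket y))"
  by (simp add: qf_def cinner_slice_op)

lemma slice_op_linear:
  "slice_op y (S + T) = slice_op y S + slice_op y T"
  "slice_op y (c *\<^sub>C S) = c *\<^sub>C slice_op y S"
  by (rule l2op_eqI, simp add: l2op_apply_slice_op l2op_apply_ops l2op_apply_scaleC_left slice_linear)+

lemma norm_slice_op_le: "norm (slice_op y h) \<le> norm h"
proof (rule norm_l2op_leI)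
  fix v
  have "norm (l2op_apply (slice_op y h) v) \<le> norm (l2op_apply h (tensor_vec v (ket y)))"
    unfolding l2op_apply_slice_op by (rule norm_slice_le)
  also have "\<dots> \<le> norm h * norm (tensor_vec v (ket y))"
    by (rule norm_l2op_apply)
  also have "\<dots> \<le> norm h * norm v"
    using norm_tensor_vec_le[of v "ket y"] by (intro mult_left_mono) simp_all
  finally show "norm (l2op_apply (slice_op y h) v) \<le> norm h * norm v" .
qed simp

lemma bounded_linear_slice_op: "bounded_linear (slice_op y)"
  by (rule bounded_linear_intro[where K = 1])
    (simp_all add: slice_op_linear scaleR_eq_scaleC norm_slice_op_le)

lemma slice_op_tensor: "slice_op y (tensor_op a b) = ell2_apply (l2op_apply b (ket y)) y *\<^sub>C a"
  by (rule l2op_eqI) (simp add: l2op_apply_slice_op tensor_op_tensor_vec slice_linear l2op_apply_scaleC_left)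

lemma slice_op_star: "slice_op y (star h) = star (slice_op y h)"
proof (rule l2op_eqI, rule cinner_eqI)
  fix u v
  show "cinner u (l2op_apply (slice_op y (star h)) v) = cinner u (l2op_apply (star (slice_op y h)) v)"
    by (metis cinner_slice_op cinner_star cinner_commute)
qed

lemma slice_op_module: "slice_op y (tensor_op a 1 * h * tensor_op b 1) = a * slice_op y h * b"
proof (rule l2op_eqI, rule cinner_eqI)
  fix u v
  have "cinner u (l2op_apply (slice_op y (tensor_op a 1 * h * tensor_op b 1)) v)
      = cinner (l2op_apply (star (tensor_op a 1)) (tensor_vec u (ket y)))
          (l2op_apply h (l2op_apply (tensor_op b 1) (tensor_vec v (ket y))))"
    by (simp add: cinner_slice_op l2op_apply_ops cinner_star')
  also have "\<dots> = cinner (tensor_vec (l2op_apply (star a) u) (ket y)) (l2op_apply h (tensor_vec (l2op_apply b v) (ket y)))"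
    by (simp add: tensor_op_star tensor_op_tensor_vec)
  also have "\<dots> = cinner u (l2op_apply (a * slice_op y h * b) v)"
    by (simp add: cinner_slice_op[symmetric] l2op_apply_ops cinner_star')
  finally show "cinner u (l2op_apply (slice_op y (tensor_op a 1 * h * tensor_op b 1)) v)
      = cinner u (l2op_apply (a * slice_op y h * b) v)" .
qed

lemma pos_op_slice_op: "pos_op h \<Longrightarrow> pos_op (slice_op y h)"
  unfolding pos_op_def qf_slice_op slice_op_star[symmetric] by simp

text \<open>If all these slices vanish, the square root of \<open>h\<close> kills every basis vector
  \<open>ket (x, y)\<close>.\<close>

lemma slice_op_nonzero:
  assumes "pos_op h" "h \<noteq> 0" shows "\<exists>y. slice_op y h \<noteq> 0"
proof (rule ccontr)
  assume *: "\<not> ?thesis"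
  have "l2op_apply (sqrt_op h) (ket (x, y)) = 0" for x y
  proof -
    have "(norm (l2op_apply (sqrt_op h) (ket (x, y))))\<^sup>2 = qf h (ket (x, y))"
      using qf_star_mult[of "sqrt_op h"] sqrt_op[OF assms(1)] by simp
    also have "\<dots> = qf (slice_op y h) (ket x)"
      by (simp add: qf_slice_op ket_pair)
    also have "\<dots> = 0" using * by (simp add: qf_ops)
    finally show ?thesis by simp
  qed
  then have "sqrt_op h = 0"
    by (intro l2op_eqI_ket) (metis l2op_apply_ops(4) surj_pair)
  then show False
    using sqrt_op(1)[OF assms(1)] assms(2) by simp
qed

subsection \<open>The minimal tensor product as a C*-algebra\<close>

definition tensor_alg :: "'x l2op set \<Rightarrow> 'y l2op set \<Rightarrow> ('x \<times> 'y) l2op set"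
  where "tensor_alg A B = {\<Sum>i<m. tensor_op (a i) (b i) | m (a :: nat \<Rightarrow> 'x l2op) (b :: nat \<Rightarrow> 'y l2op).
      \<forall>i<m. a i \<in> A \<and> b i \<in> B}"

definition tensor_cl :: "'x l2op set \<Rightarrow> 'y l2op set \<Rightarrow> ('x \<times> 'y) l2op set"
  where "tensor_cl A B = closure (tensor_alg A B)"

lemma min_tensor_eq:
  fixes A :: "'a::cstar_algebra set" and B :: "'b::cstar_algebra set"
    and \<pi> :: "'a \<Rightarrow> 'x l2op" and \<sigma> :: "'b \<Rightarrow> 'y l2op"
  shows "min_tensor A \<pi> B \<sigma> = tensor_cl (\<pi> ` A) (\<sigma> ` B)"
proof -
  have "{\<Sum>i<m. tensor_op (\<pi> (a i)) (\<sigma> (b i)) | m (a :: nat \<Rightarrow> 'a) (b :: nat \<Rightarrow> 'b). \<forall>i<m. a i \<in> A \<and> b i \<in> B}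
      = tensor_alg (\<pi> ` A) (\<sigma> ` B)" (is "?L = _")
  proof
    show "?L \<subseteq> tensor_alg (\<pi> ` A) (\<sigma> ` B)"
    proof
      fix x assume "x \<in> ?L"
      then obtain m :: nat and a b where *: "x = (\<Sum>i<m. tensor_op (\<pi> (a i)) (\<sigma> (b i)))" "\<forall>i<m. a i \<in> A \<and> b i \<in> B"
        by blast
      then show "x \<in> tensor_alg (\<pi> ` A) (\<sigma> ` B)"
        unfolding tensor_alg_def
        by (intro CollectI exI[of _ m] exI[of _ "\<lambda>i. \<pi> (a i)"] exI[of _ "\<lambda>i. \<sigma> (b i)"]) simp
    qed
    show "tensor_alg (\<pi> ` A) (\<sigma> ` B) \<subseteq> ?L"
    proof
      fix x assume "x \<in> tensor_alg (\<pi> ` A) (\<sigma> ` B)"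
      then obtain m :: nat and a b where *: "x = (\<Sum>i<m. tensor_op (a i) (b i))" "\<forall>i<m. a i \<in> \<pi> ` A \<and> b i \<in> \<sigma> ` B"
        unfolding tensor_alg_def by blast
      have "\<pi> (inv_into A \<pi> (a i)) = a i" "\<sigma> (inv_into B \<sigma> (b i)) = b i"
        "inv_into A \<pi> (a i) \<in> A" "inv_into B \<sigma> (b i) \<in> B" if "i < m" for i
        using *(2) that by (auto simp: f_inv_into_f inv_into_into)
      then show "x \<in> ?L"
        unfolding *(1)
        by (intro CollectI exI[of _ m] exI[of _ "\<lambda>i. inv_into A \<pi> (a i)"] exI[of _ "\<lambda>i. inv_into B \<sigma> (b i)"]) simp
    qed
  qed
  then show ?thesis
    by (simp only: min_tensor_def tensor_cl_def)
qed

lemma tensor_alg_zero: "0 \<in> tensor_alg A B"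
  unfolding tensor_alg_def by (intro CollectI exI[of _ 0]) simp

lemma tensor_alg_elem: "a \<in> A \<Longrightarrow> b \<in> B \<Longrightarrow> tensor_op a b \<in> tensor_alg A B"
  unfolding tensor_alg_def
  by (intro CollectI exI[of _ 1] exI[of _ "\<lambda>_. a"] exI[of _ "\<lambda>_. b"]) simp

lemma tensor_algD:
  "x \<in> tensor_alg A B \<Longrightarrow> \<exists>(m::nat) a b. x = (\<Sum>i<m. tensor_op (a i) (b i)) \<and> (\<forall>i<m. a i \<in> A \<and> b i \<in> B)"
  unfolding tensor_alg_def by blast

lemma tensor_alg_add_elem:
  assumes "x \<in> tensor_alg A B" "a' \<in> A" "b' \<in> B"
  shows "x + tensor_op a' b' \<in> tensor_alg A B"
proof -
  obtain m :: nat and a b where *: "x = (\<Sum>i<m. tensor_op (a i) (b i))" "\<forall>i<m. a i \<in> A \<and> b i \<in> B"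
    using tensor_algD[OF assms(1)] by blast
  have "x + tensor_op a' b' = (\<Sum>i<Suc m. tensor_op ((a(m := a')) i) ((b(m := b')) i))"
    unfolding *(1) by simp
  then show ?thesis
    unfolding tensor_alg_def using * assms
    by (intro CollectI exI[of _ "Suc m"] exI[of _ "a(m := a')"] exI[of _ "b(m := b')"]) auto
qed

lemma tensor_alg_add: "x \<in> tensor_alg A B \<Longrightarrow> y \<in> tensor_alg A B \<Longrightarrow> x + y \<in> tensor_alg A B"
proof -
  assume x: "x \<in> tensor_alg A B"
  assume "y \<in> tensor_alg A B"
  then obtain m :: nat and a b where *: "y = (\<Sum>i<m. tensor_op (a i) (b i))" "\<forall>i<m. a i \<in> A \<and> b i \<in> B"
    using tensor_algD by blast
  have "x + (\<Sum>i<k. tensor_op (a i) (b i)) \<in> tensor_alg A B" if "k \<le> m" for k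
    using that
  proof (induction k)
    case (Suc k)
    have "x + (\<Sum>i<k. tensor_op (a i) (b i)) + tensor_op (a k) (b k) \<in> tensor_alg A B"
      using Suc * by (intro tensor_alg_add_elem) auto
    then show ?case by (simp add: add.assoc)
  qed (use x in simp)
  then show ?thesis using *(1) by simp
qed

lemma tensor_alg_sum: "(\<And>i. i \<in> I \<Longrightarrow> f i \<in> tensor_alg A B) \<Longrightarrow> (\<Sum>i\<in>I. f i) \<in> tensor_alg A B"
  by (induction I rule: infinite_finite_induct) (auto simp: tensor_alg_zero tensor_alg_add)

lemma cstar_subalgebra_closure:
  assumes E: "0 \<in> E" "\<And>x y. x \<in> E \<Longrightarrow> y \<in> E \<Longrightarrow> x + y \<in> E" "\<And>x y. x \<in> E \<Longrightarrow> y \<in> E \<Longrightarrow> x * y \<in> E"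
    "\<And>c x. x \<in> E \<Longrightarrow> c *\<^sub>C x \<in> E" "\<And>x. x \<in> E \<Longrightarrow> star x \<in> E"
  shows "cstar_subalgebra (closure E)"
  unfolding cstar_subalgebra_def
proof (intro conjI ballI allI)
  show "0 \<in> closure E" using E(1) closure_subset by blast
  fix x y c assume "x \<in> closure E" "y \<in> closure E"
  then obtain X Y where X: "\<And>n. X n \<in> E" "X \<longlonglongrightarrow> x" and Y: "\<And>n. Y n \<in> E" "Y \<longlonglongrightarrow> y"
    unfolding closure_sequential by blast
  show "x + y \<in> closure E"
    unfolding closure_sequential using X(1) Y(1) E(2) tendsto_add[OF X(2) Y(2)]
    by (intro exI[of _ "\<lambda>n. X n + Y n"]) simp
  show "x * y \<in> closure E"
    unfolding closure_sequential using X(1) Y(1) E(3) tendsto_mult[OF X(2) Y(2)]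
    by (intro exI[of _ "\<lambda>n. X n * Y n"]) simp
next
  fix x c assume "x \<in> closure E"
  then obtain X where X: "\<And>n. X n \<in> E" "X \<longlonglongrightarrow> x"
    unfolding closure_sequential by blast
  show "c *\<^sub>C x \<in> closure E"
    unfolding closure_sequential using X(1) E(4) tendsto_scaleC[OF X(2)]
    by (intro exI[of _ "\<lambda>n. c *\<^sub>C X n"]) simp
  show "star x \<in> closure E"
    unfolding closure_sequential using X(1) E(5) tendsto_star[OF X(2)]
    by (intro exI[of _ "\<lambda>n. star (X n)"]) simp
qed simp

context
  fixes A :: "'x l2op set" and B :: "'y l2op set"
  assumes A: "cstar_subalgebra A" and B: "cstar_subalgebra B"
begin

lemma cstar_subalgebra_tensor: "cstar_subalgebra (tensor_cl A B)"
  unfolding tensor_cl_def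
proof (rule cstar_subalgebra_closure)
  fix x y c assume x: "x \<in> tensor_alg A B"
  then obtain m :: nat and a b where *: "x = (\<Sum>i<m. tensor_op (a i) (b i))" "\<forall>i<m. a i \<in> A \<and> b i \<in> B"
    using tensor_algD by blast
  have "c *\<^sub>C x = (\<Sum>i<m. tensor_op (c *\<^sub>C a i) (b i))" "star x = (\<Sum>i<m. tensor_op (star (a i)) (star (b i)))"
    unfolding *(1) by (simp_all add: scaleC_sum_right star_sum tensor_op_linear tensor_op_star)
  then show "c *\<^sub>C x \<in> tensor_alg A B" "star x \<in> tensor_alg A B"
    using * by (auto intro!: tensor_alg_sum tensor_alg_elem cstar_subalgebraD[OF A] cstar_subalgebraD[OF B])
  assume "y \<in> tensor_alg A B"
  then obtain m' :: nat and a' b' where **: "y = (\<Sum>i<m'. tensor_op (a' i) (b' i))" "\<forall>i<m'. a' i \<in> A \<and> b' i \<in> B"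
    using tensor_algD by blast
  have "x * y = (\<Sum>i<m. \<Sum>j<m'. tensor_op (a i * a' j) (b i * b' j))"
    unfolding *(1) **(1) by (simp add: sum_product tensor_op_mult)
  then show "x * y \<in> tensor_alg A B"
    using * ** by (auto intro!: tensor_alg_sum tensor_alg_elem cstar_subalgebraD[OF A] cstar_subalgebraD[OF B])
qed (simp_all add: tensor_alg_zero tensor_alg_add)

lemma tensor_cl_elem: "a \<in> A \<Longrightarrow> b \<in> B \<Longrightarrow> tensor_op a b \<in> tensor_cl A B"
  unfolding tensor_cl_def using tensor_alg_elem closure_subset by blast

lemma tensor_cl_approx:
  assumes "h \<in> tensor_cl A B" "0 < e"
  shows "\<exists>(m::nat) a b. norm (h - (\<Sum>i<m. tensor_op (a i) (b i))) < e \<and> (\<forall>i<m. a i \<in> A \<and> b i \<in> B)"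
proof -
  obtain x where x: "x \<in> tensor_alg A B" "dist x h < e"
    using assms unfolding tensor_cl_def closure_approachable by blast
  have "norm (h - x) < e"
    using x(2) by (simp add: dist_norm norm_minus_commute)
  then show ?thesis
    using tensor_algD[OF x(1)] by blast
qed

lemma tensor_cl_induct:
  assumes h: "h \<in> tensor_cl A B" and X: "closed X" "0 \<in> X" "\<And>x y. x \<in> X \<Longrightarrow> y \<in> X \<Longrightarrow> x + y \<in> X"
    "\<And>a b. a \<in> A \<Longrightarrow> b \<in> B \<Longrightarrow> tensor_op a b \<in> X"
  shows "h \<in> X"
proof -
  have "tensor_alg A B \<subseteq> X"
  proof
    fix x assume "x \<in> tensor_alg A B"
    then obtain m :: nat and a b where *: "x = (\<Sum>i<m. tensor_op (a i) (b i))" "\<forall>i<m. a i \<in> A \<and> b i \<in> B"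
      using tensor_algD by blast
    have sum: "(\<Sum>i\<in>I. tensor_op (a i) (b i)) \<in> X" if "\<And>i. i \<in> I \<Longrightarrow> a i \<in> A \<and> b i \<in> B" for I
      using that by (induction I rule: infinite_finite_induct) (simp_all add: X)
    show "x \<in> X" unfolding *(1) by (rule sum) (use *(2) in simp)
  qed
  then show ?thesis
    using h X(1) unfolding tensor_cl_def by (meson closure_minimal subsetD)
qed

lemma slice_op_in: "h \<in> tensor_cl A B \<Longrightarrow> slice_op y h \<in> A"
proof -
  assume h: "h \<in> tensor_cl A B"
  have "h \<in> slice_op y -` A"
  proof (rule tensor_cl_induct[OF h])
    show "closed (slice_op y -` A)"
      by (intro closed_vimage cstar_subalgebraD(6)[OF A] linear_continuous_on bounded_linear_slice_op)
    show "0 \<in> slice_op y -` A"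
      by (simp add: linear_0[OF bounded_linear.linear[OF bounded_linear_slice_op]] cstar_subalgebraD(1)[OF A])
  qed (auto simp: slice_op_linear slice_op_tensor intro: cstar_subalgebraD[OF A])
  then show ?thesis by simp
qed

end

section \<open>Absence of minimal projections\<close>

lemma closed_idealI:
  assumes A: "cstar_subalgebra A" and X: "closed X" "0 \<in> X"
    "\<And>x y. x \<in> A \<Longrightarrow> y \<in> A \<Longrightarrow> x \<in> X \<Longrightarrow> y \<in> X \<Longrightarrow> x + y \<in> X"
    "\<And>c x. x \<in> A \<Longrightarrow> x \<in> X \<Longrightarrow> c *\<^sub>C x \<in> X"
    "\<And>x b. x \<in> A \<Longrightarrow> x \<in> X \<Longrightarrow> b \<in> A \<Longrightarrow> x * b \<in> X"
    "\<And>x b. x \<in> A \<Longrightarrow> x \<in> X \<Longrightarrow> b \<in> A \<Longrightarrow> b * x \<in> X"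
  shows "closed_ideal A (A \<inter> X)"
  unfolding closed_ideal_def
  by (intro conjI ballI allI closed_Int X(1) cstar_subalgebraD(6)[OF A])
    (simp_all add: X cstar_subalgebraD[OF A])

lemma simple_cstarD:
  assumes "simple_cstar A"
  shows "cstar_subalgebra A" "closed_ideal A I \<Longrightarrow> x \<in> I \<Longrightarrow> x \<noteq> 0 \<Longrightarrow> I = A"
  using assms unfolding simple_cstar_def by blast+

text \<open>Otherwise the elements \<open>x\<close> with \<open>u1 A x = 0\<close> form a closed
  ideal that contains \<open>u2\<close>, hence all of \<open>A\<close>. Taking
  \<open>x = u1 star u1\<close> makes the square of \<open>u1 star u1\<close> vanish, and with it
  \<open>u1\<close>.\<close>

lemma simple_cstar_prime:
  assumes simple: "simple_cstar A" and u: "u1 \<in> A" "u1 \<noteq> 0" "u2 \<in> A" "u2 \<noteq> 0"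
  shows "\<exists>c\<in>A. u1 * c * u2 \<noteq> 0"
proof (rule ccontr)
  assume "\<not> ?thesis"
  then have *: "u1 * c * u2 = 0" if "c \<in> A" for c using that by blast
  note A = simple_cstarD(1)[OF simple]
  define X where "X = (\<Inter>c\<in>A. {x. u1 * c * x = 0})"
  have X: "x \<in> X \<longleftrightarrow> (\<forall>c\<in>A. u1 * c * x = 0)" for x
    by (simp add: X_def)
  have "closed_ideal A (A \<inter> X)"
  proof (rule closed_idealI[OF A])
    show "closed X" unfolding X_def
      by (intro closed_INT ballI closed_Collect_eq continuous_intros)
    show "b * x \<in> X" if "x \<in> X" "b \<in> A" for x b
      unfolding X
    proof
      fix c assume "c \<in> A"
      then have "u1 * (c * b) * x = 0"
        using that X cstar_subalgebraD(3)[OF A] by blast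
      then show "u1 * c * (b * x) = 0" by (simp only: mult.assoc)
    qed
    show "x * b \<in> X" if "x \<in> X" "b \<in> A" for x b
      unfolding X
    proof
      fix c assume "c \<in> A"
      then have "u1 * c * x = 0"
        using that X by blast
      then show "u1 * c * (x * b) = 0" by (simp only: mult.assoc[symmetric] mult_zero_left)
    qed
  qed (simp_all add: X distrib_left mult_scaleC_right)
  moreover have "u2 \<in> A \<inter> X" using u * by (simp add: X)
  ultimately have "A \<inter> X = A"
    by (rule simple_cstarD(2)[OF simple _ _ u(4)])
  moreover have su: "star u1 \<in> A" "u1 * star u1 \<in> A"
    using u by (simp_all add: cstar_subalgebraD[OF A])
  ultimately have "u1 * star u1 \<in> X"
    by blast
  then have "u1 * star u1 * (u1 * star u1) = 0"
    using su(1) X by blast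
  then have "norm (u1 * star u1) = 0"
    using norm_selfadjoint_sq[of "u1 * star u1"] by (simp add: star_mult star_star)
  then show False using u(2) by (simp add: norm_star_mult_self)
qed

text \<open>The closed right ideal generated by the square root of \<open>a\<close>. The root is
  used because, for \<open>z\<close> and \<open>z'\<close> the limits of \<open>sqrt a * y n\<close>
  and \<open>sqrt a * y' n\<close>, the products \<open>star (y n) * a * y' n\<close> then converge
  to \<open>star z * z'\<close>, which is the form that \<open>copies\<close> asks for.\<close>

definition right_ideal :: "'x l2op set \<Rightarrow> 'x l2op \<Rightarrow> 'x l2op set"
  where "right_ideal A a = closure ((\<lambda>y. sqrt_op a * y) ` A)"

context
  fixes A :: "'x l2op set" and a :: "'x l2op"
  assumes A: "cstar_subalgebra A" and a: "a \<in> A" "pos_op a"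
begin

lemma right_ideal_seq: "x \<in> right_ideal A a \<longleftrightarrow> (\<exists>y. (\<forall>n::nat. y n \<in> A) \<and> (\<lambda>n. sqrt_op a * y n) \<longlonglongrightarrow> x)"
proof
  assume "x \<in> right_ideal A a"
  then obtain f where f: "\<forall>n. f n \<in> (\<lambda>y. sqrt_op a * y) ` A" "f \<longlonglongrightarrow> x"
    unfolding right_ideal_def closure_sequential by blast
  define y where "y n = inv_into A (\<lambda>y. sqrt_op a * y) (f n)" for n
  have "y n \<in> A" "sqrt_op a * y n = f n" for n
    using f(1) inv_into_into[of "f n" "\<lambda>y. sqrt_op a * y" A] f_inv_into_f[of "f n" "\<lambda>y. sqrt_op a * y" A]
    by (simp_all add: y_def)
  then show "\<exists>y. (\<forall>n. y n \<in> A) \<and> (\<lambda>n. sqrt_op a * y n) \<longlonglongrightarrow> x"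
    using f(2) by (intro exI[of _ y]) simp
next
  assume "\<exists>y. (\<forall>n. y n \<in> A) \<and> (\<lambda>n. sqrt_op a * y n) \<longlonglongrightarrow> x"
  then obtain y where "\<And>n. y n \<in> A" "(\<lambda>n. sqrt_op a * y n) \<longlonglongrightarrow> x"
    by blast
  then show "x \<in> right_ideal A a"
    unfolding right_ideal_def closure_sequential
    by (intro exI[of _ "\<lambda>n. sqrt_op a * y n"]) simp
qed

lemma right_ideal:
  shows "closed (right_ideal A a)" "0 \<in> right_ideal A a" "right_ideal A a \<subseteq> A"
    "x \<in> right_ideal A a \<Longrightarrow> y \<in> right_ideal A a \<Longrightarrow> x + y \<in> right_ideal A a"
    "x \<in> right_ideal A a \<Longrightarrow> r *\<^sub>R x \<in> right_ideal A a"
    "x \<in> right_ideal A a \<Longrightarrow> b \<in> A \<Longrightarrow> x * b \<in> right_ideal A a"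
    "a \<in> right_ideal A a"
proof -
  have s: "sqrt_op a \<in> A" "sqrt_op a * sqrt_op a = a"
    using sqrt_op_in[OF A a] sqrt_op[OF a(2)] by simp_all
  show cl: "closed (right_ideal A a)" by (simp add: right_ideal_def)
  show "0 \<in> right_ideal A a"
    unfolding right_ideal_seq by (intro exI[of _ "\<lambda>_. 0"]) (simp add: cstar_subalgebraD(1)[OF A])
  show "right_ideal A a \<subseteq> A"
    unfolding right_ideal_def
    by (rule closure_minimal) (auto intro: cstar_subalgebraD[OF A] s)
  show "a \<in> right_ideal A a"
    unfolding right_ideal_seq by (intro exI[of _ "\<lambda>_. sqrt_op a"]) (simp add: s)
  assume "x \<in> right_ideal A a"
  then obtain f where f: "\<And>n. f n \<in> A" "(\<lambda>n. sqrt_op a * f n) \<longlonglongrightarrow> x"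
    unfolding right_ideal_seq by blast
  show "r *\<^sub>R x \<in> right_ideal A a"
    unfolding right_ideal_seq using tendsto_scaleR[OF tendsto_const f(2), of r]
    by (intro exI[of _ "\<lambda>n. r *\<^sub>R f n"]) (simp add: f cstar_subalgebraD[OF A])
  show "x * b \<in> right_ideal A a" if "b \<in> A"
    unfolding right_ideal_seq using tendsto_mult[OF f(2) tendsto_const, of b] that
    by (intro exI[of _ "\<lambda>n. f n * b"]) (simp add: f cstar_subalgebraD[OF A] mult.assoc)
  assume "y \<in> right_ideal A a"
  then obtain g where g: "\<And>n. g n \<in> A" "(\<lambda>n. sqrt_op a * g n) \<longlonglongrightarrow> y"
    unfolding right_ideal_seq by blast
  show "x + y \<in> right_ideal A a"
    unfolding right_ideal_seq using tendsto_add[OF f(2) g(2)]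
    by (intro exI[of _ "\<lambda>n. f n + g n"]) (simp add: f g cstar_subalgebraD[OF A] distrib_left)
qed

lemma right_ideal_fc: "x \<in> right_ideal A a \<Longrightarrow> star x = x \<Longrightarrow> cont0 f \<Longrightarrow> fc f x \<in> right_ideal A a"
  using right_ideal(3) by (intro fc_in_closed) (auto intro: right_ideal)

text \<open>Without two nonzero orthogonal elements below \<open>a\<close>, every self-adjoint element below
  \<open>a\<close> has at most one nonzero spectral value.\<close>
lemma minimal_projection_exists:
  assumes a0: "a \<noteq> 0"
    and no: "\<And>u1 u2. u1 \<in> right_ideal A a \<Longrightarrow> u2 \<in> right_ideal A a \<Longrightarrow> star u1 = u1 \<Longrightarrow> star u2 = u2 \<Longrightarrow>
      u1 * u2 = 0 \<Longrightarrow> u1 = 0 \<or> u2 = 0"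
  obtains p where "p \<in> A" "p * p = p" "star p = p" "p \<noteq> 0" "\<And>y. y \<in> A \<Longrightarrow> \<exists>c. p * y * p = c *\<^sub>C p"
proof -
  have sq: "\<exists>m. m \<noteq> 0 \<and> x * x = m *\<^sub>R x" if x: "x \<in> right_ideal A a" "star x = x" "x \<noteq> 0" for x
  proof -
    obtain m where m: "m \<in> rspec UNIV x"
      using norm_in_rspec[OF cstar_subalgebra_UNIV UNIV_I x(2,3)] by blast
    have m0: "m \<noteq> 0"
      using rspec_nonzero[OF cstar_subalgebra_UNIV UNIV_I x(2) m] .
    have uniq: "t = m" if t: "t \<in> rspec UNIV x" for t
    proof (rule ccontr)
      assume tm: "t \<noteq> m"
      \<comment> \<open>Bumps supported where \<open>s\<close> is closer to \<open>m\<close>,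
        respectively closer to \<open>t\<close>; the factor \<open>s\<close> makes them vanish at 0.
        Their product is 0, and neither vanishes at its own spectral value.\<close>
      define f where "f s = s * max 0 (\<bar>s - t\<bar> - \<bar>s - m\<bar>)" for s
      define g where "g s = s * max 0 (\<bar>s - m\<bar> - \<bar>s - t\<bar>)" for s
      have f: "cont0 f" and g: "cont0 g"
        by (auto simp: cont0_def f_def[abs_def] g_def[abs_def] intro!: continuous_intros)
      have fg: "(\<lambda>s. f s * g s) = (\<lambda>s. 0)"
        by (auto simp: f_def g_def max_def)
      have "fc f x * fc g x = fc (\<lambda>s. 0) x"
        unfolding fc_add_mult(2)[OF x(2) f g, symmetric] fg ..
      also have "\<dots> = 0"
        using norm_fc_le[OF x(2) cont0_intros(6), of 0] by simp
      finally have "fc f x = 0 \<or> fc g x = 0"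
        using no right_ideal_fc[OF x(1,2)] star_fc[OF x(2)] f g by blast
      moreover have "f m \<noteq> 0" "g t \<noteq> 0"
        using tm m0 rspec_nonzero[OF cstar_subalgebra_UNIV UNIV_I x(2) t] by (auto simp: f_def g_def)
      ultimately show False
        using le_norm_fun_calc[OF cstar_subalgebra_UNIV UNIV_I x(2) f m]
          le_norm_fun_calc[OF cstar_subalgebra_UNIV UNIV_I x(2) g t] by auto
    qed
    have "x * x = fc (\<lambda>t. t * t) x"
      by (simp add: fc_add_mult(2)[OF x(2)] cont0_intros fc_id[OF x(2) cont0_intros(5) cont0_intros(5)])
    also have "\<dots> = fc (\<lambda>t. m * t) x"
      by (rule fc_cong[OF x(2)]) (auto intro!: cont0_intros dest: uniq)
    also have "\<dots> = m *\<^sub>R x"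
      by (simp add: fc_scale[OF x(2) cont0_intros(5) cont0_intros(5)] fc_id[OF x(2) cont0_intros(5) cont0_intros(5)])
    finally show ?thesis using m0 by blast
  qed
  have proj: "\<exists>m. m \<noteq> 0 \<and> (m *\<^sub>R x) * (m *\<^sub>R x) = m *\<^sub>R x" if x: "x \<in> right_ideal A a" "star x = x" "x \<noteq> 0" for x
  proof -
    obtain m where "m \<noteq> 0" "x * x = m *\<^sub>R x" using sq[OF x] by blast
    then show ?thesis by (intro exI[of _ "1 / m"]) simp
  qed
  obtain m where m: "m \<noteq> 0" "(m *\<^sub>R a) * (m *\<^sub>R a) = m *\<^sub>R a"
    using proj[OF right_ideal(7) pos_opD(1)[OF a(2)] a0] by blast
  define p where "p = m *\<^sub>R a"
  have p: "p \<in> right_ideal A a" "p * p = p" "star p = p" "p \<noteq> 0" "p \<in> A"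
    using m a0 right_ideal pos_opD(1)[OF a(2)] cstar_subalgebraD(9)[OF A a(1)] by (simp_all add: p_def star_scaleR)
  have sa: "\<exists>c. p * y * p = c *\<^sub>C p" if y: "y \<in> A" "star y = y" for y
  proof (cases "p * y * p = 0")
    case True
    then show ?thesis by (intro exI[of _ 0]) simp
  next
    case False
    define x where "x = p * y * p"
    have x: "x \<in> right_ideal A a" "star x = x" "x \<noteq> 0"
      using right_ideal(6)[OF right_ideal(6)[OF p(1) y(1)] p(5)] False
      by (simp_all add: x_def star_mult p y mult.assoc)
    obtain k where k: "k \<noteq> 0" "(k *\<^sub>R x) * (k *\<^sub>R x) = k *\<^sub>R x" using proj[OF x] by blast
    define q where "q = k *\<^sub>R x"
    have q: "q \<in> right_ideal A a" "star q = q" "q * q = q" "q \<noteq> 0" "p * q = q"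
      using k x by (simp_all add: q_def right_ideal star_scaleR) (simp add: x_def mult.assoc[symmetric] p)
    \<comment> \<open>\<open>q\<close> is a projection below \<open>p\<close>, so
      \<open>p - q\<close> and \<open>q\<close> are orthogonal and one of them must vanish.\<close>
    have pq: "p - q \<in> right_ideal A a"
      using right_ideal(4)[OF p(1) right_ideal(5)[OF q(1), of "-1"]] by simp
    have "p - q = 0 \<or> q = 0"
      by (rule no[OF pq q(1)]) (simp_all add: p q star_diff left_diff_distrib)
    then have "p = k *\<^sub>R x" using q by (simp add: q_def)
    then have "(1 / k) *\<^sub>R p = x"
      using k(1) by simp
    then have "x = complex_of_real (1 / k) *\<^sub>C p"
      by (simp only: scaleR_eq_scaleC)
    then show ?thesis unfolding x_def by blast
  qed
  have "\<exists>c. p * y * p = c *\<^sub>C p" if y: "y \<in> A" for y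
  proof -
    define y1 where "y1 = (1/2) *\<^sub>R (y + star y)"
    define y2 where "y2 = (- \<i> / 2) *\<^sub>C (y - star y)"
    have "y1 \<in> A" "star y1 = y1" "y2 \<in> A" "star y2 = y2"
      using y by (simp_all add: y1_def y2_def cstar_subalgebraD[OF A] star_scaleR star_scaleC star_add star_star
          star_diff add.commute scaleC_diff_right scaleC_minus_left)
    then obtain c1 c2 where c: "p * y1 * p = c1 *\<^sub>C p" "p * y2 * p = c2 *\<^sub>C p"
      using sa by blast
    have "y = y1 + \<i> *\<^sub>C y2"
    proof -
      have "\<i> *\<^sub>C y2 = (1/2) *\<^sub>R (y - star y)"
        by (simp add: y2_def scaleC_scaleC scaleR_eq_scaleC)
      then have "y1 + \<i> *\<^sub>C y2 = (1/2) *\<^sub>R (y + y)"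
        by (simp add: y1_def flip: scaleR_add_right)
      then show ?thesis by (simp flip: scaleR_2)
    qed
    then have "p * y * p = p * y1 * p + \<i> *\<^sub>C (p * y2 * p)"
      by (simp add: distrib_left distrib_right mult_scaleC_left mult_scaleC_right)
    also have "\<dots> = (c1 + \<i> * c2) *\<^sub>C p"
      by (simp add: c scaleC_scaleC scaleC_add_left)
    finally show ?thesis by blast
  qed
  then show thesis using that[of p] p by blast
qed

end

section \<open>Real rank-one projections in the 2 by 2 matrices\<close>

definition M2 :: "real \<Rightarrow> real \<Rightarrow> real \<Rightarrow> complex mat"
  where "M2 u v w = mat 2 2 (\<lambda>(i, j). complex_of_real (if i = 0 \<and> j = 0 then u else if i = 1 \<and> j = 1 then w else v))"

lemma M2_carrier: "M2 u v w \<in> carrier_mat 2 2"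
  by (simp add: M2_def)

lemma M2_index:
  "M2 u v w $$ (0, 0) = u" "M2 u v w $$ (0, Suc 0) = v" "M2 u v w $$ (Suc 0, 0) = v" "M2 u v w $$ (Suc 0, Suc 0) = w"
  by (simp_all add: M2_def)

lemma mat2_eqI:
  assumes "X \<in> carrier_mat 2 2" "Y \<in> carrier_mat 2 2"
    "X $$ (0, 0) = Y $$ (0, 0)" "X $$ (0, Suc 0) = Y $$ (0, Suc 0)"
    "X $$ (Suc 0, 0) = Y $$ (Suc 0, 0)" "X $$ (Suc 0, Suc 0) = Y $$ (Suc 0, Suc 0)"
  shows "X = Y"
proof (rule mat_eqI_carrier[OF assms(1,2)])
  fix i j :: nat assume "i < 2" "j < 2"
  then show "X $$ (i, j) = Y $$ (i, j)"
    using assms by (auto simp: less_2_cases_iff)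
qed

lemma M2_mult: "(M2 u v w * M2 u' v' w') $$ (0, 0) = u * u' + v * v'"
  "(M2 u v w * M2 u' v' w') $$ (0, Suc 0) = u * v' + v * w'"
  "(M2 u v w * M2 u' v' w') $$ (Suc 0, 0) = v * u' + w * v'"
  "(M2 u v w * M2 u' v' w') $$ (Suc 0, Suc 0) = v * v' + w * w'"
  using M2_carrier[of u v w] M2_carrier[of u' v' w']
  by (simp_all add: mat_alg_simps(2)[of _ 2] M2_index numeral_2_eq_2 del: index_mult_mat)

text \<open>A linear functional on these matrices is thus determined by three scalars. When
  \<open>u + w = 1\<close> and \<open>v^2 = u w\<close> the matrix is a rank-one projection with
  complement \<open>M2 w (- v) u\<close>, which is the source of all the orthogonal pairs used
  below.\<close>

lemma M2_linear: "M2 u v w = complex_of_real u *\<^sub>C M2 1 0 0 + (complex_of_real w *\<^sub>C M2 0 0 1 + complex_of_real v *\<^sub>C M2 0 1 0)"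
  by (rule mat2_eqI) (simp_all add: M2_carrier mat_alg_carrier mat_alg_simps[of _ 2] M2_index scaleC_complex_def)

context
  fixes u v w :: real
  assumes u: "u + w = 1" "v * v = u * w"
begin

lemma M2_projection: "M2 u v w * M2 u v w = M2 u v w" "star (M2 u v w) = M2 u v w"
proof -
  have "u * u + v * v = u * (u + w)" "u * v + v * w = v * (u + w)"
    "v * u + w * v = v * (u + w)" "v * v + w * w = w * (u + w)"
    by (simp_all only: u(2) distrib_left mult.commute)
  then have 1: "u * u + v * v = u" "u * v + v * w = v" "v * u + w * v = v" "v * v + w * w = w"
    by (simp_all only: u(1) mult_1_right)
  show "M2 u v w * M2 u v w = M2 u v w"
    by (rule mat2_eqI)
      (simp_all only: M2_carrier mat_alg_carrier M2_mult M2_index 1 flip: of_real_mult of_real_add)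
  show "star (M2 u v w) = M2 u v w"
    by (rule mat2_eqI)
      (simp_all add: M2_carrier mat_alg_carrier mat_alg_simps[of _ 2] M2_index star_complex_def)
qed

lemma M2_positive: "positive_in (cmat_alg 2) (M2 u v w)"
  by (rule positive_in_projection[OF M2_carrier M2_projection])

lemma M2_orth: "M2 u v w * M2 w (- v) u = 0\<^sub>m 2 2"
proof (rule mat2_eqI)
  have "u * w + v * - v = 0" "u * - v + v * u = 0" "v * w + w * - v = 0" "v * - v + w * u = 0"
    using u(2) by (simp_all add: mult.commute)
  then show "(M2 u v w * M2 w (- v) u) $$ (0, 0) = 0\<^sub>m 2 2 $$ (0, 0)"
    "(M2 u v w * M2 w (- v) u) $$ (0, Suc 0) = 0\<^sub>m 2 2 $$ (0, Suc 0)"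
    "(M2 u v w * M2 w (- v) u) $$ (Suc 0, 0) = 0\<^sub>m 2 2 $$ (Suc 0, 0)"
    "(M2 u v w * M2 w (- v) u) $$ (Suc 0, Suc 0) = 0\<^sub>m 2 2 $$ (Suc 0, Suc 0)"
    unfolding M2_mult by (simp_all flip: of_real_mult of_real_add of_real_minus)
qed (simp_all add: M2_carrier mat_alg_carrier)

lemma M2_opnorm: "mat_opnorm (M2 u v w) \<le> 1"
  unfolding mat_opnorm_def
proof (rule cSup_least)
  have "vec_l2norm (0\<^sub>v 2) \<le> 1"
    by (simp add: vec_l2norm_def L2_set_def)
  then show "{vec_l2norm (M2 u v w *\<^sub>v x) |x. x \<in> carrier_vec (dim_col (M2 u v w)) \<and> vec_l2norm x \<le> 1} \<noteq> {}"
    using M2_carrier[of u v w] by (auto intro!: exI[of _ "0\<^sub>v 2"])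
  fix s assume "s \<in> {vec_l2norm (M2 u v w *\<^sub>v x) |x. x \<in> carrier_vec (dim_col (M2 u v w)) \<and> vec_l2norm x \<le> 1}"
  then obtain x where x: "s = vec_l2norm (M2 u v w *\<^sub>v x)" "x \<in> carrier_vec 2" "vec_l2norm x \<le> 1"
    using M2_carrier[of u v w] by auto
  define \<alpha> \<beta> where "\<alpha> = vec_index x 0" and "\<beta> = vec_index x (Suc 0)"
  have nx: "(vec_l2norm x)\<^sup>2 = (cmod \<alpha>)\<^sup>2 + (cmod \<beta>)\<^sup>2"
    using x(2) by (simp add: vec_l2norm_def L2_set_def \<alpha>_def \<beta>_def numeral_2_eq_2 lessThan_Suc add.commute)
  have ind: "vec_index (M2 u v w *\<^sub>v x) 0 = u * \<alpha> + v * \<beta>" "vec_index (M2 u v w *\<^sub>v x) (Suc 0) = v * \<alpha> + w * \<beta>"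
    using x(2) M2_carrier[of u v w]
    by (simp_all add: scalar_prod_def numeral_2_eq_2 \<alpha>_def \<beta>_def M2_def)
  have "s\<^sup>2 = (cmod (u * \<alpha> + v * \<beta>))\<^sup>2 + (cmod (v * \<alpha> + w * \<beta>))\<^sup>2"
    using M2_carrier[of u v w] ind
    by (simp add: x(1) vec_l2norm_def L2_set_def numeral_2_eq_2 lessThan_Suc add.commute)
  \<comment> \<open>The added squares come from the complementary projection, so that the total is
    the squared norm of the vector.\<close>
  also have "\<dots> \<le> \<dots> + ((cmod (w * \<alpha> - v * \<beta>))\<^sup>2 + (cmod (- v * \<alpha> + u * \<beta>))\<^sup>2)"
    by simp
  also have "\<dots> = (cmod \<alpha>)\<^sup>2 + (cmod \<beta>)\<^sup>2"
  proof -
    have real: "(u * x + v * y)\<^sup>2 + (v * x + w * y)\<^sup>2 + (w * x - v * y)\<^sup>2 + (u * y - v * x)\<^sup>2 = x\<^sup>2 + y\<^sup>2" for x y :: real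
    proof -
      have "u * u + 2 * (v * v) + w * w = (u + w) * (u + w)"
        by (simp add: u(2) algebra_simps)
      then have "u * u + 2 * (v * v) + w * w = 1"
        by (simp only: u(1) mult_1_right)
      moreover have "(u * x + v * y)\<^sup>2 + (v * x + w * y)\<^sup>2 + (w * x - v * y)\<^sup>2 + (u * y - v * x)\<^sup>2
          = (u * u + 2 * (v * v) + w * w) * (x\<^sup>2 + y\<^sup>2)"
        by (simp add: power2_eq_square algebra_simps)
      ultimately show ?thesis by simp
    qed
    show ?thesis
      using real[of "Re \<alpha>" "Re \<beta>"] real[of "Im \<alpha>" "Im \<beta>"] by (simp add: cmod_power2)
  qed
  also have "\<dots> = (vec_l2norm x)\<^sup>2" by (simp only: nx)
  also have "\<dots> \<le> 1\<^sup>2"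
    using x(3) by (intro power_mono) (simp_all add: vec_l2norm_def)
  finally show "s \<le> 1"
    by (rule power2_le_imp_le) simp
qed

end

lemma norm_projection:
  fixes p :: "'a::cstar_algebra"
  assumes "p * p = p" "star p = p" "p \<noteq> 0" shows "norm p = 1"
proof -
  have "norm p * norm p = 1 * norm p"
    using norm_selfadjoint_sq[OF assms(2)] unfolding assms(1) power2_eq_square by linarith
  then show ?thesis
    using assms(3) by (simp only: mult_cancel_right norm_eq_zero) blast
qed

text \<open>The projection \<open>r = p + star y y\<close> has rank two over the minimal
  \<open>p\<close>, whereas \<open>v p star v\<close> has rank one. After compression by
  \<open>r\<close> it becomes \<open>w star w\<close> with
  \<open>w = \<alpha> p + \<beta> star y\<close>. The element
  \<open>u = \<beta> p - \<alpha> y\<close> satisfies \<open>u w = 0\<close> and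
  \<open>u r = u\<close>, so multiplying \<open>t r - w star w\<close> by \<open>u\<close> leaves
  \<open>t u\<close>. If \<open>u = 0\<close>, then \<open>w = 0\<close> already.\<close>

lemma rank_one_defect:
  fixes p y v :: "'a::cstar_algebra"
  assumes p: "p * p = p" "star p = p" "p \<noteq> 0" and y: "y * star y = p" "y * p = 0" "p * y = y"
    and min: "\<exists>\<alpha>. p * v * p = \<alpha> *\<^sub>C p" "\<exists>\<beta>. p * (y * v) * p = \<beta> *\<^sub>C p"
    and le: "norm (t *\<^sub>C (p + star y * y) - v * p * star v) \<le> (e::real)"
  shows "cmod t \<le> e"
proof -
  define q where "q = star y * y"
  define r where "r = p + q"
  have sy: "star y * p = star y" "p * star y = 0"
    using arg_cong[OF y(3), of star] arg_cong[OF y(2), of star] p(2) by (simp_all add: star_mult)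
  have q: "q * p = 0" "p * q = 0" "star q = q" "q * q = q" "y * q = y"
  proof -
    show "q * p = 0" by (simp add: q_def mult.assoc y)
    show "p * q = 0" by (simp add: q_def mult.assoc[symmetric] sy)
    show "star q = q" by (simp add: q_def star_mult star_star)
    have "y * q = y * star y * y" by (simp add: q_def mult.assoc)
    then show yq: "y * q = y" by (simp add: y)
    have "q * q = star y * (y * q)" by (simp add: q_def mult.assoc)
    then have "q * q = star y * y" by (simp only: yq)
    then show "q * q = q" by (simp only: q_def[symmetric])
  qed
  have r: "r * r = r" "star r = r" "p * r = p" "r * p = p" "y * r = y"
    by (simp_all add: r_def p q y distrib_left distrib_right star_add)
  have np: "norm p = 1"
    by (rule norm_projection[OF p])
  have nr: "norm r = 1"
  proof -
    have "norm p \<le> norm r * norm p" using norm_mult_ineq[of r p] r(4) by simp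
    then have "r \<noteq> 0" using np by (metis mult_zero_left norm_zero not_one_le_zero)
    then show ?thesis by (rule norm_projection[OF r(1,2)])
  qed
  obtain \<alpha> \<beta> where \<alpha>: "p * v * p = \<alpha> *\<^sub>C p" and \<beta>: "p * (y * v) * p = \<beta> *\<^sub>C p"
    using min by blast
  define w where "w = r * v * p"
  have w: "w = \<alpha> *\<^sub>C p + \<beta> *\<^sub>C star y"
  proof -
    have "q * v * p = star y * (y * v * p)" by (simp add: q_def mult.assoc)
    also have "y * v * p = p * (y * v) * p" by (simp only: mult.assoc[symmetric] y(3))
    finally have "q * v * p = \<beta> *\<^sub>C star y" by (simp add: \<beta> mult_scaleC_right sy)
    then show ?thesis by (simp add: w_def r_def distrib_right \<alpha>)
  qed
  have "r * (t *\<^sub>C r - v * p * star v) * r = t *\<^sub>C r - w * star w"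
  proof -
    have "star w = p * star v * r" by (simp add: w_def star_mult p(2) r(2) mult.assoc)
    then have "w * star w = r * v * (p * p) * star v * r" by (simp only: w_def mult.assoc)
    then have "w * star w = r * (v * p * star v) * r" by (simp only: p(1) mult.assoc)
    moreover have "r * (t *\<^sub>C r) * r = t *\<^sub>C r" by (simp add: mult_scaleC_left mult_scaleC_right r)
    ultimately show ?thesis by (simp only: right_diff_distrib left_diff_distrib)
  qed
  then have "norm (t *\<^sub>C r - w * star w) \<le> (norm r)\<^sup>2 * norm (t *\<^sub>C r - v * p * star v)"
    using norm_conj_le[of r "t *\<^sub>C r - v * p * star v"] r(2) by simp
  also have "\<dots> \<le> e" using le nr by (simp add: r_def q_def)
  finally have e: "norm (t *\<^sub>C r - w * star w) \<le> e" .
  define u where "u = \<beta> *\<^sub>C p - \<alpha> *\<^sub>C y"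
  have ur: "u * r = u" by (simp add: u_def left_diff_distrib mult_scaleC_left r)
  have uw: "u * w = 0"
    by (simp add: u_def w left_diff_distrib distrib_left mult_scaleC_left mult_scaleC_right scaleC_scaleC
        p y sy scaleC_add_right scaleC_diff_right scaleC_minus_right mult.commute)
  show ?thesis
  proof (cases "u = 0")
    case True
    have "u * p = \<beta> *\<^sub>C p" by (simp add: u_def left_diff_distrib mult_scaleC_left p y)
    then have b: "\<beta> = 0" using True p(3) by (simp add: scaleC_eq_0_iff)
    have "y \<noteq> 0" using y(1) p(3) by (metis mult_zero_left)
    then have "\<alpha> = 0" using True b by (simp add: u_def scaleC_eq_0_iff)
    then have "w = 0" using b w by simp
    then show ?thesis using e nr by (simp add: norm_scaleC)
  next
    case False
    have "u * (t *\<^sub>C r - w * star w) = t *\<^sub>C u"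
      by (simp add: right_diff_distrib mult_scaleC_right ur mult.assoc[symmetric] uw)
    then have "cmod t * norm u \<le> norm u * e"
      using norm_mult_ineq[of u "t *\<^sub>C r - w * star w"] mult_left_mono[OF e, of "norm u"]
      by (simp add: norm_scaleC)
    then show ?thesis using False by (simp add: mult.commute[of _ e])
  qed
qed

lemma mat_opnorm_one_le: "mat_opnorm (1\<^sub>m n) \<le> 1"
  unfolding mat_opnorm_def
proof (rule cSup_least)
  have "vec_l2norm (0\<^sub>v n) \<le> 1"
    by (simp add: vec_l2norm_def L2_set_def)
  then show "{vec_l2norm (1\<^sub>m n *\<^sub>v x) |x. x \<in> carrier_vec (dim_col (1\<^sub>m n)) \<and> vec_l2norm x \<le> 1} \<noteq> {}"
    by (auto intro!: exI[of _ "0\<^sub>v n"])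
qed auto

lemma cpc_order_zero_one:
  assumes A: "cstar_subalgebra A" and \<phi>: "cpc_order_zero n A \<phi>"
  shows "\<phi> (1\<^sub>m n) \<in> A" "pos_op (\<phi> (1\<^sub>m n))" "pos_op (1 - \<phi> (1\<^sub>m n))" "norm (\<phi> (1\<^sub>m n)) \<le> 1"
proof -
  have "positive_in A (\<phi> (1\<^sub>m n))"
    by (rule completely_positive_positive[OF A cpc_order_zeroD(4)[OF \<phi>] positive_one_mat])
  then show 1: "\<phi> (1\<^sub>m n) \<in> A" "pos_op (\<phi> (1\<^sub>m n))"
    by (simp_all add: positive_in_iff_pos_op[OF A])
  have "norm (\<phi> (1\<^sub>m n)) \<le> mat_opnorm (1\<^sub>m n :: complex mat)"
    by (rule cpc_order_zeroD(5)[OF \<phi>]) simp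
  also have "\<dots> \<le> 1" by (rule mat_opnorm_one_le)
  finally show n1: "norm (\<phi> (1\<^sub>m n)) \<le> 1" .
  have "pos_op (- \<phi> (1\<^sub>m n) + 1 *\<^sub>R 1)"
    using pos_opD(1)[OF 1(2)] n1 by (intro pos_op_add_norm) (simp_all add: star_minus)
  then show "pos_op (1 - \<phi> (1\<^sub>m n))" by simp
qed

lemma isomorphic_complex:
  fixes p :: "'a::cstar_algebra"
  assumes A: "\<And>x. x \<in> A \<longleftrightarrow> (\<exists>c. x = c *\<^sub>C p)" and p: "p * p = p" "star p = p" "p \<noteq> 0"
  shows "cstar_isomorphic A (UNIV :: complex set)"
proof -
  define \<theta> where "\<theta> c = c *\<^sub>C p" for c :: complex
  have hom: "star_hom_on UNIV \<theta>"
    unfolding star_hom_on_def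
    by (simp add: \<theta>_def scaleC_add_left mult_scaleC_left mult_scaleC_right scaleC_scaleC p star_scaleC
        scaleC_complex_def star_complex_def mult.commute)
  have inj: "inj_on \<theta> UNIV"
  proof (rule inj_onI)
    fix c d assume "\<theta> c = \<theta> d"
    then have "(c - d) *\<^sub>C p = 0" by (simp add: \<theta>_def scaleC_diff_left)
    then show "c = d" using p(3) by (simp add: scaleC_eq_0_iff)
  qed
  have "A = \<theta> ` UNIV" using A by (auto simp: \<theta>_def)
  moreover have "star_hom_on (\<theta> ` UNIV) (inv_into UNIV \<theta>)"
    by (rule star_hom_inv[OF cstar_subalgebra_UNIV hom inj])
  moreover have "bij_betw (inv_into UNIV \<theta>) (\<theta> ` UNIV) UNIV"
    by (rule bij_betw_inv_into[OF inj_on_imp_bij_betw[OF inj]])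
  ultimately show ?thesis
    unfolding cstar_isomorphic_def by blast
qed

lemma scaleC_inject: "(p::'a::cstar_algebra) \<noteq> 0 \<Longrightarrow> c *\<^sub>C p = d *\<^sub>C p \<Longrightarrow> c = d"
  using scaleC_eq_0_iff[of "c - d" p] by (simp add: scaleC_diff_left)

section \<open>Consequences of a hypothetical minimal projection\<close>

context
  fixes A :: "'x l2op set" and p :: "'x l2op"
  assumes simple: "simple_cstar A" and not_C: "\<not> cstar_isomorphic A (UNIV :: complex set)"
    and p: "p \<in> A" "p * p = p" "star p = p" "p \<noteq> 0"
    and min: "\<And>y. y \<in> A \<Longrightarrow> \<exists>c. p * y * p = c *\<^sub>C p"
begin

private lemma A: "cstar_subalgebra A" by (rule simple_cstarD(1)[OF simple])

text \<open>If \<open>p b = p b p\<close> held for every \<open>b\<close>, the elements fixed by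
  compression with \<open>p\<close> would form a closed ideal containing \<open>p\<close>, hence be
  all of \<open>A\<close>, and minimality would give \<open>A = C p\<close>. Otherwise
  \<open>y0 = p b - p b p\<close> is nonzero for some \<open>b\<close>, and minimality makes
  \<open>y0 star y0\<close> a multiple of \<open>p\<close>, which is then normalized.\<close>

lemma orthogonal_copy_exists:
  obtains y where "y \<in> A" "y * star y = p" "y * p = 0" "p * y = y"
proof -
  have "\<exists>b\<in>A. p * b - p * b * p \<noteq> 0"
  proof (rule ccontr)
    assume "\<not> ?thesis"
    then have "p * b - p * b * p = 0" if "b \<in> A" for b using that by blast
    then have pb: "p * b * p = p * b" if "b \<in> A" for b 
      by (rule eq_iff_diff_eq_0[THEN iffD2, symmetric]) (rule that)
    have bp: "p * b * p = b * p" if "b \<in> A" for b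
    proof -
      have "star (p * star b * p) = star (p * star b)"
        using pb[of "star b"] that by (simp add: cstar_subalgebraD[OF A])
      then show ?thesis by (simp add: star_mult star_star p mult.assoc)
    qed
    have "closed_ideal A (A \<inter> {x. p * x * p = x})"
    proof (rule closed_idealI[OF A])
      show "closed {x. p * x * p = x}" by (intro closed_Collect_eq continuous_intros)
      fix x b assume x: "x \<in> A" "x \<in> {x. p * x * p = x}" and b: "b \<in> A"
      have xe: "p * x * p = x" using x by simp
      have xp: "x * p = x" "p * x = x"
        using arg_cong[OF xe, of "\<lambda>t. t * p"] arg_cong[OF xe, of "\<lambda>t. p * t"] xe
        by (simp_all add: mult.assoc p)
      have "p * (x * b) * p = (p * x) * (b * p)" by (simp only: mult.assoc)
      also have "\<dots> = x * (p * b * p)" by (simp only: xp(2) bp[OF b])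
      also have "\<dots> = (x * p) * b" by (simp only: pb[OF b]) (simp only: mult.assoc)
      finally show "x * b \<in> {x. p * x * p = x}" by (simp only: mem_Collect_eq xp)
      have "p * (b * x) * p = (p * b) * (x * p)" by (simp only: mult.assoc)
      also have "\<dots> = (p * b * p) * x" by (simp only: xp pb[OF b])
      also have "\<dots> = b * (p * x)" by (simp only: bp[OF b]) (simp only: mult.assoc)
      finally show "b * x \<in> {x. p * x * p = x}" by (simp only: mem_Collect_eq xp)
    qed (simp_all add: distrib_left distrib_right mult_scaleC_left mult_scaleC_right)
    moreover have "p \<in> A \<inter> {x. p * x * p = x}" using p by simp
    ultimately have "A \<inter> {x. p * x * p = x} = A"
      by (rule simple_cstarD(2)[OF simple _ _ p(4)])
    then have pxp: "p * x * p = x" if "x \<in> A" for x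
      using that by blast
    have "x \<in> A \<longleftrightarrow> (\<exists>c. x = c *\<^sub>C p)" for x
    proof
      assume x: "x \<in> A"
      show "\<exists>c. x = c *\<^sub>C p" using min[OF x] unfolding pxp[OF x] .
    next
      assume "\<exists>c. x = c *\<^sub>C p"
      then show "x \<in> A" using cstar_subalgebraD(4)[OF A p(1)] by blast
    qed
    then show False
      using isomorphic_complex[of A p] p not_C by blast
  qed
  then obtain b where b: "b \<in> A" "p * b - p * b * p \<noteq> 0" by blast
  define y0 where "y0 = p * b - p * b * p"
  have y0: "y0 \<in> A" "y0 \<noteq> 0" "p * y0 = y0" "y0 * p = 0"
  proof -
    show "y0 \<in> A" using b p by (simp add: y0_def cstar_subalgebraD[OF A])
    show "y0 \<noteq> 0" using b by (simp add: y0_def)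
    show "p * y0 = y0" by (simp only: y0_def right_diff_distrib mult.assoc[symmetric] p)
    show "y0 * p = 0" by (simp add: y0_def left_diff_distrib mult.assoc p)
  qed
  have sy0: "star y0 * p = star y0"
    using arg_cong[OF y0(3), of star] by (simp add: star_mult p)
  obtain c where "p * (y0 * star y0) * p = c *\<^sub>C p"
    using min[OF cstar_subalgebraD(3)[OF A y0(1) cstar_subalgebraD(5)[OF A y0(1)]]] by blast
  moreover have "p * (y0 * star y0) * p = (p * y0) * (star y0 * p)" by (simp only: mult.assoc)
  ultimately have c: "y0 * star y0 = c *\<^sub>C p" by (simp only: y0 sy0)
  \<comment> \<open>Testing on such a vector shows that the scalar in
    \<open>y0 star y0 = c p\<close> is nonnegative.\<close>
  obtain v where v: "qf p v > 0"
  proof -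
    have "pos_op p" using pos_op_star_mult(1)[of p] p by simp
    then have "\<exists>v. \<not> qf p v \<le> 0" using pos_op_zeroI[of p] p(4) by blast
    then show thesis using that by (meson not_le)
  qed
  have "star (c *\<^sub>C p) = c *\<^sub>C p"
    unfolding c[symmetric] by (simp add: star_mult star_star)
  then have "cnj c *\<^sub>C p = c *\<^sub>C p"
    by (simp add: star_scaleC p(3))
  then have "cnj c = c" by (rule scaleC_inject[OF p(4)])
  then obtain s where s: "c = complex_of_real s"
    by (metis Reals_cnj_iff Reals_cases)
  have c': "y0 * star y0 = s *\<^sub>R p" by (simp only: c s scaleR_eq_scaleC)
  have "0 \<le> s * qf p v"
    using pos_opD(2)[OF pos_op_star_mult(2)[of y0], of v] by (simp add: c' qf_ops)
  then have "0 \<le> s" using v by (simp add: zero_le_mult_iff)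
  moreover have "s \<noteq> 0"
    using c' y0(2) norm_star_mult_self[of y0] by auto
  ultimately have s0: "0 < s" by simp
  define y where "y = (1 / sqrt s) *\<^sub>R y0"
  have "y * star y = p"
    using s0 c' by (simp add: y_def star_scaleR)
  then show thesis
    using that[of y] y0 by (simp add: y_def cstar_subalgebraD[OF A])
qed

context
  fixes y :: "'x l2op"
  assumes y: "y \<in> A" "y * star y = p" "y * p = 0" "p * y = y"
begin

private abbreviation "r \<equiv> p + star y * y"

private lemma sy: "star y * p = star y" "p * star y = 0" "norm y = 1" "norm p = 1"
proof -
  show "star y * p = star y" "p * star y = 0"
    using arg_cong[OF y(4), of star] arg_cong[OF y(3), of star] by (simp_all add: star_mult p)
  show np: "norm p = 1" by (rule norm_projection[OF p(2-4)])
  have "(norm y)\<^sup>2 = 1" using norm_star_mult_self[of y] by (simp add: y np)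
  then show "norm y = 1" using norm_ge_zero[of y] by (auto simp: power2_eq_1_iff)
qed

private lemma r: "r \<in> A" "star r = r" "r * r = r" "norm r = 1" "pos_op r"
proof -
  show rA: "r \<in> A" using p y by (simp add: cstar_subalgebraD[OF A])
  show sr: "star r = r" by (simp add: star_add star_mult star_star p)
  have "star y * y * (star y * y) = star y * (y * star y) * y" by (simp only: mult.assoc)
  also have "\<dots> = star y * y" by (simp only: y sy)
  finally have "star y * y * (star y * y) = star y * y" .
  moreover have "p * (star y * y) = 0" by (simp add: mult.assoc[symmetric] sy)
  moreover have "star y * y * p = 0" by (simp add: mult.assoc y)
  ultimately show rr: "r * r = r" by (simp add: distrib_left distrib_right p)
  have "r * p = p" using \<open>star y * y * p = 0\<close> by (simp add: distrib_right p)
  then have "r \<noteq> 0" using p(4) by (metis mult_zero_left)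
  then show "norm r = 1" by (rule norm_projection[OF rr sr])
  show "pos_op r" using pos_op_star_mult(1)[of r] by (simp only: sr rr)
qed

text \<open>Write \<open>r = p + q\<close>. The two off-diagonal corners of \<open>h\<close> are
  compressed commutators with \<open>p\<close>, and the corner at \<open>q\<close> is carried by
  \<open>y\<close> to the one at \<open>p\<close>, at the cost of the commutator with
  \<open>y\<close>. That accounts for three errors \<open>e\<close>.\<close>

lemma compress_estimate:
  assumes h: "p * h * p = t *\<^sub>C p" and e: "norm (h * p - p * h) \<le> e" "norm (h * y - y * h) \<le> e"
  shows "norm (r * h * r - t *\<^sub>C r) \<le> 3 * e"
proof -
  define q where "q = star y * y"
  have q: "p * q = 0" "q * p = 0" "norm q = 1"
    using norm_star_mult_self[of "star y"]
    by (simp_all add: q_def mult.assoc y) (simp_all add: mult.assoc[symmetric] sy star_star cstar_identity)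
  have 1: "p * h * q = - ((h * p - p * h) * q)"
    by (simp add: left_diff_distrib mult.assoc q)
  have 2: "q * h * p = q * (h * p - p * h)"
    by (simp add: right_diff_distrib mult.assoc[symmetric] q)
  have 3: "q * h * q - t *\<^sub>C q = - (star y * ((h * y - y * h) * star y) * y)"
  proof -
    have "star y * (h * y * star y) * y = star y * (h * p) * y"
      by (simp only: mult.assoc y(2))
    also have "\<dots> = (star y * p) * (h * p) * y" by (simp only: sy)
    also have "\<dots> = star y * (p * h * p) * y" by (simp only: mult.assoc)
    also have "\<dots> = t *\<^sub>C (star y * y)"
      by (simp add: h mult_scaleC_left mult_scaleC_right sy)
    finally have "star y * (h * y * star y) * y = t *\<^sub>C q" by (simp only: q_def)
    moreover have "star y * (y * h * star y) * y = q * h * q"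
      by (simp only: q_def mult.assoc)
    ultimately show ?thesis
      by (simp only: left_diff_distrib right_diff_distrib) simp
  qed
  have n1: "norm (p * h * q) \<le> e"
    unfolding 1 norm_minus_cancel using norm_mult_ineq[of "h * p - p * h" q] e(1) by (simp add: q)
  have n2: "norm (q * h * p) \<le> e"
    unfolding 2 using norm_mult_ineq[of q "h * p - p * h"] e(1) by (simp add: q)
  have n3: "norm (q * h * q - t *\<^sub>C q) \<le> e"
  proof -
    have "norm (star y * ((h * y - y * h) * star y) * y) \<le> norm (star y * ((h * y - y * h) * star y)) * norm y"
      by (rule norm_mult_ineq)
    also have "\<dots> \<le> norm ((h * y - y * h) * star y)"
      using norm_mult_ineq[of "star y" "(h * y - y * h) * star y"] by (simp add: sy)
    also have "\<dots> \<le> norm (h * y - y * h)"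
      using norm_mult_ineq[of "h * y - y * h" "star y"] by (simp add: sy)
    finally show ?thesis unfolding 3 norm_minus_cancel using e(2) by simp
  qed
  have "r * h * r - t *\<^sub>C r = p * h * q + (q * h * p + (q * h * q - t *\<^sub>C q))"
    unfolding q_def[symmetric] by (simp add: distrib_left distrib_right h scaleC_add_right)
  then have "norm (r * h * r - t *\<^sub>C r) \<le> norm (p * h * q) + (norm (q * h * p) + norm (q * h * q - t *\<^sub>C q))"
    using norm_triangle_ineq[of "p * h * q" "q * h * p + (q * h * q - t *\<^sub>C q)"]
      norm_triangle_ineq[of "q * h * p" "q * h * q - t *\<^sub>C q"] by simp
  then show ?thesis using n1 n2 n3 by simp
qed

text \<open>\<open>a\<close>, \<open>b\<close>, \<open>k\<close> are the compressions by
  \<open>p\<close> of the order zero map at the two diagonal matrix units and at the flip.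
  Absorption is applied with \<open>x = r\<close> and small element \<open>p\<close>: the defect
  \<open>r - r \<phi>(1) r\<close>, close to \<open>(1 - (a + b)) r\<close>, is almost dominated by
  rank one, so \<open>rank_one_defect\<close> makes \<open>1 - (a + b)\<close> small. The five
  errors are three from compressing, one from the cut and one from the Cuntz relation.\<close>

lemma order_zero_scalars:
  assumes Z: "tracially_Z_absorbing A" and e: "0 < e"
  shows "\<exists>a b k. cmod (1 - (a + b)) \<le> 5 * e \<and>
    (\<forall>u v w. u + w = 1 \<longrightarrow> v * v = u * w \<longrightarrow>
      cmod ((complex_of_real u * a + (complex_of_real w * b + complex_of_real v * k)) * (complex_of_real w * a + (complex_of_real u * b + complex_of_real (- v) * k))) \<le> e)"
proof -
  have pp: "pos_op p" using pos_op_star_mult(1)[of p] p by simp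
  have "positive_in A r" "positive_in A p"
    using r p pp by (simp_all add: positive_in_iff_pos_op[OF A])
  then obtain \<phi> where \<phi>: "cpc_order_zero 2 A \<phi>"
    and cut: "cuntz_below A (cut_down A (r * r - r * \<phi> (1\<^sub>m 2) * r) e) p"
    and comm: "\<forall>z\<in>carrier_mat 2 2. mat_opnorm z \<le> 1 \<longrightarrow> (\<forall>b\<in>{p, y}. norm (\<phi> z * b - b * \<phi> z) < e)"
    using tracially_Z_absorbingD(3)[OF Z, of r p "{p, y}" e 2] e p y by auto
  note \<phi>D = cpc_order_zeroD[OF \<phi>]
  define T where "T z = (SOME c. p * \<phi> z * p = c *\<^sub>C p)" for z
  have T: "p * \<phi> z * p = T z *\<^sub>C p" if "z \<in> carrier_mat 2 2" for z
    unfolding T_def by (rule someI_ex, rule min, rule \<phi>D(1)[OF that])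
  define a b k where "a = T (M2 1 0 0)" and "b = T (M2 0 0 1)" and "k = T (M2 0 1 0)"
  have TM: "T (M2 u v w) = complex_of_real u * a + (complex_of_real w * b + complex_of_real v * k)" for u v w
  proof (rule scaleC_inject[OF p(4)])
    have "\<phi> (M2 u v w) = complex_of_real u *\<^sub>C \<phi> (M2 1 0 0)
      + (complex_of_real w *\<^sub>C \<phi> (M2 0 0 1) + complex_of_real v *\<^sub>C \<phi> (M2 0 1 0))"
      by (subst M2_linear) (simp add: \<phi>D M2_carrier mat_alg_carrier)
    then have "p * \<phi> (M2 u v w) * p = complex_of_real u *\<^sub>C (p * \<phi> (M2 1 0 0) * p)
      + (complex_of_real w *\<^sub>C (p * \<phi> (M2 0 0 1) * p) + complex_of_real v *\<^sub>C (p * \<phi> (M2 0 1 0) * p))"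
      by (simp add: distrib_left distrib_right mult_scaleC_left mult_scaleC_right)
    then show "T (M2 u v w) *\<^sub>C p = (complex_of_real u * a + (complex_of_real w * b + complex_of_real v * k)) *\<^sub>C p"
      by (simp add: T M2_carrier a_def b_def k_def scaleC_add_left scaleC_scaleC)
  qed
  have one: "1\<^sub>m 2 = M2 1 0 1"
    by (rule mat2_eqI) (simp_all add: M2_carrier M2_index)
  define h where "h = \<phi> (1\<^sub>m 2)"
  have h: "h \<in> A" "pos_op h" "pos_op (1 - h)"
    using cpc_order_zero_one[OF A \<phi>] by (simp_all add: h_def)
  have ph: "p * h * p = (a + b) *\<^sub>C p"
    unfolding h_def using T[of "1\<^sub>m 2"] TM[of 1 0 1] by (simp add: one M2_carrier)
  define c where "c = r * r - r * h * r"
  have cpos: "pos_op c"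
  proof -
    have "c = star r * (1 - h) * r" unfolding r(2) by (simp only: c_def left_diff_distrib right_diff_distrib mult_1_right)
    then show ?thesis using pos_op_conj[OF h(3)] by simp
  qed
  have cA: "c \<in> A" unfolding c_def using r(1) h(1) by (simp only: cstar_subalgebraD[OF A])
  have "cut_down A c e = cut e c"
    using e by (intro cut_down_eq_fc[OF A cA pos_opD(1)[OF cpos]]) simp
  then have "cuntz_below A (cut e c) p" using cut by (simp only: c_def h_def)
  then obtain v where v: "v \<in> A" "norm (cut e c - v * p * star v) < e"
    using cuntz_belowD[OF _ e] by blast
  have n1: "norm (c - cut e c) \<le> e"
    by (rule norm_cut_diff[OF pos_opD(1)[OF cpos] cpos]) (use e in simp)
  have n2: "norm (r * h * r - (a + b) *\<^sub>C r) \<le> 3 * e"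
    using comm mat_opnorm_one_le[of 2]
    by (intro compress_estimate[OF ph]) (simp_all add: h_def less_imp_le)
  have eq: "(1 - (a + b)) *\<^sub>C r - v * p * star v
      = (r * h * r - (a + b) *\<^sub>C r) + ((c - cut e c) + (cut e c - v * p * star v))"
    by (simp only: c_def r(3) scaleC_diff_left scaleC_one) simp
  have "norm ((1 - (a + b)) *\<^sub>C r - v * p * star v) \<le> 5 * e"
    unfolding eq
    using norm_triangle_ineq[of "r * h * r - (a + b) *\<^sub>C r" "(c - cut e c) + (cut e c - v * p * star v)"]
      norm_triangle_ineq[of "c - cut e c" "cut e c - v * p * star v"] n1 n2 v(2) by linarith
  then have "cmod (1 - (a + b)) \<le> 5 * e"
    using min[OF v(1)] min[of "y * v"] y v(1)
    by (intro rank_one_defect[OF p(2-4) y(2-4)]) (simp_all add: cstar_subalgebraD[OF A])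
  moreover have "cmod (T (M2 u v w) * T (M2 w (- v) u)) \<le> e" if uvw: "u + w = 1" "v * v = u * w" for u v w
  proof -
    have uvw': "w + u = 1" "- v * - v = w * u" using uvw by (simp_all add: mult.commute)
    define P Q where "P = \<phi> (M2 u v w)" and "Q = \<phi> (M2 w (- v) u)"
    have PQ: "P * Q = 0"
      unfolding P_def Q_def
      by (rule \<phi>D(6)[OF M2_positive[OF uvw] M2_positive[OF uvw'] M2_orth[OF uvw]])
    have nP: "norm P \<le> 1"
      unfolding P_def by (rule order_trans[OF \<phi>D(5)[OF M2_carrier] M2_opnorm[OF uvw]])
    have nQ: "norm (Q * p - p * Q) \<le> e"
      using comm M2_carrier[of w "- v" u] M2_opnorm[OF uvw'] by (simp add: Q_def less_imp_le)
    have "(T (M2 u v w) * T (M2 w (- v) u)) *\<^sub>C p = (p * P * p) * (p * Q * p)"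
      by (simp add: P_def Q_def T M2_carrier mult_scaleC_left mult_scaleC_right scaleC_scaleC p mult.commute)
    also have "\<dots> = p * P * (p * p) * Q * p" by (simp only: mult.assoc)
    \<comment> \<open>The inner \<open>p\<close> is moved past \<open>Q\<close>, which costs one
      commutator; what remains contains \<open>P * Q = 0\<close>.\<close>
    also have "\<dots> = p * (P * Q) * (p * p) - p * (P * (Q * p - p * Q)) * p"
      by (simp add: p left_diff_distrib right_diff_distrib mult.assoc)
    also have "\<dots> = - (p * (P * (Q * p - p * Q)) * p)" by (simp add: PQ)
    finally have "cmod (T (M2 u v w) * T (M2 w (- v) u)) = norm (p * (P * (Q * p - p * Q)) * p)"
      using norm_scaleC[of "T (M2 u v w) * T (M2 w (- v) u)" p] by (simp add: sy)
    also have "\<dots> \<le> norm (p * (P * (Q * p - p * Q)))"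
      using norm_mult_ineq[of "p * (P * (Q * p - p * Q))" p] by (simp add: sy)
    also have "\<dots> \<le> norm (P * (Q * p - p * Q))"
      using norm_mult_ineq[of p "P * (Q * p - p * Q)"] by (simp add: sy)
    also have "\<dots> \<le> norm P * norm (Q * p - p * Q)" by (rule norm_mult_ineq)
    also have "\<dots> \<le> 1 * e" by (intro mult_mono nP nQ) simp_all
    finally show ?thesis by simp
  qed
  ultimately show ?thesis
    unfolding TM by blast
qed

end

text \<open>In the limit the scalars satisfy \<open>a b = 0\<close>, \<open>(a + b)\<^sup>2 = k\<^sup>2\<close> and
  \<open>k (a - b) = 0\<close>, hence \<open>(a + b)\<^sup>4 = 0\<close>, contradicting \<open>a + b = 1\<close>.\<close>
lemma no_minimal_projection: "\<not> tracially_Z_absorbing A"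
proof
  assume Z: "tracially_Z_absorbing A"
  obtain y where y: "y \<in> A" "y * star y = p" "y * p = 0" "p * y = y"
    by (rule orthogonal_copy_exists)
  have ex: "\<exists>a b k. cmod (1 - (a + b)) \<le> 5 * inverse (real (Suc n)) \<and>
    (\<forall>u v w. u + w = 1 \<longrightarrow> v * v = u * w \<longrightarrow>
      cmod ((complex_of_real u * a + (complex_of_real w * b + complex_of_real v * k)) * (complex_of_real w * a + (complex_of_real u * b + complex_of_real (- v) * k))) \<le> inverse (real (Suc n)))" for n
    by (rule order_zero_scalars[OF y Z]) simp
  obtain a b k :: "nat \<Rightarrow> complex" where 1: "\<And>n. cmod (1 - (a n + b n)) \<le> 5 * inverse (real (Suc n))"
    and 2: "\<And>n u v w. u + w = 1 \<Longrightarrow> v * v = u * w \<Longrightarrow>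
      cmod ((complex_of_real u * a n + (complex_of_real w * b n + complex_of_real v * k n)) * (complex_of_real w * a n + (complex_of_real u * b n + complex_of_real (- v) * k n))) \<le> inverse (real (Suc n))"
    using ex by metis
  have S: "(\<lambda>n. 1 - (a n + b n)) \<longlonglongrightarrow> 0"
  proof (rule Lim_null_comparison)
    show "\<forall>\<^sub>F n in sequentially. norm (1 - (a n + b n)) \<le> 5 * inverse (real (Suc n))"
      using 1 by (intro always_eventually allI)
    show "(\<lambda>n. 5 * inverse (real (Suc n))) \<longlonglongrightarrow> 0"
      using tendsto_mult_right_zero[OF LIMSEQ_inverse_real_of_nat, of 5] by simp
  qed
  have X: "(\<lambda>n. (complex_of_real u * a n + (complex_of_real w * b n + complex_of_real v * k n)) * (complex_of_real w * a n + (complex_of_real u * b n + complex_of_real (- v) * k n))) \<longlonglongrightarrow> 0"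
    if "u + w = 1" "v * v = u * w" for u v w
    by (rule Lim_null_comparison[OF _ LIMSEQ_inverse_real_of_nat])
      (use 2[OF that] in \<open>intro always_eventually allI\<close>)
  have X1: "(\<lambda>n. a n * b n) \<longlonglongrightarrow> 0"
    using X[of 1 0 0] by simp
  have X2: "(\<lambda>n. (a n + b n)\<^sup>2 - (k n)\<^sup>2) \<longlonglongrightarrow> 0"
  proof -
    have "(\<lambda>n. 4 * ((complex_of_real (1/2) * a n + ((1/2::real) * b n + (1/2::real) * k n)) * ((1/2::real) * a n + ((1/2::real) * b n + complex_of_real (- (1/2)) * k n)))) \<longlonglongrightarrow> 4 * 0"
      by (intro tendsto_mult tendsto_const X) simp_all
    then show ?thesis by (simp add: power2_eq_square algebra_simps)
  qed
  \<comment> \<open>The pair \<open>X1\<close>, \<open>X2\<close> uses the projections for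
    \<open>(u, v, w) = (1, 0, 0)\<close> and \<open>(1/2, 1/2, 1/2)\<close>. A third one with
    \<open>u \<noteq> w\<close> and \<open>v \<noteq> 0\<close> is needed to see
    \<open>k (a - b)\<close>; the triple 3, 4, 5 provides rational entries 16/25, 12/25,
    9/25.\<close>
  have X3: "(\<lambda>n. (16 * a n + (9 * b n + 12 * k n)) * (9 * a n + (16 * b n + - 12 * k n))) \<longlonglongrightarrow> 0"
  proof -
    have "(\<lambda>n. 625 * ((complex_of_real (16/25) * a n + ((9/25::real) * b n + (12/25::real) * k n)) * ((9/25::real) * a n + ((16/25::real) * b n + complex_of_real (- (12/25)) * k n)))) \<longlonglongrightarrow> 625 * 0"
      by (intro tendsto_mult tendsto_const X) simp_all
    then show ?thesis by (simp add: algebra_simps)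
  qed
  have K: "(\<lambda>n. k n * (a n - b n)) \<longlonglongrightarrow> 0"
  proof -
    \<comment> \<open>Expanding the third product leaves \<open>-84 k (a - b)\<close> besides
      multiples of the two quantities already known to tend to 0.\<close>
    have eq: "k n * (a n - b n) = (1/84) * (49 * (a n * b n) - (16 * a n + (9 * b n + 12 * k n)) * (9 * a n + (16 * b n + - 12 * k n))
        + 144 * ((a n + b n)\<^sup>2 - (k n)\<^sup>2))" for n
      by (simp add: power2_eq_square algebra_simps)
    have "(\<lambda>n. (1/84) * (49 * (a n * b n) - (16 * a n + (9 * b n + 12 * k n)) * (9 * a n + (16 * b n + - 12 * k n))
        + 144 * ((a n + b n)\<^sup>2 - (k n)\<^sup>2))) \<longlonglongrightarrow> (1/84) * (49 * 0 - 0 + 144 * 0)"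
      by (intro tendsto_intros X1 X2 X3)
    then show ?thesis unfolding eq[symmetric] by simp
  qed
  \<comment> \<open>The term is identically 0, since
    \<open>k^2 = (a + b)^2 - ((a + b)^2 - k^2)\<close> and
    \<open>(a - b)^2 = (a + b)^2 - 4 a b\<close>, but its limit is -1. Writing \<open>a + b\<close>
    as \<open>1 - (1 - (a + b))\<close> lets the limit \<open>S\<close> apply.\<close>
  have "(\<lambda>n. (k n * (a n - b n))\<^sup>2 - ((1 - (1 - (a n + b n)))\<^sup>2 - ((a n + b n)\<^sup>2 - (k n)\<^sup>2)) *
      ((1 - (1 - (a n + b n)))\<^sup>2 - 4 * (a n * b n))) \<longlonglongrightarrow> 0\<^sup>2 - ((1 - 0)\<^sup>2 - 0) * ((1 - 0)\<^sup>2 - 4 * 0)"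
    by (intro tendsto_intros K S X1 X2)
  moreover have "(k n * (a n - b n))\<^sup>2 - ((1 - (1 - (a n + b n)))\<^sup>2 - ((a n + b n)\<^sup>2 - (k n)\<^sup>2)) *
      ((1 - (1 - (a n + b n)))\<^sup>2 - 4 * (a n * b n)) = 0" for n
  proof -
    have "(a n - b n)\<^sup>2 = (a n + b n)\<^sup>2 - 4 * (a n * b n)" by (simp add: power2_eq_square algebra_simps)
    then show ?thesis by (simp add: power_mult_distrib)
  qed
  ultimately show False
    by (simp add: LIMSEQ_const_iff)
qed

end

section \<open>Orthogonal copies below a positive element\<close>

text \<open>Approximately, \<^term>\<open>k\<close> pairwise orthogonal copies of \<^term>\<open>d\<close> fit below
  \<^term>\<open>a\<close>, i.e. \<open>d \<otimes> 1\<^sub>k \<precsim> a\<close>.\<close>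
definition copies :: "'x l2op set \<Rightarrow> 'x l2op \<Rightarrow> 'x l2op \<Rightarrow> nat \<Rightarrow> bool"
  where "copies A a d k \<longleftrightarrow> (\<forall>e>0. \<exists>y. (\<forall>i<k. y i \<in> A) \<and>
    (\<forall>i<k. \<forall>j<k. norm (star (y i) * a * y j - (if i = j then d else 0)) < e))"

context
  fixes A :: "'x l2op set"
  assumes Z: "tracially_Z_absorbing A"
begin

private lemma simpleA: "simple_cstar A" by (rule tracially_Z_absorbingD(1)[OF Z])
private lemma subA: "cstar_subalgebra A" by (rule simple_cstarD(1)[OF simpleA])

lemma orthogonal_pair_exists:
  assumes a: "a \<in> A" "pos_op a" "a \<noteq> 0"
  shows "\<exists>u1 u2. u1 \<in> right_ideal A a \<and> u2 \<in> right_ideal A a \<and> star u1 = u1 \<and> star u2 = u2 \<and>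
      u1 * u2 = 0 \<and> u1 \<noteq> 0 \<and> u2 \<noteq> 0"
proof (rule ccontr)
  assume no: "\<not> ?thesis"
  obtain p where p: "p \<in> A" "p * p = p" "star p = p" "p \<noteq> 0" "\<And>y. y \<in> A \<Longrightarrow> \<exists>c. p * y * p = c *\<^sub>C p"
    by (rule minimal_projection_exists[OF subA a]) (use no in blast)+
  show False
    using no_minimal_projection[OF simpleA tracially_Z_absorbingD(2)[OF Z] p] Z by blast
qed

text \<open>By primeness there is a nonzero \<open>z = u1 c u2\<close>. Put
  \<open>d = star z z\<close> and \<open>m\<close> its root. Both \<open>z\<close> and
  \<open>m\<close> lie in the right ideal and have \<open>star z z = m m = d\<close>; as
  \<open>star z\<close> ends in \<open>u1\<close> and \<open>u1 d = 0\<close>, they satisfy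
  \<open>star z m = 0\<close>. Approximating \<open>z\<close> and \<open>m\<close> by
  \<open>sqrt a * y n\<close> gives the two copies.\<close>

lemma copies_two:
  assumes a: "a \<in> A" "pos_op a" "a \<noteq> 0"
  shows "\<exists>d\<in>A. pos_op d \<and> d \<noteq> 0 \<and> copies A a d 2"
proof -
  obtain u1 u2 where u: "u1 \<in> right_ideal A a" "u2 \<in> right_ideal A a" "star u1 = u1" "star u2 = u2"
    "u1 * u2 = 0" "u1 \<noteq> 0" "u2 \<noteq> 0"
    using orthogonal_pair_exists[OF a] by blast
  note R = right_ideal[OF subA a(1,2)]
  have uA: "u1 \<in> A" "u2 \<in> A" using u R(3) by auto
  obtain c where c: "c \<in> A" "u1 * c * u2 \<noteq> 0"
    using simple_cstar_prime[OF simpleA uA(1) u(6) uA(2) u(7)] by blast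
  define z where "z = u1 * c * u2"
  define d where "d = star z * z"
  have zz: "star z = u2 * star c * u1" by (simp add: z_def star_mult u mult.assoc)
  have zR: "z \<in> right_ideal A a" "d \<in> right_ideal A a"
  proof -
    show 1: "z \<in> right_ideal A a"
      unfolding z_def by (intro R(6) u c uA)
    have "star c * u1 * z \<in> A"
      using 1 R(3) c(1) uA(1) by (intro cstar_subalgebraD[OF subA]) auto
    from R(6)[OF u(2) this] show "d \<in> right_ideal A a"
      by (simp only: d_def zz mult.assoc)
  qed
  have d: "d \<in> A" "pos_op d" "d \<noteq> 0"
    using zR R(3) pos_op_star_mult(1)[of z] star_mult_self_eq_0_iff[of z] c(2) by (auto simp: d_def z_def)
  define m where "m = sqrt_op d"
  have m: "m * m = d" "star m = m" using sqrt_op[OF d(2)] by (simp_all add: m_def)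
  have mR: "m \<in> right_ideal A a"
    unfolding m_def sqrt_op_def
    by (rule right_ideal_fc[OF subA a(1,2) zR(2) pos_opD(1)[OF d(2)]]) auto
  have "u1 * d = 0" unfolding d_def zz by (simp only: mult.assoc[symmetric] u(5) mult_zero_left)
  then have um: "u1 * m = 0"
    unfolding m_def sqrt_op_def by (intro mult_fc_eq_0 pos_opD(1)[OF d(2)]) auto
  then have zm: "star z * m = 0" by (simp add: zz mult.assoc)
  have "m * z = star (star z * m)" by (simp add: star_mult star_star m)
  then have mz: "m * z = 0" by (simp add: zm)
  obtain f where f: "\<And>n. f n \<in> A" "(\<lambda>n. sqrt_op a * f n) \<longlonglongrightarrow> z"
    using zR(1) unfolding right_ideal_seq[OF subA a(1,2)] by blast
  obtain g where g: "\<And>n. g n \<in> A" "(\<lambda>n. sqrt_op a * g n) \<longlonglongrightarrow> m"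
    using mR unfolding right_ideal_seq[OF subA a(1,2)] by blast
  define Y where "Y i = (if i = 0 then f else g)" for i :: nat
  define L where "L i = (if i = 0 then z else m)" for i :: nat
  have Y: "Y i n \<in> A" "(\<lambda>n. sqrt_op a * Y i n) \<longlonglongrightarrow> L i" for i n
    using f g by (simp_all add: Y_def L_def)
  have lim: "(\<lambda>n. star (Y i n) * a * Y j n) \<longlonglongrightarrow> star (L i) * L j" for i j
  proof -
    have "(\<lambda>n. star (sqrt_op a * Y i n) * (sqrt_op a * Y j n)) \<longlonglongrightarrow> star (L i) * L j"
      by (intro tendsto_mult tendsto_star Y)
    moreover have "star (sqrt_op a * Y i n) * (sqrt_op a * Y j n) = star (Y i n) * (sqrt_op a * sqrt_op a) * Y j n" for n
      by (simp only: star_mult sqrt_op(2)[OF a(2)] mult.assoc)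
    ultimately show ?thesis by (simp only: sqrt_op(1)[OF a(2)])
  qed
  have LL: "star (L i) * L j = (if i = j then d else 0)" if "i < 2" "j < 2" for i j
    using that m zm mz by (auto simp: L_def d_def less_2_cases_iff)
  have "copies A a d 2"
    unfolding copies_def
  proof (intro allI impI)
    fix e :: real assume e: "0 < e"
    have "\<forall>\<^sub>F n in sequentially. norm (star (Y i n) * a * Y j n - star (L i) * L j) < e" for i j
      using tendstoD[OF lim e, of i j] by (simp only: dist_norm)
    then have "\<forall>\<^sub>F n in sequentially. \<forall>i\<in>{..<2}. \<forall>j\<in>{..<2}. norm (star (Y i n) * a * Y j n - star (L i) * L j) < e"
      by (intro eventually_ball_finite ballI) simp_all
    then obtain n where n: "\<forall>i\<in>{..<2}. \<forall>j\<in>{..<2}. norm (star (Y i n) * a * Y j n - star (L i) * L j) < e"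
      using eventually_happens'[OF sequentially_bot] by blast
    show "\<exists>y :: nat \<Rightarrow> 'x l2op. (\<forall>i<2. y i \<in> A) \<and> (\<forall>i<2. \<forall>j<2. norm (star (y i) * a * y j - (if i = j then d else 0)) < e)"
    proof (intro exI[of _ "\<lambda>i. Y i n"] conjI allI impI Y(1))
      fix i j :: nat assume ij: "i < 2" "j < 2"
      then have "norm (star (Y i n) * a * Y j n - star (L i) * L j) < e" using n by simp
      then show "norm (star (Y i n) * a * Y j n - (if i = j then d else 0)) < e"
        by (simp only: LL[OF ij])
    qed
  qed
  then show ?thesis using d by blast
qed

text \<open>Every copy of \<open>d\<close> inside \<open>a\<close> is filled with \<open>k\<close>
  copies of \<open>d'\<close>: the product \<open>y (i div k) * z (i mod k)\<close> enumerates them.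
  Since \<open>z\<close> is fixed first, \<open>\<delta>\<close> can absorb its norms.\<close>

lemma copies_mult:
  assumes ad: "copies A a d 2" and dd: "copies A d d' k"
  shows "copies A a d' (2 * k)"
  unfolding copies_def
proof (intro allI impI)
  fix e :: real assume e: "0 < e"
  obtain z where z: "\<forall>i<k. z i \<in> A" "\<forall>i<k. \<forall>j<k. norm (star (z i) * d * z j - (if i = j then d' else 0)) < e / 2"
    using dd e unfolding copies_def by (meson half_gt_zero)
  define M where "M = 1 + (\<Sum>i<k. norm (z i))"
  have M: "0 < M" by (simp add: M_def add_pos_nonneg sum_nonneg)
  have zM: "norm (z i) \<le> M" if "i < k" for i
    using member_le_sum[of i "{..<k}" "\<lambda>i. norm (z i)"] that by (simp add: M_def)
  define \<delta> where "\<delta> = e / (2 * (1 + M * M))"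
  have M1: "0 < 1 + M * M" by (simp add: add_pos_nonneg)
  have \<delta>: "0 < \<delta>" "M * M * \<delta> \<le> e / 2"
    using e M1 by (simp_all add: \<delta>_def field_simps)
  obtain y :: "nat \<Rightarrow> 'x l2op" where y: "\<forall>i<2. y i \<in> A" "\<forall>i<2. \<forall>j<2. norm (star (y i) * a * y j - (if i = j then d else 0)) < \<delta>"
    using ad \<delta>(1) unfolding copies_def by blast
  define Y where "Y i = y (i div k) * z (i mod k)" for i
  show "\<exists>y. (\<forall>i<2 * k. y i \<in> A) \<and> (\<forall>i<2 * k. \<forall>j<2 * k. norm (star (y i) * a * y j - (if i = j then d' else 0)) < e)"
  proof (intro exI[of _ Y] conjI allI impI)
    fix i assume i: "i < 2 * k"
    have ik: "i div k < 2" "i mod k < k"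
      using i by (simp_all add: less_mult_imp_div_less)
    show "Y i \<in> A" unfolding Y_def using y(1) z(1) ik by (intro cstar_subalgebraD(3)[OF subA]) simp_all
    fix j assume j: "j < 2 * k"
    have jk: "j div k < 2" "j mod k < k"
      using j by (simp_all add: less_mult_imp_div_less)
    define D where "D = (if i div k = j div k then d else 0)"
    define E where "E = star (y (i div k)) * a * y (j div k) - D"
    have E: "norm E < \<delta>" using y(2) ik jk by (simp add: E_def D_def)
    have eq: "star (Y i) * a * Y j - (if i = j then d' else 0)
      = star (z (i mod k)) * E * z (j mod k) + (star (z (i mod k)) * D * z (j mod k) - (if i = j then d' else 0))"
      by (simp add: Y_def E_def star_mult left_diff_distrib right_diff_distrib mult.assoc)
    have "norm (star (z (i mod k)) * E * z (j mod k)) \<le> norm (star (z (i mod k)) * E) * norm (z (j mod k))"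
      by (rule norm_mult_ineq)
    also have "\<dots> \<le> (norm (z (i mod k)) * norm E) * norm (z (j mod k))"
      using norm_mult_ineq[of "star (z (i mod k))" E] by (intro mult_right_mono) simp_all
    also have "\<dots> \<le> (M * \<delta>) * M"
      by (intro mult_mono zM[OF ik(2)] zM[OF jk(2)] less_imp_le[OF E] mult_nonneg_nonneg)
        (use M \<delta> ik jk in \<open>auto intro: less_imp_le\<close>)
    also have "\<dots> \<le> e / 2" using \<delta>(2) by (simp add: mult.assoc mult.commute mult.left_commute)
    finally have n1: "norm (star (z (i mod k)) * E * z (j mod k)) \<le> e / 2" .
    have n2: "norm (star (z (i mod k)) * D * z (j mod k) - (if i = j then d' else 0)) < e / 2"
    proof (cases "i div k = j div k")
      case True
      have "i = j \<longleftrightarrow> i mod k = j mod k"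
        using True by (metis div_mult_mod_eq)
      then show ?thesis using z(2) ik(2) jk(2) True by (simp add: D_def)
    next
      case False
      then have "i \<noteq> j" by auto
      then show ?thesis using False e by (simp add: D_def)
    qed
    show "norm (star (Y i) * a * Y j - (if i = j then d' else 0)) < e"
      unfolding eq using norm_triangle_ineq[of "star (z (i mod k)) * E * z (j mod k)"
        "star (z (i mod k)) * D * z (j mod k) - (if i = j then d' else 0)"] n1 n2 by linarith
  qed
qed

lemma copies_exist:
  assumes a: "a \<in> A" "pos_op a" "a \<noteq> 0"
  shows "\<exists>d\<in>A. pos_op d \<and> d \<noteq> 0 \<and> copies A a d k"
proof -
  have pow: "\<exists>d\<in>A. pos_op d \<and> d \<noteq> 0 \<and> copies A a d (2 ^ m)" if "a \<in> A" "pos_op a" "a \<noteq> 0" for m a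
    using that
  proof (induction m arbitrary: a)
    case 0
    \<comment> \<open>Without a unit, \<open>a\<close> itself need not have the form
      \<open>star y * a * y\<close>; the choice \<open>y = a\<close> yields one exact copy of the
      cube.\<close>
    define s where "s = a * a * a"
    have "copies A a s 1"
      unfolding copies_def
    proof (intro allI impI exI[of _ "\<lambda>_. a"] conjI)
      fix e :: real and i j :: nat assume "0 < e" "i < 1" "j < 1"
      then show "norm (star a * a * a - (if i = j then s else 0)) < e"
        using pos_opD(1)[OF 0(2)] by (simp add: s_def)
    qed (rule 0(1))
    moreover have "s \<in> A" using 0(1) by (simp add: s_def cstar_subalgebraD[OF subA])
    moreover have "pos_op s" using pos_op_conj[OF 0(2), of a] pos_opD(1)[OF 0(2)] by (simp add: s_def)
    moreover have "s \<noteq> 0"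
    proof
      assume "s = 0"
      then have "s * a = 0" by simp
      then have "(a * a) * (a * a) = 0" by (simp add: s_def mult.assoc)
      moreover have "star (a * a) = a * a" using pos_opD(1)[OF 0(2)] by (simp add: star_mult)
      ultimately have "a * a = 0" using star_mult_self_eq_0_iff[of "a * a"] by simp
      then show False using star_mult_self_eq_0_iff[of a] pos_opD(1)[OF 0(2)] 0(3) by simp
    qed
    ultimately show ?case by (intro bexI[of _ s]) simp_all
  next
    case (Suc m)
    obtain d where d: "d \<in> A" "pos_op d" "d \<noteq> 0" "copies A a d 2"
      using copies_two[OF Suc.prems] by blast
    obtain d' where d': "d' \<in> A" "pos_op d'" "d' \<noteq> 0" "copies A d d' (2 ^ m)"
      using Suc.IH[OF d(1-3)] by blast
    show ?case
      using copies_mult[OF d(4) d'(4)] d' by (intro bexI[of _ d']) simp_all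
  qed
  obtain d where d: "d \<in> A" "pos_op d" "d \<noteq> 0" "copies A a d (2 ^ k)"
    using pow[OF a] by blast
  \<comment> \<open>Surplus copies are dropped.\<close>
  have "k \<le> 2 ^ k" by (simp add: less_imp_le)
  then have "copies A a d k"
    using d(4) unfolding copies_def by (meson order_less_le_trans)
  then show ?thesis using d by blast
qed

end

section \<open>Excision\<close>

text \<open>With \<open>s\<close> the sum of all \<open>x star x + star x x\<close>, the square of
  \<open>norm ((1 - u) x)\<close> is at most \<open>norm ((1 - u) s (1 - u))\<close>. For
  \<open>u = f(s)\<close> this is small because \<open>t (1 - f t)^2 \<le> \<eta>\<close> on the
  spectrum, with \<open>\<eta> = (e / 2)^2\<close>. Both products enter \<open>s\<close> since the
  estimate is needed on both sides.\<close>

lemma approximate_unit: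
  assumes A: "cstar_subalgebra A" and F: "finite F" "F \<subseteq> A" and e: "0 < e"
  shows "\<exists>u\<in>A. pos_op u \<and> norm u \<le> 1 \<and> (\<forall>x\<in>F. norm (u * x - x) < e \<and> norm (x * u - x) < e)"
proof -
  define s where "s = (\<Sum>x\<in>F. x * star x + star x * x)"
  have sA: "s \<in> A" unfolding s_def
    using F(2) by (intro cstar_subalgebra_sum[OF A] cstar_subalgebraD[OF A]) auto
  have xs: "pos_op (x * star x + star x * x)" for x :: "'a l2op"
    by (intro pos_op_intros(2) pos_op_star_mult)
  have ps: "pos_op s" unfolding s_def by (rule pos_op_sum) (rule xs)
  note ss = pos_opD(1)[OF ps]
  have le: "pos_op (s - x * star x)" "pos_op (s - star x * x)" if x: "x \<in> F" for x
  proof -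
    have s: "s = x * star x + star x * x + (\<Sum>x\<in>F - {x}. x * star x + star x * x)"
      unfolding s_def by (rule sum.remove[OF F(1) x])
    have r: "pos_op (\<Sum>x\<in>F - {x}. x * star x + star x * x)" by (rule pos_op_sum) (rule xs)
    have "s - x * star x = star x * x + (\<Sum>x\<in>F - {x}. x * star x + star x * x)"
      "s - star x * x = x * star x + (\<Sum>x\<in>F - {x}. x * star x + star x * x)"
      by (subst s, simp)+
    then show "pos_op (s - x * star x)" "pos_op (s - star x * x)"
      using r pos_op_star_mult[of x] by (auto intro: pos_op_intros)
  qed
  define \<eta> where "\<eta> = e\<^sup>2 / 4"
  have \<eta>: "0 < \<eta>" using e by (simp add: \<eta>_def)
  define f where "f t = min 1 (max t 0 / \<eta>)" for t
  have f: "cont0 f" using \<eta> by (auto simp: cont0_def f_def[abs_def] intro!: continuous_intros)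
  have f01: "0 \<le> f t" "f t \<le> 1" for t using \<eta> by (auto simp: f_def)
  define u where "u = fc f s"
  have u: "u \<in> A" "pos_op u" "norm u \<le> 1" "star u = u"
    using fc_in[OF A sA ss f] pos_op_fc[OF ss f f01(1)] norm_fc_le[OF ss f, of 1] f01 star_fc[OF ss f]
    by (simp_all add: u_def)
  have ids: "fc (\<lambda>t. t) s = s" by (rule fc_id[OF ss cont0_intros(5) cont0_intros(5)])
  have us: "(1 - u) * s * (1 - u) = fc (\<lambda>t. (t - f t * t) - (t - f t * t) * f t) s"
    by (simp only: fc_diff[OF ss] fc_add_mult(2)[OF ss] cont0_intros f ids)
      (simp add: u_def left_diff_distrib right_diff_distrib)
  have "norm ((1 - u) * s * (1 - u)) \<le> \<eta>"
    unfolding us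
  proof (rule norm_fc_le[OF ss])
    show "cont0 (\<lambda>t. (t - f t * t) - (t - f t * t) * f t)" by (intro cont0_intros f)
    fix t assume "t \<in> rspec UNIV s"
    then have t: "0 \<le> t" by (rule pos_op_rspec[OF cstar_subalgebra_UNIV UNIV_I ps])
    have eq: "(t - f t * t) - (t - f t * t) * f t = t * ((1 - f t) * (1 - f t))" by (simp add: algebra_simps)
    show "\<bar>(t - f t * t) - (t - f t * t) * f t\<bar> \<le> \<eta>"
    proof (cases "t \<le> \<eta>")
      case True
      have "(1 - f t) * (1 - f t) \<le> 1 * 1" using f01[of t] by (intro mult_mono) auto
      then have "t * ((1 - f t) * (1 - f t)) \<le> t * 1" using t by (intro mult_left_mono) auto
      then show ?thesis unfolding eq using t True by (simp add: abs_mult)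
    next
      case False
      then have "f t = 1" using \<eta> by (simp add: f_def field_simps)
      then show ?thesis using \<eta> by (simp add: eq)
    qed
  qed (use \<eta> in simp)
  then have small: "norm ((1 - u) * s * (1 - u)) \<le> (e / 2)\<^sup>2"
    by (simp add: \<eta>_def power_divide)
  have est: "norm ((1 - u) * z) < e" if z: "pos_op (s - z * star z)" for z
  proof -
    have su: "star (1 - u) = 1 - u" by (simp add: star_diff u)
    have eq: "((1 - u) * z) * star ((1 - u) * z) = (1 - u) * (z * star z) * (1 - u)"
      by (simp only: star_mult su mult.assoc)
    have "(norm ((1 - u) * z))\<^sup>2 = norm ((1 - u) * (z * star z) * (1 - u))"
      unfolding eq[symmetric] by (simp only: norm_star_mult_self)
    also have "\<dots> \<le> norm ((1 - u) * s * (1 - u))"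
    proof (rule norm_mono_pos_op)
      show "pos_op ((1 - u) * (z * star z) * (1 - u))"
        using pos_op_conj[OF pos_op_star_mult(2)[of z], of "1 - u"] by (simp only: su)
      have "(1 - u) * s * (1 - u) - (1 - u) * (z * star z) * (1 - u) = (1 - u) * (s - z * star z) * (1 - u)"
        by (simp add: left_diff_distrib right_diff_distrib mult.assoc)
      then show "pos_op ((1 - u) * s * (1 - u) - (1 - u) * (z * star z) * (1 - u))"
        using pos_op_conj[OF z, of "1 - u"] by (simp only: su)
    qed
    also note small
    finally have "norm ((1 - u) * z) \<le> e / 2"
      by (rule power2_le_imp_le) (use e in simp)
    then show ?thesis using e by simp
  qed
  have "norm (u * x - x) < e \<and> norm (x * u - x) < e" if x: "x \<in> F" for x
  proof
    have "norm (u * x - x) = norm ((1 - u) * x)"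
      by (simp add: left_diff_distrib norm_minus_commute)
    then show "norm (u * x - x) < e" using est[OF le(1)[OF x]] by simp
    have "norm (x * u - x) = norm (star (x * u - x))" by (simp only: norm_star)
    also have "\<dots> = norm ((1 - u) * star x)"
      by (simp add: left_diff_distrib star_diff star_mult u norm_minus_commute)
    also have "\<dots> < e" using est[of "star x"] le(2)[OF x] by (simp add: star_star)
    finally show "norm (x * u - x) < e" .
  qed
  then show ?thesis using u by blast
qed

section \<open>Bump functions and excision by functional calculus\<close>

definition ramp :: "real \<Rightarrow> real \<Rightarrow> real \<Rightarrow> real"
  where "ramp l r t = max 0 (min 1 ((t - l) / (r - l)))"

lemma ramp:
  assumes "l < r"
  shows "0 \<le> ramp l r t" "ramp l r t \<le> 1" "t \<le> l \<Longrightarrow> ramp l r t = 0" "r \<le> t \<Longrightarrow> ramp l r t = 1"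
    "ramp l r t \<noteq> 0 \<Longrightarrow> l < t" "0 \<le> l \<Longrightarrow> cont0 (ramp l r)"
proof -
  show 1: "0 \<le> ramp l r t" "ramp l r t \<le> 1" by (auto simp: ramp_def)
  show 2: "t \<le> l \<Longrightarrow> ramp l r t = 0" for t
    using divide_nonpos_pos[of "t - l" "r - l"] assms by (auto simp: ramp_def)
  show "r \<le> t \<Longrightarrow> ramp l r t = 1" using assms by (simp add: ramp_def min_def field_simps)
  show "ramp l r t \<noteq> 0 \<Longrightarrow> l < t" using 2 by (meson not_le)
  show "0 \<le> l \<Longrightarrow> cont0 (ramp l r)"
    using 2[of 0] assms by (auto simp: cont0_def ramp_def[abs_def] intro!: continuous_intros)
qed

lemma ramp_absorb: "l < r \<Longrightarrow> r \<le> l' \<Longrightarrow> l' < r' \<Longrightarrow> ramp l r t * ramp l' r' t = ramp l' r' t"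
  using ramp(3)[of l' r' t] ramp(4)[of l r t] by (cases "t \<le> l'") auto

text \<open>\<open>v\<close> certifies that \<open>w\<close> acts as a unit on a nonzero part of the
  algebra. The next pair is built from \<open>v\<close>, hence absorbed by \<open>w\<close>, and the
  construction can be repeated.\<close>

definition excising_pair :: "'x l2op set \<Rightarrow> 'x l2op \<Rightarrow> 'x l2op \<Rightarrow> bool"
  where "excising_pair A w v \<longleftrightarrow> w \<in> A \<and> v \<in> A \<and> pos_op w \<and> norm w \<le> 1 \<and> pos_op v \<and> v \<noteq> 0 \<and> w * v = v"

lemma norm_in_rspec_pos:
  assumes "pos_op x" "x \<noteq> 0" shows "norm x \<in> rspec UNIV x"
proof -
  have "- norm x \<notin> rspec UNIV x"
  proof
    assume "- norm x \<in> rspec UNIV x"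
    then have "0 \<le> - norm x" by (rule pos_op_rspec[OF cstar_subalgebra_UNIV UNIV_I assms(1)])
    then show False using assms(2) by simp
  qed
  then show ?thesis
    using norm_in_rspec[OF cstar_subalgebra_UNIV UNIV_I pos_opD(1)[OF assms(1)] assms(2)] by blast
qed

text \<open>The first ramp lives where the spectrum exceeds \<open>l\<close>, and there
  \<open>x\<close> differs from \<open>norm x\<close> by at most \<open>norm x - l\<close>. The
  second ramp is 1 at the spectral value \<open>norm x\<close>, so that it yields a nonzero
  element.\<close>

lemma excising_pair_top:
  assumes A: "cstar_subalgebra A" and x: "x \<in> A" "pos_op x" "x \<noteq> 0" and l: "0 < l" "l < norm x"
  defines "m \<equiv> (l + norm x) / 2"
  shows "excising_pair A (fc (ramp l m) x) (fc (ramp m (norm x)) x)"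
    "pos_op (fc (ramp l m) x * (x - l *\<^sub>R 1) * fc (ramp l m) x)"
    "norm (fc (ramp l m) x * x * fc (ramp l m) x - norm x *\<^sub>R (fc (ramp l m) x * fc (ramp l m) x)) \<le> norm x - l"
proof -
  note xs = pos_opD(1)[OF x(2)]
  have m: "l < m" "m < norm x" using l by (simp_all add: m_def)
  define g where "g = ramp l m"
  have g: "cont0 g" and g': "cont0 (ramp m (norm x))"
    using ramp(6) m l by (simp_all add: g_def)
  define w where "w = fc g x"
  have w: "w \<in> A" "pos_op w" "norm w \<le> 1"
    using fc_in[OF A x(1) xs g] pos_op_fc[OF xs g] norm_fc_le[OF xs g, of 1] ramp(1,2)[OF m(1)]
    by (simp_all add: w_def g_def)
  define v where "v = fc (ramp m (norm x)) x"
  have v: "v \<in> A" "pos_op v"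
    using fc_in[OF A x(1) xs g'] pos_op_fc[OF xs g' ramp(1)[OF m(2)]] by (simp_all add: v_def)
  have "w * v = fc (\<lambda>t. g t * ramp m (norm x) t) x"
    unfolding w_def v_def by (rule fc_add_mult(2)[OF xs g g', symmetric])
  also have "(\<lambda>t. g t * ramp m (norm x) t) = ramp m (norm x)"
    unfolding g_def by (rule ext) (rule ramp_absorb[OF m(1) order_refl m(2)])
  finally have wv: "w * v = v" by (simp only: v_def)
  have "\<bar>ramp m (norm x) (norm x)\<bar> \<le> norm v"
    unfolding v_def by (rule le_norm_fun_calc[OF cstar_subalgebra_UNIV UNIV_I xs g' norm_in_rspec_pos[OF x(2,3)]])
  then have "v \<noteq> 0" using ramp(4)[OF m(2) order_refl] by auto
  then show "excising_pair A (fc (ramp l m) x) (fc (ramp m (norm x)) x)"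
    using w v wv unfolding excising_pair_def w_def v_def g_def by blast
  have idx: "fc (\<lambda>t. t) x = x" by (rule fc_id[OF xs cont0_intros(5) cont0_intros(5)])
  have eq: "w * x * w - r *\<^sub>R (w * w) = fc (\<lambda>t. g t * t * g t - r * (g t * g t)) x" for r
    by (simp only: fc_diff[OF xs] fc_add_mult(2)[OF xs] fc_scale[OF xs _ g] cont0_intros g idx w_def)
  have cont: "cont0 (\<lambda>t. g t * t * g t - r * (g t * g t))" for r by (intro cont0_intros g)
  have ge: "g t * t * g t - r * (g t * g t) = (g t * g t) * (t - r)" for t r by (simp add: algebra_simps)
  have "pos_op (fc (\<lambda>t. g t * t * g t - l * (g t * g t)) x)"
  proof (rule pos_op_fc[OF xs cont])
    fix t show "0 \<le> g t * t * g t - l * (g t * g t)"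
      unfolding ge using ramp(5)[OF m(1), of t] by (cases "g t = 0") (auto simp: g_def)
  qed
  moreover have "w * (x - l *\<^sub>R 1) * w = w * x * w - l *\<^sub>R (w * w)"
    by (simp add: left_diff_distrib right_diff_distrib)
  ultimately show "pos_op (fc (ramp l m) x * (x - l *\<^sub>R 1) * fc (ramp l m) x)"
    by (simp add: eq w_def[symmetric] g_def[symmetric])
  have "norm (fc (\<lambda>t. g t * t * g t - norm x * (g t * g t)) x) \<le> norm x - l"
  proof (rule norm_fc_le[OF xs cont])
    fix t assume "t \<in> rspec UNIV x"
    then have t: "t \<le> norm x" using rspec_bound[OF cstar_subalgebra_UNIV UNIV_I xs, of t] by simp
    show "\<bar>g t * t * g t - norm x * (g t * g t)\<bar> \<le> norm x - l"
    proof (cases "g t = 0")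
      case False
      then have lt: "l < t" using ramp(5)[OF m(1), of t] by (simp add: g_def)
      have "g t * g t \<le> 1 * 1" using ramp(1,2)[OF m(1), of t] by (intro mult_mono) (simp_all add: g_def)
      then have "(g t * g t) * (norm x - t) \<le> 1 * (norm x - t)" using t by (intro mult_right_mono) simp_all
      moreover have "0 \<le> (g t * g t) * (norm x - t)" using t by simp
      moreover have "g t * t * g t - norm x * (g t * g t) = - ((g t * g t) * (norm x - t))" by (simp add: algebra_simps)
      ultimately show ?thesis using lt by simp
    qed (use l in simp)
  qed (use l in simp)
  then show "norm (fc (ramp l m) x * x * fc (ramp l m) x - norm x *\<^sub>R (fc (ramp l m) x * fc (ramp l m) x)) \<le> norm x - l"
    unfolding g_def[symmetric] w_def[symmetric] eq .
qed

text \<open>With bump functions \<open>v\<^sub>i\<close> of \<open>v\<close> concentrating at the top of its spectrum, the norms of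
  \<open>v\<^sub>i Y v\<^sub>i\<close> decrease, so two consecutive ones almost agree. Vectors near the top of the
  spectrum of \<open>v\<^sub>i\<^sub>+\<^sub>1 Y v\<^sub>i\<^sub>+\<^sub>1\<close> are then almost fixed by \<open>v\<^sub>i\<^sub>+\<^sub>1\<close>.\<close>
lemma stable_bump_exists:
  assumes A: "cstar_subalgebra A" and v: "v \<in> A" "pos_op v" "norm v = 1"
    and Y: "pos_op Y" "pos_op (Y - 1)" and \<eta>: "0 < \<eta>"
  shows "\<exists>a\<in>A. \<exists>b\<in>A. pos_op a \<and> pos_op b \<and> norm a \<le> 1 \<and> norm b \<le> 1 \<and> a * b = b \<and>
    1 \<le> norm (b * Y * b) \<and> norm (a * Y * a) \<le> norm (b * Y * b) + \<eta> \<and>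
    (\<forall>w. w * v = v \<longrightarrow> w * b = b)"
proof -
  note vs = pos_opD(1)[OF v(2)]
  \<comment> \<open>Ramps climbing towards the top spectral value 1: each is 1 on the support of the
    next, and all are 1 at 1.\<close>
  define f where "f i = ramp (1 - (1/2)^i) (1 - (1/2)^(Suc i))" for i :: nat
  have lt: "1 - (1/2)^i < 1 - (1/2::real)^(Suc i)" for i :: nat by simp
  have l0: "0 \<le> 1 - (1/2::real)^i" for i by (simp add: power_le_one)
  have f: "cont0 (f i)" "0 \<le> f i t" "f i t \<le> 1" "f i 1 = 1" for i t
    using ramp(6)[OF lt l0] ramp(1,2)[OF lt] ramp(4)[OF lt, of i 1] by (simp_all add: f_def)
  have ff: "f i t * f (Suc i) t = f (Suc i) t" for i t
    unfolding f_def by (rule ramp_absorb[OF lt order_refl lt])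
  define V where "V i = fc (f i) v" for i
  have V: "V i \<in> A" "pos_op (V i)" "norm (V i) \<le> 1" "star (V i) = V i" for i
    using fc_in[OF A v(1) vs f(1)] pos_op_fc[OF vs f(1,2)] norm_fc_le[OF vs f(1), of 1 i] f(2,3) star_fc[OF vs f(1)]
    by (simp_all add: V_def)
  have VV: "V i * V (Suc i) = V (Suc i)" for i
  proof -
    have "V i * V (Suc i) = fc (\<lambda>t. f i t * f (Suc i) t) v"
      unfolding V_def by (rule fc_add_mult(2)[OF vs f(1) f(1), symmetric])
    also have "(\<lambda>t. f i t * f (Suc i) t) = f (Suc i)" using ff by (rule ext)
    finally show ?thesis by (simp only: V_def)
  qed
  have V'V: "V (Suc i) * V i = V (Suc i)" for i
    using arg_cong[OF VV[of i], of star] by (simp only: star_mult V)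
  have "v \<noteq> 0" using v(3) by auto
  then have "1 \<in> rspec UNIV v" using norm_in_rspec_pos[OF v(2)] v(3) by simp
  then have "\<bar>f i 1\<bar> \<le> norm (V i)" for i
    unfolding V_def by (rule le_norm_fun_calc[OF cstar_subalgebra_UNIV UNIV_I vs f(1)])
  then have V1: "norm (V i) = 1" for i using V(3)[of i] by (simp add: f(4) order_antisym)
  define N where "N i = norm (V i * Y * V i)" for i
  have N1: "1 \<le> N i" for i
  proof -
    have "norm (V i * V i) = 1" using norm_selfadjoint_sq[OF V(4)] V1 by simp
    moreover have "norm (V i * V i) \<le> norm (V i * Y * V i)"
    proof (rule norm_mono_pos_op)
      show "pos_op (V i * V i)" using pos_op_star_mult(1)[of "V i"] by (simp only: V)
      have "V i * Y * V i - V i * V i = V i * (Y - 1) * V i" by (simp add: left_diff_distrib right_diff_distrib)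
      then show "pos_op (V i * Y * V i - V i * V i)"
        using pos_op_conj[OF Y(2), of "V i"] by (simp only: V)
    qed
    ultimately show ?thesis by (simp add: N_def)
  qed
  have dec: "N (Suc i) \<le> N i" for i
  proof -
    have "V (Suc i) * Y * V (Suc i) = V (Suc i) * (V i * Y * V i) * star (V (Suc i))"
      unfolding V(4) by (metis V'V VV mult.assoc)
    then have "N (Suc i) \<le> (norm (V (Suc i)))\<^sup>2 * N i"
      unfolding N_def using norm_conj_le by metis
    then show ?thesis by (simp add: V1)
  qed
  have "\<exists>i. N i \<le> N (Suc i) + \<eta>"
  proof (rule ccontr)
    assume "\<not> ?thesis"
    then have *: "N (Suc i) + \<eta> < N i" for i by (simp add: not_le)
    have "N n + real n * \<eta> \<le> N 0" for n
    proof (induction n)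
      case (Suc n) then show ?case using *[of n] by (simp add: algebra_simps)
    qed simp
    then have "real n * \<eta> \<le> N 0" for n using N1[of n] by (smt (verit))
    moreover obtain n where "N 0 < real n * \<eta>" using ex_less_of_nat_mult[OF \<eta>] by blast
    ultimately show False by (meson not_le)
  qed
  then obtain i where i: "N i \<le> N (Suc i) + \<eta>" by blast
  have unit: "w * V j = V j" if "w * v = v" for w j
    unfolding V_def by (rule unit_mult_fc[OF vs f(1) that])
  show ?thesis
    using V VV[of i] N1[of "Suc i"] i unit unfolding N_def by blast
qed

text \<open>For \<open>0 \<le> b \<le> 1\<close> one has \<open>b^2 \<le> b\<close>. Expanding the
  square of \<open>u - b u\<close> and replacing the form of \<open>b\<close> by that of
  \<open>b^2\<close> gives the bound.\<close>

lemma norm_diff_sq_le: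
  fixes b :: "'x l2op"
  assumes b: "pos_op b" "norm b \<le> 1"
  shows "(norm (u - l2op_apply b u))\<^sup>2 \<le> (norm u)\<^sup>2 - (norm (l2op_apply b u))\<^sup>2"
proof -
  note bs = pos_opD(1)[OF b(1)]
  have "pos_op (b - b * b)"
  proof -
    have s: "sqrt_op b * sqrt_op b = b" "star (sqrt_op b) = sqrt_op b" by (rule sqrt_op[OF b(1)])+
    have p1: "pos_op (1 - b)"
      using pos_op_add_norm[of "- b" 1] b bs by (simp add: star_minus)
    have "b - b * b = sqrt_op b * (1 - b) * sqrt_op b"
      by (simp add: left_diff_distrib right_diff_distrib) (metis s(1) mult.assoc)
    then show ?thesis using pos_op_conj[OF p1, of "sqrt_op b"] by (simp only: s)
  qed
  then have le: "qf (b * b) u \<le> qf b u" using pos_opD(2)[of "b - b * b" u] by (simp add: qf_ops)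
  have bb: "qf (b * b) u = (norm (l2op_apply b u))\<^sup>2"
    using qf_star_mult[of b u] by (simp only: bs)
  have "(norm (u - l2op_apply b u))\<^sup>2 = qf (star (1 - b) * (1 - b)) u"
    unfolding qf_star_mult by (simp add: l2op_apply_ops)
  also have "star (1 - b) * (1 - b) = 1 - b - b + b * b"
    by (simp add: star_diff bs left_diff_distrib right_diff_distrib)
  also have "qf \<dots> u = (norm u)\<^sup>2 - qf b u - qf b u + qf (b * b) u"
    by (simp add: qf_ops)
  finally show ?thesis using le bb by simp
qed

text \<open>Shift \<open>y\<close> to \<open>Y \<ge> 1\<close>, take stable bumps \<open>a\<close>,
  \<open>b\<close>, and let \<open>w'\<close> cut out the top of the spectrum of
  \<open>x = b Y b\<close>. For \<open>u\<close> in the range of \<open>w'\<close>, the form of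
  \<open>x\<close> at \<open>u\<close> is almost \<open>norm x\<close> times the square of
  \<open>norm u\<close>, and it equals the form of \<open>Y\<close> at \<open>b u\<close>, at most
  about \<open>norm x\<close> times the square of \<open>norm (b u)\<close>. Hence
  \<open>norm (b u)\<close> is almost \<open>norm u\<close>, so \<open>b u\<close> is close to
  \<open>u\<close>, and \<open>w' Y w'\<close> is close to \<open>w' x w'\<close>, which is close to
  \<open>norm x\<close> times \<open>w'^2\<close>.\<close>

lemma excision_step:
  assumes A: "cstar_subalgebra A" and wv: "excising_pair A w v" and y: "y \<in> A" "star y = y" and \<delta>: "0 < \<delta>"
  shows "\<exists>w' v' t. excising_pair A w' v' \<and> w * w' = w' \<and> norm (w' * y * w' - t *\<^sub>R (w' * w')) \<le> \<delta>"
proof -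
  have v: "v \<in> A" "pos_op v" "v \<noteq> 0" "w * v = v" using wv by (simp_all add: excising_pair_def)
  define v1 where "v1 = (1 / norm v) *\<^sub>R v"
  have v1: "v1 \<in> A" "pos_op v1" "norm v1 = 1" "w * v1 = v1"
    using v by (simp_all add: v1_def cstar_subalgebraD[OF A] pos_op_intros)
  define s where "s = norm y + 1"
  define Y where "Y = y + s *\<^sub>R 1"
  have Y: "star Y = Y" "pos_op (Y - 1)" "pos_op Y"
  proof -
    show sY: "star Y = Y" by (simp add: Y_def star_add star_scaleR y)
    have "Y - 1 = y + norm y *\<^sub>R 1" by (simp add: Y_def s_def scaleR_left_distrib)
    then show 1: "pos_op (Y - 1)" using pos_op_add_norm[OF y(2) order_refl] by simp
    show "pos_op Y" using pos_op_intros(2)[OF 1 pos_op_intros(4)] by simp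
  qed
  define K where "K = norm Y + 1"
  have K: "1 \<le> K" "norm Y \<le> K" by (simp_all add: K_def)
  \<comment> \<open>The first bound keeps \<open>l\<close> positive, the second controls the
    spectral width left by \<open>w'\<close>, and the third makes \<open>sqrt (2 * \<eta>)\<close>
    at most \<open>\<delta> / (4 * K)\<close>.\<close>
  define \<eta> where "\<eta> = min (1/2) (min (\<delta> / 2) ((\<delta> / (8 * K))\<^sup>2))"
  have K0: "0 < K" using K by simp
  have \<eta>: "0 < \<eta>" "\<eta> \<le> 1/2" "\<eta> \<le> \<delta> / 2" "\<eta> \<le> (\<delta> / (8 * K))\<^sup>2"
    using \<delta> K0 by (auto simp: \<eta>_def)
  obtain a b where ab: "a \<in> A" "b \<in> A" "pos_op a" "pos_op b" "norm a \<le> 1" "norm b \<le> 1" "a * b = b"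
    and N: "1 \<le> norm (b * Y * b)" "norm (a * Y * a) \<le> norm (b * Y * b) + \<eta>"
    and unit: "\<And>w. w * v1 = v1 \<Longrightarrow> w * b = b"
    using stable_bump_exists[OF A v1(1-3) Y(3,2) \<eta>(1)] by blast
  note as = pos_opD(1)[OF ab(3)] and bs = pos_opD(1)[OF ab(4)]
  define x where "x = b * Y * b"
  have xA: "x \<in> A"
  proof -
    have "x = b * y * b + s *\<^sub>R (b * b)" by (simp add: x_def Y_def distrib_left distrib_right)
    then show ?thesis using ab y by (simp add: cstar_subalgebraD[OF A])
  qed
  have xp: "pos_op x" using pos_op_conj[OF Y(3), of b] by (simp only: x_def bs)
  have x0: "x \<noteq> 0" "1 \<le> norm x" using N(1) by (auto simp: x_def)
  define l where "l = norm x - \<eta>"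
  have l: "0 < l" "l < norm x" using x0 \<eta> by (auto simp: l_def)
  define w' v' where "w' = fc (ramp l ((l + norm x) / 2)) x" and "v' = fc (ramp ((l + norm x) / 2) (norm x)) x"
  note top = excising_pair_top[OF A xA xp x0(1) l, folded w'_def v'_def]
  have w': "w' \<in> A" "pos_op w'" "norm w' \<le> 1" using top(1) by (simp_all add: excising_pair_def)
  note ws = pos_opD(1)[OF w'(2)]
  have cont: "cont0 (ramp l ((l + norm x) / 2))" using l by (intro ramp(6)) simp_all
  have unit': "z * w' = w'" if "z * b = b" for z
  proof -
    have "z * x = x" unfolding x_def by (simp only: mult.assoc[symmetric] that)
    then show ?thesis unfolding w'_def by (rule unit_mult_fc[OF pos_opD(1)[OF xp] cont])
  qed
  have ww: "w * w' = w'" by (rule unit'[OF unit[OF v1(4)]])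
  have aw: "a * w' = w'" by (rule unit'[OF ab(7)])
  have near: "norm ((1 - b) * w') \<le> sqrt (2 * \<eta>)"
  proof (rule norm_l2op_leI)
    fix z
    define u where "u = l2op_apply w' z"
    have au: "l2op_apply a u = u" using arg_cong[OF aw, of "\<lambda>T. l2op_apply T z"] by (simp add: u_def l2op_apply_ops)
    have ab': "l2op_apply a (l2op_apply b u) = l2op_apply b u"
      using arg_cong[OF ab(7), of "\<lambda>T. l2op_apply T u"] by (simp add: l2op_apply_ops)
    \<comment> \<open>A vector fixed by \<open>a\<close> sees \<open>Y\<close> only through
      \<open>a * Y * a\<close>; \<open>b u\<close> is such a vector because
      \<open>a * b = b\<close>.\<close>
    have upper: "qf Y u' \<le> (norm x + \<eta>) * (norm u')\<^sup>2" if "l2op_apply a u' = u'" for u'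
    proof -
      have "qf Y u' = qf (star a * Y * a) u'" by (simp only: qf_conj that)
      also have "\<dots> \<le> norm (a * Y * a) * (norm u')\<^sup>2" using abs_qf_le[of "a * Y * a" u'] by (simp add: as)
      also have "\<dots> \<le> (norm x + \<eta>) * (norm u')\<^sup>2" using N(2) by (intro mult_right_mono) (simp_all add: x_def)
      finally show ?thesis .
    qed
    have "0 \<le> qf (star w' * (x - l *\<^sub>R 1) * w') z" using pos_opD(2)[OF top(2)] by (simp only: ws)
    then have "0 \<le> qf (x - l *\<^sub>R 1) u" by (simp only: qf_conj u_def)
    then have "l * (norm u)\<^sup>2 \<le> qf x u" by (simp add: qf_ops)
    also have "qf x u = qf Y (l2op_apply b u)" using qf_conj[of b Y u] by (simp only: x_def bs)
    also have "\<dots> \<le> (norm x + \<eta>) * (norm (l2op_apply b u))\<^sup>2" by (rule upper[OF ab'])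
    finally have 1: "(norm x - \<eta>) * (norm u)\<^sup>2 \<le> (norm x + \<eta>) * (norm (l2op_apply b u))\<^sup>2" by (simp only: l_def)
    define p q where "p = (norm u)\<^sup>2" and "q = (norm (l2op_apply b u))\<^sup>2"
    have pq: "0 \<le> p" "q \<le> p"
    proof -
      show "0 \<le> p" by (simp add: p_def)
      have "norm (l2op_apply b u) \<le> 1 * norm u"
        using norm_l2op_apply[of b u] mult_right_mono[OF ab(6), of "norm u"] by simp
      then show "q \<le> p" unfolding p_def q_def by (intro power_mono) simp_all
    qed
    have "norm x * (p - q) \<le> \<eta> * (p + q)" using 1 by (simp add: p_def q_def algebra_simps)
    moreover have "1 * (p - q) \<le> norm x * (p - q)" using x0(2) pq by (intro mult_right_mono) simp_all
    moreover have "\<eta> * (p + q) \<le> \<eta> * (2 * p)" using pq \<eta> by (intro mult_left_mono) simp_all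
    ultimately have "p - q \<le> 2 * \<eta> * p" by simp
    then have "(norm (u - l2op_apply b u))\<^sup>2 \<le> (sqrt (2 * \<eta>) * norm u)\<^sup>2"
      using norm_diff_sq_le[OF ab(4,6), of u] \<eta> by (simp add: p_def q_def power_mult_distrib)
    then have "norm (u - l2op_apply b u) \<le> sqrt (2 * \<eta>) * norm u"
      by (rule power2_le_imp_le) (use \<eta> in simp)
    also have "\<dots> \<le> sqrt (2 * \<eta>) * norm z"
      using norm_l2op_apply[of w' z] mult_right_mono[OF w'(3), of "norm z"] \<eta>
      by (intro mult_left_mono) (simp_all add: u_def)
    finally show "norm (l2op_apply ((1 - b) * w') z) \<le> sqrt (2 * \<eta>) * norm z"
      by (simp add: l2op_apply_ops u_def)
  qed (use \<eta> in simp)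
  have "sqrt (2 * \<eta>) \<le> \<delta> / (4 * K)"
  proof (rule real_le_lsqrt)
    have "2 * \<eta> \<le> 4 * (\<delta> / (8 * K))\<^sup>2" using \<eta>(1,4) by simp
    also have "\<dots> = (\<delta> / (4 * K))\<^sup>2" by (simp add: power2_eq_square)
    finally show "2 * \<eta> \<le> (\<delta> / (4 * K))\<^sup>2" .
  qed (use \<delta> K0 in simp)
  then have near': "norm ((1 - b) * w') \<le> \<delta> / (4 * K)" using near by simp
  have near'': "norm (w' * (1 - b)) \<le> \<delta> / (4 * K)"
  proof -
    have "norm (w' * (1 - b)) = norm (star (w' * (1 - b)))" by (simp only: norm_star)
    also have "star (w' * (1 - b)) = (1 - b) * w'" by (simp add: star_mult star_diff ws bs)
    finally show ?thesis using near' by simp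
  qed
  have eq: "w' * Y * w' - norm x *\<^sub>R (w' * w')
    = (w' * (1 - b)) * (Y * w') + ((w' * b) * (Y * ((1 - b) * w')) + (w' * x * w' - norm x *\<^sub>R (w' * w')))"
    by (simp add: x_def left_diff_distrib right_diff_distrib mult.assoc)
  have "norm (Y * w') \<le> K"
    using norm_mult_ineq[of Y w'] mult_mono[OF K(2) w'(3)] K0 by simp
  then have n1: "norm ((w' * (1 - b)) * (Y * w')) \<le> \<delta> / 4"
  proof -
    have "norm ((w' * (1 - b)) * (Y * w')) \<le> norm (w' * (1 - b)) * norm (Y * w')" by (rule norm_mult_ineq)
    also have "\<dots> \<le> \<delta> / (4 * K) * K"
      by (intro mult_mono near'' \<open>norm (Y * w') \<le> K\<close>) (use \<delta> K0 in simp_all)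
    finally show ?thesis using K0 by simp
  qed
  have n2: "norm ((w' * b) * (Y * ((1 - b) * w'))) \<le> \<delta> / 4"
  proof -
    have wb: "norm (w' * b) \<le> 1" using norm_mult_ineq[of w' b] mult_mono[OF w'(3) ab(6)] by simp
    have "norm (Y * ((1 - b) * w')) \<le> norm Y * norm ((1 - b) * w')" by (rule norm_mult_ineq)
    also have "\<dots> \<le> K * (\<delta> / (4 * K))" by (intro mult_mono near' K(2)) (use K0 in simp_all)
    finally have "norm (Y * ((1 - b) * w')) \<le> \<delta> / 4" using K0 by simp
    then have "norm (w' * b) * norm (Y * ((1 - b) * w')) \<le> 1 * (\<delta> / 4)"
      by (intro mult_mono wb) simp_all
    then show ?thesis using norm_mult_ineq[of "w' * b" "Y * ((1 - b) * w')"] by simp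
  qed
  have n3: "norm (w' * x * w' - norm x *\<^sub>R (w' * w')) \<le> \<delta> / 2"
    using top(3) \<eta>(3) by (simp add: l_def)
  have "norm (w' * Y * w' - norm x *\<^sub>R (w' * w')) \<le> \<delta>"
    unfolding eq using n1 n2 n3
      norm_triangle_ineq[of "(w' * (1 - b)) * (Y * w')" "(w' * b) * (Y * ((1 - b) * w')) + (w' * x * w' - norm x *\<^sub>R (w' * w'))"]
      norm_triangle_ineq[of "(w' * b) * (Y * ((1 - b) * w'))" "w' * x * w' - norm x *\<^sub>R (w' * w')"] by linarith
  moreover have "w' * Y * w' - norm x *\<^sub>R (w' * w') = w' * y * w' - (norm x - s) *\<^sub>R (w' * w')"
    by (simp add: Y_def distrib_left distrib_right scaleR_left_diff_distrib)
  ultimately have "norm (w' * y * w' - (norm x - s) *\<^sub>R (w' * w')) \<le> \<delta>" by (simp only:)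
  then show ?thesis using top(1) ww by blast
qed

text \<open>One element of \<open>F\<close> is treated at a time. Every later \<open>w2\<close> is
  absorbed by the earlier \<open>w1\<close>, so estimates already achieved survive further
  compression by a contraction.\<close>

lemma excision_real:
  assumes A: "cstar_subalgebra A" and wv: "excising_pair A w v" and F: "finite F" "F \<subseteq> A" "\<And>y. y \<in> F \<Longrightarrow> star y = y"
    and \<delta>: "0 < \<delta>"
  shows "\<exists>w' v'. excising_pair A w' v' \<and> w * w' = w' \<and> (\<forall>y\<in>F. \<exists>t. norm (w' * y * w' - t *\<^sub>R (w' * w')) \<le> \<delta>)"
  using F
proof (induction F rule: finite_induct)
  case empty
  obtain w' v' t where "excising_pair A w' v'" "w * w' = w'"
    using excision_step[OF A wv cstar_subalgebraD(1)[OF A] star_zero \<delta>] by blast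
  then show ?case by blast
next
  case (insert y F)
  have "\<exists>w1 v1. excising_pair A w1 v1 \<and> w * w1 = w1 \<and> (\<forall>y\<in>F. \<exists>t. norm (w1 * y * w1 - t *\<^sub>R (w1 * w1)) \<le> \<delta>)"
    by (rule insert.IH) (use insert.prems in simp_all)
  then obtain w1 v1 where 1: "excising_pair A w1 v1" "w * w1 = w1" "\<forall>y\<in>F. \<exists>t. norm (w1 * y * w1 - t *\<^sub>R (w1 * w1)) \<le> \<delta>"
    by (elim exE conjE)
  have y: "y \<in> A" "star y = y" using insert.prems by simp_all
  obtain w2 v2 t where 2: "excising_pair A w2 v2" "w1 * w2 = w2" "norm (w2 * y * w2 - t *\<^sub>R (w2 * w2)) \<le> \<delta>"
    using excision_step[OF A 1(1) y \<delta>] by blast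
  have p: "pos_op w1" "pos_op w2" "norm w2 \<le> 1" using 1(1) 2(1) by (simp_all add: excising_pair_def)
  have w21: "w2 * w1 = w2" using arg_cong[OF 2(2), of star] by (simp only: star_mult pos_opD(1)[OF p(1)] pos_opD(1)[OF p(2)])
  have "\<exists>t. norm (w2 * y' * w2 - t *\<^sub>R (w2 * w2)) \<le> \<delta>" if y': "y' \<in> F" for y'
  proof -
    obtain t where t: "norm (w1 * y' * w1 - t *\<^sub>R (w1 * w1)) \<le> \<delta>" using bspec[OF 1(3) y'] by (elim exE)
    have "w2 * (w1 * y' * w1 - t *\<^sub>R (w1 * w1)) * star w2
      = (w2 * w1) * y' * (w1 * w2) - t *\<^sub>R ((w2 * w1) * (w1 * w2))"
      by (simp only: pos_opD(1)[OF p(2)] left_diff_distrib right_diff_distrib mult.assoc mult_scaleR_left mult_scaleR_right)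
    also have "\<dots> = w2 * y' * w2 - t *\<^sub>R (w2 * w2)" by (simp only: w21 2(2))
    finally have eq: "w2 * (w1 * y' * w1 - t *\<^sub>R (w1 * w1)) * star w2 = w2 * y' * w2 - t *\<^sub>R (w2 * w2)" .
    have "norm (w2 * y' * w2 - t *\<^sub>R (w2 * w2)) \<le> (norm w2)\<^sup>2 * norm (w1 * y' * w1 - t *\<^sub>R (w1 * w1))"
      unfolding eq[symmetric] by (rule norm_conj_le)
    moreover have "(norm w2)\<^sup>2 \<le> 1" using p(3) by (simp add: power_le_one)
    then have "(norm w2)\<^sup>2 * norm (w1 * y' * w1 - t *\<^sub>R (w1 * w1)) \<le> 1 * \<delta>"
      by (rule mult_mono[OF _ t]) simp_all
    ultimately have "norm (w2 * y' * w2 - t *\<^sub>R (w2 * w2)) \<le> \<delta>" by linarith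
    then show ?thesis by (rule exI)
  qed
  then have "\<forall>y'\<in>insert y F. \<exists>t. norm (w2 * y' * w2 - t *\<^sub>R (w2 * w2)) \<le> \<delta>" using 2(3) by blast
  moreover have "w * w2 = w2"
  proof -
    have "w * w2 = w * w1 * w2" by (simp only: mult.assoc 2(2))
    then show ?thesis by (simp only: 1(2) 2(2))
  qed
  ultimately show ?case using 2(1) by blast
qed

text \<open>Real and imaginary parts are excised together, each to accuracy
  \<open>\<delta> / 2\<close>, and the two real scalars combine to a complex one.\<close>

lemma excision:
  assumes A: "cstar_subalgebra A" and wv: "excising_pair A w v" and F: "finite F" "F \<subseteq> A" and \<delta>: "0 < \<delta>"
  shows "\<exists>w' v'. excising_pair A w' v' \<and> w * w' = w' \<and> (\<forall>y\<in>F. \<exists>t. norm (w' * y * w' - t *\<^sub>C (w' * w')) \<le> \<delta>)"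
proof -
  define re im where "re y = (1/2) *\<^sub>R (y + star y)" and "im y = (- \<i> / 2) *\<^sub>C (y - star y)" for y :: "'a l2op"
  have sa: "star (re y) = re y" "star (im y) = im y" for y
    by (simp_all add: re_def im_def star_scaleR star_scaleC star_add star_star star_diff add.commute
        scaleC_diff_right scaleC_minus_left)
  have dec: "y = re y + \<i> *\<^sub>C im y" for y
  proof -
    have "\<i> *\<^sub>C im y = (1/2) *\<^sub>R (y - star y)"
      by (simp add: im_def scaleC_scaleC scaleR_eq_scaleC)
    then have "re y + \<i> *\<^sub>C im y = (1/2) *\<^sub>R (y + y)"
      by (simp add: re_def flip: scaleR_add_right)
    then show ?thesis by (simp flip: scaleR_2)
  qed
  have re_im: "re ` F \<union> im ` F \<subseteq> A"
    using F(2) by (auto simp: re_def im_def intro!: cstar_subalgebraD[OF A])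
  obtain w' v' where 1: "excising_pair A w' v'" "w * w' = w'"
    and t: "\<forall>y\<in>re ` F \<union> im ` F. \<exists>t. norm (w' * y * w' - t *\<^sub>R (w' * w')) \<le> \<delta> / 2"
  proof -
    have "finite (re ` F \<union> im ` F)" "0 < \<delta> / 2" using F(1) \<delta> by simp_all
    moreover have "star y = y" if "y \<in> re ` F \<union> im ` F" for y using that sa by (elim UnE imageE) simp_all
    ultimately have "\<exists>w' v'. excising_pair A w' v' \<and> w * w' = w' \<and>
        (\<forall>y\<in>re ` F \<union> im ` F. \<exists>t. norm (w' * y * w' - t *\<^sub>R (w' * w')) \<le> \<delta> / 2)"
      by (intro excision_real[OF A wv] re_im)
    then show thesis using that by (elim exE conjE)
  qed
  have "\<exists>t. norm (w' * y * w' - t *\<^sub>C (w' * w')) \<le> \<delta>" if y: "y \<in> F" for y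
  proof -
    obtain t1 t2 where t: "norm (w' * re y * w' - t1 *\<^sub>R (w' * w')) \<le> \<delta> / 2" "norm (w' * im y * w' - t2 *\<^sub>R (w' * w')) \<le> \<delta> / 2"
      using bspec[OF t UnI1[OF imageI[OF y]]] bspec[OF t UnI2[OF imageI[OF y]]] by (elim exE)
    have "w' * y * w' = w' * re y * w' + \<i> *\<^sub>C (w' * im y * w')"
      by (subst dec[of y]) (simp only: distrib_left distrib_right mult_scaleC_left mult_scaleC_right)
    then have "w' * y * w' - (t1 + \<i> * t2) *\<^sub>C (w' * w')
      = (w' * re y * w' - t1 *\<^sub>R (w' * w')) + \<i> *\<^sub>C (w' * im y * w' - t2 *\<^sub>R (w' * w'))"
      by (simp add: scaleC_add_left scaleC_diff_right scaleC_scaleC scaleR_eq_scaleC)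
    then have "norm (w' * y * w' - (t1 + \<i> * t2) *\<^sub>C (w' * w'))
      \<le> norm (w' * re y * w' - t1 *\<^sub>R (w' * w')) + norm (\<i> *\<^sub>C (w' * im y * w' - t2 *\<^sub>R (w' * w')))"
      by (metis norm_triangle_ineq)
    then show ?thesis using t by (intro exI[of _ "t1 + \<i> * t2"]) (simp add: norm_scaleC)
  qed
  then show ?thesis using 1 by blast
qed

section \<open>Slices and simplicity of tensor products\<close>

text \<open>Split \<open>t\<close> into its truncation to the interval from 0 to
  \<open>\<theta>\<close>, the part above \<open>\<theta>\<close>, and minus the negative part. The
  first contributes at most \<open>\<theta>\<close>, the last has the favourable sign.\<close>

lemma qf_le_cut:
  assumes b: "star b = b" and \<theta>: "0 \<le> \<theta>"
  shows "qf b u \<le> qf (cut \<theta> b) u + \<theta> * (norm u)\<^sup>2"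
proof -
  define f where "f = (\<lambda>t::real. max 0 (min t \<theta>))"
  define g where "g = (\<lambda>t::real. max (0 - t) 0)"
  have f: "cont0 f" and g: "cont0 g"
    using \<theta> by (auto simp: cont0_def f_def g_def intro!: continuous_intros)
  note k = cont0_cut[OF \<theta>]
  have "fc (\<lambda>t. f t + max (t - \<theta>) 0 - g t) b = fc f b + cut \<theta> b - fc g b"
    by (simp only: fc_diff[OF b cont0_intros(1)[OF f k] g] fc_add_mult(1)[OF b f k])
  moreover have "(\<lambda>t. f t + max (t - \<theta>) 0 - g t) = (\<lambda>t. t)"
    using \<theta> by (auto simp: f_def g_def fun_eq_iff max_def min_def)
  ultimately have dec: "b = fc f b + cut \<theta> b - fc g b"
    by (simp only: fc_id[OF b cont0_intros(5) cont0_intros(5)])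
  have "norm (fc f b) \<le> \<theta>" by (rule norm_fc_le[OF b f \<theta>]) (use \<theta> in \<open>auto simp: f_def\<close>)
  then have "\<bar>qf (fc f b) u\<bar> \<le> \<theta> * (norm u)\<^sup>2"
    using abs_qf_le[of "fc f b" u] mult_right_mono[of "norm (fc f b)" \<theta> "(norm u)\<^sup>2"] by simp
  moreover have "0 \<le> qf (fc g b) u"
    by (rule pos_opD(2)[OF pos_op_fc[OF b g]]) (simp add: g_def)
  moreover have "qf b u = qf (fc f b) u + qf (cut \<theta> b) u - qf (fc g b) u"
    by (subst dec) (simp only: qf_ops)
  ultimately show ?thesis by linarith
qed

lemma cut_conj:
  assumes b: "star b = b" and \<theta>: "0 \<le> \<theta>"
  shows "pos_op (cut \<theta> b * b * cut \<theta> b - \<theta> *\<^sub>R (cut \<theta> b * cut \<theta> b))"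
proof -
  define f where "f = (\<lambda>t::real. max (t - \<theta>) 0)"
  have f: "cont0 f" unfolding f_def by (rule cont0_cut[OF \<theta>])
  have "cut \<theta> b * b * cut \<theta> b - \<theta> *\<^sub>R (cut \<theta> b * cut \<theta> b) = fc (\<lambda>t. f t * t * f t - \<theta> * (f t * f t)) b"
    by (simp only: fc_diff[OF b] fc_add_mult(2)[OF b] fc_scale[OF b _ f] cont0_intros f
        fc_id[OF b cont0_intros(5) cont0_intros(5)] flip: f_def)
  moreover have "pos_op (fc (\<lambda>t. f t * t * f t - \<theta> * (f t * f t)) b)"
  proof (rule pos_op_fc[OF b])
    show "cont0 (\<lambda>t. f t * t * f t - \<theta> * (f t * f t))" by (intro cont0_intros f)
    fix t
    have "f t * t * f t - \<theta> * (f t * f t) = f t * f t * (t - \<theta>)" by (simp add: algebra_simps)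
    also have "0 \<le> \<dots>" by (cases "\<theta> \<le> t") (simp_all add: f_def)
    finally show "0 \<le> f t * t * f t - \<theta> * (f t * f t)" .
  qed
  ultimately show ?thesis by simp
qed

context
  fixes A :: "'x l2op set" and B :: "'y l2op set"
  assumes A: "cstar_subalgebra A" and B: "cstar_subalgebra B"
begin

private abbreviation "T \<equiv> tensor_cl A B"

private lemma subT: "cstar_subalgebra T" by (rule cstar_subalgebra_tensor[OF A B])

text \<open>If \<open>e a_i e\<close> is close to \<open>t_i e^2\<close> for every \<open>i\<close>,
  then compressing the sum of the \<open>a_i \<otimes> b_i\<close> almost collapses it to the single
  elementary tensor of \<open>e^2\<close> with the sum of the \<open>t_i b_i\<close>.\<close>

lemma excised_approximation:
  assumes h: "h \<in> T" and wv: "excising_pair A w v" and \<delta>: "0 < \<delta>"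
  shows "\<exists>e v' b. excising_pair A e v' \<and> w * e = e \<and> b \<in> B \<and>
    norm (tensor_op e 1 * h * tensor_op e 1 - tensor_op (e * e) b) \<le> \<delta>"
proof -
  obtain m a b where ab: "norm (h - (\<Sum>i<m. tensor_op (a i) (b i))) < \<delta> / 2"
    and mem: "\<forall>i<(m::nat). a i \<in> A \<and> b i \<in> B"
    using tensor_cl_approx[OF A B h, of "\<delta> / 2"] \<delta> by auto
  define C where "C = 1 + (\<Sum>i<m. norm (b i))"
  have C: "0 < C" unfolding C_def by (simp add: add_pos_nonneg sum_nonneg)
  have "0 < \<delta> / 2 / C" using \<delta> C by simp
  then obtain e v' where e: "excising_pair A e v'" "w * e = e"
    and t: "\<forall>y\<in>a ` {..<m}. \<exists>t. norm (e * y * e - t *\<^sub>C (e * e)) \<le> \<delta> / 2 / C"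
    using excision[OF A wv, of "a ` {..<m}" "\<delta> / 2 / C"] mem by blast
  have "\<forall>i. \<exists>t. i < m \<longrightarrow> norm (e * a i * e - t *\<^sub>C (e * e)) \<le> \<delta> / 2 / C"
    using t by blast
  from choice[OF this]
  obtain t where t: "\<forall>i. i < m \<longrightarrow> norm (e * a i * e - t i *\<^sub>C (e * e)) \<le> \<delta> / 2 / C"
    by (elim exE)
  have e1: "pos_op e" "norm e \<le> 1" using e(1) by (simp_all add: excising_pair_def)
  define b' where "b' = (\<Sum>i<m. t i *\<^sub>C b i)"
  have b'B: "b' \<in> B" unfolding b'_def
    using mem by (intro cstar_subalgebra_sum[OF B] cstar_subalgebraD[OF B]) auto
  define E where "E = tensor_op e (1 :: 'y l2op)"
  have E: "norm E \<le> 1" "star E = E"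
    using norm_tensor_op_le[of e "1 :: 'y l2op"] e1 by (simp_all add: E_def tensor_op_star star_one pos_opD)
  have "E * (\<Sum>i<m. tensor_op (a i) (b i)) * E = (\<Sum>i<m. tensor_op (e * a i * e) (b i))"
    by (simp add: E_def sum_distrib_left sum_distrib_right tensor_op_mult)
  moreover have "tensor_op (e * e) b' = (\<Sum>i<m. tensor_op (t i *\<^sub>C (e * e)) (b i))"
    by (simp add: b'_def tensor_op_sum_right tensor_op_linear)
  ultimately have dec: "E * h * E - tensor_op (e * e) b' = E * (h - (\<Sum>i<m. tensor_op (a i) (b i))) * E
      + (\<Sum>i<m. tensor_op (e * a i * e - t i *\<^sub>C (e * e)) (b i))"
    by (simp only: right_diff_distrib left_diff_distrib tensor_op_linear2 sum_subtractf) simp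
  have "norm (\<Sum>i<m. tensor_op (e * a i * e - t i *\<^sub>C (e * e)) (b i)) \<le> (\<Sum>i<m. \<delta> / 2 / C * norm (b i))"
  proof (rule sum_norm_le)
    fix i assume "i \<in> {..<m}"
    then show "norm (tensor_op (e * a i * e - t i *\<^sub>C (e * e)) (b i)) \<le> \<delta> / 2 / C * norm (b i)"
      using t[rule_format, of i] by (intro order_trans[OF norm_tensor_op_le] mult_right_mono) simp_all
  qed
  also have "\<dots> = \<delta> / 2 / C * (\<Sum>i<m. norm (b i))" by (rule sum_distrib_left[symmetric])
  also have "\<dots> \<le> \<delta> / 2 / C * C"
    by (rule mult_left_mono) (use \<delta> C in \<open>simp_all add: C_def\<close>)
  also have "\<dots> = \<delta> / 2" using C by simp
  finally have n2: "norm (\<Sum>i<m. tensor_op (e * a i * e - t i *\<^sub>C (e * e)) (b i)) \<le> \<delta> / 2" .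
  define x where "x = h - (\<Sum>i<m. tensor_op (a i) (b i))"
  have "norm (E * x * star E) \<le> (norm E)\<^sup>2 * norm x" by (rule norm_conj_le)
  also have "\<dots> \<le> 1 * norm x" using E(1) by (intro mult_right_mono power_le_one) simp_all
  also have "\<dots> \<le> \<delta> / 2" using ab by (simp add: x_def)
  finally have n1: "norm (E * x * E) \<le> \<delta> / 2" by (simp only: E(2))
  have "norm (E * h * E - tensor_op (e * e) b') \<le> \<delta>"
    unfolding dec x_def[symmetric]
    using norm_triangle_ineq[of "E * x * E" "\<Sum>i<m. tensor_op (e * a i * e - t i *\<^sub>C (e * e)) (b i)"] n1 n2 by linarith
  then show ?thesis using e b'B unfolding E_def by blast
qed

lemma tensor_below_exists:
  assumes h: "h \<in> T" "pos_op h" "h \<noteq> 0"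
  shows "\<exists>a b. a \<in> A \<and> pos_op a \<and> a \<noteq> 0 \<and> b \<in> B \<and> pos_op b \<and> b \<noteq> 0 \<and> cuntz_below T (tensor_op a b) h"
proof -
  obtain y where y: "slice_op y h \<noteq> 0" using slice_op_nonzero[OF h(2,3)] by blast
  define \<Phi> where "\<Phi> = slice_op y h"
  have \<Phi>: "\<Phi> \<in> A" "pos_op \<Phi>" "\<Phi> \<noteq> 0"
    using slice_op_in[OF A B h(1)] pos_op_slice_op[OF h(2)] y by (simp_all add: \<Phi>_def)
  define l where "l = norm \<Phi> / 2"
  have l: "0 < l" "l < norm \<Phi>" using \<Phi>(3) by (simp_all add: l_def)
  define m where "m = (l + norm \<Phi>) / 2"
  define w where "w = fc (ramp l m) \<Phi>"
  note top = excising_pair_top(1,2)[OF A \<Phi> l, folded m_def, folded w_def]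
  have wp: "star w = w" using top(1) by (simp add: excising_pair_def pos_opD)
  \<comment> \<open>Were the form of \<open>b'\<close> at \<open>ket y\<close> at most
    \<open>4 \<delta>\<close>, slicing would give \<open>l \<le> \<delta> + 4 \<delta>\<close>; any
    divisor above 5 serves.\<close>
  define \<delta> where "\<delta> = l / 8"
  have \<delta>: "0 < \<delta>" using l by (simp add: \<delta>_def)
  obtain e v b where ev: "excising_pair A e v" "w * e = e" and b: "b \<in> B"
    and near: "norm (tensor_op e 1 * h * tensor_op e 1 - tensor_op (e * e) b) \<le> \<delta>"
    using excised_approximation[OF h(1) top(1) \<delta>] by blast
  have e: "e \<in> A" "pos_op e" "star e = e" and v: "v \<in> A" "pos_op v" "v \<noteq> 0" "star v = v" "e * v = v"
    using ev(1) by (simp_all add: excising_pair_def pos_opD)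
  have ve: "v * e = v" using arg_cong[OF v(5), of star] by (simp only: star_mult e(3) v(4))
  define E where "E = tensor_op e (1 :: 'y l2op)"
  have Es: "star E = E" by (simp add: E_def tensor_op_star star_one e)
  define H where "H = E * h * E"
  have Hs: "star H = H" by (simp add: H_def star_mult Es pos_opD(1)[OF h(2)] mult.assoc)
  \<comment> \<open>\<open>H\<close> is self-adjoint, so passing to the self-adjoint part of
    \<open>b\<close> averages the error with its adjoint and does not enlarge it.\<close>
  define b' where "b' = (1/2) *\<^sub>R (b + star b)"
  have b': "b' \<in> B" "star b' = b'"
    using b by (simp_all add: b'_def cstar_subalgebraD[OF B] star_scaleR star_add star_star add.commute)
  define D where "D = H - tensor_op (e * e) b'"
  define X where "X = H - tensor_op (e * e) b"
  have nX: "norm X \<le> \<delta>" using near by (simp add: X_def H_def E_def)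
  have DX: "D = (1/2) *\<^sub>R (X + star X)"
  proof -
    have "star X = H - tensor_op (e * e) (star b)"
      by (simp add: X_def star_diff Hs tensor_op_star star_mult e)
    then have "X + star X = (H + H) - (tensor_op (e * e) b + tensor_op (e * e) (star b))"
      by (simp add: X_def)
    moreover have "D = (1/2) *\<^sub>R ((H + H) - (tensor_op (e * e) b + tensor_op (e * e) (star b)))"
      unfolding D_def b'_def scaleR_diff_right scaleR_half_double tensor_op_linear2 tensor_op_linear by (rule refl)
    ultimately show ?thesis by simp
  qed
  have nD: "norm D \<le> \<delta>"
    using norm_triangle_ineq[of X "star X"] nX by (simp add: DX)
  have Ds: "star D = D"
    by (simp add: DX star_scaleR star_add star_star add.commute)
  define q where "q = cut (4 * \<delta>) b'"
  have \<theta>: "0 \<le> 4 * \<delta>" using \<delta> by simp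
  have q: "q \<in> B" "pos_op q"
    unfolding q_def using fc_in[OF B b' cont0_cut[OF \<theta>]] pos_op_fc[OF b'(2) cont0_cut[OF \<theta>]] by simp_all
  note qs = pos_opD(1)[OF q(2)]
  \<comment> \<open>The slice of \<open>D\<close> is tested on a vector \<open>\<zeta>\<close> in
    the range of \<open>v\<close>. It is fixed by \<open>e\<close> and \<open>w\<close>, hence the
    form of \<open>\<Phi>\<close> there is at least \<open>l\<close> times its squared norm, whereas
    a vanishing cut would bound the form of \<open>b'\<close> at \<open>ket y\<close> by
    \<open>4 \<delta>\<close>.\<close>
  have q0: "q \<noteq> 0"
  proof
    assume q0: "q = 0"
    obtain \<xi> where \<xi>: "l2op_apply v \<xi> \<noteq> 0" using v(3) l2op_eqI[of v 0] by (auto simp: l2op_apply_ops)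
    define \<zeta> where "\<zeta> = l2op_apply v \<xi>"
    have e\<zeta>: "l2op_apply e \<zeta> = \<zeta>" using arg_cong[OF v(5), of "\<lambda>S. l2op_apply S \<xi>"] by (simp add: \<zeta>_def l2op_apply_ops)
    have w\<zeta>: "l2op_apply w \<zeta> = \<zeta>"
      using arg_cong[OF ev(2), of "\<lambda>S. l2op_apply S \<zeta>"] by (simp add: l2op_apply_ops e\<zeta>)
    define c where "c = ell2_apply (l2op_apply b' (ket y)) y"
    have sl: "slice_op y D = e * \<Phi> * e - c *\<^sub>C (e * e)"
    proof -
      have "slice_op y D = slice_op y H - slice_op y (tensor_op (e * e) b')"
        unfolding D_def by (rule linear_diff[OF bounded_linear.linear[OF bounded_linear_slice_op]])
      then show ?thesis by (simp only: H_def E_def slice_op_module slice_op_tensor c_def \<Phi>_def)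
    qed
    have "0 \<le> qf (star w * (\<Phi> - l *\<^sub>R 1) * w) \<zeta>" using pos_opD(2)[OF top(2)] by (simp only: wp)
    then have "l * (norm \<zeta>)\<^sup>2 \<le> qf \<Phi> \<zeta>" by (simp add: qf_conj w\<zeta> qf_ops)
    also have "\<dots> = qf (star e * \<Phi> * e) \<zeta>" by (simp only: qf_conj e\<zeta>)
    also have "star e * \<Phi> * e = slice_op y D + c *\<^sub>C (e * e)" by (simp add: sl e)
    also have "qf \<dots> \<zeta> = qf (slice_op y D) \<zeta> + qf (c *\<^sub>C (e * e)) \<zeta>" by (rule qf_ops)
    also have "qf (c *\<^sub>C (e * e)) \<zeta> = Re c * (norm \<zeta>)\<^sup>2"
      by (simp add: qf_def l2op_apply_scaleC_left l2op_apply_ops e\<zeta> cinner_scaleC_right cinner_self_norm)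
    also have "qf (slice_op y D) \<zeta> \<le> \<delta> * (norm \<zeta>)\<^sup>2"
    proof -
      have "\<bar>qf (slice_op y D) \<zeta>\<bar> \<le> norm (slice_op y D) * (norm \<zeta>)\<^sup>2" by (rule abs_qf_le)
      also have "\<dots> \<le> \<delta> * (norm \<zeta>)\<^sup>2"
        using norm_slice_op_le[of y D] nD by (intro mult_right_mono) simp_all
      finally show ?thesis by simp
    qed
    finally have "l * (norm \<zeta>)\<^sup>2 \<le> (\<delta> + Re c) * (norm \<zeta>)\<^sup>2" by (simp add: distrib_right)
    then have "l \<le> \<delta> + Re c" using \<xi> by (simp add: \<zeta>_def)
    moreover have "Re c = qf b' (ket y)" by (simp add: c_def qf_def cinner_ket_left)
    moreover have "qf b' (ket y) \<le> 4 * \<delta>"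
      using qf_le_cut[OF b'(2) \<theta>, of "ket y"] by (simp add: qf_ops q0 flip: q_def)
    ultimately show False using l by (simp add: \<delta>_def)
  qed
  define S where "S = tensor_op v q"
  have S: "S \<in> T" "star S = S"
    using tensor_cl_elem[OF A B v(1) q(1)] by (simp_all add: S_def tensor_op_star v qs)
  have SE: "S * E = S" "E * S = S" by (simp_all add: S_def E_def tensor_op_mult ve v)
  have ShS: "S * h * S = S * H * S"
  proof -
    have "S * H * S = (S * E) * h * (E * S)" by (simp only: H_def mult.assoc)
    then show ?thesis by (simp only: SE)
  qed
  \<comment> \<open>Conjugating \<open>H \<ge> e^2 \<otimes> b' - \<delta>\<close> by
    \<open>S\<close> gives \<open>S h S \<ge> v^2 \<otimes> (q b' q - \<delta> q^2)\<close>, and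
    \<open>q b' q \<ge> 4 \<delta> q^2\<close>. This leaves \<open>3 \<delta>\<close>, of which
    \<open>2 \<delta>\<close> is used.\<close>
  define a1 b1 where "a1 = v * v" and "b1 = (2 * \<delta>) *\<^sub>R (q * q)"
  have "v * v \<noteq> 0" "q * q \<noteq> 0"
    using norm_selfadjoint_sq[OF v(4)] v(3) norm_selfadjoint_sq[OF qs] q0 by auto
  then have ab: "a1 \<in> A" "pos_op a1" "a1 \<noteq> 0" "b1 \<in> B" "pos_op b1" "b1 \<noteq> 0"
    using v q \<delta> pos_op_star_mult(1)[of v] pos_op_star_mult(1)[of q] unfolding a1_def b1_def
    by (simp_all add: cstar_subalgebraD[OF A] cstar_subalgebraD[OF B] pos_op_intros qs)
  have "pos_op (S * h * S - tensor_op a1 b1)"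
  proof -
    have 1: "pos_op (S * (D + \<delta> *\<^sub>R 1) * S)"
      using pos_op_conj[OF pos_op_add_norm[OF Ds nD], of S] by (simp only: S)
    have 2: "pos_op (tensor_op (v * v) (q * b' * q - (4 * \<delta>) *\<^sub>R (q * q)))"
      using pos_op_tensor[OF pos_op_star_mult(1)[of v] cut_conj[OF b'(2) \<theta>]] by (simp only: v q_def)
    have 3: "pos_op (\<delta> *\<^sub>R tensor_op (v * v) (q * q))"
      using pos_op_tensor[OF pos_op_star_mult(1)[of v] pos_op_star_mult(1)[of q]] \<delta>
      by (simp add: v qs pos_op_intros)
    have S1: "S * tensor_op (e * e) b' * S = tensor_op (v * v) (q * b' * q)"
    proof -
      have "v * (e * e) * v = (v * e) * (e * v)" by (simp only: mult.assoc)
      then show ?thesis by (simp add: S_def tensor_op_mult ve v)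
    qed
    have S2: "S * S = tensor_op (v * v) (q * q)" by (simp add: S_def tensor_op_mult)
    have "S * (D + \<delta> *\<^sub>R 1) * S = S * h * S - tensor_op (v * v) (q * b' * q) + \<delta> *\<^sub>R tensor_op (v * v) (q * q)"
      unfolding D_def
      by (simp only: distrib_left distrib_right left_diff_distrib right_diff_distrib S1 ShS
          mult_scaleR_left mult_scaleR_right mult_1_right S2)
    then have "S * h * S - tensor_op a1 b1 = S * (D + \<delta> *\<^sub>R 1) * S
      + (tensor_op (v * v) (q * b' * q - (4 * \<delta>) *\<^sub>R (q * q)) + \<delta> *\<^sub>R tensor_op (v * v) (q * q))"
      unfolding a1_def b1_def tensor_op_linear2 by (simp add: flip: scaleR_left_distrib scaleR_left_diff_distrib)
    then show ?thesis using pos_op_intros(2)[OF 1 pos_op_intros(2)[OF 2 3]] by simp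
  qed
  then have "cuntz_below T (tensor_op a1 b1) (S * h * S)"
    using tensor_cl_elem[OF A B ab(1,4)] pos_op_tensor[OF ab(2,5)] S h pos_op_conj[OF h(2), of S]
    by (intro cuntz_below_of_le[OF subT] cstar_subalgebraD(3)[OF subT]) simp_all
  moreover have "cuntz_below T (S * h * S) h"
    using cuntz_below_conj[OF S(1), of h] by (simp only: S(2))
  ultimately have "cuntz_below T (tensor_op a1 b1) h" by (rule cuntz_below_trans[OF subT])
  then show ?thesis using ab by blast
qed

lemma closed_approx: "closed I \<Longrightarrow> (\<And>e. 0 < e \<Longrightarrow> \<exists>y\<in>I. norm (y - x) < e) \<Longrightarrow> x \<in> I"
  unfolding closed_approachable[symmetric] closure_approachable dist_norm by (metis closed_approachable dist_norm)

lemma tensor_op_nonzero: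
  fixes a :: "'x l2op" and b :: "'y l2op"
  assumes "a \<noteq> 0" "b \<noteq> 0" shows "tensor_op a b \<noteq> 0"
proof
  assume 0: "tensor_op a b = 0"
  obtain v where "l2op_apply a v \<noteq> 0" using assms(1) l2op_eqI[of a 0] by (auto simp: l2op_apply_ops)
  then obtain x where x: "ell2_apply (l2op_apply a v) x \<noteq> 0"
    using ell2_eqI[of "l2op_apply a v" 0] by (auto simp: zero_ell2.rep_eq)
  obtain w where "l2op_apply b w \<noteq> 0" using assms(2) l2op_eqI[of b 0] by (auto simp: l2op_apply_ops)
  then obtain z where z: "ell2_apply (l2op_apply b w) z \<noteq> 0"
    using ell2_eqI[of "l2op_apply b w" 0] by (auto simp: zero_ell2.rep_eq)
  have "tensor_vec (l2op_apply a v) (l2op_apply b w) = 0"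
    using tensor_op_tensor_vec[of a b v w] by (simp add: 0 l2op_apply_ops)
  then have "ell2_apply (l2op_apply a v) x * ell2_apply (l2op_apply b w) z = 0"
    using ell2_apply_tensor_vec[of "l2op_apply a v" "l2op_apply b w" x z] by (simp add: zero_ell2.rep_eq)
  then show False using x z by simp
qed

text \<open>\<open>c \<otimes> 1\<close> need not belong to the tensor product. Multiplying by
  \<open>c \<otimes> u\<close> instead, with \<open>u\<close> an approximate unit for
  \<open>b\<close>, approximates the required element, and the ideal is closed.\<close>

private lemma ideal_left:
  assumes I: "closed_ideal T I" and ab: "tensor_op a b \<in> I" "a \<in> A" "b \<in> B" and c: "c \<in> A"
  shows "tensor_op (a * c) b \<in> I" "tensor_op (c * a) b \<in> I"
proof -
  have "\<exists>y\<in>I. norm (y - tensor_op (a * c) b) < e \<and> (\<exists>y'\<in>I. norm (y' - tensor_op (c * a) b) < e)" if e: "0 < e" for e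
  proof -
    define K where "K = 1 + norm (a * c) + norm (c * a)"
    have K: "0 < K" by (simp add: K_def add_pos_nonneg)
    obtain u where u: "u \<in> B" "norm (u * b - b) < e / K" "norm (b * u - b) < e / K"
      using approximate_unit[OF B, of "{b}" "e / K"] ab e K by auto
    have n: "norm (tensor_op p x) < e" if "norm x < e / K" "norm p \<le> K" for p x
    proof (rule le_less_trans[OF norm_tensor_op_le])
      have "norm p * norm x \<le> K * norm x" using that(2) by (rule mult_right_mono) simp
      also have "\<dots> < e" using that(1) K by (simp add: field_simps)
      finally show "norm p * norm x < e" .
    qed
    have "norm (tensor_op (a * c) (b * u - b)) < e" "norm (tensor_op (c * a) (u * b - b)) < e"
      by (intro n u; simp add: K_def)+
    moreover have "tensor_op (a * c) (b * u) \<in> I" "tensor_op (c * a) (u * b) \<in> I"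
      using closed_idealD(5,6)[OF I ab(1) tensor_cl_elem[OF A B c u(1)]] by (simp_all add: tensor_op_mult)
    ultimately show ?thesis unfolding tensor_op_linear2 by blast
  qed
  then show "tensor_op (a * c) b \<in> I" "tensor_op (c * a) b \<in> I"
    by (meson closed_approx closed_idealD(7)[OF I])+
qed

private lemma ideal_right:
  assumes I: "closed_ideal T I" and ab: "tensor_op a b \<in> I" "a \<in> A" "b \<in> B" and c: "c \<in> B"
  shows "tensor_op a (b * c) \<in> I" "tensor_op a (c * b) \<in> I"
proof -
  have "\<exists>y\<in>I. norm (y - tensor_op a (b * c)) < e \<and> (\<exists>y'\<in>I. norm (y' - tensor_op a (c * b)) < e)" if e: "0 < e" for e
  proof -
    define K where "K = 1 + norm (b * c) + norm (c * b)"
    have K: "0 < K" by (simp add: K_def add_pos_nonneg)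
    obtain u where u: "u \<in> A" "norm (u * a - a) < e / K" "norm (a * u - a) < e / K"
      using approximate_unit[OF A, of "{a}" "e / K"] ab e K by auto
    have n: "norm (tensor_op x p) < e" if "norm x < e / K" "norm p \<le> K" for p x
    proof (rule le_less_trans[OF norm_tensor_op_le])
      have "norm x * norm p \<le> norm x * K" using that(2) by (rule mult_left_mono) simp
      also have "\<dots> < e" using that(1) K by (simp add: field_simps)
      finally show "norm x * norm p < e" .
    qed
    have "norm (tensor_op (a * u - a) (b * c)) < e" "norm (tensor_op (u * a - a) (c * b)) < e"
      by (intro n u; simp add: K_def)+
    moreover have "tensor_op (a * u) (b * c) \<in> I" "tensor_op (u * a) (c * b) \<in> I"
      using closed_idealD(5,6)[OF I ab(1) tensor_cl_elem[OF A B u(1) c]] by (simp_all add: tensor_op_mult)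
    ultimately show ?thesis unfolding tensor_op_linear2 by blast
  qed
  then show "tensor_op a (b * c) \<in> I" "tensor_op a (c * b) \<in> I"
    by (meson closed_approx closed_idealD(7)[OF I])+
qed

text \<open>A nonzero ideal contains some \<open>star x * x\<close>, and with it a nonzero
  elementary tensor Cuntz below it. With one factor fixed, the admissible other factors form a
  closed ideal, so simplicity of \<open>A\<close> and then of \<open>B\<close> yields all elementary
  tensors.\<close>

lemma simple_cstar_tensor:
  assumes simpleA: "simple_cstar A" and simpleB: "simple_cstar B"
  shows "simple_cstar T"
proof -
  obtain a0 b0 where 0: "a0 \<in> A" "a0 \<noteq> 0" "b0 \<in> B" "b0 \<noteq> 0"
    using simpleA simpleB cstar_subalgebraD(1)[OF A] cstar_subalgebraD(1)[OF B] unfolding simple_cstar_def by blast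
  have "T \<noteq> {0}" using tensor_cl_elem[OF A B 0(1,3)] tensor_op_nonzero[OF 0(2,4)] by blast
  moreover have "I = T" if I: "closed_ideal T I" "I \<noteq> {0}" for I
  proof -
    note ID = closed_idealD[OF I(1)]
    obtain x where x: "x \<in> I" "x \<noteq> 0" using I(2) ID(2) by blast
    have xT: "x \<in> T" using ID(1) x(1) by blast
    define h where "h = star x * x"
    have h: "h \<in> I" "pos_op h" "h \<noteq> 0"
      using ID(6)[OF x(1) cstar_subalgebraD(5)[OF subT xT]] pos_op_star_mult(1)[of x] x(2)
      by (simp_all add: h_def star_mult_self_eq_0_iff)
    have hT: "h \<in> T" using ID(1) h(1) by blast
    obtain a b where ab: "a \<in> A" "a \<noteq> 0" "b \<in> B" "b \<noteq> 0" "cuntz_below T (tensor_op a b) h"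
      using tensor_below_exists[OF hT h(2,3)] by blast
    have "tensor_op a b \<in> I"
    proof (rule closed_approx[OF ID(7)])
      fix e :: real assume "0 < e"
      then obtain v where v: "v \<in> T" "norm (tensor_op a b - v * h * star v) < e" using cuntz_belowD[OF ab(5)] by blast
      have "v * h * star v \<in> I"
        by (intro ID(5,6) h v cstar_subalgebraD(5)[OF subT])
      then show "\<exists>y\<in>I. norm (y - tensor_op a b) < e" using v(2)[unfolded norm_minus_commute[of "tensor_op a b"]] by blast
    qed
    moreover have "A \<inter> {a. tensor_op a b \<in> I} = A" if "tensor_op a b \<in> I" "a \<in> A" "a \<noteq> 0" "b \<in> B" for a b
    proof (rule simple_cstarD(2)[OF simpleA])
      show "closed_ideal A (A \<inter> {a. tensor_op a b \<in> I})"
      proof (rule closed_idealI[OF A])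
        show "closed {a. tensor_op a b \<in> I}"
          using closed_vimage[OF ID(7) linear_continuous_on[OF bounded_linear_tensor_op_left[of b]]]
          by (simp add: vimage_def)
      qed (use that ideal_left[OF I(1)] in \<open>auto simp: tensor_op_linear tensor_op_linear2 ID(2,3,4)\<close>)
      show "a \<in> A \<inter> {a. tensor_op a b \<in> I}" using that by simp
    qed (use that in simp)
    ultimately have 1: "tensor_op a' b \<in> I" if "a' \<in> A" for a' using ab that by blast
    have 2: "B \<inter> {b. tensor_op a b \<in> I} = B" if "a \<in> A" for a
    proof (rule simple_cstarD(2)[OF simpleB])
      show "closed_ideal B (B \<inter> {b. tensor_op a b \<in> I})"
      proof (rule closed_idealI[OF B])
        show "closed {b. tensor_op a b \<in> I}"
          using closed_vimage[OF ID(7) linear_continuous_on[OF bounded_linear_tensor_op_right[of a]]]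
          by (simp add: vimage_def)
      qed (use that ideal_right[OF I(1)] in \<open>auto simp: tensor_op_linear tensor_op_linear2 ID(2,3,4)\<close>)
      show "b \<in> B \<inter> {b. tensor_op a b \<in> I}" using that ab 1 by simp
    qed (use ab in simp)
    have "h' \<in> I" if "h' \<in> T" for h'
      by (rule tensor_cl_induct[OF A B that ID(7,2,3)]) (use 2 in blast)+
    then show "I = T" using ID(1) by blast
  qed
  ultimately show ?thesis using subT unfolding simple_cstar_def by blast
qed

end

section \<open>Elements below finitely many copies of a positive element\<close>

text \<open>Positive elements lying below finitely many copies of \<open>b\<close>. They are
  generated term by term, so that sums and conjugates need no reindexing.\<close>

inductive_set conj_sums :: "'y l2op set \<Rightarrow> 'y l2op \<Rightarrow> 'y l2op set" for B b where
  zero: "0 \<in> conj_sums B b"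
| add: "t \<in> conj_sums B b \<Longrightarrow> c \<in> B \<Longrightarrow> t + c * b * star c \<in> conj_sums B b"

lemma conj_sums_sum:
  assumes "t \<in> conj_sums B b"
  shows "\<exists>(k::nat) c. (\<forall>i<k. c i \<in> B) \<and> t = (\<Sum>i<k. c i * b * star (c i))"
  using assms
proof induction
  case zero then show ?case by (intro exI[of _ 0]) simp
next
  case (add t d)
  then obtain k :: nat and c where "\<forall>i<k. c i \<in> B" "t = (\<Sum>i<k. c i * b * star (c i))" by blast
  then have "(\<forall>i<Suc k. (c(k := d)) i \<in> B) \<and>
      t + d * b * star d = (\<Sum>i<Suc k. (c(k := d)) i * b * star ((c(k := d)) i))"
    using add.hyps(2) by (simp add: less_Suc_eq)
  then show ?case by blast
qed

context
  fixes B :: "'y l2op set" and b :: "'y l2op"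
  assumes B: "cstar_subalgebra B" and b: "b \<in> B" "pos_op b"
begin

lemma conj_sums:
  shows "t \<in> conj_sums B b \<Longrightarrow> s \<in> conj_sums B b \<Longrightarrow> s + t \<in> conj_sums B b"
    "t \<in> conj_sums B b \<Longrightarrow> d \<in> B \<Longrightarrow> d * t * star d \<in> conj_sums B b"
    "t \<in> conj_sums B b \<Longrightarrow> 0 \<le> r \<Longrightarrow> r *\<^sub>R t \<in> conj_sums B b"
    "t \<in> conj_sums B b \<Longrightarrow> t \<in> B \<and> pos_op t"
proof -
  show "s + t \<in> conj_sums B b" if "t \<in> conj_sums B b" "s \<in> conj_sums B b" for s t
    using that by induction (auto simp: add.assoc[symmetric] intro: conj_sums.add)
  show "d * t * star d \<in> conj_sums B b" if "t \<in> conj_sums B b" "d \<in> B" for d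
    using that(1)
  proof induction
    case zero then show ?case by (simp add: conj_sums.zero)
  next
    case (add t c)
    have "d * (t + c * b * star c) * star d = d * t * star d + (d * c) * b * star (d * c)"
      by (simp only: distrib_left distrib_right star_mult mult.assoc)
    then show ?case using conj_sums.add[OF add.IH cstar_subalgebraD(3)[OF B that(2) add.hyps(2)]] by simp
  qed
  show "r *\<^sub>R t \<in> conj_sums B b" if "t \<in> conj_sums B b" "0 \<le> r"
    using that(1)
  proof induction
    case zero then show ?case by (simp add: conj_sums.zero)
  next
    case (add t c)
    have "(sqrt r *\<^sub>R c) * b * star (sqrt r *\<^sub>R c) = r *\<^sub>R (c * b * star c)"
      using that(2) by (simp add: star_scaleR)
    then show ?case
      using conj_sums.add[OF add.IH cstar_subalgebraD(9)[OF B add.hyps(2)], of "sqrt r"] by (simp add: scaleR_right_distrib)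
  qed
  show "t \<in> B \<and> pos_op t" if "t \<in> conj_sums B b"
    using that by induction
      (auto intro!: pos_op_intros pos_op_conj' b cstar_subalgebraD(1,2,3,5)[OF B])
qed

text \<open>An algebraic two-sided ideal: right factors are absorbed by \<open>x d d\<^sup>* x\<^sup>* \<le> \<parallel>d\<parallel>\<^sup>2 x x\<^sup>*\<close>.\<close>
definition dominated :: "'y l2op set"
  where "dominated = {x \<in> B. \<exists>t\<in>conj_sums B b. pos_op (t - x * star x)}"

lemma dominated:
  shows "0 \<in> dominated" "x \<in> dominated \<Longrightarrow> y \<in> dominated \<Longrightarrow> x + y \<in> dominated"
    "x \<in> dominated \<Longrightarrow> c *\<^sub>C x \<in> dominated" "x \<in> dominated \<Longrightarrow> d \<in> B \<Longrightarrow> d * x \<in> dominated"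
    "x \<in> dominated \<Longrightarrow> d \<in> B \<Longrightarrow> x * d \<in> dominated" "b \<in> dominated"
proof -
  show "0 \<in> dominated"
    using conj_sums.zero[of B b] cstar_subalgebraD(1)[OF B] pos_op_intros(1) by (auto simp: dominated_def star_zero)
  show "x + y \<in> dominated" if xy: "x \<in> dominated" "y \<in> dominated" for x y
  proof -
    obtain s t where st: "s \<in> conj_sums B b" "t \<in> conj_sums B b" "pos_op (s - x * star x)" "pos_op (t - y * star y)"
      and xyB: "x \<in> B" "y \<in> B"
      using xy unfolding dominated_def by blast
    \<comment> \<open>Parallelogram law: adding this term to the one for \<open>x + y\<close> gives
      twice the sum of \<open>x star x\<close> and \<open>y star y\<close>.\<close>
    have "pos_op ((x - y) * star (x - y))" by (rule pos_op_star_mult)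
    moreover have "2 *\<^sub>R (s + t) - (x + y) * star (x + y)
      = 2 *\<^sub>R (s - x * star x) + (2 *\<^sub>R (t - y * star y) + (x - y) * star (x - y))"
      by (simp add: star_add star_diff algebra_simps scaleR_2)
    ultimately have "pos_op (2 *\<^sub>R (s + t) - (x + y) * star (x + y))"
      using st by (simp add: pos_op_intros)
    then show ?thesis
      using conj_sums(3)[OF conj_sums(1)[OF st(2,1)], of 2] cstar_subalgebraD(2)[OF B xyB] unfolding dominated_def by auto
  qed
  have *: "x' \<in> dominated" if x': "x' \<in> B" "0 \<le> r" "x \<in> dominated" "pos_op (r *\<^sub>R (x * star x) - x' * star x')" for x x' r
  proof -
    obtain t where t: "t \<in> conj_sums B b" "pos_op (t - x * star x)" using x'(3) unfolding dominated_def by blast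
    have "pos_op (r *\<^sub>R (t - x * star x) + (r *\<^sub>R (x * star x) - x' * star x'))"
      by (intro pos_op_intros(2,3) t x')
    then have "pos_op (r *\<^sub>R t - x' * star x')" by (simp add: scaleR_diff_right)
    then show ?thesis using conj_sums(3)[OF t(1) x'(2)] x'(1) unfolding dominated_def by blast
  qed
  show "c *\<^sub>C x \<in> dominated" if x: "x \<in> dominated"
  proof (rule *[OF _ _ x])
    show "c *\<^sub>C x \<in> B" using x cstar_subalgebraD(4)[OF B] by (simp add: dominated_def)
    have "(c *\<^sub>C x) * star (c *\<^sub>C x) = (cmod c)\<^sup>2 *\<^sub>R (x * star x)"
      unfolding scaleR_eq_scaleC complex_norm_square
      by (simp only: star_scaleC mult_scaleC_left mult_scaleC_right scaleC_scaleC mult.commute[of "cnj c"])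
    then show "pos_op ((cmod c)\<^sup>2 *\<^sub>R (x * star x) - (c *\<^sub>C x) * star (c *\<^sub>C x))" by (simp add: pos_op_intros)
  qed simp
  show "d * x \<in> dominated" if xd: "x \<in> dominated" and d: "d \<in> B"
  proof -
    obtain t where t: "t \<in> conj_sums B b" "pos_op (t - x * star x)" and x: "x \<in> B"
      using xd unfolding dominated_def by blast
    have "d * (t - x * star x) * star d = d * t * star d - (d * x) * star (d * x)"
      by (simp only: left_diff_distrib right_diff_distrib star_mult mult.assoc)
    then have "pos_op (d * t * star d - (d * x) * star (d * x))" using pos_op_conj'[OF t(2), of d] by simp
    then show ?thesis using conj_sums(2)[OF t(1) d] cstar_subalgebraD(3)[OF B d x] unfolding dominated_def by blast
  qed
  show "x * d \<in> dominated" if x: "x \<in> dominated" and d: "d \<in> B"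
  proof (rule *[OF _ _ x])
    show "x * d \<in> B" using x cstar_subalgebraD(3)[OF B _ d] by (simp add: dominated_def)
    have "pos_op (- (d * star d) + norm (d * star d) *\<^sub>R 1)"
      by (rule pos_op_add_norm) (simp_all add: star_minus star_mult star_star)
    then have "pos_op (x * (- (d * star d) + norm (d * star d) *\<^sub>R 1) * star x)" by (rule pos_op_conj')
    moreover have "x * (- (d * star d) + norm (d * star d) *\<^sub>R 1) * star x
      = norm (d * star d) *\<^sub>R (x * star x) - (x * d) * star (x * d)"
      by (simp add: left_diff_distrib right_diff_distrib star_mult mult.assoc)
    ultimately show "pos_op (norm (d * star d) *\<^sub>R (x * star x) - (x * d) * star (x * d))" by simp
  qed simp
  \<comment> \<open>\<open>b * star b\<close> is itself a conjugate of \<open>b\<close>, by its own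
    square root.\<close>
  have "0 + sqrt_op b * b * star (sqrt_op b) \<in> conj_sums B b"
    by (rule conj_sums.add[OF conj_sums.zero sqrt_op_in[OF B b]])
  moreover have "sqrt_op b * b * star (sqrt_op b) = b * star b"
    by (metis mult.assoc sqrt_op[OF b(2)] pos_opD(1)[OF b(2)])
  ultimately have "\<exists>t\<in>conj_sums B b. pos_op (t - b * star b)"
    by (intro bexI[of _ "b * star b"]) (simp_all add: pos_op_intros)
  then show "b \<in> dominated" using b unfolding dominated_def by blast
qed

text \<open>Sums of conjugates are not a linear space, so simplicity is applied to the closure of
  \<open>dominated\<close>: \<open>f\<close> is a limit of elements \<open>s\<close> with
  \<open>s star s \<le> t\<close> for a sum \<open>t\<close> of conjugates. By
  \<open>cuntz_below_of_le\<close> the product \<open>s star s\<close> is close to some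
  \<open>d t star d\<close>, which is again such a sum.\<close>

lemma simple_conj_sums:
  assumes simple: "simple_cstar B" and b0: "b \<noteq> 0" and f: "f \<in> B" and e: "0 < e"
  shows "\<exists>t\<in>conj_sums B b. norm (f * star f - t) < e"
proof -
  have dB: "dominated \<subseteq> B" by (auto simp: dominated_def)
  have cl: "x \<in> closure dominated \<longleftrightarrow> (\<exists>s. (\<forall>n. s n \<in> dominated) \<and> s \<longlonglongrightarrow> x)" for x
    by (rule closure_sequential)
  have "closed_ideal B (B \<inter> closure dominated)"
  proof (rule closed_idealI[OF B])
    show "0 \<in> closure dominated" using dominated(1) closure_subset by blast
    show "x + y \<in> closure dominated" if xy: "x \<in> closure dominated" "y \<in> closure dominated" for x y
    proof -
      obtain s t where "\<forall>n. s n \<in> dominated" "s \<longlonglongrightarrow> x" "\<forall>n. t n \<in> dominated" "t \<longlonglongrightarrow> y"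
        using xy unfolding cl by (elim exE conjE)
      then show ?thesis unfolding cl by (intro exI[of _ "\<lambda>n. s n + t n"] conjI allI tendsto_add dominated(2)) simp_all
    qed
    have cont: "g x \<in> closure dominated" if "continuous_on UNIV g" "\<And>x. x \<in> dominated \<Longrightarrow> g x \<in> dominated" "x \<in> closure dominated" for g x
      using image_closure_subset[of dominated g "closure dominated"] that continuous_on_subset[OF that(1) subset_UNIV]
        closure_subset[of dominated] by blast
    show "c *\<^sub>C x \<in> closure dominated" if "x \<in> closure dominated" for c x
      by (rule cont[OF _ dominated(3) that]) (intro linear_continuous_on bounded_linear_scaleC)
    show "x * d \<in> closure dominated" if "x \<in> closure dominated" "d \<in> B" for d x
      by (rule cont[OF _ dominated(5)[OF _ that(2)] that(1)]) (intro continuous_intros)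
    show "d * x \<in> closure dominated" if "x \<in> closure dominated" "d \<in> B" for d x
      by (rule cont[OF _ dominated(4)[OF _ that(2)] that(1)]) (intro continuous_intros)
  qed simp
  then have "B \<inter> closure dominated = B"
    using simple_cstarD(2)[OF simple _ _ b0] dominated(6) b(1) closure_subset by blast
  then obtain s where s: "\<And>n. s n \<in> dominated" "s \<longlonglongrightarrow> f" using f cl[of f] by auto
  have "(\<lambda>n. s n * star (s n)) \<longlonglongrightarrow> f * star f" by (intro tendsto_mult tendsto_star s)
  then obtain n where n: "norm (s n * star (s n) - f * star f) < e / 2"
    using LIMSEQ_D[of _ _ "e / 2"] e by (meson half_gt_zero order_refl)
  obtain t where t: "t \<in> conj_sums B b" "pos_op (t - s n * star (s n))" and sB: "s n \<in> B"
    using s(1)[of n] unfolding dominated_def by blast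
  have "cuntz_below B (s n * star (s n)) t"
    using t conj_sums(4)[OF t(1)] sB
    by (intro cuntz_below_of_le[OF B] pos_op_star_mult cstar_subalgebraD[OF B]) simp_all
  then obtain d where d: "d \<in> B" "norm (s n * star (s n) - d * t * star d) < e / 2"
    using cuntz_belowD[of B _ _ "e / 2"] e by (meson half_gt_zero)
  have "norm (f * star f - d * t * star d) < e"
    using norm_triangle_ineq[of "f * star f - s n * star (s n)" "s n * star (s n) - d * t * star d"] n d(2)
    by (simp add: norm_minus_commute)
  then show ?thesis using conj_sums(2)[OF t(1) d(1)] by blast
qed

end

section \<open>Matrices over operator algebras as operators\<close>

lemma tensor_op_sum_left: "tensor_op (\<Sum>i\<in>I. S i) T = (\<Sum>i\<in>I. tensor_op (S i) T)"
  by (rule linear_sum[OF bounded_linear.linear[OF bounded_linear_tensor_op_left]])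

lemma scaleC_ell2_linear:
  "(c + d) *\<^sub>C (v :: 'x ell2) = c *\<^sub>C v + d *\<^sub>C v" "(c * d) *\<^sub>C v = c *\<^sub>C d *\<^sub>C v"
  by (rule ell2_eqI; simp add: scaleC_ell2.rep_eq plus_ell2.rep_eq algebra_simps)+

text \<open>Matrix units on one infinite-dimensional space, so that matrices of every size act on
  the same Hilbert space and the size stays out of the type.\<close>

definition mat_unit :: "nat \<Rightarrow> nat \<Rightarrow> nat l2op"
  where "mat_unit i j = Abs_l2op (Blinfun (\<lambda>v. ell2_apply v j *\<^sub>C ket i))"

lemma l2op_apply_mat_unit: "l2op_apply (mat_unit i j) v = ell2_apply v j *\<^sub>C ket i"
  unfolding mat_unit_def
proof (rule l2op_apply_Abs_l2op)
  show "bounded_linear (\<lambda>v. ell2_apply v j *\<^sub>C (ket i :: nat ell2))"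
  proof (rule bounded_linear_intro[where K = 1])
    show "norm (ell2_apply v j *\<^sub>C (ket i :: nat ell2)) \<le> norm v * 1" for v
    proof -
      have "(cmod (ell2_apply v j))\<^sup>2 \<le> (norm v)\<^sup>2" using finite_sum_le_norm_ell2[of "{j}" v] by simp
      then have "cmod (ell2_apply v j) \<le> norm v" by (rule power2_le_imp_le) simp
      then show ?thesis by (simp add: norm_scaleC_ell2)
    qed
  qed (simp_all add: plus_ell2.rep_eq scaleR_ell2.rep_eq scaleC_ell2_linear ell2_scaleR_scaleC scaleC_ell2.rep_eq)
qed (simp add: scaleC_ell2.rep_eq scaleC_ell2_linear)

lemma mat_unit:
  "mat_unit i j * mat_unit l m = (if j = l then mat_unit i m else 0)"
  "star (mat_unit i j) = mat_unit j i"
proof -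
  show "mat_unit i j * mat_unit l m = (if j = l then mat_unit i m else 0)"
    by (rule l2op_eqI) (simp add: l2op_apply_ops l2op_apply_mat_unit scaleC_ell2.rep_eq ell2_apply_ket ell2_eqI zero_ell2.rep_eq)
  show "star (mat_unit i j) = mat_unit j i"
  proof (rule l2op_eqI, rule cinner_eqI)
    fix v u :: "nat ell2"
    show "cinner u (l2op_apply (star (mat_unit i j)) v) = cinner u (l2op_apply (mat_unit j i) v)"
      using cinner_commute[of u "ket j"]
      by (simp add: cinner_star l2op_apply_mat_unit cinner_scaleC_left cinner_scaleC_right cinner_ket_left)
  qed
qed

text \<open>Turns a matrix over an operator algebra into an operator, so that square roots and
  quadratic forms become available for the positivity of amplifications.\<close>

definition mat_rep :: "nat \<Rightarrow> (nat \<Rightarrow> nat \<Rightarrow> 'x l2op) \<Rightarrow> ('x \<times> nat) l2op"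
  where "mat_rep k Y = (\<Sum>i<k. \<Sum>j<k. tensor_op (Y i j) (mat_unit i j))"

text \<open>The matrix units move the entry to the corner \<open>(0, 0)\<close>, where a slice reads
  it off. As bounded linear maps the entries also show that \<open>mat_rep_alg\<close> is
  closed.\<close>

definition rep_entry :: "nat \<Rightarrow> nat \<Rightarrow> ('x \<times> nat) l2op \<Rightarrow> 'x l2op"
  where "rep_entry i j Z = slice_op 0 (tensor_op 1 (mat_unit 0 i) * Z * tensor_op 1 (mat_unit j 0))"

lemma mat_rep_cong: "(\<And>i j. i < k \<Longrightarrow> j < k \<Longrightarrow> Y i j = Y' i j) \<Longrightarrow> mat_rep k Y = mat_rep k Y'"
  unfolding mat_rep_def by (intro sum.cong) simp_all

lemma mat_rep_linear:
  "mat_rep k (\<lambda>i j. Y i j + Y' i j) = mat_rep k Y + mat_rep k Y'"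
  "mat_rep k (\<lambda>i j. c *\<^sub>C Y i j) = c *\<^sub>C mat_rep k Y"
  "mat_rep k (\<lambda>i j. 0) = 0"
  unfolding mat_rep_def by (simp_all add: tensor_op_linear tensor_op_linear2 sum.distrib scaleC_sum_right)

lemma mat_rep_mult: "mat_rep k Y * mat_rep k Y' = mat_rep k (\<lambda>i j. \<Sum>l<k. Y i l * Y' l j)"
proof -
  have step: "tensor_op (Y i j) (mat_unit i j) * mat_rep k Y' = (\<Sum>m<k. tensor_op (Y i j * Y' j m) (mat_unit i m))"
    if j: "j \<in> {..<k}" for i j
  proof -
    have "tensor_op (Y i j) (mat_unit i j) * mat_rep k Y'
      = (\<Sum>l<k. if j = l then \<Sum>m<k. tensor_op (Y i j * Y' l m) (mat_unit i m) else 0)"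
      unfolding mat_rep_def sum_distrib_left tensor_op_mult
      by (intro sum.cong refl) (simp add: mat_unit tensor_op_linear2)
    then show ?thesis using j by (simp add: sum.delta)
  qed
  have "mat_rep k Y * mat_rep k Y' = (\<Sum>i<k. \<Sum>j<k. tensor_op (Y i j) (mat_unit i j) * mat_rep k Y')"
    by (simp only: mat_rep_def[of k Y] sum_distrib_right)
  also have "\<dots> = (\<Sum>i<k. \<Sum>j<k. \<Sum>m<k. tensor_op (Y i j * Y' j m) (mat_unit i m))"
    by (intro sum.cong refl step)
  also have "\<dots> = (\<Sum>i<k. \<Sum>m<k. \<Sum>j<k. tensor_op (Y i j * Y' j m) (mat_unit i m))"
    by (rule sum.cong[OF refl]) (rule sum.swap)
  finally show ?thesis by (simp add: mat_rep_def tensor_op_sum_left)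
qed

lemma mat_rep_star: "star (mat_rep k Y) = mat_rep k (\<lambda>i j. star (Y j i))"
  by (simp add: mat_rep_def star_sum tensor_op_star mat_unit) (rule sum.swap)

lemma bounded_linear_rep_entry: "bounded_linear (rep_entry i j)"
  unfolding rep_entry_def
  by (intro bounded_linear_compose[OF bounded_linear_slice_op]
      bounded_linear_compose[OF bounded_linear_mult_left] bounded_linear_mult_right)

lemma rep_entry_mat_rep:
  assumes "i < k" "j < k" shows "rep_entry i j (mat_rep k Y) = Y i j"
proof -
  have "tensor_op 1 (mat_unit 0 i) * mat_rep k Y * tensor_op 1 (mat_unit j 0)
    = (\<Sum>l<k. \<Sum>m<k. tensor_op (Y l m) (mat_unit 0 i * mat_unit l m * mat_unit j 0))"
    by (simp add: mat_rep_def sum_distrib_left sum_distrib_right tensor_op_mult)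
  also have "\<dots> = (\<Sum>l<k. if i = l then \<Sum>m<k. if m = j then tensor_op (Y l m) (mat_unit 0 0) else 0 else 0)"
  proof (rule sum.cong[OF refl])
    fix l
    have "tensor_op (Y l m) (mat_unit 0 i * mat_unit l m * mat_unit j 0)
      = (if i = l then if m = j then tensor_op (Y l m) (mat_unit 0 0) else 0 else 0)" for m
      by (simp add: mat_unit tensor_op_linear2)
    then show "(\<Sum>m<k. tensor_op (Y l m) (mat_unit 0 i * mat_unit l m * mat_unit j 0))
      = (if i = l then \<Sum>m<k. if m = j then tensor_op (Y l m) (mat_unit 0 0) else 0 else 0)"
      by (cases "i = l") simp_all
  qed
  also have "\<dots> = tensor_op (Y i j) (mat_unit 0 0)"
    using assms by (simp add: sum.delta)
  finally show ?thesis
    by (simp add: rep_entry_def slice_op_tensor l2op_apply_mat_unit ell2_apply_ket scaleC_ell2.rep_eq scaleC_one)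
qed

definition mat_rep_alg :: "nat \<Rightarrow> 'x l2op set \<Rightarrow> ('x \<times> nat) l2op set"
  where "mat_rep_alg k A = mat_rep k ` {Y. \<forall>i<k. \<forall>j<k. Y i j \<in> A}"

context
  fixes A :: "'x l2op set"
  assumes A: "cstar_subalgebra A"
begin

lemma mat_rep_algD:
  assumes "Z \<in> mat_rep_alg k A"
  shows "i < k \<Longrightarrow> j < k \<Longrightarrow> rep_entry i j Z \<in> A" "mat_rep k (\<lambda>i j. rep_entry i j Z) = Z"
proof -
  obtain Y where Y: "Z = mat_rep k Y" "\<forall>i<k. \<forall>j<k. Y i j \<in> A" using assms unfolding mat_rep_alg_def by blast
  show "i < k \<Longrightarrow> j < k \<Longrightarrow> rep_entry i j Z \<in> A" using Y by (simp add: rep_entry_mat_rep)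
  show "mat_rep k (\<lambda>i j. rep_entry i j Z) = Z" unfolding Y(1) by (rule mat_rep_cong) (rule rep_entry_mat_rep)
qed

lemma mat_rep_algI: "(\<And>i j. i < k \<Longrightarrow> j < k \<Longrightarrow> Y i j \<in> A) \<Longrightarrow> mat_rep k Y \<in> mat_rep_alg k A"
  by (auto simp: mat_rep_alg_def)

lemma cstar_subalgebra_mat_rep: "cstar_subalgebra (mat_rep_alg k A)"
proof -
  have "closed (mat_rep_alg k A)"
    unfolding closed_sequential_limits
  proof (intro allI impI, elim conjE)
    fix X Z assume "\<forall>n. X n \<in> mat_rep_alg k A" and lim: "X \<longlonglongrightarrow> Z"
    then have X: "X n \<in> mat_rep_alg k A" for n by blast
    have entry: "(\<lambda>n. rep_entry i j (X n)) \<longlonglongrightarrow> rep_entry i j Z" for i j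
      by (rule bounded_linear.tendsto[OF bounded_linear_rep_entry lim])
    have "(\<lambda>n. mat_rep k (\<lambda>i j. rep_entry i j (X n))) \<longlonglongrightarrow> mat_rep k (\<lambda>i j. rep_entry i j Z)"
      unfolding mat_rep_def by (intro tendsto_sum bounded_linear.tendsto[OF bounded_linear_tensor_op_left] entry)
    then have "X \<longlonglongrightarrow> mat_rep k (\<lambda>i j. rep_entry i j Z)" by (simp only: mat_rep_algD(2)[OF X])
    then have "Z = mat_rep k (\<lambda>i j. rep_entry i j Z)" by (rule LIMSEQ_unique[OF lim])
    moreover have "mat_rep k (\<lambda>i j. rep_entry i j Z) \<in> mat_rep_alg k A"
    proof (rule mat_rep_algI)
      fix i j assume "i < k" "j < k"
      then show "rep_entry i j Z \<in> A"
        using closed_sequentially[OF cstar_subalgebraD(6)[OF A] _ entry] mat_rep_algD(1)[OF X] by blast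
    qed
    ultimately show "Z \<in> mat_rep_alg k A" by simp
  qed
  moreover have "0 \<in> mat_rep_alg k A"
    using mat_rep_algI[of k "\<lambda>i j. 0"] cstar_subalgebraD(1)[OF A] by (simp add: mat_rep_linear)
  moreover have "mat_rep k Y + mat_rep k Y' \<in> mat_rep_alg k A" "mat_rep k Y * mat_rep k Y' \<in> mat_rep_alg k A"
    "c *\<^sub>C mat_rep k Y \<in> mat_rep_alg k A" "star (mat_rep k Y) \<in> mat_rep_alg k A"
    if "\<forall>i<k. \<forall>j<k. Y i j \<in> A" "\<forall>i<k. \<forall>j<k. Y' i j \<in> A" for Y Y' c
    unfolding mat_rep_mult mat_rep_star mat_rep_linear(1,2)[symmetric]
    using that by (auto intro!: mat_rep_algI cstar_subalgebraD(2-5)[OF A] cstar_subalgebra_sum[OF A])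
  ultimately show ?thesis unfolding cstar_subalgebra_def by (auto simp: mat_rep_alg_def)
qed

text \<open>Reading off entries inverts \<open>mat_rep\<close>, and both directions respect the
  operations. So each of them transports quasi-inverses and thereby the spectral definition of
  positivity.\<close>

lemma positive_in_mat_iff:
  assumes Y: "Y \<in> mat_alg k A"
  shows "positive_in (mat_alg k A) Y \<longleftrightarrow> pos_op (mat_rep k (\<lambda>i j. Y $$ (i, j)))"
proof -
  define h where "h Y = mat_rep k (\<lambda>i j. Y $$ (i, j))" for Y :: "'x l2op mat"
  define g where "g Z = mat k k (\<lambda>(i, j). rep_entry i j Z)" for Z :: "('x \<times> nat) l2op"
  note sub = cstar_subalgebra_mat_rep[of k]
  have in_mat: "mat_alg k A = {X \<in> carrier_mat k k. \<forall>i<k. \<forall>j<k. X $$ (i, j) \<in> A}"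
    by (auto simp: mat_alg_iff)
  have hS: "h X \<in> mat_rep_alg k A" if "X \<in> mat_alg k A" for X
    unfolding h_def using that by (intro mat_rep_algI) (simp add: mat_alg_iff)
  have h: "h (X + X') = h X + h X'" "h (X * X') = h X * h X'" "h (c *\<^sub>C X) = c *\<^sub>C h X" "h (star X) = star (h X)"
    if "X \<in> carrier_mat k k" "X' \<in> carrier_mat k k" for X X' c
    unfolding h_def mat_rep_mult mat_rep_star mat_rep_linear(1,2)[symmetric]
    using that by (auto intro!: mat_rep_cong simp: mat_alg_simps[where k = k] simp del: index_mult_mat(1))
  have gh: "g (h X) = X" if "X \<in> carrier_mat k k" for X
    using that by (intro mat_eqI_carrier[of _ k]) (simp_all add: g_def h_def rep_entry_mat_rep)
  have gS: "g Z \<in> mat_alg k A" if "Z \<in> mat_rep_alg k A" for Z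
    using mat_rep_algD(1)[OF that] by (simp add: g_def mat_alg_iff)
  have hg: "h (g Z) = Z" if "Z \<in> mat_rep_alg k A" for Z
  proof -
    have "h (g Z) = mat_rep k (\<lambda>i j. rep_entry i j Z)"
      unfolding h_def by (rule mat_rep_cong) (simp add: g_def)
    then show ?thesis by (simp only: mat_rep_algD(2)[OF that])
  qed
  have carrier: "g Z \<in> carrier_mat k k" for Z by (simp add: g_def)
  have g: "g (Z + Z') = g Z + g Z'" "g (Z * Z') = g Z * g Z'" "g (c *\<^sub>C Z) = c *\<^sub>C g Z" "g (star Z) = star (g Z)"
    if Z: "Z \<in> mat_rep_alg k A" "Z' \<in> mat_rep_alg k A" for Z Z' c
  proof -
    have "g (h (g Z + g Z')) = g Z + g Z'" "g (h (g Z * g Z')) = g Z * g Z'"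
      "g (h (c *\<^sub>C g Z)) = c *\<^sub>C g Z" "g (h (star (g Z))) = star (g Z)"
      by (rule gh, intro mat_alg_carrier carrier)+
    then show "g (Z + Z') = g Z + g Z'" "g (Z * Z') = g Z * g Z'" "g (c *\<^sub>C Z) = c *\<^sub>C g Z" "g (star Z) = star (g Z)"
      by (simp_all only: h[OF carrier carrier] hg Z)
  qed
  have "positive_in (mat_alg k A) Y \<longleftrightarrow> positive_in (mat_rep_alg k A) (h Y)"
  proof
    show "positive_in (mat_rep_alg k A) (h Y)" if "positive_in (mat_alg k A) Y"
      by (rule positive_in_hom[OF _ _ _ _ _ _ that])
        (auto simp: mat_alg_iff h intro: hS[unfolded mat_alg_iff] mat_alg_carrier simp: mat_alg_simps[where k = k] cstar_subalgebraD(4)[OF A])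
    assume "positive_in (mat_rep_alg k A) (h Y)"
    then have "positive_in (mat_alg k A) (g (h Y))"
      by (rule positive_in_hom[rotated -1]) (use gS g cstar_subalgebraD(4)[OF sub] in blast)+
    then show "positive_in (mat_alg k A) Y" using Y by (simp add: gh mat_alg_iff)
  qed
  then show ?thesis unfolding positive_in_iff_pos_op[OF sub] using hS[OF Y] by (simp add: h_def)
qed

end

text \<open>This is complete positivity of \<open>a \<mapsto> a \<otimes> g\<close>: the square root
  taken inside the matrix algebra factors the matrix as \<open>star q * q\<close>, and tensoring the
  entries of \<open>q\<close> with the root of \<open>g\<close> factors the new matrix.\<close>

lemma positive_in_mat_tensor:
  assumes A: "cstar_subalgebra A" and B: "cstar_subalgebra B" and g: "g \<in> B" "pos_op g" and Y: "positive_in (mat_alg k A) Y"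
  shows "positive_in (mat_alg k (tensor_cl A B)) (mat k k (\<lambda>(i, j). tensor_op (Y $$ (i, j)) g))"
proof -
  have YA: "Y \<in> mat_alg k A" using Y by (simp add: positive_in_def)
  define P where "P = mat_rep k (\<lambda>i j. Y $$ (i, j))"
  have P: "pos_op P" using Y positive_in_mat_iff[OF A YA] by (simp add: P_def)
  have PS: "P \<in> mat_rep_alg k A" unfolding P_def using YA by (intro mat_rep_algI[OF A]) (simp add: mat_alg_iff)
  define Q where "Q = sqrt_op P"
  have Q: "Q \<in> mat_rep_alg k A" "star Q * Q = P"
    using sqrt_op_in[OF cstar_subalgebra_mat_rep[OF A] PS P] sqrt_op[OF P] by (simp_all add: Q_def)
  define q where "q = (\<lambda>i j. rep_entry i j Q)"
  have Qq: "mat_rep k q = Q" unfolding q_def by (rule mat_rep_algD(2)[OF A Q(1)])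
  have "P = star (mat_rep k q) * mat_rep k q" by (simp only: Qq Q(2))
  then have Pq: "P = mat_rep k (\<lambda>i j. \<Sum>l<k. star (q l i) * q l j)"
    by (simp only: mat_rep_star mat_rep_mult)
  have Yq: "Y $$ (i, j) = (\<Sum>l<k. star (q l i) * q l j)" if ij: "i < k" "j < k" for i j
    using arg_cong[OF Pq, of "rep_entry i j"] unfolding P_def rep_entry_mat_rep[OF ij] .
  define s where "s = sqrt_op g"
  have s: "star s * s = g" using sqrt_op[OF g(2)] by (simp add: s_def)
  define W where "W = mat_rep k (\<lambda>i j. tensor_op (q i j) s)"
  define Y' where "Y' = mat k k (\<lambda>(i, j). tensor_op (Y $$ (i, j)) g)"
  have "Y' \<in> mat_alg k (tensor_cl A B)"
    using YA tensor_cl_elem[OF A B _ g(1)] by (simp add: Y'_def mat_alg_iff)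
  note iff = positive_in_mat_iff[OF cstar_subalgebra_tensor[OF A B] this]
  have "mat_rep k (\<lambda>i j. Y' $$ (i, j)) = star W * W"
    unfolding W_def mat_rep_mult mat_rep_star
    by (rule mat_rep_cong) (simp add: Y'_def tensor_op_star tensor_op_mult s Yq tensor_op_sum_left)
  then have "positive_in (mat_alg k (tensor_cl A B)) Y'"
    using iff pos_op_star_mult(1)[of W] by simp
  then show ?thesis by (simp only: Y'_def)
qed

lemma cpc_order_zero_tensor:
  assumes A: "cstar_subalgebra A" and B: "cstar_subalgebra B" and \<phi>: "cpc_order_zero n A \<phi>"
    and g: "g \<in> B" "pos_op g" "norm g \<le> 1"
  shows "cpc_order_zero n (tensor_cl A B) (\<lambda>z. tensor_op (\<phi> z) g)"
  unfolding cpc_order_zero_def linear_on_mat_def completely_positive_def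
proof (intro conjI allI impI ballI)
  note D = cpc_order_zeroD[OF \<phi>]
  show "tensor_op (\<phi> X) g \<in> tensor_cl A B" if "X \<in> carrier_mat n n" for X
    by (rule tensor_cl_elem[OF A B D(1)[OF that] g(1)])
  show "tensor_op (\<phi> (X + Y)) g = tensor_op (\<phi> X) g + tensor_op (\<phi> Y) g"
    if "X \<in> carrier_mat n n" "Y \<in> carrier_mat n n" for X Y
    by (simp only: D(2)[OF that] tensor_op_linear)
  show "tensor_op (\<phi> (c *\<^sub>C X)) g = c *\<^sub>C tensor_op (\<phi> X) g" if "X \<in> carrier_mat n n" for X c
    by (simp only: D(3)[OF that] tensor_op_linear)
  show "norm (tensor_op (\<phi> X) g) \<le> mat_opnorm X" if "X \<in> carrier_mat n n" for X
  proof -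
    have "norm (tensor_op (\<phi> X) g) \<le> norm (\<phi> X) * norm g" by (rule norm_tensor_op_le)
    also have "\<dots> \<le> norm (\<phi> X) * 1" by (rule mult_left_mono[OF g(3)]) simp
    finally show ?thesis using D(5)[OF that] by simp
  qed
  show "tensor_op (\<phi> Y) g * tensor_op (\<phi> Z) g = 0"
    if "positive_in (cmat_alg n) Y \<and> positive_in (cmat_alg n) Z \<and> Y * Z = 0\<^sub>m n n" for Y Z
  proof -
    have "\<phi> Y * \<phi> Z = 0" using that by (intro D(6)) simp_all
    then show ?thesis by (simp only: tensor_op_mult tensor_op_linear2)
  qed
  fix k :: nat and X assume "1 \<le> k" "positive_in (cmat_alg (k * n)) X"
  then have "positive_in (mat_alg k A) (amplification k n \<phi> X)"
    using D(4)[unfolded completely_positive_def, rule_format, of k X] by blast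
  then have "positive_in (mat_alg k (tensor_cl A B)) (mat k k (\<lambda>(i, j). tensor_op (amplification k n \<phi> X $$ (i, j)) g))"
    by (rule positive_in_mat_tensor[OF A B g(1,2)])
  moreover have "mat k k (\<lambda>(i, j). tensor_op (amplification k n \<phi> X $$ (i, j)) g) = amplification k n (\<lambda>z. tensor_op (\<phi> z) g) X"
    by (rule mat_eqI_carrier[of _ k]) (simp_all add: amplification_def)
  ultimately show "positive_in (mat_alg k (tensor_cl A B)) (amplification k n (\<lambda>z. tensor_op (\<phi> z) g) X)" by simp
qed

section \<open>Tracial absorption for tensor products\<close>

context
  fixes A :: "'x l2op set" and B :: "'y l2op set"
  assumes A: "cstar_subalgebra A" and B: "cstar_subalgebra B"
begin

private abbreviation "AB \<equiv> tensor_cl A B"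

private lemma subAB: "cstar_subalgebra AB" by (rule cstar_subalgebra_tensor[OF A B])

text \<open>The finite sets are fixed before \<open>h\<close> and \<open>g\<close>, which range over
  all contractions and not only over elements of the algebras. It can thus be used with
  \<open>h = e\<close> and with \<open>h = 1\<close>.\<close>

lemma tensor_unit_estimate:
  assumes x: "x \<in> AB" and \<epsilon>: "0 < \<epsilon>"
  shows "\<exists>FA FB \<gamma>. finite FA \<and> FA \<subseteq> A \<and> finite FB \<and> FB \<subseteq> B \<and> 0 < \<gamma> \<and>
    (\<forall>h g. norm h \<le> 1 \<longrightarrow> norm g \<le> 1 \<longrightarrow> (\<forall>a\<in>FA. norm (h * a - a) < \<gamma>) \<longrightarrow> (\<forall>b\<in>FB. norm (g * b - b) < \<gamma>) \<longrightarrow>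
      norm (tensor_op h g * x - x) < \<epsilon>)"
proof -
  obtain m a b where ab: "norm (x - (\<Sum>i<m. tensor_op (a i) (b i))) < \<epsilon> / 3"
    and mem: "\<forall>i<(m::nat). a i \<in> A \<and> b i \<in> B"
    using tensor_cl_approx[OF A B x, of "\<epsilon> / 3"] \<epsilon> by auto
  define s where "s = (\<Sum>i<m. tensor_op (a i) (b i))"
  define K where "K = 1 + (\<Sum>i<m. norm (b i) + norm (a i))"
  have K: "0 < K" unfolding K_def by (simp add: add_pos_nonneg sum_nonneg)
  define \<gamma> where "\<gamma> = \<epsilon> / 3 / K"
  have \<gamma>: "0 < \<gamma>" using \<epsilon> K by (simp add: \<gamma>_def)
  have "norm (tensor_op h g * x - x) < \<epsilon>"
    if n: "norm h \<le> 1" "norm g \<le> 1"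
      and h: "\<forall>a\<in>a ` {..<m}. norm (h * a - a) < \<gamma>" and g: "\<forall>b\<in>b ` {..<m}. norm (g * b - b) < \<gamma>" for h g
  proof -
    have "tensor_op h g * s - s = (\<Sum>i<m. tensor_op (h * a i - a i) (g * b i) + tensor_op (a i) (g * b i - b i))"
      by (simp add: s_def sum_distrib_left tensor_op_mult tensor_op_linear2 flip: sum_subtractf)
    also have "norm \<dots> \<le> (\<Sum>i<m. \<gamma> * (norm (b i) + norm (a i)))"
    proof (rule sum_norm_le)
      fix i assume i: "i \<in> {..<m}"
      have "norm (g * b i) \<le> 1 * norm (b i)"
        by (rule order_trans[OF norm_mult_ineq]) (intro mult_right_mono n norm_ge_zero)
      then have "norm (tensor_op (h * a i - a i) (g * b i)) \<le> \<gamma> * norm (b i)"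
        using h i \<gamma> by (intro order_trans[OF norm_tensor_op_le] mult_mono) (auto intro: less_imp_le)
      moreover have "norm (tensor_op (a i) (g * b i - b i)) \<le> norm (a i) * \<gamma>"
        using g i by (intro order_trans[OF norm_tensor_op_le] mult_left_mono) (auto intro: less_imp_le)
      ultimately show "norm (tensor_op (h * a i - a i) (g * b i) + tensor_op (a i) (g * b i - b i))
          \<le> \<gamma> * (norm (b i) + norm (a i))"
        by (intro order_trans[OF norm_triangle_ineq]) (simp add: algebra_simps)
    qed
    also have "\<dots> = \<gamma> * (\<Sum>i<m. norm (b i) + norm (a i))" by (rule sum_distrib_left[symmetric])
    also have "\<dots> < \<gamma> * K" by (rule mult_strict_left_mono[OF _ \<gamma>]) (simp add: K_def)
    also have "\<dots> = \<epsilon> / 3" using K by (simp add: \<gamma>_def)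
    finally have 1: "norm (tensor_op h g * s - s) < \<epsilon> / 3" .
    have "norm (tensor_op h g) \<le> 1"
      by (rule order_trans[OF norm_tensor_op_le]) (use mult_mono[OF n] in simp)
    then have "norm (tensor_op h g * (x - s)) \<le> 1 * norm (x - s)"
      by (intro order_trans[OF norm_mult_ineq] mult_right_mono) simp_all
    then have 2: "norm (tensor_op h g * (x - s)) < \<epsilon> / 3" using ab by (simp add: s_def)
    have "tensor_op h g * x - x = tensor_op h g * (x - s) + (tensor_op h g * s - s) - (x - s)"
      by (simp add: right_diff_distrib)
    then have "norm (tensor_op h g * x - x) \<le> norm (tensor_op h g * (x - s)) + norm (tensor_op h g * s - s) + norm (x - s)"
      using norm_triangle_ineq4[of "tensor_op h g * (x - s) + (tensor_op h g * s - s)" "x - s"]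
        norm_triangle_ineq[of "tensor_op h g * (x - s)" "tensor_op h g * s - s"] by simp
    then show ?thesis using 1 2 ab by (simp add: s_def)
  qed
  then show ?thesis
    using mem \<gamma> by (intro exI[of _ "a ` {..<m}"] exI[of _ "b ` {..<m}"] exI[of _ \<gamma>]) (simp add: image_subset_iff)
qed

text \<open>The commutator of \<open>h \<otimes> g\<close> with \<open>a \<otimes> b\<close> is
  \<open>(h a - a h) \<otimes> g b + a h \<otimes> (g b - b) - a h \<otimes> (b g - b)\<close>. So
  commutation is required of \<open>h\<close> only, while \<open>g\<close> just has to be an
  approximate unit.\<close>

lemma tensor_commutator_estimate1:
  assumes x: "x \<in> AB" and \<epsilon>: "0 < \<epsilon>"
  shows "\<exists>FA FB \<gamma>. finite FA \<and> FA \<subseteq> A \<and> finite FB \<and> FB \<subseteq> B \<and> 0 < \<gamma> \<and>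
    (\<forall>h g. norm h \<le> 1 \<longrightarrow> norm g \<le> 1 \<longrightarrow> (\<forall>a\<in>FA. norm (h * a - a * h) < \<gamma>) \<longrightarrow>
      (\<forall>b\<in>FB. norm (g * b - b) < \<gamma> \<and> norm (b * g - b) < \<gamma>) \<longrightarrow>
      norm (tensor_op h g * x - x * tensor_op h g) < \<epsilon>)"
proof -
  obtain m a b where ab: "norm (x - (\<Sum>i<m. tensor_op (a i) (b i))) < \<epsilon> / 3"
    and mem: "\<forall>i<(m::nat). a i \<in> A \<and> b i \<in> B"
    using tensor_cl_approx[OF A B x, of "\<epsilon> / 3"] \<epsilon> by auto
  define s where "s = (\<Sum>i<m. tensor_op (a i) (b i))"
  define K where "K = 1 + (\<Sum>i<m. norm (b i) + 2 * norm (a i))"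
  have K: "0 < K" unfolding K_def by (simp add: add_pos_nonneg sum_nonneg)
  define \<gamma> where "\<gamma> = \<epsilon> / 3 / K"
  have \<gamma>: "0 < \<gamma>" using \<epsilon> K by (simp add: \<gamma>_def)
  have "norm (tensor_op h g * x - x * tensor_op h g) < \<epsilon>"
    if n: "norm h \<le> 1" "norm g \<le> 1" and h: "\<forall>a\<in>a ` {..<m}. norm (h * a - a * h) < \<gamma>"
      and g: "\<forall>b\<in>b ` {..<m}. norm (g * b - b) < \<gamma> \<and> norm (b * g - b) < \<gamma>" for h g
  proof -
    define H where "H = tensor_op h g"
    have "H * s - s * H = (\<Sum>i<m. tensor_op (h * a i - a i * h) (g * b i)
        + (tensor_op (a i * h) (g * b i - b i) - tensor_op (a i * h) (b i * g - b i)))"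
      by (simp add: H_def s_def sum_distrib_left sum_distrib_right tensor_op_mult tensor_op_linear2 flip: sum_subtractf)
    also have "norm \<dots> \<le> (\<Sum>i<m. \<gamma> * (norm (b i) + 2 * norm (a i)))"
    proof (rule sum_norm_le)
      fix i assume i: "i \<in> {..<m}"
      have gb: "norm (g * b i) \<le> 1 * norm (b i)"
        by (rule order_trans[OF norm_mult_ineq]) (intro mult_right_mono n norm_ge_zero)
      have ah: "norm (a i * h) \<le> norm (a i)"
        using order_trans[OF norm_mult_ineq mult_left_mono[OF n(1)], of "a i"] by simp
      have 1: "norm (tensor_op (h * a i - a i * h) (g * b i)) \<le> \<gamma> * norm (b i)"
        using h i \<gamma> gb by (intro order_trans[OF norm_tensor_op_le] mult_mono) (auto intro: less_imp_le)
      have 2: "norm (tensor_op (a i * h) y) \<le> norm (a i) * \<gamma>" if "norm y < \<gamma>" for y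
        using that \<gamma> ah by (intro order_trans[OF norm_tensor_op_le] mult_mono) (auto intro: less_imp_le)
      show "norm (tensor_op (h * a i - a i * h) (g * b i)
        + (tensor_op (a i * h) (g * b i - b i) - tensor_op (a i * h) (b i * g - b i))) \<le> \<gamma> * (norm (b i) + 2 * norm (a i))"
        using norm_triangle_ineq[of "tensor_op (h * a i - a i * h) (g * b i)" "tensor_op (a i * h) (g * b i - b i) - tensor_op (a i * h) (b i * g - b i)"]
          norm_triangle_ineq4[of "tensor_op (a i * h) (g * b i - b i)" "tensor_op (a i * h) (b i * g - b i)"]
          1 2[of "g * b i - b i"] 2[of "b i * g - b i"] g i by (simp add: algebra_simps)
    qed
    also have "\<dots> = \<gamma> * (\<Sum>i<m. norm (b i) + 2 * norm (a i))" by (rule sum_distrib_left[symmetric])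
    also have "\<dots> < \<gamma> * K" by (rule mult_strict_left_mono[OF _ \<gamma>]) (simp add: K_def)
    also have "\<dots> = \<epsilon> / 3" using K by (simp add: \<gamma>_def)
    finally have 1: "norm (H * s - s * H) < \<epsilon> / 3" .
    have H1: "norm H \<le> 1" unfolding H_def
      by (rule order_trans[OF norm_tensor_op_le]) (use mult_mono[OF n] in simp)
    have 2: "norm (H * (x - s)) < \<epsilon> / 3" "norm ((x - s) * H) < \<epsilon> / 3"
      using order_trans[OF norm_mult_ineq mult_right_mono[OF H1], of "x - s"]
        order_trans[OF norm_mult_ineq mult_left_mono[OF H1], of "x - s"] ab by (simp_all add: s_def)
    have "H * x - x * H = H * (x - s) + (H * s - s * H) - (x - s) * H"
      by (simp add: right_diff_distrib left_diff_distrib)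
    then have "norm (H * x - x * H) \<le> norm (H * (x - s)) + norm (H * s - s * H) + norm ((x - s) * H)"
      using norm_triangle_ineq4[of "H * (x - s) + (H * s - s * H)" "(x - s) * H"]
        norm_triangle_ineq[of "H * (x - s)" "H * s - s * H"] by simp
    then show ?thesis using 1 2 by (simp add: H_def)
  qed
  then show ?thesis
    using mem \<gamma> by (intro exI[of _ "a ` {..<m}"] exI[of _ "b ` {..<m}"] exI[of _ \<gamma>]) (simp add: image_subset_iff)
qed

lemma tensor_commutator_estimate:
  assumes F: "finite F" "F \<subseteq> AB" and \<epsilon>: "0 < \<epsilon>"
  shows "\<exists>FA FB \<gamma>. finite FA \<and> FA \<subseteq> A \<and> finite FB \<and> FB \<subseteq> B \<and> 0 < \<gamma> \<and>
    (\<forall>h g. norm h \<le> 1 \<longrightarrow> norm g \<le> 1 \<longrightarrow> (\<forall>a\<in>FA. norm (h * a - a * h) < \<gamma>) \<longrightarrow>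
      (\<forall>b\<in>FB. norm (g * b - b) < \<gamma> \<and> norm (b * g - b) < \<gamma>) \<longrightarrow>
      (\<forall>x\<in>F. norm (tensor_op h g * x - x * tensor_op h g) < \<epsilon>))"
  using F
proof (induction F rule: finite_induct)
  case empty
  show ?case by (intro exI[of _ "{}"] exI[of _ "1::real"]) simp
next
  case (insert x F)
  have "F \<subseteq> AB" "x \<in> AB" using insert.prems by simp_all
  obtain FA FB \<gamma> where 1: "finite FA" "FA \<subseteq> A" "finite FB" "FB \<subseteq> B" "0 < \<gamma>"
    and e1: "\<forall>h g. norm h \<le> 1 \<longrightarrow> norm g \<le> 1 \<longrightarrow> (\<forall>a\<in>FA. norm (h * a - a * h) < \<gamma>) \<longrightarrow>
      (\<forall>b\<in>FB. norm (g * b - b) < \<gamma> \<and> norm (b * g - b) < \<gamma>) \<longrightarrow>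
      (\<forall>x\<in>F. norm (tensor_op h g * x - x * tensor_op h g) < \<epsilon>)"
    using insert.IH[OF \<open>F \<subseteq> AB\<close>] by (elim exE conjE)
  obtain FA' FB' \<gamma>' where 2: "finite FA'" "FA' \<subseteq> A" "finite FB'" "FB' \<subseteq> B" "0 < \<gamma>'"
    and e2: "\<forall>h g. norm h \<le> 1 \<longrightarrow> norm g \<le> 1 \<longrightarrow> (\<forall>a\<in>FA'. norm (h * a - a * h) < \<gamma>') \<longrightarrow>
      (\<forall>b\<in>FB'. norm (g * b - b) < \<gamma>' \<and> norm (b * g - b) < \<gamma>') \<longrightarrow>
      norm (tensor_op h g * x - x * tensor_op h g) < \<epsilon>"
    using tensor_commutator_estimate1[OF \<open>x \<in> AB\<close> \<epsilon>] by (elim exE conjE)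
  show ?case
  proof (intro exI[of _ "FA \<union> FA'"] exI[of _ "FB \<union> FB'"] exI[of _ "min \<gamma> \<gamma>'"] conjI allI impI)
    fix h g assume *: "norm h \<le> 1" "norm g \<le> 1" "\<forall>a\<in>FA \<union> FA'. norm (h * a - a * h) < min \<gamma> \<gamma>'"
      "\<forall>b\<in>FB \<union> FB'. norm (g * b - b) < min \<gamma> \<gamma>' \<and> norm (b * g - b) < min \<gamma> \<gamma>'"
    then have "\<forall>x\<in>F. norm (tensor_op h g * x - x * tensor_op h g) < \<epsilon>" by (intro e1[rule_format, THEN ballI]) auto
    moreover have "norm (tensor_op h g * x - x * tensor_op h g) < \<epsilon>"
      by (rule e2[rule_format]) (use * in auto)
    ultimately show "\<forall>x\<in>insert x F. norm (tensor_op h g * x - x * tensor_op h g) < \<epsilon>" by blast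
  qed (use 1 2 in auto)
qed

text \<open>The witness is the sum of the \<open>w star (y i) \<otimes> c i\<close>. Conjugating
  \<open>a \<otimes> b\<close> by it produces
  \<open>w star (y i) a (y j) star w \<otimes> c i b star (c j)\<close>; orthogonality of the copies
  makes the cross terms small, and the diagonal adds up to nearly
  \<open>w d star w \<otimes> t\<close>.\<close>

lemma cuntz_below_copies:
  assumes C: "cuntz_below A C d" and copies: "copies A a d k" and c: "\<forall>i<k. c i \<in> B"
  shows "cuntz_below AB (tensor_op C (\<Sum>i<k. c i * b * star (c i))) (tensor_op a b)"
  unfolding cuntz_below_iff
proof (intro allI impI)
  fix e :: real assume e: "0 < e"
  define t where "t = (\<Sum>i<k. c i * b * star (c i))"
  define K where "K = 1 + norm t"
  define e1 where "e1 = e / 2 / K"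
  have t1: "0 < K" "norm t \<le> K" by (simp_all add: K_def add_pos_nonneg)
  have e1: "0 < e1" using e t1 by (simp add: e1_def)
  obtain w where w: "w \<in> A" "norm (C - w * d * star w) < e1" using cuntz_belowD[OF C e1] by blast
  define M where "M = 1 + (\<Sum>i<k. \<Sum>j<k. (norm w)\<^sup>2 * norm (c i * b * star (c j)))"
  have M: "0 < M" unfolding M_def by (intro add_pos_nonneg sum_nonneg) simp_all
  define e2 where "e2 = e / 2 / M"
  have e2: "0 < e2" using e M by (simp add: e2_def)
  obtain y where y: "\<forall>i<k. y i \<in> A"
    and yy: "\<forall>i<k. \<forall>j<k. norm (star (y i) * a * y j - (if i = j then d else 0)) < e2"
    using copies e2 unfolding copies_def by blast
  define V where "V = (\<Sum>i<k. tensor_op (w * star (y i)) (c i))"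
  have VT: "V \<in> AB" unfolding V_def
    using w y c by (intro cstar_subalgebra_sum[OF subAB] tensor_cl_elem[OF A B] cstar_subalgebraD(3,5)[OF A]) auto
  have sV: "star V = (\<Sum>j<k. tensor_op (y j * star w) (star (c j)))"
    by (simp add: V_def star_sum tensor_op_star star_mult star_star)
  have VV: "V * tensor_op a b * star V = (\<Sum>i<k. \<Sum>j<k. tensor_op (w * (star (y i) * a * y j) * star w) (c i * b * star (c j)))"
    unfolding sV unfolding V_def by (simp add: sum_distrib_left sum_distrib_right tensor_op_mult mult.assoc) (rule sum.swap)
  have wt: "tensor_op (w * d * star w) t
    = (\<Sum>i<k. \<Sum>j<k. tensor_op (w * (if i = j then d else 0) * star w) (c i * b * star (c j)))"
  proof -
    have "(\<Sum>j<k. tensor_op (w * (if i = j then d else 0) * star w) (c i * b * star (c j)))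
      = tensor_op (w * d * star w) (c i * b * star (c i))" if "i < k" for i
    proof -
      have "(\<Sum>j<k. tensor_op (w * (if i = j then d else 0) * star w) (c i * b * star (c j)))
        = (\<Sum>j<k. if i = j then tensor_op (w * d * star w) (c i * b * star (c j)) else 0)"
        by (intro sum.cong refl) (simp add: tensor_op_linear2)
      then show ?thesis using that by (simp add: sum.delta)
    qed
    then show ?thesis by (simp add: t_def tensor_op_sum_right)
  qed
  have "V * tensor_op a b * star V - tensor_op (w * d * star w) t = (\<Sum>i<k. \<Sum>j<k.
      tensor_op (w * (star (y i) * a * y j - (if i = j then d else 0)) * star w) (c i * b * star (c j)))"
    unfolding VV wt sum_subtractf[symmetric]
    by (intro sum.cong refl) (simp only: tensor_op_linear2 left_diff_distrib right_diff_distrib)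
  also have "norm \<dots> \<le> (\<Sum>i<k. \<Sum>j<k. e2 * ((norm w)\<^sup>2 * norm (c i * b * star (c j))))"
  proof (intro sum_norm_le)
    fix i j assume ij: "i \<in> {..<k}" "j \<in> {..<k}"
    define z where "z = star (y i) * a * y j - (if i = j then d else 0)"
    have "norm z < e2" using yy ij by (simp add: z_def)
    then have "norm (w * z * star w) \<le> (norm w)\<^sup>2 * e2"
      by (intro order_trans[OF norm_conj_le] mult_left_mono) simp_all
    then have "norm (w * z * star w) * norm (c i * b * star (c j)) \<le> (norm w)\<^sup>2 * e2 * norm (c i * b * star (c j))"
      by (rule mult_right_mono) simp
    then show "norm (tensor_op (w * (star (y i) * a * y j - (if i = j then d else 0)) * star w) (c i * b * star (c j)))
      \<le> e2 * ((norm w)\<^sup>2 * norm (c i * b * star (c j)))"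
      unfolding z_def[symmetric] using norm_tensor_op_le[of "w * z * star w" "c i * b * star (c j)"] by (simp add: algebra_simps)
  qed
  also have "\<dots> = e2 * (M - 1)" by (simp add: M_def sum_distrib_left)
  also have "\<dots> < e2 * M" by (rule mult_strict_left_mono[OF _ e2]) simp
  also have "\<dots> = e / 2" using M by (simp add: e2_def)
  finally have 1: "norm (V * tensor_op a b * star V - tensor_op (w * d * star w) t) < e / 2" .
  have "norm (tensor_op (C - w * d * star w) t) \<le> norm (C - w * d * star w) * norm t" by (rule norm_tensor_op_le)
  also have "\<dots> \<le> e1 * norm t" using w(2) by (intro mult_right_mono) simp_all
  also have "\<dots> \<le> e1 * K" using e1 t1 by (intro mult_left_mono) simp_all
  also have "\<dots> = e / 2" using t1 by (simp add: e1_def)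
  finally have 2: "norm (tensor_op C t - tensor_op (w * d * star w) t) \<le> e / 2" by (simp only: tensor_op_linear2)
  have "norm (tensor_op C t - V * tensor_op a b * star V) < e"
    using norm_triangle_ineq4[of "tensor_op C t - tensor_op (w * d * star w) t" "V * tensor_op a b * star V - tensor_op (w * d * star w) t"]
      1 2 by simp
  then show "\<exists>v\<in>AB. norm (tensor_op C (\<Sum>i<k. c i * b * star (c i)) - v * tensor_op a b * star v) < e"
    using VT unfolding t_def by blast
qed

text \<open>Replacing \<open>x\<^sup>2\<close> and \<open>x (p \<otimes> f) x\<close> by their compressions by \<open>u = e \<otimes> f\<close> turns
  \<open>x\<^sup>2 - x (p \<otimes> f) x\<close> into \<open>x ((e\<^sup>2 - e p e) \<otimes> f\<^sup>2) x\<close>.\<close>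
lemma compression_estimate:
  fixes x :: "('x \<times> 'y) l2op" and e p :: "'x l2op" and f :: "'y l2op"
  assumes x: "star x = x" and ef: "star e = e" "norm e \<le> 1" "star f = f" "norm f \<le> 1" and p: "norm p \<le> 1"
    and u: "norm (tensor_op e f * x - x) \<le> \<eta>" "norm (tensor_op 1 f * x - x) \<le> \<eta>"
  shows "norm ((x * x - x * tensor_op p f * x) - x * tensor_op (e * e - e * p * e) (f * f) * x) \<le> 5 * (\<eta> * norm x)"
proof -
  define N where "N = norm x"
  have N: "0 \<le> N" "norm x \<le> N" by (simp_all add: N_def)
  define w where "w = tensor_op e f"
  define P where "P = tensor_op p (1 :: 'y l2op)"
  have w: "star w = w" "norm w \<le> 1"
    using norm_tensor_op_le[of e f] mult_mono[OF ef(2,4)] by (simp_all add: w_def tensor_op_star ef)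
  have P: "norm P \<le> 1" using norm_tensor_op_le[of p "1 :: 'y l2op"] p by (simp add: P_def)
  define r where "r = w * x - x"
  have r: "norm r \<le> \<eta>" "norm (star r) \<le> \<eta>" using u(1) by (simp_all add: r_def w_def)
  have sr: "star r = x * w - x" by (simp add: r_def star_diff star_mult w x)
  define q where "q = tensor_op 1 f * x - x"
  have q: "norm q \<le> \<eta>" using u(2) by (simp add: q_def)
  have \<eta>: "0 \<le> \<eta>" using norm_ge_zero r(1) by (rule order_trans)
  have wx: "norm (w * x) \<le> N"
    using norm_mult_ineq[of w x] mult_right_mono[OF w(2), of "norm x"] by (simp add: N_def)
  have Px: "norm (P * z) \<le> norm z" for z
    using norm_mult_ineq[of P z] mult_right_mono[OF P, of "norm z"] by simp
  have pf: "tensor_op p f = P * tensor_op 1 f" by (simp add: P_def tensor_op_mult)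
  have wPw: "tensor_op (e * e - e * p * e) (f * f) = w * w - w * P * w"
    by (simp add: w_def P_def tensor_op_mult tensor_op_linear2)
  \<comment> \<open>Each of the five terms contains exactly one of the errors \<open>r\<close>,
    \<open>star r\<close>, \<open>q\<close> and otherwise only contractions and one factor
    \<open>x\<close>.\<close>
  have eq: "(x * x - x * tensor_op p f * x) - x * tensor_op (e * e - e * p * e) (f * f) * x
    = (star r * (P * (w * x)) + x * (P * r)) - (star r * (w * x) + x * r) - x * (P * q)"
    unfolding wPw pf sr unfolding r_def q_def
    by (simp add: left_diff_distrib right_diff_distrib mult.assoc)
  have "norm ((x * x - x * tensor_op p f * x) - x * tensor_op (e * e - e * p * e) (f * f) * x)
    \<le> (norm (star r * (P * (w * x))) + norm (x * (P * r))) + (norm (star r * (w * x)) + norm (x * r)) + norm (x * (P * q))"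
    unfolding eq using norm_triangle_ineq4[of "(star r * (P * (w * x)) + x * (P * r)) - (star r * (w * x) + x * r)" "x * (P * q)"]
      norm_triangle_ineq4[of "star r * (P * (w * x)) + x * (P * r)" "star r * (w * x) + x * r"]
      norm_triangle_ineq[of "star r * (P * (w * x))" "x * (P * r)"] norm_triangle_ineq[of "star r * (w * x)" "x * r"] by linarith
  moreover have "norm (star r * (P * (w * x))) \<le> \<eta> * N"
    using norm_mult_ineq[of "star r" "P * (w * x)"] mult_mono[OF r(2) order_trans[OF Px wx]] \<eta> by simp
  moreover have "norm (star r * (w * x)) \<le> \<eta> * N"
    using norm_mult_ineq[of "star r" "w * x"] mult_mono[OF r(2) wx] \<eta> by simp
  moreover have "norm (x * (P * r)) \<le> N * \<eta>"
    using norm_mult_ineq[of x "P * r"] mult_mono[OF N(2) order_trans[OF Px r(1)]] N by simp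
  moreover have "norm (x * (P * q)) \<le> N * \<eta>"
    using norm_mult_ineq[of x "P * q"] mult_mono[OF N(2) order_trans[OF Px q]] N by simp
  moreover have "norm (x * r) \<le> N * \<eta>"
    using norm_mult_ineq[of x r] mult_mono[OF N(2) r(1)] N by simp
  ultimately show ?thesis by (simp add: N_def mult.commute)
qed

text \<open>Two nonzero orthogonal elements of \<open>A\<close>, tensored with the same nonzero
  \<open>b\<close>, are nonzero zero divisors, which the complex numbers do not have.\<close>

lemma tensor_not_isomorphic_complex:
  assumes Z: "tracially_Z_absorbing A" and simpleB: "simple_cstar B"
  shows "\<not> cstar_isomorphic AB (UNIV :: complex set)"
proof
  assume "cstar_isomorphic AB (UNIV :: complex set)"
  then obtain \<psi> where \<psi>: "star_hom_on AB \<psi>" "bij_betw \<psi> AB (UNIV :: complex set)" unfolding cstar_isomorphic_def by blast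
  have "simple_cstar A" by (rule tracially_Z_absorbingD(1)[OF Z])
  then obtain a0 b where 0: "a0 \<in> A" "a0 \<noteq> 0" "b \<in> B" "b \<noteq> 0"
    using simpleB cstar_subalgebraD(1)[OF A] cstar_subalgebraD(1)[OF B] unfolding simple_cstar_def by blast
  define a where "a = star a0 * a0"
  have a: "a \<in> A" "pos_op a" "a \<noteq> 0"
    using 0 pos_op_star_mult(1)[of a0] by (simp_all add: a_def star_mult_self_eq_0_iff cstar_subalgebraD[OF A])
  obtain u1 u2 where u: "u1 \<in> right_ideal A a" "u2 \<in> right_ideal A a" "u1 * u2 = 0" "u1 \<noteq> 0" "u2 \<noteq> 0"
    using orthogonal_pair_exists[OF Z a] by blast
  have uA: "u1 \<in> A" "u2 \<in> A" using u(1,2) right_ideal(3)[OF A a(1,2)] by blast+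
  note AB = tensor_cl_elem[OF A B uA(1) 0(3)] tensor_cl_elem[OF A B uA(2) 0(3)]
  have \<psi>0: "\<psi> 0 = 0" by (rule star_hom_zero[OF subAB \<psi>(1)])
  have "\<psi> (tensor_op u1 b) * \<psi> (tensor_op u2 b) = \<psi> (tensor_op u1 b * tensor_op u2 b)"
    by (rule star_hom_onD(2)[OF \<psi>(1) AB, symmetric])
  also have "\<dots> = 0" by (simp add: tensor_op_mult u(3) tensor_op_linear2 \<psi>0)
  finally have "\<psi> (tensor_op u1 b) = \<psi> 0 \<or> \<psi> (tensor_op u2 b) = \<psi> 0" by (simp add: \<psi>0)
  then have "tensor_op u1 b = 0 \<or> tensor_op u2 b = 0"
    using inj_onD[OF bij_betw_imp_inj_on[OF \<psi>(2)] _ AB(1) cstar_subalgebraD(1)[OF subAB]]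
      inj_onD[OF bij_betw_imp_inj_on[OF \<psi>(2)] _ AB(2) cstar_subalgebraD(1)[OF subAB]] by blast
  then show False using tensor_op_nonzero[OF A B] u(4,5) 0(4) by blast
qed

lemma tracially_Z_absorbing_tensor:
  assumes Z: "tracially_Z_absorbing A" and simpleB: "simple_cstar B"
  shows "tracially_Z_absorbing AB"
  unfolding tracially_Z_absorbing_def
proof (intro conjI allI impI)
  have simpleA: "simple_cstar A" by (rule tracially_Z_absorbingD(1)[OF Z])
  show "simple_cstar AB" by (rule simple_cstar_tensor[OF A B simpleA simpleB])
  show "\<not> cstar_isomorphic AB (UNIV :: complex set)" by (rule tensor_not_isomorphic_complex[OF Z simpleB])
  fix x a F and \<epsilon> :: real and n :: nat
  assume "positive_in AB x \<and> positive_in AB a \<and> a \<noteq> 0 \<and> finite F \<and> F \<subseteq> AB \<and> 0 < \<epsilon> \<and> 1 \<le> n"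
  then have x: "x \<in> AB" "pos_op x" and a: "a \<in> AB" "pos_op a" "a \<noteq> 0" and F: "finite F" "F \<subseteq> AB"
    and \<epsilon>: "0 < \<epsilon>" and n: "1 \<le> n"
    by (simp_all add: positive_in_iff_pos_op[OF subAB])
  note xs = pos_opD(1)[OF x(2)]
  obtain a1 b1 where a1: "a1 \<in> A" "pos_op a1" "a1 \<noteq> 0" and b1: "b1 \<in> B" "pos_op b1" "b1 \<noteq> 0"
    and ab: "cuntz_below AB (tensor_op a1 b1) a"
    using tensor_below_exists[OF A B a] by blast
  define N where "N = 1 + norm x"
  have N: "1 \<le> N" "0 < N" "norm x \<le> N" by (simp_all add: N_def add_pos_nonneg)
  \<comment> \<open>Three errors of \<open>\<epsilon> / 3\<close> are allowed:
    \<open>5 \<eta> N\<close> for compressing \<open>x\<close>, \<open>N^2 \<delta>\<close> for the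
    cut taken in \<open>A\<close>, and \<open>3 N^2 \<rho>\<close> for replacing \<open>f^2\<close>
    by \<open>t\<close>, where 3 bounds the norm of \<open>C\<close>.\<close>
  define \<eta> where "\<eta> = \<epsilon> / (15 * N)"
  have \<eta>: "0 < \<eta>" using \<epsilon> N by (simp add: \<eta>_def)
  define \<rho> where "\<rho> = \<epsilon> / (9 * N\<^sup>2)"
  have \<rho>: "0 < \<rho>" using \<epsilon> N by (simp add: \<rho>_def)
  obtain FA FB \<gamma> where 1: "finite FA" "FA \<subseteq> A" "finite FB" "FB \<subseteq> B" "0 < \<gamma>"
    and comm: "\<forall>h g. norm h \<le> 1 \<longrightarrow> norm g \<le> 1 \<longrightarrow> (\<forall>a\<in>FA. norm (h * a - a * h) < \<gamma>) \<longrightarrow>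
      (\<forall>b\<in>FB. norm (g * b - b) < \<gamma> \<and> norm (b * g - b) < \<gamma>) \<longrightarrow>
      (\<forall>x\<in>F. norm (tensor_op h g * x - x * tensor_op h g) < \<epsilon>)"
    using tensor_commutator_estimate[OF F \<epsilon>] by (elim exE conjE)
  obtain FA' FB' \<gamma>' where 2: "finite FA'" "FA' \<subseteq> A" "finite FB'" "FB' \<subseteq> B" "0 < \<gamma>'"
    and unit: "\<forall>h g. norm h \<le> 1 \<longrightarrow> norm g \<le> 1 \<longrightarrow> (\<forall>a\<in>FA'. norm (h * a - a) < \<gamma>') \<longrightarrow>
      (\<forall>b\<in>FB'. norm (g * b - b) < \<gamma>') \<longrightarrow> norm (tensor_op h g * x - x) < \<eta>"
    using tensor_unit_estimate[OF x(1) \<eta>] by (elim exE conjE)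
  obtain e where e: "e \<in> A" "pos_op e" "norm e \<le> 1" "\<forall>y\<in>FA'. norm (e * y - y) < \<gamma>'"
    using approximate_unit[OF A 2(1,2,5)] by blast
  have "finite (FB \<union> FB')" "FB \<union> FB' \<subseteq> B" "0 < min \<gamma> \<gamma>'" using 1 2 by simp_all
  from approximate_unit[OF B this]
  obtain f where f: "f \<in> B" "pos_op f" "norm f \<le> 1"
    and ff: "\<forall>y\<in>FB \<union> FB'. norm (f * y - y) < min \<gamma> \<gamma>' \<and> norm (y * f - y) < min \<gamma> \<gamma>'"
    by blast
  note es = pos_opD(1)[OF e(2)] and fs = pos_opD(1)[OF f(2)]
  obtain t where t: "t \<in> conj_sums B b1" "norm (f * f - t) < \<rho>"
    using simple_conj_sums[OF B b1(1,2) simpleB b1(3) f(1) \<rho>] by (auto simp: fs)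
  have tB: "t \<in> B" "pos_op t" using conj_sums(4)[OF B b1(1,2) t(1)] by simp_all
  obtain k :: nat and c where c: "\<forall>i<k. c i \<in> B" "t = (\<Sum>i<k. c i * b1 * star (c i))"
    using conj_sums_sum[OF t(1)] by (elim exE conjE)
  obtain a2 where a2: "a2 \<in> A" "pos_op a2" "a2 \<noteq> 0" "copies A a1 a2 k" using copies_exist[OF Z a1] by blast
  \<comment> \<open>The bound 1 gives \<open>norm C \<le> 3\<close>, \<open>\<gamma>\<close> serves
    the commutators, and the last entry is the share of the cut in the error.\<close>
  define \<delta> where "\<delta> = min 1 (min \<gamma> (\<epsilon> / (3 * N\<^sup>2)))"
  have \<delta>: "0 < \<delta>" "\<delta> \<le> 1" "\<delta> \<le> \<gamma>" "\<delta> \<le> \<epsilon> / (3 * N\<^sup>2)" using \<epsilon> N 1(5) by (simp_all add: \<delta>_def)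
  have "positive_in A e" "positive_in A a2" using e a2 by (simp_all add: positive_in_iff_pos_op[OF A])
  from tracially_Z_absorbingD(3)[OF Z this a2(3) 1(1,2) \<delta>(1) n]
  obtain \<phi> where \<phi>: "cpc_order_zero n A \<phi>"
    and cut: "cuntz_below A (cut_down A (e * e - e * \<phi> (1\<^sub>m n) * e) \<delta>) a2"
    and \<phi>c: "\<forall>z\<in>carrier_mat n n. mat_opnorm z \<le> 1 \<longrightarrow> (\<forall>b\<in>FA. norm (\<phi> z * b - b * \<phi> z) < \<delta>)"
    by (elim exE conjE)
  define p where "p = \<phi> (1\<^sub>m n)"
  note p = cpc_order_zero_one[OF A \<phi>, folded p_def]
  define c' where "c' = e * e - e * p * e"
  have c': "c' \<in> A" "pos_op c'" "norm c' \<le> 2"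
  proof -
    show "c' \<in> A" using e p by (simp add: c'_def cstar_subalgebraD[OF A])
    have "c' = star e * (1 - p) * e" by (simp add: c'_def es left_diff_distrib right_diff_distrib)
    then show "pos_op c'" using pos_op_conj[OF p(3), of e] by simp
    have "norm (e * e) \<le> 1" using norm_mult_ineq[of e e] mult_mono[OF e(3,3)] by simp
    moreover have "norm (e * p) \<le> 1" using norm_mult_ineq[of e p] mult_mono[OF e(3) p(4)] by simp
    then have "norm (e * p * e) \<le> 1" using norm_mult_ineq[of "e * p" e] mult_mono[of "norm (e * p)" 1 "norm e" 1] e(3) by simp
    ultimately show "norm c' \<le> 2" using norm_triangle_ineq4[of "e * e" "e * p * e"] by (simp add: c'_def)
  qed
  note c's = pos_opD(1)[OF c'(2)]
  have \<delta>0: "0 \<le> \<delta>" using \<delta> by simp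
  define C where "C = cut \<delta> c'"
  have C: "C \<in> A" "pos_op C" "norm (c' - C) \<le> \<delta>"
    using fc_in[OF A c'(1) c's cont0_cut[OF \<delta>0]] pos_op_fc[OF c's cont0_cut[OF \<delta>0]] norm_cut_diff[OF c's c'(2) \<delta>0]
    by (simp_all add: C_def)
  have C3: "norm C \<le> 3" using norm_triangle_ineq4[of c' "c' - C"] c'(3) C(3) \<delta>(2) by simp
  have "cut_down A c' \<delta> = C" unfolding C_def by (rule cut_down_eq_fc[OF A c'(1) c's \<delta>0])
  then have Ca2: "cuntz_below A C a2" using cut by (simp add: c'_def p_def)
  define \<psi> where "\<psi> z = tensor_op (\<phi> z) f" for z
  have \<psi>: "cpc_order_zero n AB \<psi>" unfolding \<psi>_def by (rule cpc_order_zero_tensor[OF A B \<phi> f(1-3)])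
  define X where "X = x * x - x * \<psi> (1\<^sub>m n) * x"
  have XX: "X = x * x - x * tensor_op p f * x" by (simp add: X_def \<psi>_def p_def)
  have X: "X \<in> AB" "star X = X"
  proof -
    show "X \<in> AB" unfolding XX
      using x(1) tensor_cl_elem[OF A B p(1) f(1)] by (simp add: cstar_subalgebraD[OF subAB])
    show "star X = X"
      by (simp add: XX star_diff star_mult xs tensor_op_star pos_opD(1)[OF p(2)] fs mult.assoc)
  qed
  define Y where "Y = x * tensor_op C t * x"
  have Ct: "tensor_op C t \<in> AB" "pos_op (tensor_op C t)"
    by (rule tensor_cl_elem[OF A B C(1) tB(1)], rule pos_op_tensor[OF C(2) tB(2)])
  have Y: "Y \<in> AB" "pos_op Y"
    using x(1) Ct pos_op_conj[OF Ct(2), of x] by (simp_all add: Y_def xs cstar_subalgebraD[OF subAB])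
  have conj: "norm (x * z * x) \<le> N\<^sup>2 * norm z" for z
  proof -
    have "norm (x * z * star x) \<le> (norm x)\<^sup>2 * norm z" by (rule norm_conj_le)
    also have "\<dots> \<le> N\<^sup>2 * norm z" using N by (intro mult_right_mono power_mono) simp_all
    finally show ?thesis by (simp only: xs)
  qed
  have "norm (X - x * tensor_op c' (f * f) * x) \<le> 5 * (\<eta> * norm x)"
    unfolding XX c'_def
  proof (rule compression_estimate[OF xs es e(3) fs f(3) p(4)])
    show "norm (tensor_op e f * x - x) \<le> \<eta>"
      using unit[rule_format, of e f] e(3,4) f(3) ff by (simp add: less_imp_le)
    \<comment> \<open>The unit may lie outside \<open>A\<close>, but the estimate holds for every
      contraction in the first factor.\<close>
    show "norm (tensor_op 1 f * x - x) \<le> \<eta>"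
      using unit[rule_format, of 1 f] f(3) ff 2(5) by (simp add: less_imp_le)
  qed
  also have "\<dots> \<le> 5 * (\<eta> * N)" using N \<eta> by simp
  also have "\<dots> = \<epsilon> / 3" using N by (simp add: \<eta>_def)
  finally have d1: "norm (X - x * tensor_op c' (f * f) * x) \<le> \<epsilon> / 3" .
  have ff1: "norm (f * f) \<le> 1" using norm_mult_ineq[of f f] mult_mono[OF f(3,3)] by simp
  have N2: "0 < N\<^sup>2" using N by simp
  have "norm (tensor_op (c' - C) (f * f)) \<le> \<delta> * 1"
    by (rule order_trans[OF norm_tensor_op_le]) (intro mult_mono C(3) ff1 \<delta>0 norm_ge_zero)
  then have "N\<^sup>2 * norm (tensor_op (c' - C) (f * f)) \<le> N\<^sup>2 * (\<epsilon> / (3 * N\<^sup>2))"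
    using \<delta>(4) by (intro mult_left_mono) simp_all
  also have "\<dots> = \<epsilon> / 3" using N2 by simp
  finally have d2: "norm (x * tensor_op (c' - C) (f * f) * x) \<le> \<epsilon> / 3"
    using conj[of "tensor_op (c' - C) (f * f)"] by simp
  have "norm (tensor_op C (f * f - t)) \<le> 3 * \<rho>"
    by (rule order_trans[OF norm_tensor_op_le]) (intro mult_mono C3 less_imp_le[OF t(2)] norm_ge_zero, simp)
  then have "N\<^sup>2 * norm (tensor_op C (f * f - t)) \<le> N\<^sup>2 * (3 * \<rho>)"
    by (intro mult_left_mono) simp_all
  also have "\<dots> = \<epsilon> / 3" using N2 by (simp add: \<rho>_def)
  finally have d3: "norm (x * tensor_op C (f * f - t) * x) \<le> \<epsilon> / 3"
    using conj[of "tensor_op C (f * f - t)"] by simp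
  have eq: "X - Y = (X - x * tensor_op c' (f * f) * x) + (x * tensor_op (c' - C) (f * f) * x + x * tensor_op C (f * f - t) * x)"
    by (simp add: Y_def tensor_op_linear2 left_diff_distrib right_diff_distrib)
  have "norm (X - Y) \<le> \<epsilon>"
    unfolding eq using norm_triangle_ineq[of "X - x * tensor_op c' (f * f) * x" "x * tensor_op (c' - C) (f * f) * x + x * tensor_op C (f * f - t) * x"]
      norm_triangle_ineq[of "x * tensor_op (c' - C) (f * f) * x" "x * tensor_op C (f * f - t) * x"] d1 d2 d3 by linarith
  then have "cuntz_below AB (cut \<epsilon> X) Y" by (rule cuntz_below_cut_norm[OF subAB X Y])
  moreover have "cuntz_below AB Y (tensor_op C t)"
    using cuntz_below_conj[OF x(1), of "tensor_op C t"] by (simp only: Y_def xs)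
  moreover have "cuntz_below AB (tensor_op C t) (tensor_op a1 b1)"
    unfolding c(2) by (rule cuntz_below_copies[OF Ca2 a2(4) c(1)])
  ultimately have "cuntz_below AB (cut \<epsilon> X) a"
    using ab cuntz_below_trans[OF subAB] by blast
  then have below: "cuntz_below AB (cut_down AB X \<epsilon>) a"
    using cut_down_eq_fc[OF subAB X, of \<epsilon>] \<epsilon> by simp
  show "\<exists>\<phi>. cpc_order_zero n AB \<phi> \<and> cuntz_below AB (cut_down AB (x * x - x * \<phi> (1\<^sub>m n) * x) \<epsilon>) a \<and>
      (\<forall>z\<in>carrier_mat n n. mat_opnorm z \<le> 1 \<longrightarrow> (\<forall>b\<in>F. norm (\<phi> z * b - b * \<phi> z) < \<epsilon>))"
  proof (intro exI[of _ \<psi>] conjI ballI impI)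
    show "cpc_order_zero n AB \<psi>" by (rule \<psi>)
    show "cuntz_below AB (cut_down AB (x * x - x * \<psi> (1\<^sub>m n) * x) \<epsilon>) a" using below by (simp only: X_def)
    fix z y assume z: "z \<in> carrier_mat n n" "mat_opnorm z \<le> 1" and y: "y \<in> F"
    have "norm (\<phi> z) \<le> 1" using cpc_order_zeroD(5)[OF \<phi> z(1)] z(2) by simp
    moreover have "\<forall>a\<in>FA. norm (\<phi> z * a - a * \<phi> z) < \<gamma>"
      using \<phi>c[rule_format, OF z] \<delta>(3) by (auto intro: less_le_trans)
    moreover have "\<forall>b\<in>FB. norm (f * b - b) < \<gamma> \<and> norm (b * f - b) < \<gamma>" using ff by simp
    ultimately show "norm (\<psi> z * y - y * \<psi> z) < \<epsilon>"
      using comm f(3) y unfolding \<psi>_def by blast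
  qed
qed

end

theorem theorem5p1:
  fixes A :: "'a::cstar_algebra set" and B :: "'b::cstar_algebra set"
    and \<pi> :: "'a \<Rightarrow> 'x l2op" and \<sigma> :: "'b \<Rightarrow> 'y l2op"
  assumes "simple_cstar A" and "tracially_Z_absorbing A"
    and "simple_cstar B"
    and "faithful_rep A \<pi>" and "faithful_rep B \<sigma>"
  shows "tracially_Z_absorbing (min_tensor A \<pi> B \<sigma>)"
proof -
  have A: "cstar_subalgebra A" and B: "cstar_subalgebra B"
    by (rule simple_cstarD(1)[OF assms(1)], rule simple_cstarD(1)[OF assms(3)])
  have \<pi>: "star_hom_on A \<pi>" "inj_on \<pi> A" and \<sigma>: "star_hom_on B \<sigma>" "inj_on \<sigma> B"
    using assms(4,5) unfolding faithful_rep_def by simp_all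
  show ?thesis
    unfolding min_tensor_eq
    by (rule tracially_Z_absorbing_tensor[OF cstar_subalgebra_image[OF A \<pi>] cstar_subalgebra_image[OF B \<sigma>]
          tracially_Z_absorbing_image[OF A \<pi> assms(2)] simple_cstar_image[OF B \<sigma> assms(3)]])
qed

end
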